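(* Let $0<\nu\le \frac12$. Then the polynomials $P_n$ exist for all $n$ large enough. In addition, the zeros of the polynomial $z\mapsto P_n(in\pi z)$ all tend to the interval $[-1,1]$ as $n\to\infty$ (i.e. for every open set $O\subset\mathbb C$ containing $[-1,1]$, all zeros of $z\mapsto P_n(in\pi z)$ lie in $O$ for $n$ large enough), and they have the limiting density $$\psi(x)=\frac1\pi\log\frac{1+\sqrt{1-x^2}}{|x|},\qquad x\in[-1,1],$$ in the sense of weak convergence of normalized zero counting measures: if $z_{1,n},\dots,z_{n,n}$ denote the $n$ zeros of $P_n$ (with multiplicity), then $$\lim_{n\to\infty}\frac1n\sum_{j=1}^n f\left(\frac{z_{j,n}}{i\pi n}\right)=\int_{-1}^1 f(x)\psi(x)\,dx$$ for every function $f$ that is defined and continuous in a neighborhood of $[-1,1]$ in the complex plane.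
   Context: Let $J_\nu$ be the Bessel function of order $\nu\ge 0$. The polynomials $P_n$ are the monic polynomials of degree $n$ that are "orthogonal with respect to $J_\nu$ on $[0,\infty)$" in the regularized sense: for $s>0$ let $P_n(\cdot;s)$ be the monic polynomial of degree $n$ with $\int_0^\infty P_n(x;s)x^jJ_\nu(x)e^{-sx}\,dx=0$ for $j=0,\dots,n-1$, and $P_n(x)=\lim_{s\to0+}P_n(x;s)$. Equivalently, with the regularized moments $$m_j=\lim_{s\to0+}\int_0^\infty x^jJ_\nu(x)e^{-sx}\,dx=2^j\,\frac{\Gamma(\frac{1+\nu+j}{2})}{\Gamma(\frac{1+\nu-j}{2})}$$ (with $1/\Gamma=0$ at the poles of $\Gamma$) and $\Delta_n=\det[m_{i+j}]_{i,j=0}^{n-1}$, the polynomial $P_n$ exists if and only if $\Delta_n\ne0$, and then $P_n(x)=\frac1{\Delta_n}\det M_n(x)$, where $M_n(x)$ is the $(n+1)\times(n+1)$ matrix whose rows $i=0,\dots,n-1$ are $(m_i,m_{i+1},\dots,m_{i+n})$ and whose last row is $(1,x,\dots,x^n)$. *)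

theory Defs
  imports "HOL-Analysis.Analysis" "HOL-Computational_Algebra.Computational_Algebra"
begin

text \<open>
  The Bessel function of the first kind of order \<open>\<nu> \<ge> 0\<close> at real \<open>x \<ge> 0\<close>.  Since \<open>0 powr 0 = 0\<close>,
  the value at \<open>x = 0\<close> is correct for \<open>\<nu> > 0\<close> only; \<open>J\<^sub>0(0) = 1\<close> is not reproduced.
\<close>
definition bessel_J :: "real \<Rightarrow> real \<Rightarrow> real" where
  "bessel_J \<nu> x = (\<Sum>k. (-1) ^ k / (fact k * Gamma (\<nu> + real k + 1)) * (x / 2) powr (\<nu> + 2 * real k))"

definition is_bessel_OP_reg :: "real \<Rightarrow> nat \<Rightarrow> real \<Rightarrow> real poly \<Rightarrow> bool" where
  "is_bessel_OP_reg \<nu> n s p \<longleftrightarrow>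
     degree p = n \<and> lead_coeff p = 1 \<and>
     (\<forall>j<n. ((\<lambda>x. poly p x * x ^ j * bessel_J \<nu> x * exp (- s * x)) has_integral 0) {0..})"

definition bessel_OP_reg :: "real \<Rightarrow> nat \<Rightarrow> real \<Rightarrow> real poly" where
  "bessel_OP_reg \<nu> n s = (THE p. is_bessel_OP_reg \<nu> n s p)"

text \<open>
  \<open>P\<^sub>n(x) = lim P\<^sub>n(x;s)\<close> as \<open>s \<rightarrow> 0+\<close>.  This presupposes that \<open>P\<^sub>n(\<cdot>;s)\<close> is well defined, which is
  required for all sufficiently small \<open>s > 0\<close>.
\<close>
definition is_bessel_OP :: "real \<Rightarrow> nat \<Rightarrow> real poly \<Rightarrow> bool" where
  "is_bessel_OP \<nu> n p \<longleftrightarrow>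
     (\<forall>\<^sub>F s in at_right 0. \<exists>!q. is_bessel_OP_reg \<nu> n s q) \<and>
     (\<forall>x. ((\<lambda>s. poly (bessel_OP_reg \<nu> n s) x) \<longlongrightarrow> poly p x) (at_right 0))"

text \<open>
  The polynomial \<open>P\<^sub>n\<close>, with its (real) coefficients embedded in the complex numbers.  It is
  meaningful only if some \<open>p\<close> with \<^term>\<open>is_bessel_OP \<nu> n p\<close> exists; that \<open>p\<close> is then unique, a
  polynomial being determined by its values.
\<close>
definition bessel_OP :: "real \<Rightarrow> nat \<Rightarrow> complex poly" where
  "bessel_OP \<nu> n = map_poly of_real (THE p. is_bessel_OP \<nu> n p)"

text \<open>At \<open>x = 0\<close>, where the density is infinite, division by zero yields the value \<open>0\<close>.\<close>
definition zero_density :: "real \<Rightarrow> real" where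
  "zero_density x = 1 / pi * ln ((1 + sqrt (1 - x\<^sup>2)) / \<bar>x\<bar>)"

end

theory Submission
  imports Defs "HOL-Complex_Analysis.Complex_Analysis" "HOL-Real_Asymp.Real_Asymp"
begin

text \<open>
  Substituting \<open>z = i \<pi> x\<close> turns the Bessel functional into the functional on the real line with the
  complex weight \<open>W(x) = e\<^sup>-\<^sup>i\<^sup>\<theta>\<^sup> \<^sup>s\<^sup>g\<^sup>n\<^sup> \<^sup>x 2 \<surd>2 K\<^sub>\<nu>(\<pi> \<bar>x\<bar>)\<close>, \<open>\<theta> = \<pi> \<nu> / 2\<close>; both have the same moments up to a
  constant factor.  Since \<open>Re W > 0\<close>, the sesquilinear form of \<open>W\<close> is sectorial, so \<open>P\<^sub>n\<close> exists for all \<open>n\<close>.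
  The weight behaves like \<open>\<bar>x\<bar>\<^sup>-\<^sup>1\<^sup>/\<^sup>2 sech (\<pi> x)\<close>, and \<open>sech (\<pi> x)\<close> has the explicit orthonormal
  Meixner--Pollaczek polynomials \<open>p\<^sub>n\<close>.  A finite combination \<open>q\<close> of \<open>x p\<^sub>n\<^sub>-\<^sub>1\<^sub>-\<^sub>i\<close> and a finite
  combination \<open>a\<close> of \<open>p\<^sub>n\<^sub>+\<^sub>j\<close>, \<open>i, j \<ge> 0\<close>, are chosen such that \<open>q W - a sech (\<pi> x)\<close> is small in the dual
  norm: in the scaling limit \<open>x / n = cos t\<close> this becomes a scalar factorization problem on the unit
  circle, which an explicit Szego function solves.  As \<open>a\<close> is orthogonal to all polynomials of degree
  less than \<open>n\<close>, coercivity of the form shows that \<open>P\<^sub>n(i \<pi> x)\<close>, suitably normalised, differs from \<open>q\<close> by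
  little in \<open>L\<^sup>2(sech (\<pi> x))\<close>.  Away from \<open>[-1, 1]\<close> the ratios \<open>p\<^sub>n\<^sub>-\<^sub>j(n z) / p\<^sub>n(n z)\<close> tend to powers of
  the inverse Joukowski map of \<open>z\<close>, so \<open>q\<close> and hence \<open>P\<^sub>n\<close> have no zeros there.  Power sums of the zeros are
  traces of powers of the compression of multiplication by \<open>x\<close>; all but boundedly many diagonal
  entries coincide with those of the Jacobi matrix of \<open>p\<^sub>n\<close>, whose averages give the moments of the density.
\<close>

text \<open>Those limits need continuous test functions, while the weight is singular at 0; the
  factor \<open>x\<close> in \<open>q\<close> turns \<bar>x\<bar>^(-1/2) into \<bar>x\<bar>^(3/2) in
  the term quadratic in \<open>q\<close>, and duality leaves \<bar>x\<bar>^(1/2) in the term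
  quadratic in \<open>a\<close>. The Szego function has branch points at i and -i, the points over x
  = 0, with exponents 1/4 + \<nu>/2 and 1/4 - \<nu>/2: their sum 1/2 yields the root singularity,
  their difference \<nu> the jump of the phase. Both are nonnegative for \<nu> \<le> 1/2. Passing
  from the Bessel weight to sech costs a factor of order sqrt n in degree below n, exactly what the
  scaling of the residual gains. The limit symbol of \<open>q\<close> is bounded below off [-1,1]
  independently of the accuracy demanded, so one fixed accuracy excludes zeros. The recurrence
  coefficients k/2 grow linearly, hence the limiting density is the arcsine law on [-u,u] averaged
  over u in [0,1].\<close>

abbreviation (input) cr :: "real \<Rightarrow> complex" where
  "cr \<equiv> complex_of_real"

section \<open>Regularized moments of the Bessel function\<close>

definition bessel_coeff :: "real \<Rightarrow> nat \<Rightarrow> real" where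
 "bessel_coeff \<nu> k = (-1) ^ k / (fact k * Gamma (\<nu> + real k + 1))"

text \<open>This is the Bessel-Clifford function at \<open>- v\<close>. Splitting off the branch
  factor \<open>(x / 2) powr \<nu>\<close> leaves an entire function of
  \<open>v = (x / 2)^2\<close>, which may be differentiated termwise, also at 0.\<close>

definition bessel_series :: "real \<Rightarrow> real \<Rightarrow> real" where
 "bessel_series \<nu> v = (\<Sum>k. bessel_coeff \<nu> k * v ^ k)"

lemma bessel_coeff_shift:
 assumes "\<nu> \<ge> 0"
 shows "bessel_coeff (\<nu> + 1) k * (\<nu> + 1 + real k) = bessel_coeff \<nu> k"
proof -
 have "Gamma (\<nu> + real k + 1 + 1) = (\<nu> + real k + 1) * Gamma (\<nu> + real k + 1)"
  using assms by (intro Gamma_plus1) (auto elim!: nonpos_Ints_cases)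
 moreover have "Gamma (\<nu> + real k + 1) > 0" using assms by (intro Gamma_real_pos) auto
 moreover have "\<nu> + 1 + real k + 1 = \<nu> + real k + 1 + 1" "\<nu> + real k + 1 \<noteq> 0"
  "\<nu> + 1 + real k = \<nu> + real k + 1" using assms by auto
 ultimately show ?thesis unfolding bessel_coeff_def
  by (simp add: divide_simps)
qed

lemma bessel_coeff_Suc:
 "(1 + real k) * bessel_coeff \<nu> (Suc k) = - bessel_coeff (\<nu> + 1) k"
proof -
 have "(1 + real k) * (a / ((1 + real k) * b)) = a / b" for a b :: real
  by (simp add: add_nonneg_eq_0_iff)
 from this[of "(-1) ^ Suc k" "fact k * Gamma (\<nu> + real (Suc k) + 1)"] show ?thesis
  by (simp add: bessel_coeff_def mult.assoc add_ac)
qed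

text \<open>\<open>bessel_coeff_Suc\<close> trades one step in \<open>k\<close> for one step in the
  order and gains \<open>1 / (1 + k)\<close>; by \<open>bessel_coeff_shift\<close>, raising the
  order does not enlarge a coefficient, so the order can be lowered again.\<close>

lemma abs_bessel_coeff_le:
 assumes "\<nu> \<ge> 0"
 shows "\<bar>bessel_coeff \<nu> k\<bar> \<le> (1 / Gamma (\<nu> + 1)) / fact k"
 using assms
proof (induction k arbitrary: \<nu>)
 case 0
 have "Gamma (\<nu> + 1) > 0" using 0 by (intro Gamma_real_pos) auto
 then show ?case by (simp add: bessel_coeff_def)
next
 case (Suc k)
 have "bessel_coeff \<nu> (Suc k) = - bessel_coeff (\<nu> + 1) k / (1 + real k)"
  using bessel_coeff_Suc[of k \<nu>] by (simp add: field_simps)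
 hence "\<bar>bessel_coeff \<nu> (Suc k)\<bar> = \<bar>bessel_coeff (\<nu> + 1) k\<bar> / (1 + real k)" by simp
 also have "\<dots> \<le> ((1 / Gamma (\<nu> + 1)) / fact k) / (1 + real k)"
 proof (intro divide_right_mono)
  have "\<bar>bessel_coeff \<nu> k\<bar> = \<bar>bessel_coeff (\<nu> + 1) k\<bar> * (\<nu> + 1 + real k)"
   using bessel_coeff_shift[OF Suc.prems, of k] Suc.prems
   by (metis abs_mult abs_of_nonneg add_nonneg_nonneg of_nat_0_le_iff zero_le_one)
  hence "\<bar>bessel_coeff (\<nu> + 1) k\<bar> * 1 \<le> \<bar>bessel_coeff \<nu> k\<bar>"
   using Suc.prems by (simp add: mult_le_cancel_left1)
  thus "\<bar>bessel_coeff (\<nu> + 1) k\<bar> \<le> 1 / Gamma (\<nu> + 1) / fact k"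
   using Suc.IH[OF Suc.prems] by simp
 qed auto
 finally show ?case by (simp add: field_simps)
qed

lemma summable_bessel_series:
 assumes "\<nu> \<ge> 0"
 shows "summable (\<lambda>k. bessel_coeff \<nu> k * v ^ k)"
proof (rule summable_comparison_test'[where N = 0])
 show "summable (\<lambda>k. (1 / Gamma (\<nu> + 1)) * (inverse (fact k) * \<bar>v\<bar> ^ k))"
  by (intro summable_mult summable_exp)
 fix k :: nat
 have "\<bar>bessel_coeff \<nu> k\<bar> * \<bar>v\<bar> ^ k \<le> ((1 / Gamma (\<nu> + 1)) / fact k) * \<bar>v\<bar> ^ k"
  by (intro mult_right_mono abs_bessel_coeff_le assms) auto
 thus "norm (bessel_coeff \<nu> k * v ^ k) \<le> (1 / Gamma (\<nu> + 1)) * (inverse (fact k) * \<bar>v\<bar> ^ k)"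
  by (simp add: abs_mult power_abs divide_inverse mult.assoc)
qed

lemma has_field_derivative_bessel_series:
 assumes "\<nu> \<ge> 0"
 shows "(bessel_series \<nu> has_field_derivative - bessel_series (\<nu> + 1) v) (at v)"
proof -
 have "((\<lambda>v. \<Sum>k. bessel_coeff \<nu> k * v ^ k) has_field_derivative
     (\<Sum>k. diffs (bessel_coeff \<nu>) k * v ^ k)) (at v)"
  by (rule termdiffs_strong_converges_everywhere) (rule summable_bessel_series[OF assms])
 moreover have "diffs (bessel_coeff \<nu>) k = - bessel_coeff (\<nu> + 1) k" for k
  using bessel_coeff_Suc[of k \<nu>] by (simp add: diffs_def)
 ultimately show ?thesis
  using suminf_minus[OF summable_bessel_series, of "\<nu> + 1" v] assms
  by (simp add: bessel_series_def[abs_def])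
qed

lemma bessel_series_three_term:
 assumes "\<nu> \<ge> 0"
 shows "bessel_series \<nu> v = (\<nu> + 1) * bessel_series (\<nu> + 1) v - v * bessel_series (\<nu> + 2) v"
proof -
 have s1: "summable (\<lambda>k. bessel_coeff (\<nu> + 1) k * v ^ k)"
  and s2: "summable (\<lambda>k. bessel_coeff (\<nu> + 2) k * v ^ k)"
  using assms by (auto intro!: summable_bessel_series)
 have "(\<lambda>k. (\<nu> + 1) * (bessel_coeff (\<nu> + 1) k * v ^ k)) sums ((\<nu> + 1) * bessel_series (\<nu> + 1) v)"
  unfolding bessel_series_def by (intro sums_mult summable_sums s1)
 moreover have "(\<lambda>k. case k of 0 \<Rightarrow> 0 | Suc k \<Rightarrow> - (v * (bessel_coeff (\<nu> + 2) k * v ^ k)))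
   sums (- (v * bessel_series (\<nu> + 2) v))"
  using sums_minus[OF sums_mult[OF summable_sums[OF s2], of v]]
   sums_Suc_iff[of "\<lambda>k. case k of 0 \<Rightarrow> 0 | Suc k \<Rightarrow> - (v * (bessel_coeff (\<nu> + 2) k * v ^ k))"]
  by (simp add: bessel_series_def)
 ultimately have "(\<lambda>k. (\<nu> + 1) * (bessel_coeff (\<nu> + 1) k * v ^ k) +
   (case k of 0 \<Rightarrow> 0 | Suc k \<Rightarrow> - (v * (bessel_coeff (\<nu> + 2) k * v ^ k))))
   sums ((\<nu> + 1) * bessel_series (\<nu> + 1) v + - (v * bessel_series (\<nu> + 2) v))"
  by (rule sums_add)
 moreover have "(\<nu> + 1) * (bessel_coeff (\<nu> + 1) k * v ^ k) +
   (case k of 0 \<Rightarrow> 0 | Suc k \<Rightarrow> - (v * (bessel_coeff (\<nu> + 2) k * v ^ k))) = bessel_coeff \<nu> k * v ^ k" for k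
 proof (cases k)
  case 0
  then show ?thesis using bessel_coeff_shift[OF assms, of 0] by (simp add: mult.commute)
 next
  case (Suc j)
  have e: "bessel_coeff (\<nu> + 2) j = - (1 + real j) * bessel_coeff (\<nu> + 1) (Suc j)"
   using bessel_coeff_Suc[of j "\<nu> + 1"] by (simp add: algebra_simps)
  have "(\<nu> + 1) * (bessel_coeff (\<nu> + 1) k * v ^ k) - v * (bessel_coeff (\<nu> + 2) j * v ^ j)
    = bessel_coeff (\<nu> + 1) k * (\<nu> + 1 + real k) * v ^ k"
   unfolding e Suc by (simp add: algebra_simps)
  thus ?thesis using bessel_coeff_shift[OF assms, of k] Suc by simp
 qed
 ultimately show ?thesis unfolding bessel_series_def by (simp add: sums_iff)
qed

lemma bessel_J_eq_series:
 assumes "\<nu> \<ge> 0" "x > 0"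
 shows "bessel_J \<nu> x = (x / 2) powr \<nu> * bessel_series \<nu> ((x / 2)^2)"
proof -
 have "(x / 2) powr (\<nu> + 2 * real k) = (x / 2) powr \<nu> * ((x / 2)^2) ^ k" for k
  using assms powr_realpow[of "x / 2" "2 * k"] by (simp add: powr_add power_mult)
 hence "bessel_J \<nu> x = (\<Sum>k. (x / 2) powr \<nu> * (bessel_coeff \<nu> k * ((x / 2)^2) ^ k))"
  unfolding bessel_J_def bessel_coeff_def by (intro suminf_cong) simp
 thus ?thesis unfolding bessel_series_def
  by (subst (asm) suminf_mult[OF summable_bessel_series[OF assms(1)]])
qed

lemma bessel_J_three_term:
 assumes "\<nu> \<ge> 0" "x > 0"
 shows "bessel_J \<nu> x = 2 * (\<nu> + 1) / x * bessel_J (\<nu> + 1) x - bessel_J (\<nu> + 2) x"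
proof -
 have "bessel_J (\<nu> + 1) x = (x / 2) powr \<nu> * (x / 2) * bessel_series (\<nu> + 1) ((x / 2)^2)"
  "bessel_J (\<nu> + 2) x = (x / 2) powr \<nu> * (x / 2)^2 * bessel_series (\<nu> + 2) ((x / 2)^2)"
  using assms by (simp_all add: bessel_J_eq_series powr_add)
 moreover have "bessel_J \<nu> x = (x / 2) powr \<nu> * bessel_series \<nu> ((x / 2)^2)"
  using assms by (rule bessel_J_eq_series)
 moreover have "2 * (\<nu> + 1) / x * (c * (x / 2) * a) - c * (x / 2)^2 * b
   = c * ((\<nu> + 1) * a - (x / 2)^2 * b)" for a b c
  using assms by (simp add: field_simps power2_eq_square)
 ultimately show ?thesis
  by (simp only: bessel_series_three_term[OF assms(1), of "(x / 2)^2"])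
qed

lemma has_field_derivative_bessel_J:
 assumes "\<nu> \<ge> 0" "x > 0"
 shows "(bessel_J \<nu> has_field_derivative \<nu> / x * bessel_J \<nu> x - bessel_J (\<nu> + 1) x) (at x)"
proof -
 have "((\<lambda>x. (x / 2) powr \<nu> * bessel_series \<nu> ((x / 2)^2)) has_field_derivative
   (x / 2) powr \<nu> * (- bessel_series (\<nu> + 1) ((x / 2)^2) * (x / 2)) +
   (\<nu> * (x / 2) powr (\<nu> - 1) * (1 / 2)) * bessel_series \<nu> ((x / 2)^2)) (at x)"
 proof -
  have d: "((\<lambda>x. (x / 2)^2) has_field_derivative x / 2) (at x)"
   by (auto intro!: derivative_eq_intros simp: power2_eq_square)
  have p: "((\<lambda>x. (x / 2) powr \<nu>) has_field_derivative \<nu> * (x / 2) powr (\<nu> - 1) * (1 / 2)) (at x)"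
   using assms by (auto intro!: derivative_eq_intros simp: powr_diff)
  show ?thesis
   using DERIV_mult[OF p DERIV_chain2[OF has_field_derivative_bessel_series[OF assms(1)] d]]
   by (simp add: add.commute mult.commute)
 qed
 moreover have "(x / 2) powr \<nu> * (- bessel_series (\<nu> + 1) ((x / 2)^2) * (x / 2)) +
   (\<nu> * (x / 2) powr (\<nu> - 1) * (1 / 2)) * bessel_series \<nu> ((x / 2)^2)
   = \<nu> / x * bessel_J \<nu> x - bessel_J (\<nu> + 1) x"
 proof -
  have "(x / 2) powr (\<nu> - 1) * (1 / 2) = (x / 2) powr \<nu> / x"
   using assms by (simp add: powr_diff)
  thus ?thesis using assms by (simp add: bessel_J_eq_series powr_add mult.commute mult.left_commute)
 qed
 ultimately have "((\<lambda>x. (x / 2) powr \<nu> * bessel_series \<nu> ((x / 2)^2)) has_field_derivative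
   \<nu> / x * bessel_J \<nu> x - bessel_J (\<nu> + 1) x) (at x)" by simp
 thus ?thesis
  by (rule has_field_derivative_transform_within_open[of _ _ _ "{0<..}"])
    (use assms in \<open>auto simp: bessel_J_eq_series\<close>)
qed

lemma has_field_derivative_bessel_J_Suc:
 assumes "\<nu> \<ge> 0" "x > 0"
 shows "(bessel_J (\<nu> + 1) has_field_derivative bessel_J \<nu> x - (\<nu> + 1) / x * bessel_J (\<nu> + 1) x) (at x)"
proof -
 have "bessel_J \<nu> x - (\<nu> + 1) / x * bessel_J (\<nu> + 1) x =
   (\<nu> + 1) / x * bessel_J (\<nu> + 1) x - bessel_J (\<nu> + 1 + 1) x"
  using assms bessel_J_three_term[of \<nu> x] by (simp add: field_simps)
 thus ?thesis using has_field_derivative_bessel_J[of "\<nu> + 1" x] assms by simp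
qed

lemma tendsto_bessel_J_powr_at_0:
 assumes "\<nu> \<ge> 0"
 shows "((\<lambda>x. bessel_J \<nu> x * x powr - \<nu>) \<longlongrightarrow> 2 powr - \<nu> / Gamma (\<nu> + 1)) (at_right 0)"
proof -
 have "isCont (bessel_series \<nu>) 0"
  using has_field_derivative_bessel_series[OF assms] DERIV_isCont by blast
 hence "(bessel_series \<nu> \<longlongrightarrow> bessel_series \<nu> 0) (at 0)" by (simp add: isCont_def)
 moreover have "filterlim (\<lambda>x::real. (x / 2)^2) (at 0) (at_right 0)"
  unfolding filterlim_at
  by (auto intro!: tendsto_eq_intros eventually_at_right_less[THEN eventually_mono])
 ultimately have "((\<lambda>x. bessel_series \<nu> ((x / 2)^2)) \<longlongrightarrow> bessel_series \<nu> 0) (at_right 0)"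
  by (rule filterlim_compose)
 hence "((\<lambda>x. 2 powr - \<nu> * bessel_series \<nu> ((x / 2)^2)) \<longlongrightarrow> 2 powr - \<nu> * bessel_series \<nu> 0) (at_right 0)"
  by (intro tendsto_intros)
 moreover have "bessel_series \<nu> 0 = 1 / Gamma (\<nu> + 1)"
  unfolding bessel_series_def using suminf_finite[of "{0}" "\<lambda>k. bessel_coeff \<nu> k * 0 ^ k"]
  by (simp add: bessel_coeff_def)
 moreover have "\<forall>\<^sub>F x in at_right 0. 2 powr - \<nu> * bessel_series \<nu> ((x / 2)^2) = bessel_J \<nu> x * x powr - \<nu>"
  using eventually_at_right_less[of 0]
 proof eventually_elim
  case (elim x)
  have "(x / 2) powr \<nu> * x powr - \<nu> = 2 powr - \<nu>"
   using elim powr_divide[of x 2 \<nu>] powr_minus_divide[of x \<nu>] powr_minus_divide[of 2 \<nu>] by simp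
  moreover have "bessel_J \<nu> x * x powr - \<nu> = ((x / 2) powr \<nu> * x powr - \<nu>) * bessel_series \<nu> ((x / 2)^2)"
   using assms elim by (simp add: bessel_J_eq_series)
  ultimately show ?case by simp
 qed
 ultimately show ?thesis by (simp add: filterlim_cong)
qed

text \<open>The sum of squares times \<open>x powr (- 2 * \<nu>)\<close> is nonincreasing: in its
  derivative the mixed products cancel and a negative multiple of the square of
  \<open>bessel_J (\<nu> + 1)\<close> remains. Its limit at 0 is the constant on the right. A
  termwise bound of the series would only give exponential growth, whereas the Laplace integrals
  must converge for every s > 0.\<close>

lemma bessel_J_energy_le:
 assumes "\<nu> \<ge> 0" "x > 0"
 shows "(bessel_J \<nu> x)^2 + (bessel_J (\<nu> + 1) x)^2 \<le> (2 powr - \<nu> / Gamma (\<nu> + 1))^2 * (x powr \<nu>)^2"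
proof -
 define e where "e x = ((bessel_J \<nu> x)^2 + (bessel_J (\<nu> + 1) x)^2) * x powr (- 2 * \<nu>)" for x
 have de: "(e has_field_derivative - ((4 * \<nu> + 2) / y * (bessel_J (\<nu> + 1) y)^2 * y powr (- 2 * \<nu>))) (at y)"
  if "y > 0" for y
 proof -
  note d = has_field_derivative_bessel_J[OF assms(1) that] has_field_derivative_bessel_J_Suc[OF assms(1) that]
  have p: "((\<lambda>x. x powr (- 2 * \<nu>)) has_field_derivative - 2 * \<nu> / y * y powr (- 2 * \<nu>)) (at y)"
   using that by (auto intro!: derivative_eq_intros simp: powr_diff)
  have "((\<lambda>x. ((bessel_J \<nu> x)^2 + (bessel_J (\<nu> + 1) x)^2) * x powr (- 2 * \<nu>)) has_field_derivative
    ((bessel_J \<nu> y)^2 + (bessel_J (\<nu> + 1) y)^2) * (- 2 * \<nu> / y * y powr (- 2 * \<nu>)) +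
    (2 * bessel_J \<nu> y * (\<nu> / y * bessel_J \<nu> y - bessel_J (\<nu> + 1) y) +
    2 * bessel_J (\<nu> + 1) y * (bessel_J \<nu> y - (\<nu> + 1) / y * bessel_J (\<nu> + 1) y)) * y powr (- 2 * \<nu>)) (at y)"
   using DERIV_mult[OF DERIV_add[OF DERIV_power[OF d(1), of 2] DERIV_power[OF d(2), of 2]] p]
   by (simp add: mult.commute mult.left_commute mult.assoc add.commute)
  moreover have "(a^2 + b^2) * (- 2 * \<nu> / y * P) + (2 * a * (\<nu> / y * a - b) + 2 * b * (a - (\<nu> + 1) / y * b)) * P
    = - ((4 * \<nu> + 2) / y * b^2 * P)" for a b P
   using that by (simp add: field_simps power2_eq_square)
  ultimately show ?thesis unfolding e_def[abs_def] by simp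
 qed
 have mono: "e x \<le> e y" if "0 < y" "y \<le> x" for y
 proof (rule DERIV_nonpos_imp_nonincreasing[OF that(2)])
  fix z assume z: "y \<le> z" "z \<le> x"
  show "\<exists>d. (e has_field_derivative d) (at z) \<and> d \<le> 0"
   by (intro exI[of _ "- ((4 * \<nu> + 2) / z * (bessel_J (\<nu> + 1) z)^2 * z powr (- 2 * \<nu>))"] conjI de)
     (use z that assms in auto)
 qed
 have "((\<lambda>y. (bessel_J \<nu> y * y powr - \<nu>)^2 + (bessel_J (\<nu> + 1) y * y powr - (\<nu> + 1) * y)^2) \<longlongrightarrow>
   (2 powr - \<nu> / Gamma (\<nu> + 1))^2 + (2 powr - (\<nu> + 1) / Gamma (\<nu> + 1 + 1) * 0)^2) (at_right 0)"
  by (intro tendsto_intros tendsto_bessel_J_powr_at_0) (use assms in auto)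
 moreover have "\<forall>\<^sub>F y in at_right 0. (bessel_J \<nu> y * y powr - \<nu>)^2 + (bessel_J (\<nu> + 1) y * y powr - (\<nu> + 1) * y)^2 = e y"
  using eventually_at_right_less[of 0]
 proof eventually_elim
  case (elim y)
  have "y powr - (\<nu> + 1) * y = y powr - \<nu>" "y powr (- 2 * \<nu>) = (y powr - \<nu>)^2"
   using elim powr_add[of y "- (\<nu> + 1)" 1] powr_add[of y "- \<nu>" "- \<nu>"]
   by (simp_all add: power2_eq_square)
  thus ?case by (simp only: e_def mult.assoc) (simp only: power_mult_distrib distrib_right)
 qed
 ultimately have "(e \<longlongrightarrow> (2 powr - \<nu> / Gamma (\<nu> + 1))^2) (at_right 0)"
  by (simp add: filterlim_cong)
 hence "e x \<le> (2 powr - \<nu> / Gamma (\<nu> + 1))^2"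
 proof (rule tendsto_lowerbound)
  show "\<forall>\<^sub>F y in at_right 0. e x \<le> e y"
   using eventually_at_right_real[OF assms(2)] by eventually_elim (use mono in auto)
 qed auto
 hence "e x * (x powr \<nu>)^2 \<le> (2 powr - \<nu> / Gamma (\<nu> + 1))^2 * (x powr \<nu>)^2"
  by (intro mult_right_mono) auto
 moreover have "x powr (- 2 * \<nu>) * (x powr \<nu>)^2 = 1"
  using assms powr_add[of x "- 2 * \<nu>" "\<nu> + \<nu>"] powr_add[of x \<nu> \<nu>]
  by (simp add: power2_eq_square)
 ultimately show ?thesis by (simp add: e_def mult.assoc)
qed

lemma abs_bessel_J_le:
 assumes "\<nu> \<ge> 0" "x > 0"
 shows "\<bar>bessel_J \<nu> x\<bar> \<le> 2 powr - \<nu> / Gamma (\<nu> + 1) * x powr \<nu>"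
  and "\<bar>bessel_J (\<nu> + 1) x\<bar> \<le> 2 powr - \<nu> / Gamma (\<nu> + 1) * x powr \<nu>"
proof -
 have G: "Gamma (\<nu> + 1) > 0" using assms by (intro Gamma_real_pos) auto
 have *: "\<bar>a\<bar> \<le> c" if "a^2 \<le> c^2" "c \<ge> 0" for a c :: real
  using that abs_le_square_iff[of a c] by simp
 have "(bessel_J \<nu> x)^2 \<le> (2 powr - \<nu> / Gamma (\<nu> + 1) * x powr \<nu>)^2"
  "(bessel_J (\<nu> + 1) x)^2 \<le> (2 powr - \<nu> / Gamma (\<nu> + 1) * x powr \<nu>)^2"
  using bessel_J_energy_le[OF assms] zero_le_power2[of "bessel_J \<nu> x"] zero_le_power2[of "bessel_J (\<nu> + 1) x"]
  unfolding power_mult_distrib by linarith+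
 thus "\<bar>bessel_J \<nu> x\<bar> \<le> 2 powr - \<nu> / Gamma (\<nu> + 1) * x powr \<nu>"
  and "\<bar>bessel_J (\<nu> + 1) x\<bar> \<le> 2 powr - \<nu> / Gamma (\<nu> + 1) * x powr \<nu>"
  using G by (auto intro!: *)
qed

section \<open>Laplace moments of functions of power growth\<close>

lemma norm_lebesgue_integral_le:
 fixes f :: "'a \<Rightarrow> 'b :: {banach, second_countable_topology}"
 assumes "integrable M f" "integrable M g" "\<And>x. norm (f x) \<le> g x"
 shows "norm (integral\<^sup>L M f) \<le> integral\<^sup>L M g"
proof -
 have "norm (integral\<^sup>L M f) \<le> (\<integral>x. norm (f x) \<partial>M)" by (rule integral_norm_bound)
 also have "\<dots> \<le> integral\<^sup>L M g"
  by (intro Bochner_Integration.integral_mono assms integrable_norm)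
 finally show ?thesis .
qed

lemma has_bochner_integral_Gamma:
 fixes b s :: real
 assumes "b > 0" "s > 0"
 shows "has_bochner_integral lborel (\<lambda>x. indicator {0<..} x * (x powr (b - 1) * exp (- (s * x)))) (Gamma b / s powr b)"
proof -
 define f :: "real \<Rightarrow> real" where "f t = indicator {0..} t * t powr (b - 1) / exp t" for t
 have "has_bochner_integral lborel f (Gamma b)"
  unfolding f_def
 proof (rule has_bochner_integral_nn_integral)
  show "(\<integral>\<^sup>+ t. ennreal (indicator {0..} t * t powr (b - 1) / exp t) \<partial>lborel) = ennreal (Gamma b)"
   by (rule Gamma_conv_nn_integral_real[OF assms(1), symmetric])
 qed (use assms Gamma_real_pos[of b] in auto)
 hence "has_bochner_integral lborel (\<lambda>x. f (0 + s * x)) (Gamma b /\<^sub>R \<bar>s\<bar>)"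
  using assms by (subst (asm) lborel_has_bochner_integral_real_affine_iff[of s _ _ 0]) auto
 from has_bochner_integral_mult_right[OF this, of "s powr (1 - b)"]
 have "has_bochner_integral lborel (\<lambda>x. s powr (1 - b) * f (0 + s * x)) (s powr (1 - b) * (Gamma b /\<^sub>R \<bar>s\<bar>))"
  by simp
 moreover have "s powr (1 - b) * (Gamma b /\<^sub>R \<bar>s\<bar>) = Gamma b / s powr b"
  using assms by (simp add: powr_diff field_simps)
 ultimately have hb: "has_bochner_integral lborel (\<lambda>x. s powr (1 - b) * f (0 + s * x)) (Gamma b / s powr b)"
  by simp
 show ?thesis
 proof (rule has_bochner_integral_cong_AE[THEN iffD1, OF _ _ _ hb])
  show "AE x in lborel. s powr (1 - b) * f (0 + s * x) = indicator {0<..} x * (x powr (b - 1) * exp (- (s * x)))"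
   using AE_lborel_singleton[of 0]
  proof eventually_elim
   case (elim x)
   have "s powr (1 - b) * (s * x) powr (b - 1) = x powr (b - 1)" if "x > 0"
    using that assms powr_add[of s "1 - b" "b - 1"] by (simp add: powr_mult)
   thus ?case using elim assms
    by (auto simp: f_def indicator_def exp_minus field_simps mult_less_0_iff zero_le_mult_iff)
  qed
 qed (auto simp: f_def)
qed

text \<open>Integration by parts without boundary terms: applied to total derivatives it yields
  linear relations between Laplace moments.\<close>

lemma set_lebesgue_FTC_eq_0:
 fixes F f :: "real \<Rightarrow> real"
 assumes "\<And>x. x > 0 \<Longrightarrow> (F has_field_derivative f x) (at x)" "continuous_on {0<..} f"
  and "set_integrable lborel {0<..} f" "(F \<longlongrightarrow> 0) (at_right 0)" "(F \<longlongrightarrow> 0) at_top"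
 shows "(LBINT x:{0<..}. f x) = 0"
proof -
 have "(LBINT x=0..\<infinity>. f x) = 0 - 0"
 proof (rule interval_integral_FTC_integrable[where F = F])
  fix x assume "0 < ereal x"
  hence x: "x > 0" by simp
  show "(F has_vector_derivative f x) (at x)"
   using assms(1)[OF x] by (simp add: has_real_derivative_iff_has_vector_derivative)
  show "isCont f x" using assms(2) x by (simp add: continuous_on_eq_continuous_at)
 qed (use assms in \<open>auto simp: ereal_tendsto_simps zero_ereal_def\<close>)
 thus ?thesis by (simp add: interval_lebesgue_integral_0_infty)
qed

definition laplace_moment :: "(real \<Rightarrow> real) \<Rightarrow> nat \<Rightarrow> real \<Rightarrow> real" where
 "laplace_moment f j s = (LBINT x:{0<..}. x ^ j * f x * exp (- (s * x)))"

context
 fixes f :: "real \<Rightarrow> real" and a c :: real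
 assumes cont: "continuous_on {0<..} f" and a: "a \<ge> 0"
  and bound: "\<And>x. x > 0 \<Longrightarrow> \<bar>f x\<bar> \<le> c * x powr a"
begin

lemma laplace_const_nonneg: "c \<ge> 0"
 using bound[of 1] by simp

lemma set_integrable_laplace:
 assumes "s > 0"
 shows "set_integrable lborel {0<..} (\<lambda>x. x ^ j * f x * exp (- (s * x)))"
proof -
 have "has_bochner_integral lborel (\<lambda>x. indicator {0<..} x * (x powr (a + real j + 1 - 1) * exp (- (s * x))))
   (Gamma (a + real j + 1) / s powr (a + real j + 1))"
  using a assms by (intro has_bochner_integral_Gamma) auto
 hence "set_integrable lborel {0<..} (\<lambda>x. c * (x powr (a + real j) * exp (- (s * x))))"
  unfolding set_integrable_def
  using has_bochner_integral_mult_right[of c lborel] by (auto simp: has_bochner_integral_iff mult.left_commute)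
 thus ?thesis
 proof (rule set_integrable_bound)
  show "set_borel_measurable lborel {0<..} (\<lambda>x. x ^ j * f x * exp (- (s * x)))"
   unfolding set_borel_measurable_def using cont
   by (subst measurable_lborel2, intro borel_measurable_continuous_on_indicator)
     (auto intro!: continuous_intros)
  have "\<bar>x ^ j * f x * exp (- (s * x))\<bar> \<le> \<bar>c * (x powr (a + real j) * exp (- (s * x)))\<bar>" if "x > 0" for x
   using that mult_right_mono[OF bound[OF that], of "x ^ j * exp (- (s * x))"] laplace_const_nonneg
   by (simp add: abs_mult powr_add powr_realpow mult_ac)
  thus "AE x in lborel. x \<in> {0<..} \<longrightarrow> norm (x ^ j * f x * exp (- (s * x)))
    \<le> norm (c * (x powr (a + real j) * exp (- (s * x))))" by auto
 qed
qed

lemma abs_laplace_moment_le: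
 assumes "s > 0"
 shows "\<bar>laplace_moment f j s\<bar> \<le> c * Gamma (a + real j + 1) / s powr (a + real j + 1)"
proof -
 have hb: "has_bochner_integral lborel (\<lambda>x. indicator {0<..} x * (x powr (a + real j + 1 - 1) * exp (- (s * x))))
   (Gamma (a + real j + 1) / s powr (a + real j + 1))"
  using a assms by (intro has_bochner_integral_Gamma) auto
 have "norm (laplace_moment f j s) \<le> (\<integral>x. c * (indicator {0<..} x * (x powr (a + real j + 1 - 1) * exp (- (s * x)))) \<partial>lborel)"
  unfolding laplace_moment_def set_lebesgue_integral_def
 proof (rule norm_lebesgue_integral_le)
  show "integrable lborel (\<lambda>x. indicat_real {0<..} x *\<^sub>R (x ^ j * f x * exp (- (s * x))))"
   using set_integrable_laplace[OF assms] by (simp add: set_integrable_def)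
  show "integrable lborel (\<lambda>x. c * (indicator {0<..} x * (x powr (a + real j + 1 - 1) * exp (- (s * x)))))"
   using hb by (auto simp: has_bochner_integral_iff)
  fix x
  show "norm (indicat_real {0<..} x *\<^sub>R (x ^ j * f x * exp (- (s * x))))
   \<le> c * (indicator {0<..} x * (x powr (a + real j + 1 - 1) * exp (- (s * x))))"
   using mult_right_mono[OF bound[of x], of "x ^ j * exp (- (s * x))"]
   by (cases "x > 0") (simp_all add: abs_mult powr_add powr_realpow mult_ac)
 qed
 also have "\<dots> = c * (Gamma (a + real j + 1) / s powr (a + real j + 1))"
  using hb by (simp add: has_bochner_integral_iff)
 finally show ?thesis by simp
qed

lemma has_field_derivative_laplace_moment:
 assumes s: "s > 0"
 shows "(laplace_moment f j has_field_derivative - laplace_moment f (Suc j) s) (at s)"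
proof -
 define C where "C = (LBINT x:{0<..}. c * (x powr (a + real (j + 2)) * exp (- (s / 2 * x))))"
 have hb: "has_bochner_integral lborel (\<lambda>x. indicator {0<..} x * (x powr (a + real (j + 2) + 1 - 1) * exp (- (s / 2 * x))))
   (Gamma (a + real (j + 2) + 1) / (s / 2) powr (a + real (j + 2) + 1))"
  using a assms by (intro has_bochner_integral_Gamma) auto
 \<comment> \<open>Differentiation under the integral by a quadratic remainder:
   \<open>exp (- (h * x))\<close> differs from \<open>1 - h * x\<close> by at most
   \<open>exp \<bar>h * x\<bar> * (h * x)^2\<close>, and \<bar>h\<bar> < s/2 sacrifices only half of
   the decay, so \<open>C\<close> does not depend on \<open>h\<close>.\<close>
 have key: "\<bar>laplace_moment f j (s + h) - laplace_moment f j s + h * laplace_moment f (Suc j) s\<bar> \<le> h^2 * C"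
  if h: "\<bar>h\<bar> < s / 2" for h
 proof -
  have sh: "s + h > 0" using h s by linarith
  note int = set_integrable_laplace[OF sh, of j, unfolded set_integrable_def]
   set_integrable_laplace[OF s, of j, unfolded set_integrable_def]
   set_integrable_laplace[OF s, of "Suc j", unfolded set_integrable_def]
  have e1: "laplace_moment f j (s + h) - laplace_moment f j s + h * laplace_moment f (Suc j) s
   = integral\<^sup>L lborel (\<lambda>x. indicat_real {0<..} x *\<^sub>R (x ^ j * f x * exp (- ((s + h) * x))) -
     indicat_real {0<..} x *\<^sub>R (x ^ j * f x * exp (- (s * x))) +
     h * (indicat_real {0<..} x *\<^sub>R (x ^ Suc j * f x * exp (- (s * x)))))"
   unfolding laplace_moment_def set_lebesgue_integral_def using int by simp
  have e2: "norm (integral\<^sup>L lborel (\<lambda>x. indicat_real {0<..} x *\<^sub>R (x ^ j * f x * exp (- ((s + h) * x))) -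
     indicat_real {0<..} x *\<^sub>R (x ^ j * f x * exp (- (s * x))) +
     h * (indicat_real {0<..} x *\<^sub>R (x ^ Suc j * f x * exp (- (s * x)))))) \<le> (\<integral>x. h^2 * (indicat_real {0<..} x *\<^sub>R (c * (x powr (a + real (j + 2)) * exp (- (s / 2 * x))))) \<partial>lborel)"
  proof (rule norm_lebesgue_integral_le)
   show "integrable lborel (\<lambda>x. indicat_real {0<..} x *\<^sub>R (x ^ j * f x * exp (- ((s + h) * x))) -
     indicat_real {0<..} x *\<^sub>R (x ^ j * f x * exp (- (s * x))) +
     h * (indicat_real {0<..} x *\<^sub>R (x ^ Suc j * f x * exp (- (s * x)))))"
    using int by auto
   show "integrable lborel (\<lambda>x. h^2 * (indicat_real {0<..} x *\<^sub>R (c * (x powr (a + real (j + 2)) * exp (- (s / 2 * x))))))"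
   proof -
    have "integrable lborel (\<lambda>x. indicator {0<..} x * (x powr (a + real (j + 2) + 1 - 1) * exp (- (s / 2 * x))))"
     using hb by (simp add: has_bochner_integral_iff)
    from integrable_mult_right[OF this, of "h^2 * c"] show ?thesis
     by (rule back_subst[of "integrable lborel"]) (auto simp: fun_eq_iff ac_simps)
   qed
   fix x :: real
   show "norm (indicat_real {0<..} x *\<^sub>R (x ^ j * f x * exp (- ((s + h) * x))) -
     indicat_real {0<..} x *\<^sub>R (x ^ j * f x * exp (- (s * x))) +
     h * (indicat_real {0<..} x *\<^sub>R (x ^ Suc j * f x * exp (- (s * x)))))
    \<le> h^2 * (indicat_real {0<..} x *\<^sub>R (c * (x powr (a + real (j + 2)) * exp (- (s / 2 * x)))))"
   proof (cases "x > 0")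
    case True
    have "\<bar>exp (- (h * x)) - (1 - h * x)\<bar> \<le> exp \<bar>h * x\<bar> * (\<bar>h * x\<bar>)^2"
     using Taylor_exp_field[of "- (h * x)" 1] by (simp add: power2_eq_square)
    also have "\<dots> \<le> exp (s / 2 * x) * (\<bar>h * x\<bar>)^2"
     using h True by (intro mult_right_mono) (auto simp: abs_mult intro!: mult_right_mono)
    finally have e: "\<bar>exp (- (h * x)) - (1 - h * x)\<bar> \<le> exp (s / 2 * x) * (\<bar>h * x\<bar>)^2" .
    have "\<bar>x ^ j * f x * exp (- (s * x)) * (exp (- (h * x)) - (1 - h * x))\<bar>
      = (x ^ j * exp (- (s * x))) * (\<bar>f x\<bar> * \<bar>exp (- (h * x)) - (1 - h * x)\<bar>)"
     using True by (simp add: abs_mult)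
    also have "\<dots> \<le> (x ^ j * exp (- (s * x))) * ((c * x powr a) * (exp (s / 2 * x) * (\<bar>h * x\<bar>)^2))"
     using True bound[OF True] e by (intro mult_left_mono mult_mono) auto
    also have "\<dots> = h^2 * (c * ((x ^ j * x^2 * x powr a) * (exp (- (s * x)) * exp (s / 2 * x))))"
     by (simp add: power_mult_distrib mult_ac)
    also have "x ^ j * x^2 * x powr a = x powr (a + real (j + 2))"
     using True by (simp only: powr_add powr_realpow power_add mult_ac)
    also have "exp (- (s * x)) * exp (s / 2 * x) = exp (- (s / 2 * x))"
     by (simp add: exp_add[symmetric])
    finally have bnd: "\<bar>x ^ j * f x * exp (- (s * x)) * (exp (- (h * x)) - (1 - h * x))\<bar>
     \<le> h^2 * (c * (x powr (a + real (j + 2)) * exp (- (s / 2 * x))))" .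
    have "exp (- ((s + h) * x)) = exp (- (s * x)) * exp (- (h * x))"
     by (simp add: exp_add[symmetric] algebra_simps)
    hence eq: "x ^ j * f x * exp (- ((s + h) * x)) - x ^ j * f x * exp (- (s * x)) + h * (x ^ Suc j * f x * exp (- (s * x)))
     = x ^ j * f x * exp (- (s * x)) * (exp (- (h * x)) - (1 - h * x))"
     by (simp add: algebra_simps)
    have ind: "indicat_real {0<..} x = 1" using True by simp
    show ?thesis unfolding ind real_scaleR_def mult_1_left eq real_norm_def by (rule bnd)
   next
    case False
    thus ?thesis by simp
   qed
  qed
  have e3: "(\<integral>x. h^2 * (indicat_real {0<..} x *\<^sub>R (c * (x powr (a + real (j + 2)) * exp (- (s / 2 * x))))) \<partial>lborel) = h^2 * C"
   unfolding C_def set_lebesgue_integral_def by (rule integral_mult_right_zero)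
  show ?thesis using e2 unfolding e3 e1[symmetric] real_norm_def .
 qed
 have "((\<lambda>h. (laplace_moment f j (s + h) - laplace_moment f j s) / h - - laplace_moment f (Suc j) s) \<longlongrightarrow> 0) (at 0)"
 proof (rule Lim_null_comparison)
  have "\<forall>\<^sub>F h in at 0. \<bar>h\<bar> < s / 2 \<and> h \<noteq> (0::real)"
   unfolding eventually_at using s by (intro exI[of _ "s / 2"]) auto
  thus "\<forall>\<^sub>F h in at 0. norm ((laplace_moment f j (s + h) - laplace_moment f j s) / h - - laplace_moment f (Suc j) s) \<le> \<bar>h\<bar> * C"
  proof eventually_elim
   case (elim h)
   have "(laplace_moment f j (s + h) - laplace_moment f j s) / h - - laplace_moment f (Suc j) s =
    (laplace_moment f j (s + h) - laplace_moment f j s + h * laplace_moment f (Suc j) s) / h"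
    using elim by (simp add: field_simps)
   moreover have "\<bar>laplace_moment f j (s + h) - laplace_moment f j s + h * laplace_moment f (Suc j) s\<bar> / \<bar>h\<bar> \<le> (h^2 * C) / \<bar>h\<bar>"
    using key elim by (intro divide_right_mono) auto
   moreover have "(h^2 * C) / \<bar>h\<bar> = \<bar>h\<bar> * C" using elim by (simp add: field_simps power2_eq_square)
   ultimately show ?case by (simp add: abs_divide)
  qed
  show "((\<lambda>h. \<bar>h\<bar> * C) \<longlongrightarrow> 0) (at 0)" by (auto intro!: tendsto_eq_intros)
 qed
 thus ?thesis unfolding DERIV_def by (rule LIM_zero_cancel)
qed

end

section \<open>The Laplace moments of two neighbouring Bessel functions as s tends to 0\<close>

lemma tendsto_0_powr_exp:
 fixes a s :: real
 assumes "a > 0" "s > 0"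
 shows "((\<lambda>x. x powr a * exp (- (s * x))) \<longlongrightarrow> 0) at_top"
  and "((\<lambda>x. x powr a * exp (- (s * x))) \<longlongrightarrow> 0) (at_right 0)"
 using assms by real_asymp+

lemma laplace_boundary_tendsto_0:
 fixes f :: "real \<Rightarrow> real"
 assumes "a \<ge> 0" "\<And>x. x > 0 \<Longrightarrow> \<bar>f x\<bar> \<le> c * x powr a" "s > 0"
 shows "((\<lambda>x. x ^ Suc j * f x * exp (- (s * x))) \<longlongrightarrow> 0) (at_right 0)"
  and "((\<lambda>x. x ^ Suc j * f x * exp (- (s * x))) \<longlongrightarrow> 0) at_top"
proof -
 have le: "norm (x ^ Suc j * f x * exp (- (s * x))) \<le> c * (x powr (a + real (Suc j)) * exp (- (s * x)))" if "x > 0" for x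
 proof -
  have "norm (x ^ Suc j * f x * exp (- (s * x))) = \<bar>f x\<bar> * (x ^ Suc j * exp (- (s * x)))"
   using that by (simp add: abs_mult mult_ac)
  also have "\<dots> \<le> c * x powr a * (x ^ Suc j * exp (- (s * x)))"
   using that by (intro mult_right_mono assms) auto
  also have "\<dots> = c * (x powr (a + real (Suc j)) * exp (- (s * x)))"
   using that by (simp only: powr_add powr_realpow mult.assoc)
  finally show ?thesis .
 qed
 have a: "a + real (Suc j) > 0" using assms by simp
 show "((\<lambda>x. x ^ Suc j * f x * exp (- (s * x))) \<longlongrightarrow> 0) (at_right 0)"
  by (rule Lim_null_comparison[OF _ tendsto_mult_right_zero[where c = c, OF tendsto_0_powr_exp(2)[OF a assms(3)]]])
    (rule eventually_mono[OF eventually_at_right_less], rule le)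
 show "((\<lambda>x. x ^ Suc j * f x * exp (- (s * x))) \<longlongrightarrow> 0) at_top"
  by (rule Lim_null_comparison[OF _ tendsto_mult_right_zero[where c = c, OF tendsto_0_powr_exp(1)[OF a assms(3)]]])
    (rule eventually_mono[OF eventually_gt_at_top[of 0]], rule le)
qed

text \<open>The two-step recurrence that Gamma (x + 1) = x Gamma x implies for 2^j Gamma ((1 + \<nu>
  + j) / 2) / Gamma ((1 + \<nu> - j) / 2), with its initial values 1 and \<nu>. In this form no
  poles have to be discussed.\<close>

fun bessel_moment :: "real \<Rightarrow> nat \<Rightarrow> real" where
 "bessel_moment \<nu> 0 = 1"
| "bessel_moment \<nu> (Suc 0) = \<nu>"
| "bessel_moment \<nu> (Suc (Suc j)) = (\<nu>^2 - (real j + 1)^2) * bessel_moment \<nu> j"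

context
 fixes \<nu> :: real
 assumes \<nu>: "\<nu> > 0"
begin

abbreviation "lapF \<equiv> laplace_moment (bessel_J \<nu>)"
abbreviation "lapG \<equiv> laplace_moment (bessel_J (\<nu> + 1))"
abbreviation "bc \<equiv> 2 powr - \<nu> / Gamma (\<nu> + 1)"

lemma bessel_bounds:
 assumes "x > 0"
 shows "\<bar>bessel_J \<nu> x\<bar> \<le> bc * x powr \<nu>" "\<bar>bessel_J (\<nu> + 1) x\<bar> \<le> bc * x powr \<nu>"
 using abs_bessel_J_le[of \<nu> x] \<nu> assms by auto

lemma continuous_bessel: "continuous_on {0<..} (bessel_J \<nu>)" "continuous_on {0<..} (bessel_J (\<nu> + 1))"
 using has_field_derivative_bessel_J[of \<nu>] has_field_derivative_bessel_J[of "\<nu> + 1"] \<nu>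
 by (auto intro!: continuous_at_imp_continuous_on DERIV_isCont)

lemmas intF = set_integrable_laplace[OF continuous_bessel(1) less_imp_le[OF \<nu>] bessel_bounds(1)]
lemmas intG = set_integrable_laplace[OF continuous_bessel(2) less_imp_le[OF \<nu>] bessel_bounds(2)]
lemmas derivF = has_field_derivative_laplace_moment[OF continuous_bessel(1) less_imp_le[OF \<nu>] bessel_bounds(1)]
lemmas derivG = has_field_derivative_laplace_moment[OF continuous_bessel(2) less_imp_le[OF \<nu>] bessel_bounds(2)]
lemmas boundF = abs_laplace_moment_le[OF continuous_bessel(1) less_imp_le[OF \<nu>] bessel_bounds(1)]
lemmas boundG = abs_laplace_moment_le[OF continuous_bessel(2) less_imp_le[OF \<nu>] bessel_bounds(2)]

text \<open>Obtained by integrating the derivatives of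
  \<open>x ^ Suc j * bessel_J \<nu> x * exp (- (s * x))\<close> and of its analogue of order
  \<open>\<nu> + 1\<close>. The derivative formulas involve only these two orders, so the system
  closes.\<close>

lemma laplace_bessel_rec:
 assumes s: "s > 0"
 shows "(real j + 1 + \<nu>) * lapF j s = lapG (Suc j) s + s * lapF (Suc j) s"
  and "(real j - \<nu>) * lapG j s + lapF (Suc j) s = s * lapG (Suc j) s"
proof -
 define E where "E x = exp (- (s * x))" for x
 have dE: "(E has_field_derivative - s * E x) (at x)" for x
  unfolding E_def[abs_def] by (auto intro!: derivative_eq_intros)
 have cE: "continuous_on {0<..} E" unfolding E_def[abs_def] by (intro continuous_intros)
 note iF = intF[OF _ s, folded E_def] and iG = intG[OF _ s, folded E_def]
 have "(LBINT x:{0<..}. (real j + 1 + \<nu>) * (x ^ j * bessel_J \<nu> x * E x) -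
   (x ^ Suc j * bessel_J (\<nu> + 1) x * E x + s * (x ^ Suc j * bessel_J \<nu> x * E x))) = 0"
 proof (rule set_lebesgue_FTC_eq_0[where F = "\<lambda>x. x ^ Suc j * bessel_J \<nu> x * E x"])
  fix x :: real assume x: "x > 0"
  have "((\<lambda>x. x ^ Suc j * bessel_J \<nu> x * E x) has_field_derivative
   (real (Suc j) * x ^ j * bessel_J \<nu> x + x ^ Suc j * (\<nu> / x * bessel_J \<nu> x - bessel_J (\<nu> + 1) x)) * E x
    + x ^ Suc j * bessel_J \<nu> x * (- s * E x)) (at x)"
   using DERIV_mult[OF DERIV_mult[OF DERIV_pow[of "Suc j" x UNIV] has_field_derivative_bessel_J[of \<nu> x]] dE] \<nu> x
   by (simp add: algebra_simps)
  also have "(real (Suc j) * x ^ j * bessel_J \<nu> x + x ^ Suc j * (\<nu> / x * bessel_J \<nu> x - bessel_J (\<nu> + 1) x)) * E x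
    + x ^ Suc j * bessel_J \<nu> x * (- s * E x) = (real j + 1 + \<nu>) * (x ^ j * bessel_J \<nu> x * E x) -
   (x ^ Suc j * bessel_J (\<nu> + 1) x * E x + s * (x ^ Suc j * bessel_J \<nu> x * E x))"
   using x by (simp add: field_simps)
  finally show "((\<lambda>x. x ^ Suc j * bessel_J \<nu> x * E x) has_field_derivative
   (real j + 1 + \<nu>) * (x ^ j * bessel_J \<nu> x * E x) -
   (x ^ Suc j * bessel_J (\<nu> + 1) x * E x + s * (x ^ Suc j * bessel_J \<nu> x * E x))) (at x)" .
 next
  show "((\<lambda>x. x ^ Suc j * bessel_J \<nu> x * E x) \<longlongrightarrow> 0) (at_right 0)"
   "((\<lambda>x. x ^ Suc j * bessel_J \<nu> x * E x) \<longlongrightarrow> 0) at_top"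
   unfolding E_def using laplace_boundary_tendsto_0[OF less_imp_le[OF \<nu>] bessel_bounds(1) s, of j]
   by simp_all
 qed (auto intro!: continuous_intros continuous_bessel cE set_integral_diff set_integral_add iF iG
     set_integrable_mult_right simp del: power_Suc)
 thus "(real j + 1 + \<nu>) * lapF j s = lapG (Suc j) s + s * lapF (Suc j) s"
  by (simp add: set_integral_diff set_integral_add iF iG set_integrable_mult_right laplace_moment_def E_def[symmetric]
    del: power_Suc)
 have "(LBINT x:{0<..}. ((real j - \<nu>) * (x ^ j * bessel_J (\<nu> + 1) x * E x) + x ^ Suc j * bessel_J \<nu> x * E x) -
   s * (x ^ Suc j * bessel_J (\<nu> + 1) x * E x)) = 0"
 proof (rule set_lebesgue_FTC_eq_0[where F = "\<lambda>x. x ^ Suc j * bessel_J (\<nu> + 1) x * E x"])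
  fix x :: real assume x: "x > 0"
  have "((\<lambda>x. x ^ Suc j * bessel_J (\<nu> + 1) x * E x) has_field_derivative
   (real (Suc j) * x ^ j * bessel_J (\<nu> + 1) x + x ^ Suc j * (bessel_J \<nu> x - (\<nu> + 1) / x * bessel_J (\<nu> + 1) x)) * E x
    + x ^ Suc j * bessel_J (\<nu> + 1) x * (- s * E x)) (at x)"
   using DERIV_mult[OF DERIV_mult[OF DERIV_pow[of "Suc j" x UNIV] has_field_derivative_bessel_J_Suc[of \<nu> x]] dE] \<nu> x
   by (simp add: algebra_simps)
  also have "(real (Suc j) * x ^ j * bessel_J (\<nu> + 1) x + x ^ Suc j * (bessel_J \<nu> x - (\<nu> + 1) / x * bessel_J (\<nu> + 1) x)) * E x
    + x ^ Suc j * bessel_J (\<nu> + 1) x * (- s * E x) =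
    ((real j - \<nu>) * (x ^ j * bessel_J (\<nu> + 1) x * E x) + x ^ Suc j * bessel_J \<nu> x * E x) -
   s * (x ^ Suc j * bessel_J (\<nu> + 1) x * E x)"
   using x by (simp add: field_simps)
  finally show "((\<lambda>x. x ^ Suc j * bessel_J (\<nu> + 1) x * E x) has_field_derivative
    ((real j - \<nu>) * (x ^ j * bessel_J (\<nu> + 1) x * E x) + x ^ Suc j * bessel_J \<nu> x * E x) -
   s * (x ^ Suc j * bessel_J (\<nu> + 1) x * E x)) (at x)" .
 next
  show "((\<lambda>x. x ^ Suc j * bessel_J (\<nu> + 1) x * E x) \<longlongrightarrow> 0) (at_right 0)"
   "((\<lambda>x. x ^ Suc j * bessel_J (\<nu> + 1) x * E x) \<longlongrightarrow> 0) at_top"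
   unfolding E_def using laplace_boundary_tendsto_0[OF less_imp_le[OF \<nu>] bessel_bounds(2) s, of j]
   by simp_all
 qed (auto intro!: continuous_intros continuous_bessel cE set_integral_diff set_integral_add iF iG
     set_integrable_mult_right simp del: power_Suc)
 thus "(real j - \<nu>) * lapG j s + lapF (Suc j) s = s * lapG (Suc j) s"
  by (simp add: set_integral_diff set_integral_add iF iG set_integrable_mult_right laplace_moment_def E_def[symmetric]
    del: power_Suc)
qed

lemma lapF_1_eq:
 assumes s: "s > 0"
 shows "(1 + s^2) * lapF (Suc 0) s = \<nu> * lapG 0 s + s * (1 + \<nu>) * lapF 0 s"
proof -
 have "lapF (Suc 0) s = \<nu> * lapG 0 s + s * ((1 + \<nu>) * lapF 0 s - s * lapF (Suc 0) s)"
  using laplace_bessel_rec[OF s, of 0] by (simp add: algebra_simps)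
 thus ?thesis by (simp add: algebra_simps power2_eq_square)
qed

text \<open>With U = sqrt (1 + s^2), the difference X of the two sides satisfies U X' = \<nu> X.
  Hence X exp (-\<nu> arsinh s) is constant, and the power bounds on both transforms force it to
  vanish at infinity.\<close>

lemma lapG_0_eq:
 assumes s: "s > 0"
 shows "lapG 0 s = (sqrt (1 + s^2) - s) * lapF 0 s"
proof -
 define U where "U s = sqrt (1 + s^2)" for s :: real
 define X where "X s = lapG 0 s - (U s - s) * lapF 0 s" for s
 define Y where "Y s = X s * exp (- \<nu> * arsinh s)" for s
 have U: "U s > 0" "(U s)^2 = 1 + s^2" for s
  unfolding U_def by (auto simp: add_pos_nonneg)
 have dY: "(Y has_field_derivative 0) (at s)" if s: "s > 0" for s
 proof -
  have dU: "(U has_field_derivative s / U s) (at s)"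
   unfolding U_def[abs_def]
   using add_pos_nonneg[OF zero_less_one zero_le_power2[of s]]
   by (auto intro!: derivative_eq_intros simp: field_simps)
  have dX: "(X has_field_derivative - lapG (Suc 0) s - ((s / U s - 1) * lapF 0 s + (U s - s) * (- lapF (Suc 0) s))) (at s)"
   unfolding X_def[abs_def]
   using DERIV_diff[OF derivG[OF _ s, of 0] DERIV_mult[OF DERIV_diff[OF dU DERIV_ident] derivF[OF _ s, of 0]]]
   by (simp add: mult.commute add.commute)
  have "U s * (- lapG (Suc 0) s - ((s / U s - 1) * lapF 0 s + (U s - s) * (- lapF (Suc 0) s)))
   = (U s)^2 * lapF (Suc 0) s - U s * (lapG (Suc 0) s + s * lapF (Suc 0) s) - s * lapF 0 s + U s * lapF 0 s"
   using U(1)[of s] by (simp add: field_simps power2_eq_square)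
  also have "\<dots> = \<nu> * X s"
  proof -
   have r: "lapG (Suc 0) s + s * lapF (Suc 0) s = (1 + \<nu>) * lapF 0 s"
    using laplace_bessel_rec(1)[OF s, of 0] by simp
   show ?thesis unfolding r U(2) lapF_1_eq[OF s] X_def by (simp add: algebra_simps)
  qed
  finally have "(- lapG (Suc 0) s - ((s / U s - 1) * lapF 0 s + (U s - s) * (- lapF (Suc 0) s))) * U s = \<nu> * X s"
   by (subst mult.commute)
  hence "- lapG (Suc 0) s - ((s / U s - 1) * lapF 0 s + (U s - s) * (- lapF (Suc 0) s)) = \<nu> * X s / U s"
   by (rule eq_divide_imp[rotated]) (use U(1)[of s] in simp)
  with dX have dX': "(X has_field_derivative \<nu> * X s / U s) (at s)" by simp
  have da: "((\<lambda>s. exp (- \<nu> * arsinh s)) has_field_derivative exp (- \<nu> * arsinh s) * (- \<nu> * (1 / U s))) (at s)"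
   using DERIV_chain2[OF DERIV_exp DERIV_cmult[OF arsinh_real_has_field_derivative[of s UNIV], of "- \<nu>"]]
   by (simp add: U_def add.commute)
  show ?thesis unfolding Y_def[abs_def]
   using DERIV_mult[OF dX' da] U(1)[of s] by (simp add: field_simps)
 qed
 obtain K where K: "\<And>s. s > 0 \<Longrightarrow> Y s = K"
  using has_field_derivative_zero_constant[of "{0<..}" Y] dY
  by (auto intro: has_field_derivative_at_within)
 have "(Y \<longlongrightarrow> 0) at_top"
 proof (rule Lim_null_comparison)
  define B where "B s = bc * Gamma (\<nu> + 1) / s powr (\<nu> + 1)" for s
  show "((\<lambda>s. B s + B s) \<longlongrightarrow> 0) at_top" unfolding B_def using \<nu> by real_asymp
  show "\<forall>\<^sub>F s in at_top. norm (Y s) \<le> B s + B s"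
   using eventually_gt_at_top[of 0]
  proof eventually_elim
   case (elim s)
   have "U s \<le> 1 + s" unfolding U_def using elim by (intro real_le_lsqrt) (auto simp: power2_eq_square algebra_simps)
   moreover have "s \<le> U s" unfolding U_def using elim by (intro real_le_rsqrt) auto
   ultimately have u: "\<bar>U s - s\<bar> \<le> 1" by simp
   have "\<bar>X s\<bar> \<le> \<bar>lapG 0 s\<bar> + \<bar>U s - s\<bar> * \<bar>lapF 0 s\<bar>"
    unfolding X_def by (simp add: abs_mult[symmetric])
   also have "\<dots> \<le> B s + 1 * B s"
    using boundF[OF _ elim, of 0] boundG[OF _ elim, of 0] u unfolding B_def by (intro add_mono mult_mono) auto
   finally have x: "\<bar>X s\<bar> \<le> B s + B s" by simp
   have "s + sqrt (s^2 + 1) \<ge> 1" using elim real_sqrt_ge_one[of "s^2 + 1"] by (simp add: add_increasing)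
   hence "arsinh s \<ge> 0" by (simp add: arsinh_real_def)
   hence "exp (- \<nu> * arsinh s) \<le> 1" using \<nu> by simp
   hence "\<bar>X s\<bar> * exp (- \<nu> * arsinh s) \<le> (B s + B s) * 1" using x by (intro mult_mono) auto
   thus ?case by (simp add: Y_def abs_mult)
  qed
 qed
 moreover have "(Y \<longlongrightarrow> K) at_top"
  by (rule tendsto_eventually) (rule eventually_mono[OF eventually_gt_at_top[of 0]], rule K)
 ultimately have "K = 0" using tendsto_unique trivial_limit_at_top_linorder by blast
 hence "X s = 0" using K[OF s] by (simp add: Y_def)
 thus ?thesis by (simp add: X_def U_def)
qed

text \<open>Here \<open>exp (\<nu> * arsinh s)\<close> is the \<nu>-th power of s + sqrt (1 + s^2).
  The constant \<open>K\<close> is left undetermined, because orthogonal polynomials see the moments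
  only up to a nonzero factor (\<open>moment_OP_scale\<close>).\<close>

lemma lapF_0_eq:
 obtains K where "\<And>s. s > 0 \<Longrightarrow> lapF 0 s = K / (sqrt (1 + s^2) * exp (\<nu> * arsinh s))"
proof -
 define U where "U s = sqrt (1 + s^2)" for s :: real
 define Y where "Y s = lapF 0 s * (U s * exp (\<nu> * arsinh s))" for s
 have U: "U s > 0" "(U s)^2 = 1 + s^2" for s
  unfolding U_def by (auto simp: add_pos_nonneg)
 have dY: "(Y has_field_derivative 0) (at s)" if s: "s > 0" for s
 proof -
  have dU: "(U has_field_derivative s / U s) (at s)"
   unfolding U_def[abs_def]
   using add_pos_nonneg[OF zero_less_one zero_le_power2[of s]]
   by (auto intro!: derivative_eq_intros simp: field_simps)
  have "(U s)^2 * lapF (Suc 0) s = (s + \<nu> * U s) * lapF 0 s"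
   using lapF_1_eq[OF s] unfolding U(2) lapG_0_eq[OF s] U_def[symmetric] by (simp add: algebra_simps)
  hence F1: "lapF (Suc 0) s = (s + \<nu> * U s) * lapF 0 s / (U s * U s)"
   using U(1)[of s] by (simp add: field_simps power2_eq_square)
  have da: "((\<lambda>s. exp (\<nu> * arsinh s)) has_field_derivative exp (\<nu> * arsinh s) * (\<nu> * (1 / U s))) (at s)"
   using DERIV_chain2[OF DERIV_exp DERIV_cmult[OF arsinh_real_has_field_derivative[of s UNIV], of "\<nu>"]]
   by (simp add: U_def add.commute)
  show ?thesis unfolding Y_def[abs_def]
   using DERIV_mult[OF derivF[OF _ s, of 0] DERIV_mult[OF dU da]] U(1)[of s]
   by (simp add: F1 field_simps)
 qed
 obtain K where K: "\<And>s. s > 0 \<Longrightarrow> Y s = K"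
  using has_field_derivative_zero_constant[of "{0<..}" Y] dY
  by (auto intro: has_field_derivative_at_within)
 show ?thesis
 proof (rule that[of K])
  fix s :: real assume "s > 0"
  from K[OF this] U(1)[of s] show "lapF 0 s = K / (sqrt (1 + s^2) * exp (\<nu> * arsinh s))"
   by (auto simp: Y_def U_def field_simps)
 qed
qed

text \<open>Mean value theorem for \<open>bessel_J \<nu> x * x powr - \<nu>\<close>, whose
  derivative \<open>- bessel_J (\<nu> + 1) x * x powr - \<nu>\<close> is bounded by
  \<open>bc\<close>. It serves to show that the constant of \<open>lapF_0_eq\<close> is not
  0.\<close>

lemma bessel_J_near_0:
 assumes x: "x > 0"
 shows "\<bar>bessel_J \<nu> x - bc * x powr \<nu>\<bar> \<le> bc * x powr (\<nu> + 1)"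
proof -
 define \<phi> where "\<phi> x = bessel_J \<nu> x * x powr - \<nu>" for x
 have d: "(\<phi> has_field_derivative - bessel_J (\<nu> + 1) y * y powr - \<nu>) (at y)" if "y > 0" for y
 proof -
  have p: "((\<lambda>x. x powr - \<nu>) has_field_derivative - \<nu> / y * y powr - \<nu>) (at y)"
   using that by (auto intro!: derivative_eq_intros simp: powr_diff)
  show ?thesis unfolding \<phi>_def[abs_def]
   using DERIV_mult[OF has_field_derivative_bessel_J[of \<nu> y] p] \<nu> that by (simp add: algebra_simps)
 qed
 have lip: "\<bar>\<phi> x - \<phi> y\<bar> \<le> bc * x" if y: "0 < y" "y < x" for y
 proof -
  obtain z where z: "z > y" "z < x" "\<phi> x - \<phi> y = (x - y) * (- bessel_J (\<nu> + 1) z * z powr - \<nu>)"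
   using MVT2[OF y(2), of \<phi> "\<lambda>y. - bessel_J (\<nu> + 1) y * y powr - \<nu>"] d y by auto
  have z0: "z > 0" using z y by simp
  have "\<bar>bessel_J (\<nu> + 1) z\<bar> * z powr - \<nu> \<le> (bc * z powr \<nu>) * z powr - \<nu>"
   using bessel_bounds(2)[OF z0] by (intro mult_right_mono) auto
  also have "\<dots> = bc" using z0 powr_add[of z \<nu> "- \<nu>"] by (simp add: field_simps)
  finally have "(x - y) * (\<bar>bessel_J (\<nu> + 1) z\<bar> * z powr - \<nu>) \<le> x * bc"
   using y by (intro mult_mono) auto
  thus ?thesis using y by (simp add: z(3) abs_mult mult.commute)
 qed
 have "((\<lambda>y. \<bar>\<phi> x - \<phi> y\<bar>) \<longlongrightarrow> \<bar>\<phi> x - bc\<bar>) (at_right 0)"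
  unfolding \<phi>_def using \<nu> by (intro tendsto_intros tendsto_bessel_J_powr_at_0) auto
 hence "\<bar>\<phi> x - bc\<bar> \<le> bc * x"
  by (rule tendsto_upperbound) (use eventually_at_right_real[OF x] lip in \<open>auto elim!: eventually_mono\<close>)
 hence "\<bar>\<phi> x - bc\<bar> * x powr \<nu> \<le> bc * x * x powr \<nu>" by (intro mult_right_mono) auto
 moreover have "\<bar>\<phi> x - bc\<bar> * x powr \<nu> = \<bar>(\<phi> x - bc) * x powr \<nu>\<bar>" by (simp add: abs_mult)
 moreover have "x powr - \<nu> * x powr \<nu> = 1" using x powr_add[of x "- \<nu>" \<nu>] by simp
 hence "(\<phi> x - bc) * x powr \<nu> = bessel_J \<nu> x - bc * x powr \<nu>"
  by (simp add: \<phi>_def left_diff_distrib mult.assoc)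
 ultimately show ?thesis using x by (simp add: powr_add mult_ac)
qed

lemma lapF_0_nonzero: "\<exists>s>0. lapF 0 s \<noteq> 0"
proof (rule ccontr)
 assume "\<not> ?thesis"
 hence z: "lapF 0 s = 0" if "s > 0" for s using that by auto
 have G: "Gamma (\<nu> + 1) > 0" "bc > 0" using \<nu> by (auto intro!: Gamma_real_pos divide_pos_pos)
 \<comment> \<open>The leading term \<open>bc * x powr \<nu>\<close> has transform
   \<open>bc * Gamma (\<nu> + 1) / s powr (\<nu> + 1)\<close>, and the transform of the remainder is
   at most \<open>(\<nu> + 1) / s\<close> times that; any \<open>s\<close> above
   \<open>\<nu> + 1\<close> leads to the contradiction.\<close>
 define s where "s = \<nu> + 2"
 have s: "s > 0" using \<nu> by (simp add: s_def)
 define f where "f x = bessel_J \<nu> x - bc * x powr \<nu>" for x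
 have hb: "has_bochner_integral lborel (\<lambda>x. indicator {0<..} x * (x powr (\<nu> + 1 - 1) * exp (- (s * x)))) (Gamma (\<nu> + 1) / s powr (\<nu> + 1))"
  using \<nu> s by (intro has_bochner_integral_Gamma) auto
 have "laplace_moment f 0 s = lapF 0 s - bc * (Gamma (\<nu> + 1) / s powr (\<nu> + 1))"
 proof -
  have 1: "integrable lborel (\<lambda>x. indicat_real {0<..} x * (bessel_J \<nu> x * exp (- (s * x))))"
   using intF[OF _ s, of 0] by (simp add: set_integrable_def)
  have 2: "integrable lborel (\<lambda>x. bc * (indicat_real {0<..} x * (x powr \<nu> * exp (- (s * x)))))"
   using hb by (auto simp: has_bochner_integral_iff intro: integrable_mult_right)
  have "laplace_moment f 0 s = (\<integral>x. indicat_real {0<..} x * (bessel_J \<nu> x * exp (- (s * x))) -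
    bc * (indicat_real {0<..} x * (x powr \<nu> * exp (- (s * x)))) \<partial>lborel)"
   unfolding laplace_moment_def set_lebesgue_integral_def f_def
   by (intro Bochner_Integration.integral_cong) (auto simp: algebra_simps)
  also have "\<dots> = (\<integral>x. indicat_real {0<..} x * (bessel_J \<nu> x * exp (- (s * x))) \<partial>lborel) -
    (\<integral>x. bc * (indicat_real {0<..} x * (x powr \<nu> * exp (- (s * x)))) \<partial>lborel)"
   by (rule Bochner_Integration.integral_diff[OF 1 2])
  finally show ?thesis using hb
   by (simp add: has_bochner_integral_iff laplace_moment_def set_lebesgue_integral_def)
 qed
 moreover have "\<bar>laplace_moment f 0 s\<bar> \<le> bc * Gamma (\<nu> + 1 + real 0 + 1) / s powr (\<nu> + 1 + real 0 + 1)"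
  using \<nu> s by (intro abs_laplace_moment_le)
   (auto intro!: continuous_intros continuous_bessel bessel_J_near_0 simp: f_def[abs_def] simp del: mult_minus_left times_divide_eq_left)
 moreover have "Gamma (\<nu> + 1 + 1) = (\<nu> + 1) * Gamma (\<nu> + 1)"
  using \<nu> by (intro Gamma_plus1) (auto elim!: nonpos_Ints_cases)
 moreover have "s powr (\<nu> + 1 + 1) = s powr (\<nu> + 1) * s" using s powr_add[of s "\<nu> + 1" 1] by simp
 ultimately have "bc * Gamma (\<nu> + 1) / s powr (\<nu> + 1) \<le> bc * ((\<nu> + 1) * Gamma (\<nu> + 1)) / (s powr (\<nu> + 1) * s)"
  using z[OF s] G by (simp add: abs_mult)
 moreover define A where "A = bc * Gamma (\<nu> + 1) / s powr (\<nu> + 1)"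
 have "b * (n * G) / (P * s) = (b * G / P) * (n / s)" for b n G P :: real
  by (simp add: mult_ac)
 hence "bc * ((\<nu> + 1) * Gamma (\<nu> + 1)) / (s powr (\<nu> + 1) * s) = A * ((\<nu> + 1) / s)"
  unfolding A_def by blast
 ultimately have "A * 1 \<le> A * ((\<nu> + 1) / s)" by (simp only: A_def mult_1_right)
 moreover have "A > 0" unfolding A_def using G s by (intro divide_pos_pos mult_pos_pos) auto
 ultimately have "1 \<le> (\<nu> + 1) / s" by (rule mult_left_le_imp_le)
 thus False using s by (simp add: s_def field_simps)
qed

text \<open>Eliminating \<open>lapG\<close> from the two recurrences expresses
  \<open>lapF (j + 2)\<close> through \<open>lapF (j + 1)\<close> and \<open>lapF j\<close> with the
  harmless denominator 1 + s^2; at s = 0 this is the recurrence of \<open>bessel_moment\<close>. Two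
  consecutive indices go through the induction together.\<close>

theorem tendsto_bessel_moments:
 obtains K where "K \<noteq> 0" "\<And>j. (lapF j \<longlongrightarrow> K * bessel_moment \<nu> j) (at_right 0)"
proof -
 obtain K where K: "\<And>s. s > 0 \<Longrightarrow> lapF 0 s = K / (sqrt (1 + s^2) * exp (\<nu> * arsinh s))"
  using lapF_0_eq by blast
 have K0: "K \<noteq> 0" using lapF_0_nonzero K by auto
 have pos: "\<forall>\<^sub>F s::real in at_right 0. s > 0" by (rule eventually_at_right_less)
 have U0: "((\<lambda>s. 1 + s^2) \<longlongrightarrow> (1::real)) (at_right 0)" by (auto intro!: tendsto_eq_intros)
 have "isCont arsinh (0::real)"
  using arsinh_real_has_field_derivative[of 0 UNIV] by (rule DERIV_isCont)
 hence as: "(arsinh \<longlongrightarrow> (0::real)) (at_right 0)"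
  using tendsto_within_subset[of arsinh _ 0 UNIV] by (auto simp: isCont_def arsinh_def)
 have "((\<lambda>s. K / (sqrt (1 + s^2) * exp (\<nu> * arsinh s))) \<longlongrightarrow> K / (sqrt 1 * exp (\<nu> * 0))) (at_right 0)"
  by (intro tendsto_intros U0 as) auto
 hence "((\<lambda>s. K / (sqrt (1 + s^2) * exp (\<nu> * arsinh s))) \<longlongrightarrow> K) (at_right 0)" by simp
 hence F0: "(lapF 0 \<longlongrightarrow> K) (at_right 0)"
  by (rule Lim_transform_eventually) (rule eventually_mono[OF pos], simp add: K)
 have "((\<lambda>s. (sqrt (1 + s^2) - s) * lapF 0 s) \<longlongrightarrow> (sqrt 1 - 0) * K) (at_right 0)"
  by (intro tendsto_intros U0 F0)
 hence "((\<lambda>s. (sqrt (1 + s^2) - s) * lapF 0 s) \<longlongrightarrow> K) (at_right 0)" by simp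
 hence G0: "(lapG 0 \<longlongrightarrow> K) (at_right 0)"
  by (rule Lim_transform_eventually) (rule eventually_mono[OF pos], simp add: lapG_0_eq)
 have "((\<lambda>s. (\<nu> * lapG 0 s + s * (1 + \<nu>) * lapF 0 s) / (1 + s^2)) \<longlongrightarrow> (\<nu> * K + 0 * (1 + \<nu>) * K) / 1) (at_right 0)"
  by (intro tendsto_intros U0 F0 G0) auto
 moreover have "\<forall>\<^sub>F s in at_right 0. (\<nu> * lapG 0 s + s * (1 + \<nu>) * lapF 0 s) / (1 + s^2) = lapF (Suc 0) s"
  using pos
 proof eventually_elim
  case (elim s)
  have "1 + s^2 \<noteq> 0" by (metis power_one sum_power2_eq_zero_iff zero_neq_one)
  thus ?case using lapF_1_eq[OF elim] by (simp add: field_simps)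
 qed
 ultimately have F1: "(lapF (Suc 0) \<longlongrightarrow> K * \<nu>) (at_right 0)"
  by (simp add: filterlim_cong mult.commute)
 have "(lapF j \<longlongrightarrow> K * bessel_moment \<nu> j) (at_right 0) \<and> (lapF (Suc j) \<longlongrightarrow> K * bessel_moment \<nu> (Suc j)) (at_right 0)" for j
 proof (induction j)
  case 0
  show ?case using F0 F1 by simp
 next
  case (Suc j)
  have "((\<lambda>s. (s * (real j + 2 + \<nu>) * lapF (Suc j) s - (real j + 1 - \<nu>) * ((real j + 1 + \<nu>) * lapF j s - s * lapF (Suc j) s)) / (1 + s^2))
    \<longlongrightarrow> (0 * (real j + 2 + \<nu>) * (K * bessel_moment \<nu> (Suc j)) - (real j + 1 - \<nu>) * ((real j + 1 + \<nu>) * (K * bessel_moment \<nu> j) - 0 * (K * bessel_moment \<nu> (Suc j)))) / 1) (at_right 0)"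
   using Suc.IH by (intro tendsto_intros U0) auto
  moreover have "(0 * (real j + 2 + \<nu>) * (K * bessel_moment \<nu> (Suc j)) - (real j + 1 - \<nu>) * ((real j + 1 + \<nu>) * (K * bessel_moment \<nu> j) - 0 * (K * bessel_moment \<nu> (Suc j)))) / 1
    = K * bessel_moment \<nu> (Suc (Suc j))"
   by (simp add: algebra_simps power2_eq_square)
  moreover have "\<forall>\<^sub>F s in at_right 0. (s * (real j + 2 + \<nu>) * lapF (Suc j) s - (real j + 1 - \<nu>) * ((real j + 1 + \<nu>) * lapF j s - s * lapF (Suc j) s)) / (1 + s^2) = lapF (Suc (Suc j)) s"
   using pos
  proof eventually_elim
   case (elim s)
   have g1: "lapG (Suc j) s = (real j + 1 + \<nu>) * lapF j s - s * lapF (Suc j) s"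
    using laplace_bessel_rec(1)[OF elim, of j] by simp
   have g2: "lapG (Suc (Suc j)) s = (real j + 2 + \<nu>) * lapF (Suc j) s - s * lapF (Suc (Suc j)) s"
    using laplace_bessel_rec(1)[OF elim, of "Suc j"] by (simp add: algebra_simps)
   have "(real j + 1 - \<nu>) * lapG (Suc j) s + lapF (Suc (Suc j)) s = s * lapG (Suc (Suc j)) s"
    using laplace_bessel_rec(2)[OF elim, of "Suc j"] by (simp add: algebra_simps)
   hence "s * (real j + 2 + \<nu>) * lapF (Suc j) s - (real j + 1 - \<nu>) * ((real j + 1 + \<nu>) * lapF j s - s * lapF (Suc j) s)
     = (1 + s^2) * lapF (Suc (Suc j)) s"
    unfolding g1 g2 by (simp add: algebra_simps power2_eq_square)
   moreover have "1 + s^2 \<noteq> 0" by (metis power_one sum_power2_eq_zero_iff zero_neq_one)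
   ultimately show ?case by (simp add: divide_eq_eq)
  qed
  ultimately show ?case using Suc.IH by (simp add: filterlim_cong)
 qed
 with K0 show ?thesis by (intro that[of K]) auto
qed

end

section \<open>Orthogonal polynomials of a moment functional\<close>

definition moment_functional :: "(nat \<Rightarrow> real) \<Rightarrow> real poly \<Rightarrow> real" where
 "moment_functional m p = (\<Sum>i\<le>degree p. coeff p i * m i)"

lemma moment_functional_eq:
 assumes "degree p \<le> N"
 shows "moment_functional m p = (\<Sum>i\<le>N. coeff p i * m i)"
 unfolding moment_functional_def using assms
 by (intro sum.mono_neutral_left) (auto simp: coeff_eq_0)

lemma moment_functional_add: "moment_functional m (p + q) = moment_functional m p + moment_functional m q"
proof -
 define N where "N = max (degree p) (degree q)"
 have "degree p \<le> N" "degree q \<le> N" "degree (p + q) \<le> N"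
  using degree_add_le_max[of p q] by (auto simp: N_def)
 thus ?thesis by (simp add: moment_functional_eq[of _ N] sum.distrib algebra_simps)
qed

lemma moment_functional_smult: "moment_functional m (smult c p) = c * moment_functional m p"
 using degree_smult_le[of c p]
 by (simp add: moment_functional_eq[of _ "degree p"] sum_distrib_left mult.assoc)

lemma moment_functional_0 [simp]: "moment_functional m 0 = 0"
 by (simp add: moment_functional_def)

lemma moment_functional_diff: "moment_functional m (p - q) = moment_functional m p - moment_functional m q"
 using moment_functional_add[of m "p - q" q] by simp

lemma moment_functional_sum: "moment_functional m (\<Sum>i\<in>A. p i) = (\<Sum>i\<in>A. moment_functional m (p i))"
 by (induction A rule: infinite_finite_induct) (auto simp: moment_functional_add)

declare sum.cong [fundef_cong]

text \<open>Gram-Schmidt for a bilinear, not sesquilinear, form. Division by 0 makes it total; it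
  produces orthogonal polynomials as long as the earlier \<open>moment_norm\<close> are nonzero.
  With \<open>sum.cong\<close> as congruence rule the termination proof sees \<open>k < n\<close>
  under the sum.\<close>

fun moment_OP :: "(nat \<Rightarrow> real) \<Rightarrow> nat \<Rightarrow> real poly" where
 "moment_OP m n = monom 1 n - (\<Sum>k<n. smult (moment_functional m (monom 1 n * moment_OP m k) /
   moment_functional m (moment_OP m k * moment_OP m k)) (moment_OP m k))"

declare sum.cong [fundef_cong del]
declare moment_OP.simps [simp del]

text \<open>If the earlier ones do not vanish, this is the quotient of the Hankel determinants of
  sizes k + 1 and k. Its nonvanishing for all indices below n thus replaces a condition on
  determinants.\<close>

definition moment_norm :: "(nat \<Rightarrow> real) \<Rightarrow> nat \<Rightarrow> real" where
 "moment_norm m k = moment_functional m (moment_OP m k * moment_OP m k)"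

lemma moment_OP_degree_coeff: "degree (moment_OP m n) \<le> n \<and> coeff (moment_OP m n) n = 1"
proof (induction n rule: less_induct)
 case (less n)
 let ?S = "\<Sum>k<n. smult (moment_functional m (monom 1 n * moment_OP m k) /
   moment_functional m (moment_OP m k * moment_OP m k)) (moment_OP m k)"
 have d: "degree (moment_OP m k) < n" if "k < n" for k
  using less[OF that] that by simp
 have "degree ?S \<le> n"
 proof (intro degree_sum_le)
  fix k assume "k \<in> {..<n}"
  thus "degree (smult (moment_functional m (monom 1 n * moment_OP m k) /
   moment_functional m (moment_OP m k * moment_OP m k)) (moment_OP m k)) \<le> n"
   using d[of k] degree_smult_le[of _ "moment_OP m k"] by (meson lessThan_iff less_imp_le order_trans)
 qed auto
 moreover have "coeff ?S n = 0"
  using d by (simp add: coeff_sum coeff_eq_0)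
 ultimately show ?case
  using degree_diff_le[of "monom 1 n" n ?S] degree_monom_le[of "1::real" n] by (subst (1 2) moment_OP.simps) simp
qed

lemma degree_moment_OP: "degree (moment_OP m n) = n"
 using moment_OP_degree_coeff[of m n] by (metis le_degree le_antisym zero_neq_one)

lemma lead_coeff_moment_OP: "lead_coeff (moment_OP m n) = 1"
 using moment_OP_degree_coeff[of m n] by (simp add: degree_moment_OP)

lemma moment_OP_orthogonal:
 assumes "\<forall>k<n. moment_norm m k \<noteq> 0" "j < n"
 shows "moment_functional m (moment_OP m n * moment_OP m j) = 0"
 using assms
proof (induction n arbitrary: j rule: less_induct)
 case (less n)
 let ?L = "moment_functional m" and ?P = "moment_OP m"
 have o: "?L (?P k * ?P j) = 0" if "k < n" "k \<noteq> j" for k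
 proof (cases "k < j")
  case True
  thus ?thesis using less.IH[of j k] less.prems that by (simp add: mult.commute)
 next
  case False
  thus ?thesis using less.IH[of k j] less.prems that by simp
 qed
 have "?L (?P n * ?P j) = ?L (monom 1 n * ?P j) -
   (\<Sum>k<n. ?L (monom 1 n * ?P k) / ?L (?P k * ?P k) * ?L (?P k * ?P j))"
  by (subst moment_OP.simps)
    (simp add: algebra_simps sum_distrib_left moment_functional_diff moment_functional_sum moment_functional_smult)
 also have "(\<Sum>k<n. ?L (monom 1 n * ?P k) / ?L (?P k * ?P k) * ?L (?P k * ?P j))
   = (\<Sum>k\<in>{j}. ?L (monom 1 n * ?P k) / ?L (?P k * ?P k) * ?L (?P k * ?P j))"
  using less.prems o by (intro sum.mono_neutral_right) auto
 also have "\<dots> = ?L (monom 1 n * ?P j)" using less.prems by (simp add: moment_norm_def)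
 finally show ?case by simp
qed

lemma moment_OP_orthogonal_poly:
 assumes "\<forall>k<n. moment_norm m k \<noteq> 0" "degree p < n"
 shows "moment_functional m (moment_OP m n * p) = 0"
 using assms(2)
proof (induction "degree p" arbitrary: p rule: less_induct)
 case less
 define d where "d = degree p"
 define q where "q = p - smult (lead_coeff p) (moment_OP m d)"
 have p: "p = q + smult (lead_coeff p) (moment_OP m d)" by (simp add: q_def)
 have q0: "moment_functional m (moment_OP m n * q) = 0"
 proof (cases "q = 0")
  case False
  have "degree q \<le> d" unfolding q_def
   by (intro degree_diff_le) (auto simp: d_def degree_moment_OP)
  moreover have "coeff q d = 0"
   using moment_OP_degree_coeff[of m d] by (simp add: q_def d_def)
  ultimately have "degree q < d"
   using False by (metis leading_coeff_0_iff le_neq_implies_less)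
  thus ?thesis using less by (simp add: d_def)
 qed auto
 show ?case
  using less.prems moment_OP_orthogonal[OF assms(1), of d]
  by (subst p) (simp add: distrib_left moment_functional_add moment_functional_smult q0 flip: d_def)
qed

lemma moment_OP_unique:
 assumes nz: "\<forall>k<n. moment_norm m k \<noteq> 0" and q: "degree q = n" "lead_coeff q = 1"
  and o: "\<And>j. j < n \<Longrightarrow> moment_functional m (q * monom 1 j) = 0"
 shows "q = moment_OP m n"
proof (rule ccontr)
 assume ne: "q \<noteq> moment_OP m n"
 define d where "d = q - moment_OP m n"
 define l where "l = degree d"
 have d0: "d \<noteq> 0" using ne by (simp add: d_def)
 have "degree d \<le> n" unfolding d_def by (intro degree_diff_le) (use q degree_moment_OP in auto)
 moreover have "coeff d n = 0" using q moment_OP_degree_coeff[of m n] by (simp add: d_def)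
 ultimately have l: "l < n" using d0 unfolding l_def by (metis leading_coeff_0_iff le_neq_implies_less)
 have orth: "moment_functional m (d * p) = 0" if "degree p < n" for p
 proof -
  have "moment_functional m (q * p) = (\<Sum>i\<le>degree p. coeff p i * moment_functional m (q * monom 1 i))"
   by (subst poly_as_sum_of_monoms[of p, symmetric])
     (simp add: sum_distrib_left moment_functional_sum flip: moment_functional_smult mult_smult_right,
     simp add: smult_monom)
  also have "\<dots> = 0" using o that by (intro sum.neutral) auto
  finally show ?thesis using moment_OP_orthogonal_poly[OF nz that]
   by (simp add: d_def algebra_simps moment_functional_diff)
 qed
 define r where "r = d - smult (lead_coeff d) (moment_OP m l)"
 have "moment_functional m (moment_OP m l * r) = 0"
 proof (cases "r = 0")
  case False
  have "degree r \<le> l" unfolding r_def by (intro degree_diff_le) (auto simp: l_def degree_moment_OP)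
  moreover have "coeff r l = 0" using moment_OP_degree_coeff[of m l] by (simp add: r_def l_def)
  ultimately have "degree r < l" using False by (metis leading_coeff_0_iff le_neq_implies_less)
  thus ?thesis using nz l by (intro moment_OP_orthogonal_poly) auto
 qed auto
 moreover have "moment_functional m (d * moment_OP m l) = 0"
  using l by (intro orth) (simp add: degree_moment_OP)
 ultimately have "lead_coeff d * moment_norm m l = 0"
  by (simp add: r_def algebra_simps moment_functional_diff moment_functional_smult moment_norm_def)
 thus False using nz l d0 by simp
qed

section \<open>Continuity of the orthogonal polynomials in the moments\<close>

lemma tendsto_moment_functional:
 assumes "\<And>j. ((\<lambda>s. m s j) \<longlongrightarrow> m0 j) F" "\<And>s. degree (p s) \<le> N" "degree p0 \<le> N"
  and "\<And>i. ((\<lambda>s. coeff (p s) i) \<longlongrightarrow> coeff p0 i) F"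
 shows "((\<lambda>s. moment_functional (m s) (p s)) \<longlongrightarrow> moment_functional m0 p0) F"
 using assms by (simp add: moment_functional_eq[of _ N]) (intro tendsto_intros)

lemma tendsto_coeff_mult:
 fixes p q :: "'b \<Rightarrow> real poly"
 assumes "\<And>i. ((\<lambda>s. coeff (p s) i) \<longlongrightarrow> coeff p0 i) F" "\<And>i. ((\<lambda>s. coeff (q s) i) \<longlongrightarrow> coeff q0 i) F"
 shows "((\<lambda>s. coeff (p s * q s) i) \<longlongrightarrow> coeff (p0 * q0) i) F"
 using assms by (simp add: coeff_mult) (intro tendsto_intros)

text \<open>Each Gram-Schmidt coefficient is a quotient whose denominator has a nonzero limit, so
  convergence of the moments passes to the coefficients by induction on the degree.\<close>

lemma tendsto_moment_OP:
 assumes m: "\<And>j. ((\<lambda>s. m s j) \<longlongrightarrow> m0 j) F" and nz: "\<forall>k<n. moment_norm m0 k \<noteq> 0"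
 shows "((\<lambda>s. coeff (moment_OP (m s) n) i) \<longlongrightarrow> coeff (moment_OP m0 n) i) F"
 using nz
proof (induction n arbitrary: i rule: less_induct)
 case (less n)
 have IH: "((\<lambda>s. coeff (moment_OP (m s) k) i) \<longlongrightarrow> coeff (moment_OP m0 k) i) F" if "k < n" for k i
  using less that by auto
 have 1: "((\<lambda>s. moment_functional (m s) (monom 1 n * moment_OP (m s) k)) \<longlongrightarrow>
   moment_functional m0 (monom 1 n * moment_OP m0 k)) F" if "k < n" for k
  by (intro tendsto_moment_functional[where N = "n + k"] m tendsto_coeff_mult IH that tendsto_const)
    (auto intro!: order_trans[OF degree_mult_le] add_mono degree_monom_le simp: degree_moment_OP)
 have 2: "((\<lambda>s. moment_functional (m s) (moment_OP (m s) k * moment_OP (m s) k)) \<longlongrightarrow>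
   moment_functional m0 (moment_OP m0 k * moment_OP m0 k)) F" if "k < n" for k
  by (intro tendsto_moment_functional[where N = "k + k"] m tendsto_coeff_mult IH that)
    (auto intro!: order_trans[OF degree_mult_le] add_mono simp: degree_moment_OP)
 show ?case
  unfolding moment_OP.simps[of _ n] coeff_diff coeff_sum coeff_smult
  by (intro tendsto_intros 1 2 IH) (use less.prems in \<open>auto simp: moment_norm_def\<close>)
qed

lemma tendsto_moment_norm:
 assumes m: "\<And>j. ((\<lambda>s. m s j) \<longlongrightarrow> m0 j) F" and nz: "\<forall>k<n. moment_norm m0 k \<noteq> 0"
 shows "((\<lambda>s. moment_norm (m s) n) \<longlongrightarrow> moment_norm m0 n) F"
 unfolding moment_norm_def
 by (intro tendsto_moment_functional[where N = "n + n"] m tendsto_coeff_mult tendsto_moment_OP nz)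
   (auto intro!: order_trans[OF degree_mult_le] add_mono simp: degree_moment_OP)

section \<open>Meixner--Pollaczek polynomials\<close>

lemma has_bochner_integral_has_integral_nonneg:
 fixes f :: "real \<Rightarrow> real"
 assumes "(f has_integral I) \<Omega>" "\<Omega> \<in> sets borel" "f \<in> borel_measurable borel" "\<And>x. x \<in> \<Omega> \<Longrightarrow> f x \<ge> 0"
 shows "has_bochner_integral lborel (\<lambda>x. indicator \<Omega> x * f x) I"
proof (rule has_bochner_integral_nn_integral)
 show "(\<integral>\<^sup>+ x. ennreal (indicator \<Omega> x * f x) \<partial>lborel) = ennreal I"
  by (rule nn_integral_has_integral_lebesgue[OF assms(4,1)])
 show "0 \<le> I" by (rule has_integral_nonneg[OF assms(1,4)])
qed (use assms in \<open>auto simp: indicator_def\<close>)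

lemma borel_measurable_cosh [measurable (raw)]:
 fixes f :: "'a \<Rightarrow> real"
 assumes "f \<in> borel_measurable M"
 shows "(\<lambda>x. cosh (f x)) \<in> borel_measurable M"
 by (rule borel_measurable_continuous_on[OF _ assms]) (intro continuous_intros)

lemma Gamma_reflection_real: "Gamma a * Gamma (1 - a) = pi / sin (pi * a)" for a :: real
proof -
 have "cr (Gamma a * Gamma (1 - a)) = cr (pi / sin (pi * a))"
  using Gamma_reflection_complex[of "cr a"]
  by (simp add: Gamma_complex_of_real[symmetric] sin_of_real[symmetric])
 thus ?thesis by (simp only: of_real_eq_iff)
qed

text \<open>The logistic substitution q = 1 / (1 + exp (-2 \<pi> x)) turns the integral into Beta a
  b / \<pi> with a + b = 1, and the reflection formula evaluates it as 1 / sin (\<pi> a), which is 1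
  / cos (s/2).\<close>

lemma sech_mgf:
 fixes s :: real
 assumes "\<bar>s\<bar> < pi"
 shows "has_bochner_integral lborel (\<lambda>x. exp (s * x) / cosh (pi * x)) (1 / cos (s / 2))"
proof -
 define a b where "a = 1 / 2 + s / (2 * pi)" and "b = 1 / 2 - s / (2 * pi)"
 have ab: "a > 0" "b > 0" "a + b = 1"
  using assms by (auto simp: a_def b_def field_simps abs_if split: if_splits)
 define g where "g x = 1 / (1 + exp (- (2 * pi * x)))" for x :: real
 define g' where "g' x = 2 * pi * (g x * (1 - g x))" for x :: real
 define f where "f q = q powr (a - 1) * (1 - q) powr (b - 1) / pi" for q
 have e1: "1 + exp y > (0::real)" for y by (simp add: add_pos_pos)
 have g: "g x > 0" "g x < 1" for x
  using e1[of "- (2 * pi * x)"] by (auto simp: g_def field_simps)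
 have der: "(g has_field_derivative g' x) (at x within UNIV)" for x
  unfolding g_def[abs_def] g'_def
  using e1[of "- (2 * pi * x)"]
  by (auto intro!: derivative_eq_intros simp: field_simps power2_eq_square)
 have inj: "inj g"
  by (rule injI) (use e1 in \<open>simp add: g_def field_simps\<close>)
 have img: "g ` UNIV = {0<..<1}"
 proof (intro equalityI subsetI)
  fix q :: real assume q: "q \<in> {0<..<1}"
  have "g (- ln ((1 - q) / q) / (2 * pi)) = q" using q by (simp add: g_def field_simps)
  thus "q \<in> g ` UNIV" by (metis rangeI)
 qed (use g in auto)
 have "((\<lambda>t. t powr (a - 1) * (1 - t) powr (b - 1)) has_integral Beta a b) {0<..<1}"
  using has_integral_Beta_real[OF ab(1,2)] by (simp add: has_integral_Icc_iff_Ioo)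
 from has_integral_divide[OF this, of pi]
 have hi: "(f has_integral Beta a b / pi) {0<..<1}" unfolding f_def .
 hence "f absolutely_integrable_on g ` UNIV \<and> integral (g ` UNIV) f = Beta a b / pi"
  unfolding img by (auto simp: has_integral_iff f_def intro!: nonnegative_absolutely_integrable_1)
 hence "(\<lambda>x. \<bar>g' x\<bar> * f (g x)) absolutely_integrable_on UNIV \<and> integral UNIV (\<lambda>x. \<bar>g' x\<bar> * f (g x)) = Beta a b / pi"
  by (subst has_absolute_integral_change_of_variables_1'[OF _ der inj]) auto
 moreover have "\<bar>g' x\<bar> * f (g x) = exp (s * x) / cosh (pi * x)" for x
 proof -
  have gx: "g x = exp (pi * x) / (2 * cosh (pi * x))"
  proof -
   have "exp (- (2 * pi * x)) = exp (- (pi * x)) * exp (- (pi * x))" by (simp add: exp_add[symmetric])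
   thus ?thesis using e1[of "- (2 * pi * x)"] by (simp add: g_def cosh_def field_simps exp_minus)
  qed
  have g1: "1 - g x = exp (- (pi * x)) / (2 * cosh (pi * x))"
   unfolding gx using cosh_real_pos[of "pi * x"] by (simp add: field_simps) (simp add: cosh_def)
  have "\<bar>g' x\<bar> * f (g x) = 2 * ((g x * g x powr (a - 1)) * ((1 - g x) * (1 - g x) powr (b - 1)))"
   using g[of x] by (simp add: g'_def f_def abs_mult)
  also have "g x * g x powr (a - 1) = g x powr a"
   using g[of x] by (simp add: powr_mult_base)
  also have "(1 - g x) * (1 - g x) powr (b - 1) = (1 - g x) powr b"
   using g[of x] by (simp add: powr_mult_base)
  also have "g x powr a = exp (pi * x * a) / (2 * cosh (pi * x)) powr a"
   unfolding gx by (subst powr_divide) (simp_all add: powr_def mult.commute)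
  also have "(1 - g x) powr b = exp (- (pi * x) * b) / (2 * cosh (pi * x)) powr b"
   unfolding g1 by (subst powr_divide) (simp_all add: powr_def mult.commute)
  also have "2 * (exp (pi * x * a) / (2 * cosh (pi * x)) powr a * (exp (- (pi * x) * b) / (2 * cosh (pi * x)) powr b))
    = 2 * exp (pi * x * a + - (pi * x) * b) / (2 * cosh (pi * x)) powr (a + b)"
   unfolding exp_add powr_add by simp
  also have "pi * x * a + - (pi * x) * b = s * x" by (simp add: a_def b_def field_simps)
  also have "(2 * cosh (pi * x)) powr (a + b) = 2 * cosh (pi * x)" unfolding ab(3) by simp
  finally show ?thesis by simp
 qed
 moreover have "Beta a b / pi = 1 / cos (s / 2)"
 proof -
  have "Gamma a * Gamma (1 - a) = pi / sin (pi * a)" by (rule Gamma_reflection_real)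
  moreover have "b = 1 - a" using ab by simp
  moreover have "pi * a = s / 2 + pi / 2" by (simp add: a_def field_simps)
  ultimately show ?thesis by (simp add: Beta_def sin_add)
 qed
 ultimately have "((\<lambda>x. exp (s * x) / cosh (pi * x)) has_integral 1 / cos (s / 2)) UNIV"
  by (simp add: has_integral_iff absolutely_integrable_on_def)
 from has_bochner_integral_has_integral_nonneg[OF this] show ?thesis by simp
qed

lemma integrable_exp_sech: "integrable lborel (\<lambda>x. exp \<bar>x\<bar> / cosh (pi * x))"
proof (rule Bochner_Integration.integrable_bound)
 show "integrable lborel (\<lambda>x. exp (1 * x) / cosh (pi * x) + exp (- 1 * x) / cosh (pi * x))"
  using sech_mgf[of 1] sech_mgf[of "-1"] pi_gt3
  by (intro Bochner_Integration.integrable_add) (auto simp: has_bochner_integral_iff)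
 show "AE x in lborel. norm (exp \<bar>x\<bar> / cosh (pi * x)) \<le> norm (exp (1 * x) / cosh (pi * x) + exp (- 1 * x) / cosh (pi * x))"
 proof (intro AE_I2)
  fix x :: real
  have "exp \<bar>x\<bar> \<le> exp (1 * x) + exp (- 1 * x)" by (auto simp: abs_if)
  hence "exp \<bar>x\<bar> / cosh (pi * x) \<le> (exp (1 * x) + exp (- 1 * x)) / cosh (pi * x)"
   by (intro divide_right_mono) auto
  moreover have "exp \<bar>x\<bar> / cosh (pi * x) \<ge> 0" by (intro divide_nonneg_nonneg) auto
  ultimately show "norm (exp \<bar>x\<bar> / cosh (pi * x)) \<le> norm (exp (1 * x) / cosh (pi * x) + exp (- 1 * x) / cosh (pi * x))"
   unfolding add_divide_distrib[symmetric] real_norm_def by linarith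
 qed
qed measurable

lemma integrable_poly_sech:
 "integrable lborel (\<lambda>x. poly f (cr x) * cr (1 / cosh (pi * x)))"
proof -
 have 1: "integrable lborel (\<lambda>x. x ^ j / cosh (pi * x))" for j :: nat
 proof (rule Bochner_Integration.integrable_bound[OF integrable_mult_right[OF integrable_exp_sech, of "fact j"]])
  show "AE x in lborel. norm (x ^ j / cosh (pi * x)) \<le> norm (fact j * (exp \<bar>x\<bar> / cosh (pi * x)))"
  proof (rule AE_I2)
   fix x :: real
   have "(\<Sum>n\<in>{j}. \<bar>x\<bar> ^ n /\<^sub>R fact n) \<le> exp \<bar>x\<bar>"
    unfolding exp_def by (intro sum_le_suminf) (use summable_exp_generic[of "\<bar>x\<bar>"] summable_exp_generic[of "\<bar>x\<bar> + 1"] in auto)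
   hence "\<bar>x\<bar> ^ j \<le> fact j * exp \<bar>x\<bar>" by (simp add: field_simps)
   hence "\<bar>x\<bar> ^ j / cosh (pi * x) \<le> fact j * exp \<bar>x\<bar> / cosh (pi * x)" by (intro divide_right_mono) auto
   thus "norm (x ^ j / cosh (pi * x)) \<le> norm (fact j * (exp \<bar>x\<bar> / cosh (pi * x)))"
    by (simp add: power_abs abs_divide)
  qed
 qed measurable
 have "integrable lborel (\<lambda>x. \<Sum>i\<le>degree f. coeff f i * cr (x ^ i / cosh (pi * x)))"
  by (intro Bochner_Integration.integrable_sum integrable_mult_right integrable_of_real 1)
 thus ?thesis by (simp add: poly_altdef sum_divide_distrib)
qed

definition sech_int :: "complex poly \<Rightarrow> complex" where
 "sech_int f = (\<integral>x. poly f (cr x) * cr (1 / cosh (pi * x)) \<partial>lborel)"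

lemma sech_int_add: "sech_int (f + g) = sech_int f + sech_int g"
 unfolding sech_int_def
 by (subst Bochner_Integration.integral_add[symmetric, OF integrable_poly_sech integrable_poly_sech])
   (simp only: poly_add distrib_right)

lemma sech_int_smult: "sech_int (smult c f) = c * sech_int f"
proof -
 have "(\<lambda>x. poly (smult c f) (cr x) * cr (1 / cosh (pi * x))) =
   (\<lambda>x. c * (poly f (cr x) * cr (1 / cosh (pi * x))))"
  by (simp add: mult.assoc)
 thus ?thesis unfolding sech_int_def by (simp only: integral_mult_right_zero)
qed

text \<open>Since Re (exp (s (x + i/2))) = exp (s x) cos (s/2), \<open>sech_mgf\<close> says that
  the exponential generating function of these integrals is the constant 1 near s = 0; its Taylor
  coefficients are compared.\<close>

lemma sech_shift_moments:
 "has_bochner_integral lborel (\<lambda>x. Re ((cr x + \<i> / 2) ^ j) / cosh (pi * x)) (if j = 0 then 1 else 0)"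
proof -
 define c where "c j x = Re ((cr x + \<i> / 2) ^ j) / cosh (pi * x)" for j :: nat and x
 define a where "a j = (\<integral>x. c j x \<partial>lborel) / fact j" for j
 have int: "integrable lborel (c j)" for j
 proof -
  have "integrable lborel (\<lambda>x. Re (poly ([:\<i> / 2, 1:] ^ j) (cr x) * cr (1 / cosh (pi * x))))"
   by (rule integrable_Re[OF integrable_poly_sech])
  thus ?thesis unfolding c_def[abs_def] by (simp add: poly_power add.commute)
 qed
 have sums: "(\<lambda>j. a j * s ^ j) sums 1" if s: "\<bar>s\<bar> < 1" for s
 proof -
  have "(\<lambda>N. \<integral>x. (\<Sum>j<N. s ^ j / fact j * c j x) \<partial>lborel) \<longlonglongrightarrow>
    (\<integral>x. cos (s / 2) * (exp (s * x) / cosh (pi * x)) \<partial>lborel)"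
  proof (rule integral_dominated_convergence[where w = "\<lambda>x. exp 1 * (exp \<bar>x\<bar> / cosh (pi * x))"])
   show "AE x in lborel. (\<lambda>N. \<Sum>j<N. s ^ j / fact j * c j x) \<longlonglongrightarrow> cos (s / 2) * (exp (s * x) / cosh (pi * x))"
   proof (rule AE_I2)
    fix x :: real
    have "(\<lambda>j. Re ((cr s * (cr x + \<i> / 2)) ^ j /\<^sub>R fact j) / cosh (pi * x)) sums
      (Re (exp (cr s * (cr x + \<i> / 2))) / cosh (pi * x))"
     by (intro sums_divide sums_Re exp_converges)
    moreover have "Re ((cr s * (cr x + \<i> / 2)) ^ j /\<^sub>R fact j) / cosh (pi * x) = s ^ j / fact j * c j x" for j
    proof -
     have e: "(cr s * (cr x + \<i> / 2)) ^ j = (s ^ j) *\<^sub>R (cr x + \<i> / 2) ^ j"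
      using power_mult_distrib[of "cr s" _ j] by (metis of_real_power scaleR_conv_of_real)
     have "Re ((s ^ j) *\<^sub>R z /\<^sub>R fact j) / w = s ^ j / fact j * (Re z / w)" for z w
      by (simp add: divide_inverse)
     thus ?thesis unfolding e c_def .
    qed
    moreover have "Re (exp (cr s * (cr x + \<i> / 2))) = exp (s * x) * cos (s / 2)"
     by (simp add: Re_exp)
    ultimately show "(\<lambda>N. \<Sum>j<N. s ^ j / fact j * c j x) \<longlonglongrightarrow> cos (s / 2) * (exp (s * x) / cosh (pi * x))"
     by (simp add: sums_def mult.commute)
   qed
   show "integrable lborel (\<lambda>x. exp 1 * (exp \<bar>x\<bar> / cosh (pi * x)))"
    by (intro integrable_mult_right integrable_exp_sech)
   show "AE x in lborel. norm (\<Sum>j<N. s ^ j / fact j * c j x) \<le> exp 1 * (exp \<bar>x\<bar> / cosh (pi * x))" for N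
   proof (rule AE_I2)
    fix x :: real
    have cb: "\<bar>c j x\<bar> \<le> (\<bar>x\<bar> + 1) ^ j / cosh (pi * x)" for j
    proof -
     have "\<bar>Re ((cr x + \<i> / 2) ^ j)\<bar> \<le> norm (cr x + \<i> / 2) ^ j"
      by (metis abs_Re_le_cmod norm_power)
     also have "\<dots> \<le> (\<bar>x\<bar> + 1) ^ j"
      using norm_triangle_ineq[of "cr x" "\<i> / 2"] by (intro power_mono) (auto simp: norm_divide)
     finally show ?thesis unfolding c_def by (simp add: abs_divide divide_right_mono)
    qed
    have "norm (\<Sum>j<N. s ^ j / fact j * c j x) \<le> (\<Sum>j<N. (\<bar>x\<bar> + 1) ^ j /\<^sub>R fact j / cosh (pi * x))"
    proof (rule sum_norm_le)
     fix j
     have "\<bar>s ^ j\<bar> \<le> 1" using s by (simp add: power_abs power_le_one)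
     hence "\<bar>s ^ j / fact j\<bar> * \<bar>c j x\<bar> \<le> (1 / fact j) * ((\<bar>x\<bar> + 1) ^ j / cosh (pi * x))"
      by (intro mult_mono cb) (auto simp: abs_divide divide_right_mono)
     thus "norm (s ^ j / fact j * c j x) \<le> (\<bar>x\<bar> + 1) ^ j /\<^sub>R fact j / cosh (pi * x)"
      by (simp add: abs_mult divide_inverse mult_ac)
    qed
    also have "\<dots> = (\<Sum>j<N. (\<bar>x\<bar> + 1) ^ j /\<^sub>R fact j) / cosh (pi * x)" by (simp add: sum_divide_distrib)
    also have "(\<Sum>j<N. (\<bar>x\<bar> + 1) ^ j /\<^sub>R fact j) \<le> exp (\<bar>x\<bar> + 1)"
     unfolding exp_def by (intro sum_le_suminf) (use summable_exp_generic[of "\<bar>x\<bar>"] summable_exp_generic[of "\<bar>x\<bar> + 1"] in auto)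
    finally show "norm (\<Sum>j<N. s ^ j / fact j * c j x) \<le> exp 1 * (exp \<bar>x\<bar> / cosh (pi * x))"
     by (simp add: exp_add divide_right_mono mult.commute)
   qed
  qed (use int in \<open>auto intro!: borel_measurable_sum borel_measurable_times\<close>)
  moreover have "(\<integral>x. (\<Sum>j<N. s ^ j / fact j * c j x) \<partial>lborel) = (\<Sum>j<N. a j * s ^ j)" for N
   using int by (subst Bochner_Integration.integral_sum) (auto simp: a_def intro!: sum.cong)
  moreover have "(\<integral>x. cos (s / 2) * (exp (s * x) / cosh (pi * x)) \<partial>lborel) = 1"
  proof -
   have "cos (s / 2) > 0" using s pi_gt3 by (intro cos_gt_zero_pi) auto
   moreover have "\<bar>s\<bar> < pi" using s pi_gt3 by linarith
   ultimately show ?thesis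
    unfolding integral_mult_right_zero using sech_mgf[of s] by (simp add: has_bochner_integral_iff)
  qed
  ultimately show ?thesis by (simp add: sums_def)
 qed
 have a0: "a 0 = 1"
  using sums_unique2[OF sums[of 0] powser_sums_zero[of a]] by simp
 have aj: "a j = 0" if "j > 0" for j
 proof (rule ccontr)
  assume nz: "a j \<noteq> 0"
  have sm: "(\<lambda>n. (a(0 := 0)) n * (x - 0) ^ n) sums 0" if "norm (x - 0) < 1" for x :: real
  proof -
   have "(\<lambda>j. a j * x ^ j) sums 1" using sums[of x] that by simp
   moreover have "(\<lambda>j. if j = 0 then 1 else 0) sums (1::real)" using sums_single[of 0 "\<lambda>_. 1::real"] by simp
   ultimately have "(\<lambda>j. a j * x ^ j - (if j = 0 then 1 else 0)) sums (1 - 1)" by (rule sums_diff)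
   moreover have "(\<lambda>j. a j * x ^ j - (if j = 0 then 1 else 0)) = (\<lambda>n. (a(0 := 0)) n * (x - 0) ^ n)"
    using a0 by (auto simp: fun_eq_iff)
   ultimately show ?thesis by simp
  qed
  have nz': "(a(0 := 0)) j \<noteq> 0" using nz that by simp
  \<comment> \<open>A power series with a nonzero coefficient has isolated zeros, but this one
    vanishes on a whole disc.\<close>
  show False
  proof (rule powser_0_nonzero[of 1 0 "a(0 := 0)" "\<lambda>_. 0::real" j])
   fix r :: real assume r: "0 < r" "\<And>z :: real. z \<in> cball 0 r - {0} \<Longrightarrow> (0::real) \<noteq> 0"
   have "r \<in> cball 0 r - {0}" using r(1) by auto
   from r(2)[OF this] show False by simp
  qed (use sm nz' that in simp_all)
 qed
 have "has_bochner_integral lborel (c j) (if j = 0 then 1 else 0)"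
  using a0 aj[of j] int[of j] by (auto simp: has_bochner_integral_iff a_def)
 thus ?thesis unfolding c_def[abs_def] .
qed

text \<open>A residue computation in disguise: moving both lines of integration to the real axis
  would pick up the pole at 0. Here it is obtained monomial by monomial from
  \<open>sech_shift_moments\<close>.\<close>

lemma sech_int_shift:
 "sech_int (pcompose f [:\<i> / 2, 1:] + pcompose f [:- \<i> / 2, 1:]) = 2 * poly f 0"
proof -
 have *: "poly (pcompose f [:\<i> / 2, 1:] + pcompose f [:- \<i> / 2, 1:]) (cr x) * cr (1 / cosh (pi * x))
   = (\<Sum>j\<le>degree f. (2 * coeff f j) * cr (Re ((cr x + \<i> / 2) ^ j) / cosh (pi * x)))" for x
 proof -
  have "(cr x + \<i> / 2) ^ j + (cr x - \<i> / 2) ^ j = 2 * cr (Re ((cr x + \<i> / 2) ^ j))" for j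
   using complex_add_cnj[of "(cr x + \<i> / 2) ^ j"] by simp
  hence "coeff f j * (cr x + \<i> / 2) ^ j + coeff f j * (cr x - \<i> / 2) ^ j = 2 * coeff f j * cr (Re ((cr x + \<i> / 2) ^ j))" for j
   by (metis distrib_left mult.assoc mult.left_commute)
  hence "poly f (cr x + \<i> / 2) + poly f (cr x - \<i> / 2) =
   (\<Sum>j\<le>degree f. 2 * coeff f j * cr (Re ((cr x + \<i> / 2) ^ j)))"
   by (simp only: poly_altdef sum.distrib[symmetric])
  thus ?thesis
   by (simp add: poly_pcompose poly_add sum_divide_distrib add.commute diff_conv_add_uminus del: add_uminus_conv_diff)
 qed
 have "sech_int (pcompose f [:\<i> / 2, 1:] + pcompose f [:- \<i> / 2, 1:]) =
   (\<Sum>j\<le>degree f. (2 * coeff f j) * cr (if j = 0 then 1 else 0))"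
  unfolding sech_int_def *
  using sech_shift_moments
  by (subst Bochner_Integration.integral_sum) (auto simp: has_bochner_integral_iff simp del: of_real_divide intro!: sum.cong)
 also have "\<dots> = 2 * poly f 0" by (simp add: poly_0_coeff_0 if_distrib[of "\<lambda>x. _ * of_real x"] cong: if_cong)
 finally show ?thesis .
qed

text \<open>The Meixner-Pollaczek polynomials with parameter 1/2 and angle \<pi>/2. In this
  normalisation they are orthonormal for sech (\<pi> x), and their Jacobi matrix has off-diagonal
  entries k/2.\<close>

fun mp :: "nat \<Rightarrow> complex poly" where
 "mp 0 = 1"
| "mp (Suc 0) = [:0, 2:]"
| "mp (Suc (Suc n)) = smult (1 / of_nat (n + 2)) ([:0, 2:] * mp (Suc n) - smult (of_nat (n + 1)) (mp n))"

text \<open>The Meixner-Pollaczek family with parameter 0, generated by ((1 - i t) / (1 + i t))^(i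
  x). Replacing x by x + i/2 and by x - i/2 and averaging yields the generating function of
  \<open>mp\<close>, which makes \<open>sech_int_shift\<close> applicable.\<close>

fun mp_shift :: "nat \<Rightarrow> complex poly" where
 "mp_shift 0 = 1"
| "mp_shift (Suc 0) = [:0, 2:]"
| "mp_shift (Suc (Suc n)) = smult (1 / of_nat (n + 2)) ([:0, 2:] * mp_shift (Suc n) - smult (of_nat n) (mp_shift n))"

lemma of_nat_plus_2_neq_0 [simp]: "2 + of_nat n \<noteq> (0 :: complex)"
 by (metis add_2_eq_Suc nat.distinct(1) of_nat_add of_nat_eq_0_iff of_nat_numeral)

lemma poly_mp_rec: "of_nat (Suc n) * poly (mp (Suc n)) x = 2 * x * poly (mp n) x - of_nat n * poly (mp (n - 1)) x"
proof (cases n)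
 case (Suc m)
 have "of_nat (Suc (Suc m)) * (1 / of_nat (m + 2) * c) = c" for c :: complex
  using of_nat_plus_2_neq_0[of m] by (simp add: add.commute)
 thus ?thesis unfolding Suc by (simp add: mult.assoc del: of_nat_Suc of_nat_add)
qed auto

lemma mp_rec: "[:0, 2:] * mp n = smult (of_nat (Suc n)) (mp (Suc n)) + smult (of_nat n) (mp (n - 1))"
proof -
 have "poly ([:0, 2:] * mp n) x = poly (smult (of_nat (Suc n)) (mp (Suc n)) + smult (of_nat n) (mp (n - 1))) x" for x
  using poly_mp_rec[of n x] by (simp add: algebra_simps del: of_nat_Suc)
 thus ?thesis by (simp add: poly_eq_poly_eq_iff[symmetric] fun_eq_iff)
qed

text \<open>Sum and difference of the shifts are treated together because the recurrence mixes them.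
  The factor \<open>of_nat n\<close> in the second identity voids the case n = 0, where
  \<open>n - 1\<close> is truncated.\<close>

lemma mp_shift_identities:
 "poly (mp_shift n) (x + \<i> / 2) + poly (mp_shift n) (x - \<i> / 2) = 2 * poly (mp n) x \<and>
  of_nat n * (\<i> * (poly (mp_shift n) (x + \<i> / 2) - poly (mp_shift n) (x - \<i> / 2))) = - 2 * of_nat n * poly (mp (n - 1)) x"
proof (induction n rule: mp_shift.induct)
 case 1
 show ?case by simp
next
 case 2
 show ?case by (simp add: algebra_simps)
next
 case (3 n)
 define a where "a k = poly (mp_shift k) (x + \<i> / 2)" for k
 define b where "b k = poly (mp_shift k) (x - \<i> / 2)" for k
 define P where "P k = poly (mp k) x" for k
 have n2: "(of_nat n + 2 :: complex) \<noteq> 0" using of_nat_plus_2_neq_0[of n] by (simp add: add.commute)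
 have ra: "(of_nat n + 2) * a (Suc (Suc n)) = (2 * x + \<i>) * a (Suc n) - of_nat n * a n"
  and rb: "(of_nat n + 2) * b (Suc (Suc n)) = (2 * x - \<i>) * b (Suc n) - of_nat n * b n"
 proof -
  have r: "(of_nat n + 2) * poly (mp_shift (Suc (Suc n))) y = 2 * y * poly (mp_shift (Suc n)) y - of_nat n * poly (mp_shift n) y" for y
  proof -
   have "(of_nat n + 2) * (1 / of_nat (n + 2) * c) = c" for c :: complex
    using n2 by (simp add: add.commute)
   thus ?thesis by (simp add: mult.assoc del: of_nat_add)
  qed
  show "(of_nat n + 2) * a (Suc (Suc n)) = (2 * x + \<i>) * a (Suc n) - of_nat n * a n"
   using r[of "x + \<i> / 2"] by (simp add: a_def distrib_left del: mp_shift.simps)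
  show "(of_nat n + 2) * b (Suc (Suc n)) = (2 * x - \<i>) * b (Suc n) - of_nat n * b n"
   using r[of "x - \<i> / 2"] by (simp add: b_def right_diff_distrib del: mp_shift.simps)
 qed
 have s1: "a (Suc n) + b (Suc n) = 2 * P (Suc n)" and s0: "a n + b n = 2 * P n"
  using 3 by (auto simp: a_def b_def P_def)
 have d1: "\<i> * (a (Suc n) - b (Suc n)) = - 2 * P n"
 proof -
  have "of_nat (Suc n) * (\<i> * (a (Suc n) - b (Suc n))) = of_nat (Suc n) * (- 2 * P n)"
   using 3(1) by (simp add: a_def b_def P_def del: of_nat_Suc)
  thus ?thesis by (subst (asm) mult_cancel_left) (simp del: of_nat_Suc)
 qed
 have d0: "of_nat n * (\<i> * (a n - b n)) = - 2 * of_nat n * P (n - 1)"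
  using 3(2) by (auto simp: a_def b_def P_def)
 have rP2: "(of_nat n + 2) * P (Suc (Suc n)) = 2 * x * P (Suc n) - (of_nat n + 1) * P n"
  using poly_mp_rec[of "Suc n" x] by (simp add: P_def algebra_simps del: mp.simps)
 have rP1: "(of_nat n + 1) * P (Suc n) = 2 * x * P n - of_nat n * P (n - 1)"
  using poly_mp_rec[of n x] by (simp add: P_def algebra_simps del: mp.simps)
 have "(of_nat n + 2) * (a (Suc (Suc n)) + b (Suc (Suc n))) =
   2 * x * (a (Suc n) + b (Suc n)) + \<i> * (a (Suc n) - b (Suc n)) - of_nat n * (a n + b n)"
  by (simp add: ra rb distrib_left) (simp add: algebra_simps)
 also have "\<dots> = 2 * ((of_nat n + 2) * P (Suc (Suc n)))"
  unfolding s1 s0 d1 rP2 by (simp add: algebra_simps)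
 finally have 1: "a (Suc (Suc n)) + b (Suc (Suc n)) = 2 * P (Suc (Suc n))"
  using n2 by simp
 have "(of_nat n + 2) * (\<i> * (a (Suc (Suc n)) - b (Suc (Suc n)))) =
   \<i> * ((of_nat n + 2) * a (Suc (Suc n)) - (of_nat n + 2) * b (Suc (Suc n)))"
  by (simp add: algebra_simps)
 also have "\<dots> = 2 * x * (\<i> * (a (Suc n) - b (Suc n))) - (a (Suc n) + b (Suc n)) - of_nat n * (\<i> * (a n - b n))"
  unfolding ra rb by (simp add: algebra_simps)
 also have "\<dots> = - 2 * (2 * x * P n - of_nat n * P (n - 1)) - 2 * P (Suc n)"
  unfolding s1 d1 d0 by (simp add: algebra_simps)
 also have "\<dots> = (of_nat n + 2) * (- 2 * P (Suc n))"
  unfolding rP1[symmetric] by (simp add: algebra_simps)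
 finally have 2: "\<i> * (a (Suc (Suc n)) - b (Suc (Suc n))) = - 2 * P (Suc n)"
  by (simp only: mult_left_cancel[OF n2])
 show ?case using 1 2 unfolding a_def b_def P_def by (simp only: diff_Suc_1 mult.assoc mult.left_commute)
qed

lemma poly_mp_shift_0: "poly (mp_shift n) 0 = (if n = 0 then 1 else 0)"
proof (induction n rule: mp_shift.induct)
 case (3 n)
 thus ?case by (cases n) auto
qed auto

lemma sech_int_mp: "sech_int (mp n) = (if n = 0 then 1 else 0)"
proof -
 have "poly (pcompose (mp_shift n) [:\<i> / 2, 1:] + pcompose (mp_shift n) [:- \<i> / 2, 1:]) x = poly (smult 2 (mp n)) x" for x
  using mp_shift_identities[of n x] by (simp add: poly_pcompose add.commute diff_conv_add_uminus del: add_uminus_conv_diff)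
 hence "pcompose (mp_shift n) [:\<i> / 2, 1:] + pcompose (mp_shift n) [:- \<i> / 2, 1:] = smult 2 (mp n)"
  by (simp only: poly_eq_poly_eq_iff[symmetric] fun_eq_iff) simp
 thus ?thesis using sech_int_shift[of "mp_shift n"] by (simp add: sech_int_smult poly_mp_shift_0)
qed

text \<open>The base case is \<open>sech_int_mp\<close>. In the step, the integral of 2 x
  \<open>mp k\<close> \<open>mp n\<close> is expanded by the recurrence of either factor; comparing
  the results determines the entry for \<open>Suc k\<close> from those for \<open>k\<close> and
  \<open>k - 1\<close>.\<close>

theorem mp_orthonormal: "sech_int (mp m * mp n) = (if m = n then 1 else 0)"
proof (induction m arbitrary: n rule: less_induct)
 case (less m)
 show ?case
 proof (cases m)
  case 0
  thus ?thesis by (simp add: sech_int_mp)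
 next
  case (Suc k)
  have "sech_int ([:0, 2:] * mp k * mp n) = of_nat (Suc k) * sech_int (mp (Suc k) * mp n) + of_nat k * sech_int (mp (k - 1) * mp n)"
   by (simp only: mp_rec) (simp add: distrib_right sech_int_add sech_int_smult del: mp.simps of_nat_Suc)
  moreover have "[:0, 2:] * mp k * mp n = mp k * ([:0, 2:] * mp n)" by (simp add: mult_ac)
  moreover have "sech_int (mp k * ([:0, 2:] * mp n)) = of_nat (Suc n) * sech_int (mp k * mp (Suc n)) + of_nat n * sech_int (mp k * mp (n - 1))"
   by (simp only: mp_rec) (simp add: distrib_left sech_int_add sech_int_smult del: mp.simps of_nat_Suc)
  ultimately have "of_nat (Suc k) * sech_int (mp (Suc k) * mp n) =
    of_nat (Suc n) * (if k = Suc n then 1 else 0) + of_nat n * (if k = n - 1 then 1 else 0) - of_nat k * (if k - 1 = n then 1 else (0::complex))"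
   using less.IH[of k "Suc n"] less.IH[of k "n - 1"] less.IH[of "k - 1" n] Suc by (simp add: algebra_simps del: mp.simps of_nat_Suc)
  also have "\<dots> = of_nat (Suc k) * (if Suc k = n then 1 else 0)"
   by (cases n; cases k) (auto simp del: of_nat_Suc)
  finally show ?thesis unfolding Suc by (simp only: mult_cancel_left of_nat_eq_0_iff) simp
 qed
qed

section \<open>The modified Bessel function\<close>

lemma Gamma_plus1_pos: "x > 0 \<Longrightarrow> Gamma (x + 1) = x * Gamma x" for x :: real
 by (rule Gamma_plus1) (auto elim!: nonpos_Ints_cases)

definition hker :: "real \<Rightarrow> real \<Rightarrow> real \<Rightarrow> real" where
 "hker \<nu> y v = indicator {0<..} v * (exp (- v) * v powr (\<nu> - 1 / 2) * (1 + v / (2 * y)) powr (\<nu> - 1 / 2))"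

text \<open>In terms of the modified Bessel function, \<open>K\<^sub>\<nu>(y) = sqrt (\<pi> / (2 y)) exp (- y) bessel_K_factor \<nu> y\<close>.\<close>

definition bessel_K_factor :: "real \<Rightarrow> real \<Rightarrow> real" where
 "bessel_K_factor \<nu> y = (\<integral>v. hker \<nu> y v \<partial>lborel) / Gamma (\<nu> + 1 / 2)"

text \<open>Up to the factor sqrt (\<pi> / 2) this is the integral of y^j K(y) over the positive
  axis, K the modified Bessel function of order \<nu>; see
  \<open>has_bochner_integral_bessel_K\<close>.\<close>

definition bessel_K_moment :: "real \<Rightarrow> nat \<Rightarrow> real" where
 "bessel_K_moment \<nu> j = 2 powr (- \<nu> - 1 / 2) * Gamma (real j + \<nu> + 1) * Beta ((real j + 1 - \<nu>) / 2) (\<nu> + 1 / 2) / Gamma (\<nu> + 1 / 2)"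

lemma hker_measurable [measurable]: "(\<lambda>p. hker \<nu> (fst p) (snd p)) \<in> borel_measurable (borel \<Otimes>\<^sub>M borel)"
 unfolding hker_def[abs_def] by measurable

lemma hker_measurable' [measurable]: "hker \<nu> y \<in> borel_measurable borel"
 unfolding hker_def[abs_def] by measurable

lemma bessel_K_factor_measurable [measurable]: "bessel_K_factor \<nu> \<in> borel_measurable borel"
 unfolding bessel_K_factor_def[abs_def] hker_def by measurable

context
 fixes \<nu> :: real
 assumes \<nu>: "0 < \<nu>" "\<nu> \<le> 1 / 2"
begin

lemma Gamma_half_pos: "Gamma (\<nu> + 1 / 2) > 0"
 using \<nu> by (intro Gamma_real_pos) auto

lemma hb_gamma_half:
 "s > 0 \<Longrightarrow> has_bochner_integral lborel (\<lambda>v. indicator {0<..} v * (v powr (\<nu> - 1 / 2) * exp (- (s * v)))) (Gamma (\<nu> + 1 / 2) / s powr (\<nu> + 1 / 2))"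
 using has_bochner_integral_Gamma[of "\<nu> + 1 / 2" s] \<nu> by simp

text \<open>For \<nu> \<le> 1/2 the power of 1 + v/(2y) has a nonpositive exponent, so the kernel is
  dominated by the integrand of the Gamma function. This gives both
  \<open>bessel_K_factor_le_1\<close> and the majorant for the limit at infinity.\<close>

lemma hker_bounds:
 assumes "y > 0"
 shows "0 \<le> hker \<nu> y v" "hker \<nu> y v \<le> indicator {0<..} v * (v powr (\<nu> - 1 / 2) * exp (- (1 * v)))"
proof -
 have "(1 + v / (2 * y)) powr (\<nu> - 1 / 2) \<le> 1" if "v > 0"
 proof -
  have b: "1 \<le> 1 + v / (2 * y)" using that assms by simp
  have "(1 + v / (2 * y)) powr (\<nu> - 1 / 2) \<le> (1 + v / (2 * y)) powr 0"
   using b \<nu> by (intro powr_mono) auto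
  also have "\<dots> = 1" using b by (subst powr_zero_eq_one) auto
  finally show ?thesis .
 qed
 hence "v > 0 \<Longrightarrow> exp (- v) * v powr (\<nu> - 1 / 2) * (1 + v / (2 * y)) powr (\<nu> - 1 / 2) \<le> exp (- v) * v powr (\<nu> - 1 / 2) * 1"
  by (intro mult_left_mono) auto
 thus "hker \<nu> y v \<le> indicator {0<..} v * (v powr (\<nu> - 1 / 2) * exp (- (1 * v)))"
  by (auto simp: hker_def indicator_def mult.commute)
 show "0 \<le> hker \<nu> y v" by (auto simp: hker_def indicator_def)
qed

lemma integrable_hker:
 assumes "y > 0"
 shows "integrable lborel (hker \<nu> y)"
proof (rule Bochner_Integration.integrable_bound)
 show "integrable lborel (\<lambda>v. indicator {0<..} v * (v powr (\<nu> - 1 / 2) * exp (- (1 * v))))"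
  using hb_gamma_half[of 1] by (simp add: has_bochner_integral_iff)
 show "AE v in lborel. norm (hker \<nu> y v) \<le> norm (indicator {0<..} v * (v powr (\<nu> - 1 / 2) * exp (- (1 * v))))"
  using hker_bounds[OF assms] by (intro AE_I2) (smt (verit) real_norm_def)
qed measurable

lemma bessel_K_factor_le_1:
 assumes "y > 0"
 shows "bessel_K_factor \<nu> y \<le> 1"
proof -
 have "(\<integral>v. hker \<nu> y v \<partial>lborel) \<le> (\<integral>v. indicator {0<..} v * (v powr (\<nu> - 1 / 2) * exp (- (1 * v))) \<partial>lborel)"
  using hb_gamma_half[of 1] integrable_hker[OF assms] hker_bounds[OF assms]
  by (intro Bochner_Integration.integral_mono) (auto simp: has_bochner_integral_iff)
 also have "\<dots> = Gamma (\<nu> + 1 / 2)" using hb_gamma_half[of 1] by (simp add: has_bochner_integral_iff)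
 finally show ?thesis using Gamma_half_pos by (simp add: bessel_K_factor_def)
qed

text \<open>The exponent \<nu> - 1/2 is lowered to -1/2, and 1 + v/(2y) \<le> exp v (1 + y) / y
  separates the variables at the cost of the decay exp (-3v/2) in place of exp (-v). The resulting
  Gamma integral loses (3/2)^(\<nu> + 1/2) \<le> 3/2, whence the constant 2/3.\<close>

lemma bessel_K_factor_ge:
 assumes y: "y > 0"
 shows "(2 / 3) * sqrt (y / (1 + y)) \<le> bessel_K_factor \<nu> y"
proof -
 have "hker \<nu> y v \<ge> sqrt (y / (1 + y)) * (indicator {0<..} v * (v powr (\<nu> - 1 / 2) * exp (- (3 / 2 * v))))" for v
 proof (cases "v > 0")
  case True
  have b: "1 \<le> 1 + v / (2 * y)" using True y by simp
  have "exp (- (v / 2)) * sqrt (y / (1 + y)) \<le> (1 + v / (2 * y)) powr (- 1 / 2)"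
  proof -
   have "1 + v / (2 * y) \<le> exp v * ((1 + y) / y)"
   proof -
    have "1 + v / (2 * y) = (y + v / 2) / y" using y by (simp add: field_simps)
    also have "\<dots> \<le> ((1 + v) * (1 + y)) / y"
     using True y by (intro divide_right_mono) (auto simp: algebra_simps)
    also have "\<dots> \<le> (exp v * (1 + y)) / y"
     using y by (intro divide_right_mono mult_right_mono) (auto simp: exp_ge_add_one_self)
    finally show ?thesis by simp
   qed
   hence "(exp v * ((1 + y) / y)) powr (- 1 / 2) \<le> (1 + v / (2 * y)) powr (- 1 / 2)"
    using b by (intro powr_mono2') auto
   moreover have "(exp v * ((1 + y) / y)) powr (- 1 / 2) = exp (- (v / 2)) * sqrt (y / (1 + y))"
   proof -
    have "(exp v * ((1 + y) / y)) powr (- 1 / 2) = exp v powr (- 1 / 2) * ((1 + y) / y) powr (- 1 / 2)"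
     by (rule powr_mult)
    also have "exp v powr (- 1 / 2) = exp (- (v / 2))" by (simp add: powr_def)
    also have "((1 + y) / y) powr (- 1 / 2) = sqrt (y / (1 + y))"
    proof -
     have "((1 + y) / y) powr (- 1 / 2) = inverse (((1 + y) / y) powr (1 / 2))"
      by (simp add: powr_minus[symmetric])
     also have "\<dots> = inverse (sqrt ((1 + y) / y))" using y by (subst powr_half_sqrt) auto
     finally show ?thesis by (simp add: real_sqrt_divide)
    qed
    finally show ?thesis .
   qed
   ultimately show ?thesis by simp
  qed
  also have "\<dots> \<le> (1 + v / (2 * y)) powr (\<nu> - 1 / 2)" using b \<nu> by (intro powr_mono) auto
  finally have "exp (- v) * v powr (\<nu> - 1 / 2) * (exp (- (v / 2)) * sqrt (y / (1 + y))) \<le> exp (- v) * v powr (\<nu> - 1 / 2) * (1 + v / (2 * y)) powr (\<nu> - 1 / 2)"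
   by (intro mult_left_mono) auto
  moreover have "exp (- (3 / 2 * v)) = exp (- v) * exp (- (v / 2))" by (simp add: exp_add[symmetric])
  ultimately show ?thesis using True by (simp add: hker_def mult_ac)
 qed (simp add: hker_def)
 hence "(\<integral>v. sqrt (y / (1 + y)) * (indicator {0<..} v * (v powr (\<nu> - 1 / 2) * exp (- (3 / 2 * v)))) \<partial>lborel) \<le> (\<integral>v. hker \<nu> y v \<partial>lborel)"
  using hb_gamma_half[of "3 / 2"] integrable_hker[OF y]
  by (intro Bochner_Integration.integral_mono integrable_mult_right) (auto simp: has_bochner_integral_iff)
 also have "(\<integral>v. sqrt (y / (1 + y)) * (indicator {0<..} v * (v powr (\<nu> - 1 / 2) * exp (- (3 / 2 * v)))) \<partial>lborel)
   = sqrt (y / (1 + y)) * (Gamma (\<nu> + 1 / 2) / (3 / 2) powr (\<nu> + 1 / 2))"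
  using hb_gamma_half[of "3 / 2"] by (subst integral_mult_right_zero) (simp add: has_bochner_integral_iff)
 finally have "sqrt (y / (1 + y)) / (3 / 2) powr (\<nu> + 1 / 2) \<le> bessel_K_factor \<nu> y"
  using Gamma_half_pos by (simp add: bessel_K_factor_def field_simps)
 moreover have "(3 / 2) powr (\<nu> + 1 / 2) \<le> (3 / 2 :: real) powr 1" using \<nu> by (intro powr_mono) auto
 hence "sqrt (y / (1 + y)) / (3 / 2) \<le> sqrt (y / (1 + y)) / (3 / 2) powr (\<nu> + 1 / 2)"
  using y by (intro divide_left_mono mult_pos_pos) auto
 ultimately have "sqrt (y / (1 + y)) / (3 / 2) \<le> bessel_K_factor \<nu> y" by linarith
 thus ?thesis by simp
qed

lemma tendsto_bessel_K_factor: "(bessel_K_factor \<nu> \<longlongrightarrow> 1) at_top"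
proof -
 have "((\<lambda>y. \<integral>v. hker \<nu> y v \<partial>lborel) \<longlongrightarrow> (\<integral>v. indicator {0<..} v * (v powr (\<nu> - 1 / 2) * exp (- (1 * v))) \<partial>lborel)) at_top"
 proof (rule integral_dominated_convergence_at_top)
  show "integrable lborel (\<lambda>v. indicator {0<..} v * (v powr (\<nu> - 1 / 2) * exp (- (1 * v))))"
   using hb_gamma_half[of 1] by (simp add: has_bochner_integral_iff)
  show "\<forall>\<^sub>F y in at_top. AE v in lborel. norm (hker \<nu> y v) \<le> indicator {0<..} v * (v powr (\<nu> - 1 / 2) * exp (- (1 * v)))"
   using eventually_gt_at_top[of 0]
   by eventually_elim (use hker_bounds in \<open>auto simp: abs_of_nonneg\<close>)
  show "AE v in lborel. ((\<lambda>y. hker \<nu> y v) \<longlongrightarrow> indicator {0<..} v * (v powr (\<nu> - 1 / 2) * exp (- (1 * v)))) at_top"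
  proof (rule AE_I2)
   fix v :: real
   have "((\<lambda>y. v / (2 * y)) \<longlongrightarrow> 0) at_top" by real_asymp
   hence "((\<lambda>y. (1 + v / (2 * y)) powr (\<nu> - 1 / 2)) \<longlongrightarrow> (1 + 0) powr (\<nu> - 1 / 2)) at_top"
    by (intro tendsto_powr tendsto_add tendsto_const) auto
   hence "((\<lambda>y. indicator {0<..} v * (exp (- v) * v powr (\<nu> - 1 / 2) * (1 + v / (2 * y)) powr (\<nu> - 1 / 2))) \<longlongrightarrow>
     indicator {0<..} v * (exp (- v) * v powr (\<nu> - 1 / 2) * (1 + 0) powr (\<nu> - 1 / 2))) at_top"
    by (rule tendsto_mult[OF tendsto_const tendsto_mult[OF tendsto_const]])
   thus "((\<lambda>y. hker \<nu> y v) \<longlongrightarrow> indicator {0<..} v * (v powr (\<nu> - 1 / 2) * exp (- (1 * v)))) at_top"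
    by (simp add: hker_def mult.commute)
  qed
 qed measurable
 hence "((\<lambda>y. (\<integral>v. hker \<nu> y v \<partial>lborel) / Gamma (\<nu> + 1 / 2)) \<longlongrightarrow> Gamma (\<nu> + 1 / 2) / Gamma (\<nu> + 1 / 2)) at_top"
  using hb_gamma_half[of 1] Gamma_half_pos
  by (intro tendsto_divide tendsto_const) (auto simp: has_bochner_integral_iff)
 thus ?thesis using Gamma_half_pos by (simp add: bessel_K_factor_def[abs_def])
qed

text \<open>Substitution q = 1 / (1 + u)^2: then 1 - q = 2 u (1 + u/2) / (1 + u)^2, and the
  integrand becomes that of the Beta function.\<close>

lemma bessel_K_beta_integral:
 "has_bochner_integral lborel (\<lambda>u. indicator {0<..} u * ((u * (1 + u / 2)) powr (\<nu> - 1 / 2) / (1 + u) powr (real j + \<nu> + 1)))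
   (2 powr (- \<nu> - 1 / 2) * Beta ((real j + 1 - \<nu>) / 2) (\<nu> + 1 / 2))"
proof -
 define a b where "a = (real j + 1 - \<nu>) / 2" and "b = \<nu> + 1 / 2"
 have ab: "a > 0" "b > 0" using \<nu> by (auto simp: a_def b_def)
 define f where "f q = 2 powr (- \<nu> - 1 / 2) * (q powr (a - 1) * (1 - q) powr (b - 1))" for q :: real
 define g where "g u = 1 / (1 + u)^2" for u :: real
 define g' where "g' u = - 2 / (1 + u) ^ 3" for u :: real
 have der: "(g has_field_derivative g' u) (at u within {0<..})" if "u \<in> {0<..}" for u
 proof -
  have r: "1 + u \<noteq> 0" using that by simp
  have "((\<lambda>u. (1 + u)^2) has_field_derivative 2 * (1 + u)) (at u within {0<..})"
   by (auto intro!: derivative_eq_intros)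
  from DERIV_inverse'[OF this] r
  have "(g has_field_derivative - (inverse ((1 + u)^2) * (2 * (1 + u)) * inverse ((1 + u)^2))) (at u within {0<..})"
   by (simp add: g_def[abs_def] inverse_eq_divide)
  moreover have "- (inverse (r^2) * (2 * r) * inverse (r^2)) = - 2 / r ^ 3" if "r \<noteq> 0" for r :: real
   using that by (simp add: field_simps power2_eq_square power3_eq_cube)
  from this[OF r] have "- (inverse ((1 + u)^2) * (2 * (1 + u)) * inverse ((1 + u)^2)) = g' u"
   unfolding g'_def .
  ultimately show ?thesis by simp
 qed
 have inj: "inj_on g {0<..}"
  by (rule inj_onI) (auto simp: g_def field_simps power2_eq_iff_nonneg)
 have img: "g ` {0<..} = {0<..<1}"
 proof (intro equalityI subsetI)
  fix q :: real assume q: "q \<in> {0<..<1}"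
  have "sqrt q < 1" using q by simp
  hence "g (1 / sqrt q - 1) = q" "1 / sqrt q - 1 > 0" using q by (auto simp: g_def field_simps)
  thus "q \<in> g ` {0<..}" by (metis greaterThan_iff image_eqI)
 next
  fix q assume "q \<in> g ` {0<..}"
  then obtain u where u: "u > 0" "q = g u" by auto
  have "(1 + u)^2 > 1" using u by (simp add: power2_eq_square field_simps) (smt (verit) mult_pos_pos)
  moreover have "0 < 1 / r \<and> 1 / r < 1" if "r > 1" for r :: real using that by simp
  ultimately show "q \<in> {0<..<1}" unfolding u(2) g_def greaterThanLessThan_iff by blast
 qed
 have "((\<lambda>t. t powr (a - 1) * (1 - t) powr (b - 1)) has_integral Beta a b) {0<..<1}"
  using has_integral_Beta_real[OF ab] by (simp add: has_integral_Icc_iff_Ioo)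
 from has_integral_mult_right[OF this, of "2 powr (- \<nu> - 1 / 2)"]
 have hi: "(f has_integral 2 powr (- \<nu> - 1 / 2) * Beta a b) {0<..<1}" unfolding f_def .
 hence "f absolutely_integrable_on g ` {0<..} \<and> integral (g ` {0<..}) f = 2 powr (- \<nu> - 1 / 2) * Beta a b"
  unfolding img by (auto simp: has_integral_iff f_def intro!: nonnegative_absolutely_integrable_1)
 hence "(\<lambda>u. \<bar>g' u\<bar> * f (g u)) absolutely_integrable_on {0<..} \<and> integral {0<..} (\<lambda>u. \<bar>g' u\<bar> * f (g u)) = 2 powr (- \<nu> - 1 / 2) * Beta a b"
  by (subst has_absolute_integral_change_of_variables_1'[OF _ der inj]) auto
 hence I: "((\<lambda>u. \<bar>g' u\<bar> * f (g u)) has_integral 2 powr (- \<nu> - 1 / 2) * Beta a b) {0<..}"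
  by (simp add: has_integral_iff absolutely_integrable_on_def)
 have eq: "\<bar>g' u\<bar> * f (g u) = (u * (1 + u / 2)) powr (\<nu> - 1 / 2) / (1 + u) powr (real j + \<nu> + 1)" if "u \<in> {0<..}" for u
 proof -
  define r where "r = 1 + u"
  have r: "r > 1" using that by (simp add: r_def)
  have r2: "r powr - 2 = 1 / r^2" "r powr - 3 = 1 / r ^ 3"
   using r powr_realpow[of r 2] powr_realpow[of r 3] powr_minus_divide[of r 2] powr_minus_divide[of r 3] by simp_all
  have gr: "g u = r powr - 2" unfolding r2 by (simp add: g_def r_def)
  have ug: "1 - g u = 2 * (u * (1 + u / 2)) * r powr - 2"
  proof -
   have "1 - g u = (r^2 - 1) / r^2" using r by (simp add: g_def r_def[symmetric] field_simps)
   also have "r^2 - 1 = 2 * (u * (1 + u / 2))" by (simp add: r_def power2_eq_square algebra_simps)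
   finally show ?thesis unfolding r2 by simp
  qed
  have c: "u * (1 + u / 2) > 0" using that by simp
  have "\<bar>g' u\<bar> = 2 * r powr - 3"
   unfolding r2 using r by (simp add: g'_def r_def[symmetric] abs_divide)
  hence "\<bar>g' u\<bar> * f (g u) = 2 * r powr - 3 * (2 powr (- \<nu> - 1 / 2) * ((r powr - 2) powr (a - 1) * (2 * (u * (1 + u / 2)) * r powr - 2) powr (b - 1)))"
   unfolding f_def ug unfolding gr by simp
  also have "(r powr - 2) powr (a - 1) = r powr (- 2 * (a - 1))" by (rule powr_powr)
  also have "(2 * (u * (1 + u / 2)) * r powr - 2) powr (b - 1) = 2 powr (b - 1) * (u * (1 + u / 2)) powr (b - 1) * r powr (- 2 * (b - 1))"
   using c by (simp only: powr_mult powr_powr)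
  also have "2 * r powr - 3 * (2 powr (- \<nu> - 1 / 2) * (r powr (- 2 * (a - 1)) * (2 powr (b - 1) * (u * (1 + u / 2)) powr (b - 1) * r powr (- 2 * (b - 1)))))
   = (2 powr 1 * 2 powr (- \<nu> - 1 / 2) * 2 powr (b - 1)) * (u * (1 + u / 2)) powr (b - 1) * (r powr - 3 * r powr (- 2 * (a - 1)) * r powr (- 2 * (b - 1)))"
   by simp
  also have "2 powr 1 * 2 powr (- \<nu> - 1 / 2) * 2 powr (b - 1) = (1 :: real)"
   by (simp only: powr_add[symmetric]) (simp add: b_def)
  also have "r powr - 3 * r powr (- 2 * (a - 1)) * r powr (- 2 * (b - 1)) = r powr - (real j + \<nu> + 1)"
  proof -
   have "- 3 + - 2 * (a - 1) + - 2 * (b - 1) = - (real j + \<nu> + 1)" by (simp add: a_def b_def field_simps)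
   thus ?thesis by (simp only: powr_add[symmetric])
  qed
  finally show ?thesis unfolding powr_minus_divide by (simp add: b_def r_def)
 qed
 have "((\<lambda>u. (u * (1 + u / 2)) powr (\<nu> - 1 / 2) / (1 + u) powr (real j + \<nu> + 1)) has_integral 2 powr (- \<nu> - 1 / 2) * Beta a b) {0<..}"
  by (rule has_integral_eq[OF eq I])
 from has_bochner_integral_has_integral_nonneg[OF this] show ?thesis by (simp add: a_def b_def)
qed

text \<open>After v = y u all terms are nonnegative, so Tonelli lets the y-integral be done first;
  it is a Gamma integral, and \<open>bessel_K_beta_integral\<close> evaluates what is left.\<close>

theorem has_bochner_integral_bessel_K:
 "has_bochner_integral lborel (\<lambda>y. indicator {0<..} y * (y powr (real j - 1 / 2) * exp (- y) * bessel_K_factor \<nu> y)) (bessel_K_moment \<nu> j)"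
proof (rule has_bochner_integral_nn_integral)
 have M0: "bessel_K_moment \<nu> j * Gamma (\<nu> + 1 / 2) \<ge> 0"
 proof -
  have "Beta ((real j + 1 - \<nu>) / 2) (\<nu> + 1 / 2) \<ge> 0"
   using has_integral_nonneg[OF has_integral_Beta_real[of "(real j + 1 - \<nu>) / 2" "\<nu> + 1 / 2"]] \<nu> by auto
  moreover have "Gamma (real j + \<nu> + 1) > 0" using \<nu> by (intro Gamma_real_pos) auto
  ultimately show ?thesis using Gamma_half_pos by (simp add: bessel_K_moment_def)
 qed
 thus "0 \<le> bessel_K_moment \<nu> j" using Gamma_half_pos by (simp add: zero_le_mult_iff)
 have inner: "ennreal (indicator {0<..} y * (y powr (real j - 1 / 2) * exp (- y) * (\<integral>v. hker \<nu> y v \<partial>lborel))) =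
   (\<integral>\<^sup>+u. ennreal (indicator {0<..} u * (u * (1 + u / 2)) powr (\<nu> - 1 / 2) * (indicator {0<..} y * (y powr (real j + \<nu> + 1 - 1) * exp (- ((1 + u) * y))))) \<partial>lborel)" for y
 proof (cases "y > 0")
  case y: True
  have "ennreal (indicator {0<..} y * (y powr (real j - 1 / 2) * exp (- y) * (\<integral>v. hker \<nu> y v \<partial>lborel))) =
    ennreal (y powr (real j - 1 / 2) * exp (- y)) * (\<integral>\<^sup>+v. ennreal (hker \<nu> y v) \<partial>lborel)"
   using y integrable_hker[OF y] hker_bounds[OF y] by (subst nn_integral_eq_integral) (auto simp: ennreal_mult')
  also have "(\<integral>\<^sup>+v. ennreal (hker \<nu> y v) \<partial>lborel) = ennreal \<bar>y\<bar> * (\<integral>\<^sup>+u. ennreal (hker \<nu> y (0 + y * u)) \<partial>lborel)"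
   using y by (intro nn_integral_real_affine) auto
  also have "ennreal (y powr (real j - 1 / 2) * exp (- y)) * (ennreal \<bar>y\<bar> * (\<integral>\<^sup>+u. ennreal (hker \<nu> y (0 + y * u)) \<partial>lborel))
    = (\<integral>\<^sup>+u. ennreal (y powr (real j - 1 / 2) * exp (- y) * (\<bar>y\<bar> * hker \<nu> y (0 + y * u))) \<partial>lborel)"
   using y hker_bounds[OF y]
   by (subst nn_integral_cmult[symmetric], simp, subst nn_integral_cmult[symmetric], simp)
     (simp add: ennreal_mult' mult.assoc)
  also have "\<dots> = (\<integral>\<^sup>+u. ennreal (indicator {0<..} u * (u * (1 + u / 2)) powr (\<nu> - 1 / 2) * (indicator {0<..} y * (y powr (real j + \<nu> + 1 - 1) * exp (- ((1 + u) * y))))) \<partial>lborel)"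
  proof (intro nn_integral_cong arg_cong[where f = ennreal])
   fix u :: real
   show "y powr (real j - 1 / 2) * exp (- y) * (\<bar>y\<bar> * hker \<nu> y (0 + y * u)) =
    indicator {0<..} u * (u * (1 + u / 2)) powr (\<nu> - 1 / 2) * (indicator {0<..} y * (y powr (real j + \<nu> + 1 - 1) * exp (- ((1 + u) * y))))"
   proof (cases "u > 0")
    case u: True
    have "y powr (real j - 1 / 2) * exp (- y) * (\<bar>y\<bar> * hker \<nu> y (0 + y * u)) =
     y powr (real j - 1 / 2) * exp (- y) * (y powr 1 * (exp (- (y * u)) * (y * u) powr (\<nu> - 1 / 2) * (1 + y * u / (2 * y)) powr (\<nu> - 1 / 2)))"
     using y u by (simp add: hker_def)
    also have "(y * u) powr (\<nu> - 1 / 2) = y powr (\<nu> - 1 / 2) * u powr (\<nu> - 1 / 2)" using y u by (simp add: powr_mult)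
    also have "1 + y * u / (2 * y) = 1 + u / 2" using y by simp
    also have "y powr (real j - 1 / 2) * exp (- y) * (y powr 1 * (exp (- (y * u)) * (y powr (\<nu> - 1 / 2) * u powr (\<nu> - 1 / 2)) * (1 + u / 2) powr (\<nu> - 1 / 2)))
      = (u powr (\<nu> - 1 / 2) * (1 + u / 2) powr (\<nu> - 1 / 2)) * ((y powr (real j - 1 / 2) * y powr 1 * y powr (\<nu> - 1 / 2)) * (exp (- y) * exp (- (y * u))))"
     by (simp only: mult_ac)
    also have "u powr (\<nu> - 1 / 2) * (1 + u / 2) powr (\<nu> - 1 / 2) = (u * (1 + u / 2)) powr (\<nu> - 1 / 2)"
     using u by (simp add: powr_mult)
    also have "y powr (real j - 1 / 2) * y powr 1 * y powr (\<nu> - 1 / 2) = y powr (real j + \<nu> + 1 - 1)"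
     by (simp only: powr_add[symmetric]) simp
    also have "exp (- y) * exp (- (y * u)) = exp (- ((1 + u) * y))" by (simp add: exp_add[symmetric] algebra_simps)
    finally show ?thesis using y u by simp
   next
    case False
    hence "\<not> y * u > 0" using y by (simp add: zero_less_mult_iff)
    thus ?thesis using False by (simp add: hker_def)
   qed
  qed
  finally show ?thesis .
 qed auto
 have "(\<integral>\<^sup>+y. ennreal (indicator {0<..} y * (y powr (real j - 1 / 2) * exp (- y) * (\<integral>v. hker \<nu> y v \<partial>lborel))) \<partial>lborel) =
  (\<integral>\<^sup>+y. \<integral>\<^sup>+u. ennreal (indicator {0<..} u * (u * (1 + u / 2)) powr (\<nu> - 1 / 2) * (indicator {0<..} y * (y powr (real j + \<nu> + 1 - 1) * exp (- ((1 + u) * y))))) \<partial>lborel \<partial>lborel)"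
  unfolding inner ..
 also have "\<dots> = (\<integral>\<^sup>+u. \<integral>\<^sup>+y. ennreal (indicator {0<..} u * (u * (1 + u / 2)) powr (\<nu> - 1 / 2) * (indicator {0<..} y * (y powr (real j + \<nu> + 1 - 1) * exp (- ((1 + u) * y))))) \<partial>lborel \<partial>lborel)"
  by (rule lborel_pair.Fubini') measurable
 also have "\<dots> = (\<integral>\<^sup>+u. ennreal (Gamma (real j + \<nu> + 1)) * ennreal (indicator {0<..} u * ((u * (1 + u / 2)) powr (\<nu> - 1 / 2) / (1 + u) powr (real j + \<nu> + 1))) \<partial>lborel)"
 proof (intro nn_integral_cong)
  fix u :: real
  show "(\<integral>\<^sup>+y. ennreal (indicator {0<..} u * (u * (1 + u / 2)) powr (\<nu> - 1 / 2) * (indicator {0<..} y * (y powr (real j + \<nu> + 1 - 1) * exp (- ((1 + u) * y))))) \<partial>lborel)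
   = ennreal (Gamma (real j + \<nu> + 1)) * ennreal (indicator {0<..} u * ((u * (1 + u / 2)) powr (\<nu> - 1 / 2) / (1 + u) powr (real j + \<nu> + 1)))"
  proof (cases "u > 0")
   case True
   have hb: "has_bochner_integral lborel (\<lambda>y. indicator {0<..} u * (u * (1 + u / 2)) powr (\<nu> - 1 / 2) * (indicator {0<..} y * (y powr (real j + \<nu> + 1 - 1) * exp (- ((1 + u) * y)))))
    (indicator {0<..} u * (u * (1 + u / 2)) powr (\<nu> - 1 / 2) * (Gamma (real j + \<nu> + 1) / (1 + u) powr (real j + \<nu> + 1)))"
    using True \<nu> by (intro has_bochner_integral_mult_right has_bochner_integral_Gamma) auto
   have G: "Gamma (real j + \<nu> + 1) > 0" using \<nu> by (intro Gamma_real_pos) auto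
   show ?thesis
    using hb True G
    by (subst nn_integral_eq_integral) (auto simp: has_bochner_integral_iff ennreal_mult'[symmetric] mult_ac intro!: AE_I2)
  qed auto
 qed
 also have "\<dots> = ennreal (Gamma (real j + \<nu> + 1)) * ennreal (2 powr (- \<nu> - 1 / 2) * Beta ((real j + 1 - \<nu>) / 2) (\<nu> + 1 / 2))"
  using bessel_K_beta_integral[of j]
  by (subst nn_integral_cmult, simp, subst nn_integral_eq_integral) (auto simp: has_bochner_integral_iff intro!: AE_I2)
 also have "\<dots> = ennreal (bessel_K_moment \<nu> j * Gamma (\<nu> + 1 / 2))"
 proof -
  have "Gamma (real j + \<nu> + 1) \<ge> 0" using \<nu> by (intro less_imp_le Gamma_real_pos) auto
  thus ?thesis using Gamma_half_pos by (simp add: ennreal_mult'[symmetric] bessel_K_moment_def mult_ac)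
 qed
 finally have *: "(\<integral>\<^sup>+y. ennreal (indicator {0<..} y * (y powr (real j - 1 / 2) * exp (- y) * (\<integral>v. hker \<nu> y v \<partial>lborel))) \<partial>lborel) = ennreal (bessel_K_moment \<nu> j * Gamma (\<nu> + 1 / 2))" .
 have "(\<integral>\<^sup>+y. ennreal (indicator {0<..} y * (y powr (real j - 1 / 2) * exp (- y) * bessel_K_factor \<nu> y)) \<partial>lborel) =
   (\<integral>\<^sup>+y. ennreal (1 / Gamma (\<nu> + 1 / 2)) * ennreal (indicator {0<..} y * (y powr (real j - 1 / 2) * exp (- y) * (\<integral>v. hker \<nu> y v \<partial>lborel))) \<partial>lborel)"
  using Gamma_half_pos by (intro nn_integral_cong) (simp add: ennreal_mult'[symmetric] bessel_K_factor_def)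
 also have "\<dots> = ennreal (1 / Gamma (\<nu> + 1 / 2)) * ennreal (bessel_K_moment \<nu> j * Gamma (\<nu> + 1 / 2))"
  unfolding *[symmetric] by (intro nn_integral_cmult) (simp add: hker_def, measurable)
 also have "\<dots> = ennreal (bessel_K_moment \<nu> j)" using Gamma_half_pos by (simp add: ennreal_mult'[symmetric])
 finally show "(\<integral>\<^sup>+y. ennreal (indicator {0<..} y * (y powr (real j - 1 / 2) * exp (- y) * bessel_K_factor \<nu> y)) \<partial>lborel) = ennreal (bessel_K_moment \<nu> j)" .
 have K0: "bessel_K_factor \<nu> y \<ge> 0" if "y > 0" for y
  using Gamma_half_pos hker_bounds[OF that] by (simp add: bessel_K_factor_def)
 show "AE y in lborel. 0 \<le> indicator {0<..} y * (y powr (real j - 1 / 2) * exp (- y) * bessel_K_factor \<nu> y)"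
  using K0 by (intro AE_I2) (auto simp: indicator_def)
qed measurable

text \<open>The recurrence of \<open>bessel_moment\<close> with the opposite sign; the sign is
  supplied by i^2 when the variable is turned to the imaginary axis.\<close>

lemma bessel_K_moment_rec: "bessel_K_moment \<nu> (Suc (Suc j)) = ((real j + 1)^2 - \<nu>^2) * bessel_K_moment \<nu> j"
proof -
 define a where "a = (real j + 1 - \<nu>) / 2"
 define g where "g = real j + \<nu> + 1"
 have a: "a > 0" and g: "g > 0" using \<nu> by (auto simp: a_def g_def)
 have G: "Gamma (g + 1 + 1) = (g + 1) * (g * Gamma g)"
  using g by (simp only: Gamma_plus1_pos add_pos_pos zero_less_one)
 have B: "(a + (\<nu> + 1 / 2)) * Beta (a + 1) (\<nu> + 1 / 2) = a * Beta a (\<nu> + 1 / 2)"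
  using a by (intro Beta_plus1_left) (auto elim!: nonpos_Ints_cases)
 have 1: "real (Suc (Suc j)) + \<nu> + 1 = g + 1 + 1" "(real (Suc (Suc j)) + 1 - \<nu>) / 2 = a + 1"
  by (simp_all add: g_def a_def field_simps)
 have 2: "a + (\<nu> + 1 / 2) = (g + 1) / 2" by (simp add: a_def g_def field_simps)
 have B': "(g + 1) * Beta (a + 1) (\<nu> + 1 / 2) = 2 * a * Beta a (\<nu> + 1 / 2)" using B unfolding 2 by simp
 have "bessel_K_moment \<nu> (Suc (Suc j)) = 2 powr (- \<nu> - 1 / 2) * g * Gamma g * ((g + 1) * Beta (a + 1) (\<nu> + 1 / 2)) / Gamma (\<nu> + 1 / 2)"
  unfolding bessel_K_moment_def 1 G by (simp add: mult_ac)
 also have "\<dots> = (g * (2 * a)) * (2 powr (- \<nu> - 1 / 2) * Gamma g * Beta a (\<nu> + 1 / 2) / Gamma (\<nu> + 1 / 2))"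
  unfolding B' by (simp add: mult_ac)
 also have "2 * a = real j + 1 - \<nu>" by (simp add: a_def)
 also have "g * (real j + 1 - \<nu>) = (real j + 1)^2 - \<nu>^2" by (simp add: g_def power2_eq_square algebra_simps)
 finally show ?thesis by (simp add: bessel_K_moment_def g_def a_def)
qed

text \<open>Reflection formulas at \<nu>/2 and (1 + \<nu>)/2. The ratio of the first two moments
  dictates the angle \<pi> \<nu> / 2 of the sector weight: with this angle its moments start in the
  ratio 1 : \<nu>, as \<open>bessel_moment\<close> does.\<close>

lemma bessel_K_moment_0_1:
 "bessel_K_moment \<nu> 0 > 0"
 "bessel_K_moment \<nu> 1 * sin (pi * \<nu> / 2) = \<nu> * bessel_K_moment \<nu> 0 * cos (pi * \<nu> / 2)"
proof -
 note G = Gamma_real_pos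
 have pos: "Gamma (\<nu> / 2) > 0" "Gamma (1 - \<nu> / 2) > 0" "Gamma ((1 + \<nu>) / 2) > 0" "Gamma ((1 - \<nu>) / 2) > 0" "Gamma (\<nu> + 1) > 0" "Gamma (\<nu> + 1 / 2) > 0"
  using \<nu> by (auto intro!: G)
 have g1: "Gamma (\<nu> / 2 + 1) = \<nu> / 2 * Gamma (\<nu> / 2)" and g2: "Gamma ((1 + \<nu>) / 2 + 1) = (1 + \<nu>) / 2 * Gamma ((1 + \<nu>) / 2)"
  and g3: "Gamma (\<nu> + 1 + 1) = (\<nu> + 1) * Gamma (\<nu> + 1)"
  using \<nu> by (intro Gamma_plus1_pos; simp)+
 define C where "C = 2 powr (- \<nu> - 1 / 2)"
 have C: "C > 0" by (simp add: C_def)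
 have M0: "bessel_K_moment \<nu> 0 = C * Gamma (\<nu> + 1) * Gamma ((1 - \<nu>) / 2) / (\<nu> / 2 * Gamma (\<nu> / 2))"
 proof -
  have "(1 - \<nu>) / 2 + (\<nu> + 1 / 2) = \<nu> / 2 + 1" by (simp add: field_simps)
  thus ?thesis using pos by (simp add: bessel_K_moment_def Beta_def C_def g1)
 qed
 have M1: "bessel_K_moment \<nu> 1 = C * ((\<nu> + 1) * Gamma (\<nu> + 1)) * Gamma (1 - \<nu> / 2) / ((1 + \<nu>) / 2 * Gamma ((1 + \<nu>) / 2))"
 proof -
  have e: "(real 1 + 1 - \<nu>) / 2 = 1 - \<nu> / 2" "1 - \<nu> / 2 + (\<nu> + 1 / 2) = (1 + \<nu>) / 2 + 1" "real 1 + \<nu> + 1 = \<nu> + 1 + 1"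
   by (simp_all add: field_simps)
  have "A * (G * H / K) / H = A * G / K" if "H > 0" for A G H K :: real using that by simp
  from this[OF pos(6)] show ?thesis unfolding bessel_K_moment_def Beta_def C_def e g2 g3 by blast
 qed
 show "bessel_K_moment \<nu> 0 > 0" unfolding M0 using pos C \<nu> by (intro divide_pos_pos mult_pos_pos) auto
 have th: "0 < pi * \<nu> / 2" "pi * \<nu> / 2 < pi / 2" using \<nu> by auto
 have s: "sin (pi * \<nu> / 2) > 0" "cos (pi * \<nu> / 2) > 0" by (rule sin_gt_zero2[OF th], rule cos_gt_zero[OF th])
 have r1: "Gamma (\<nu> / 2) * Gamma (1 - \<nu> / 2) * sin (pi * \<nu> / 2) = pi"
  using Gamma_reflection_real[of "\<nu> / 2"] s by simp
 have r2: "Gamma ((1 + \<nu>) / 2) * Gamma ((1 - \<nu>) / 2) * cos (pi * \<nu> / 2) = pi"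
 proof -
  have e1: "1 - (1 + \<nu>) / 2 = (1 - \<nu>) / 2" by (simp add: field_simps)
  have "pi * ((1 + \<nu>) / 2) = pi / 2 + pi * \<nu> / 2" by (simp add: field_simps)
  hence "sin (pi * ((1 + \<nu>) / 2)) = cos (pi * \<nu> / 2)" by (simp only: sin_add) simp
  thus ?thesis using Gamma_reflection_real[of "(1 + \<nu>) / 2"] s unfolding e1 by simp
 qed
 have "bessel_K_moment \<nu> 1 * sin (pi * \<nu> / 2) * (Gamma (\<nu> / 2) * Gamma ((1 + \<nu>) / 2)) =
   2 * C * Gamma (\<nu> + 1) * (Gamma (\<nu> / 2) * Gamma (1 - \<nu> / 2) * sin (pi * \<nu> / 2))"
 proof -
  have "C * (m * G) * B / (m / 2 * D) * S * (A * D) = 2 * C * G * (A * B * S)" if "m \<noteq> 0" "D \<noteq> 0" for m G B D S A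
   using that by (simp add: field_simps)
  moreover have "Gamma ((\<nu> + 1) / 2) \<noteq> 0"
   using less_imp_neq[OF pos(3)[unfolded add.commute[of 1 \<nu>]]] by (rule not_sym)
  moreover have "\<nu> + 1 \<noteq> 0" using \<nu> by simp
  ultimately show ?thesis unfolding M1 add.commute[of 1 \<nu>] by blast
 qed
 also have "\<dots> = 2 * C * Gamma (\<nu> + 1) * (Gamma ((1 + \<nu>) / 2) * Gamma ((1 - \<nu>) / 2) * cos (pi * \<nu> / 2))"
  unfolding r1 r2 ..
 also have "\<dots> = \<nu> * bessel_K_moment \<nu> 0 * cos (pi * \<nu> / 2) * (Gamma (\<nu> / 2) * Gamma ((1 + \<nu>) / 2))"
 proof -
  have "2 * C * G * (D * H * K) = n * (C * G * H / (n / 2 * A)) * K * (A * D)" if "n \<noteq> 0" "A \<noteq> 0" for n G H D K A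
   using that by (simp add: field_simps)
  moreover have "Gamma (\<nu> / 2) \<noteq> 0" using less_imp_neq[OF pos(1)] by (rule not_sym)
  moreover have "\<nu> \<noteq> 0" using \<nu> by simp
  ultimately show ?thesis unfolding M0 by blast
 qed
 finally show "bessel_K_moment \<nu> 1 * sin (pi * \<nu> / 2) = \<nu> * bessel_K_moment \<nu> 0 * cos (pi * \<nu> / 2)"
  using pos by simp
qed

end

section \<open>Jacobi recurrences off the interval\<close>

text \<open>The two solutions have product 1, so one lies in the closed unit disc. If its modulus r
  exceeded 1 / (1 + \<delta>), then \<bar>z - Re w\<bar> = (1/r - r) / 2 would be below \<delta>,
  although Re w belongs to [-1,1].\<close>

lemma exists_joukowski_inverse:
 fixes z :: complex
 assumes "\<delta> > 0" and dist: "\<And>s. s \<in> {-1..1} \<Longrightarrow> \<delta> \<le> cmod (z - cr s)"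
 obtains w where "w \<noteq> 0" "cmod w \<le> 1 / (1 + \<delta>)" "w + 1 / w = 2 * z"
proof -
 have close: False if w: "w \<noteq> 0" "w + 1 / w = 2 * z" "cmod w > 1 / (1 + \<delta>)" "cmod w \<le> 1" for w
 proof -
  define r where "r = cmod w"
  have r: "r > 0" "r \<le> 1" "r > 1 / (1 + \<delta>)" using w by (auto simp: r_def)
  have "z - cr (Re w) = (1 / w - cnj w) / 2"
  proof -
   have "2 * cr (Re w) = w + cnj w" by (simp add: complex_add_cnj)
   hence "2 * (z - cr (Re w)) = (w + 1 / w) - (w + cnj w)" using w(2) by simp
   thus ?thesis by (simp add: field_simps)
  qed
  also have "1 / w - cnj w = cnj w * cr (1 / r^2 - 1)"
  proof -
   have "w * cnj w = cr (r^2)" by (simp add: r_def complex_norm_square del: of_real_power)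
   hence "1 / w = cnj w / cr (r^2)" using w(1) r(1) by (simp add: field_simps del: of_real_power)
   thus ?thesis by (simp add: algebra_simps)
  qed
  finally have "cmod (z - cr (Re w)) = r * \<bar>1 / r^2 - 1\<bar> / 2"
   by (simp only: norm_divide norm_mult norm_of_real complex_mod_cnj r_def[symmetric]) simp
  also have "r * \<bar>1 / r^2 - 1\<bar> = 1 / r - r"
  proof -
   have "1 / r^2 \<ge> 1" using r by (simp add: power_le_one)
   thus ?thesis using r by (simp add: field_simps power2_eq_square)
  qed
  finally have c: "cmod (z - cr (Re w)) = (1 / r - r) / 2" .
  have "\<bar>Re w\<bar> \<le> 1" using abs_Re_le_cmod[of w] w(4) by simp
  hence "\<delta> \<le> (1 / r - r) / 2" using dist[of "Re w"] c by (simp add: abs_le_iff)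
  moreover have "1 / r < 1 + \<delta>" using r assms(1) by (simp add: field_simps)
  moreover have "r > 1 - \<delta>"
  proof -
   have "(1 - \<delta>) * (1 + \<delta>) \<le> 1" by (simp add: algebra_simps)
   hence "1 - \<delta> \<le> 1 / (1 + \<delta>)" using assms(1) by (simp add: field_simps)
   thus ?thesis using r by simp
  qed
  ultimately show False by simp
 qed
 define v where "v = csqrt (z^2 - 1)"
 have v: "v^2 = z^2 - 1" by (simp add: v_def)
 define a b where "a = z + v" and "b = z - v"
 have ab: "a * b = 1" using v by (simp add: a_def b_def algebra_simps power2_eq_square)
 hence nz: "a \<noteq> 0" "b \<noteq> 0" by auto
 have inv: "1 / a = b" "1 / b = a" using ab nz by (auto simp: field_simps)
 have sum: "a + 1 / a = 2 * z" "b + 1 / b = 2 * z" unfolding inv by (auto simp: a_def b_def)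
 have "cmod a * cmod b = 1" using ab by (metis norm_mult norm_one)
 hence "cmod a \<le> 1 \<or> cmod b \<le> 1"
  by (metis less_1_mult less_eq_real_def linorder_le_less_linear order_less_irrefl)
 thus ?thesis using that close nz sum by (metis linorder_not_less)
qed

text \<open>Sums of this kind are bounded because a real Jacobi matrix has a real numerical range.\<close>

lemma jacobi_sum_bound:
 fixes P :: "nat \<Rightarrow> complex" and a :: "nat \<Rightarrow> real" and x :: complex
 assumes rec: "\<And>k. k < n \<Longrightarrow> x * P k = a (Suc k) * P (Suc k) + a k * P (k - 1)"
  and a0: "a 0 = 0" and a: "\<And>k. k \<le> n \<Longrightarrow> 0 \<le> a k \<and> a k \<le> c / 2"
  and n: "n > 0" and d: "\<And>s. \<bar>s\<bar> \<le> c \<Longrightarrow> d \<le> cmod (x - cr s)" and d0: "d > 0"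
 shows "sqrt (\<Sum>k<n. (cmod (P k))^2) * d \<le> a n * cmod (P n)"
proof -
 define S where "S = (\<Sum>k<n. (cmod (P k))^2)"
 define T where "T = (\<Sum>k<n - 1. a (Suc k) * (2 * Re (P (Suc k) * cnj (P k))))"
 have S0: "S \<ge> 0" unfolding S_def by (intro sum_nonneg) auto
 obtain m where m: "n = Suc m" using n by (cases n) auto
 have c0: "c \<ge> 0" using a[of 0] by auto
 \<comment> \<open>Multiply the recurrence by \<open>cnj (P k)\<close> and add up: the contributions
   of neighbouring indices pair to twice a real part, and only the boundary term at \<open>j\<close>
   remains unpaired.\<close>
 have sum: "x * cr (\<Sum>k<j. (cmod (P k))^2) =
   cr (\<Sum>k<j - 1. a (Suc k) * (2 * Re (P (Suc k) * cnj (P k)))) + a j * P j * cnj (P (j - 1))" if "0 < j" "j \<le> n" for j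
  using that
 proof (induction j)
  case (Suc j)
  show ?case
  proof (cases j)
   case 0
   have "x * P 0 = a (Suc 0) * P (Suc 0)" using rec[of 0] a0 n by simp
   hence "x * (P 0 * cnj (P 0)) = a (Suc 0) * P (Suc 0) * cnj (P 0)" by (simp only: mult.assoc[symmetric])
   thus ?thesis unfolding 0 by (simp add: complex_norm_square del: of_real_power)
  next
   case (Suc i)
   have "x * cr (\<Sum>k<Suc j. (cmod (P k))^2) = x * cr (\<Sum>k<j. (cmod (P k))^2) + (x * P j) * cnj (P j)"
    by (simp add: distrib_left complex_norm_square mult.assoc del: of_real_power of_real_sum)
   also have "\<dots> = cr (\<Sum>k<j - 1. a (Suc k) * (2 * Re (P (Suc k) * cnj (P k)))) + a j * P j * cnj (P (j - 1)) +
     (a (Suc j) * P (Suc j) + a j * P (j - 1)) * cnj (P j)"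
    using Suc.IH Suc.prems Suc rec[of j] by simp
   also have "\<dots> = cr (\<Sum>k<j - 1. a (Suc k) * (2 * Re (P (Suc k) * cnj (P k)))) +
     cr (a j) * (P j * cnj (P (j - 1)) + cnj (P j * cnj (P (j - 1)))) + a (Suc j) * P (Suc j) * cnj (P j)"
    by (simp add: algebra_simps)
   also have "P j * cnj (P (j - 1)) + cnj (P j * cnj (P (j - 1))) = cr (2 * Re (P j * cnj (P (j - 1))))"
    by (rule complex_add_cnj)
   also have "cr (\<Sum>k<j - 1. a (Suc k) * (2 * Re (P (Suc k) * cnj (P k)))) +
     cr (a j) * cr (2 * Re (P j * cnj (P (j - 1)))) =
     cr (\<Sum>k<j. a (Suc k) * (2 * Re (P (Suc k) * cnj (P k))))"
    unfolding Suc by (simp del: Re_complex_of_real)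
   finally show ?thesis by simp
  qed
 qed auto
 have eq: "x * cr S - cr T = a n * P n * cnj (P m)"
  using sum[of n] n m by (simp add: S_def T_def del: of_real_sum)
 have T: "\<bar>T\<bar> \<le> c * S"
 proof -
  have "\<bar>T\<bar> \<le> (\<Sum>k<m. c / 2 * ((cmod (P (Suc k)))^2 + (cmod (P k))^2))"
   unfolding T_def m diff_Suc_1
  proof (rule order_trans[OF sum_abs], rule sum_mono)
   fix k assume k: "k \<in> {..<m}"
   have "\<bar>Re (P (Suc k) * cnj (P k))\<bar> \<le> cmod (P (Suc k)) * cmod (P k)"
    by (metis abs_Re_le_cmod complex_mod_cnj norm_mult)
   moreover have "2 * (cmod (P (Suc k)) * cmod (P k)) \<le> (cmod (P (Suc k)))^2 + (cmod (P k))^2"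
    using sum_squares_bound[of "cmod (P (Suc k))" "cmod (P k)"] by simp
   ultimately have "\<bar>2 * Re (P (Suc k) * cnj (P k))\<bar> \<le> (cmod (P (Suc k)))^2 + (cmod (P k))^2"
    by (simp add: abs_mult)
   hence "\<bar>a (Suc k)\<bar> * \<bar>2 * Re (P (Suc k) * cnj (P k))\<bar> \<le> c / 2 * ((cmod (P (Suc k)))^2 + (cmod (P k))^2)"
    using a[of "Suc k"] k m by (intro mult_mono) auto
   thus "\<bar>a (Suc k) * (2 * Re (P (Suc k) * cnj (P k)))\<bar> \<le> c / 2 * ((cmod (P (Suc k)))^2 + (cmod (P k))^2)"
    by (simp only: abs_mult)
  qed
  also have "\<dots> = c / 2 * ((\<Sum>k<m. (cmod (P (Suc k)))^2) + (\<Sum>k<m. (cmod (P k))^2))"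
   by (simp only: sum_distrib_left[symmetric] sum.distrib)
  also have "\<dots> \<le> c / 2 * (S + S)"
  proof (intro mult_left_mono add_mono)
   show "(\<Sum>k<m. (cmod (P (Suc k)))^2) \<le> S" unfolding S_def m sum.lessThan_Suc_shift by simp
   show "(\<Sum>k<m. (cmod (P k))^2) \<le> S" unfolding S_def m by simp
  qed (use c0 in auto)
  finally show ?thesis by simp
 qed
 have Pm: "cmod (P m) \<le> sqrt S"
 proof (rule real_le_rsqrt)
  show "(cmod (P m))^2 \<le> S" unfolding S_def m by (simp add: sum_nonneg)
 qed
 show ?thesis
 proof (cases "S = 0")
  case True
  thus ?thesis using a[of n] by (simp add: S_def[symmetric])
 next
  case False
  hence S: "S > 0" using S0 by simp
  \<comment> \<open>\<open>T / S\<close> is a Rayleigh quotient of the Jacobi matrix, a real point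
    of [-c,c] from which \<open>x\<close> keeps the distance \<open>d\<close>.\<close>
  have "\<bar>T / S\<bar> \<le> c" using T S by (simp add: abs_divide field_simps)
  from d[OF this] have "d * S \<le> cmod (x - cr (T / S)) * S" using S by (intro mult_right_mono) auto
  also have "\<dots> = cmod ((x - cr (T / S)) * cr S)" using S by (simp add: norm_mult)
  also have "(x - cr (T / S)) * cr S = x * cr S - cr T"
   using S by (simp add: left_diff_distrib)
  also have "cmod \<dots> = a n * cmod (P n) * cmod (P m)" unfolding eq using a[of n] by (simp add: norm_mult)
  also have "\<dots> \<le> a n * cmod (P n) * sqrt S" using a[of n] Pm by (intro mult_left_mono) auto
  finally have "(sqrt S * d) * sqrt S \<le> (a n * cmod (P n)) * sqrt S"
   using S by (simp add: mult.commute mult.left_commute flip: power2_eq_square)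
  hence "sqrt S * d \<le> a n * cmod (P n)" by (rule mult_right_le_imp_le) (use S in simp)
  thus ?thesis unfolding S_def .
 qed
qed

text \<open>Because 2z = w + 1/w, the difference d(j) = R(j) - w R(j-1) obeys d(j) = w (d(j+1) -
  error). Run downwards from the crude bound 2M at the far end this contracts by \<rho> in each
  step, which suppresses the solution growing like w^(-j).\<close>

lemma joukowski_ratio_bound:
 fixes R :: "nat \<Rightarrow> complex"
 assumes w: "w \<noteq> 0" "cmod w \<le> \<rho>" "\<rho> < 1" "w + 1 / w = 2 * z"
  and rec: "\<And>j. 1 \<le> j \<Longrightarrow> j \<le> J \<Longrightarrow> cmod (R (Suc j) - 2 * z * R j + R (j - 1)) \<le> e"
  and M: "\<And>j. j \<le> Suc J \<Longrightarrow> cmod (R j) \<le> M"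
  and j: "1 \<le> j" "j \<le> Suc J"
 shows "cmod (R j - w * R (j - 1)) \<le> \<rho> ^ (Suc J - j) * (2 * M) + e * real (Suc J - j)"
 using j
proof (induction "Suc J - j" arbitrary: j)
 case 0
 hence j: "j = Suc J" by simp
 have "cmod (R (Suc J) - w * R J) \<le> cmod (R (Suc J)) + cmod (w * R J)" by (rule norm_triangle_ineq4)
 also have "\<dots> \<le> M + 1 * M"
  unfolding norm_mult using w M[of J] M[of "Suc J"] by (intro add_mono mult_mono) auto
 finally show ?case unfolding j by simp
next
 case (Suc k)
 have jJ: "j \<le> J" "k = Suc J - Suc j" using Suc by auto
 define E where "E = R (Suc j) - 2 * z * R j + R (j - 1)"
 have E: "cmod E \<le> e" unfolding E_def using rec[of j] Suc.prems jJ by auto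
 have e0: "e \<ge> 0" using E norm_ge_zero order_trans by blast
 have IH: "cmod (R (Suc j) - w * R j) \<le> \<rho> ^ k * (2 * M) + e * real k"
  using Suc.hyps(1)[of "Suc j"] jJ by simp
 have "R j - w * R (j - 1) = w * ((R (Suc j) - w * R j) - E)"
  unfolding E_def w(4)[symmetric] using w(1) by (simp add: field_simps)
 hence "cmod (R j - w * R (j - 1)) \<le> \<rho> * (cmod (R (Suc j) - w * R j) + cmod E)"
  using w(2) norm_triangle_ineq4[of "R (Suc j) - w * R j" E] order_trans[OF norm_ge_zero w(2)]
  by (simp only: norm_mult mult_mono norm_ge_zero)
 also have "\<dots> \<le> \<rho> * ((\<rho> ^ k * (2 * M) + e * real k) + e)"
  using IH E w(2) norm_ge_zero[of w] by (intro mult_left_mono add_mono) linarith+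
 also have "\<dots> = \<rho> ^ Suc k * (2 * M) + \<rho> * (e * real k + e)" by (simp add: algebra_simps)
 also have "\<dots> \<le> \<rho> ^ Suc k * (2 * M) + 1 * (e * real k + e)"
  using w(3) e0 by (intro add_left_mono mult_right_mono) auto
 finally show ?case unfolding Suc.hyps(2)[symmetric] by (simp add: algebra_simps)
qed

section \<open>Power sums of zeros as traces\<close>

lemma triangular_basis_coordinates:
 fixes f :: "nat \<Rightarrow> complex poly"
 assumes deg: "\<And>k. k < N \<Longrightarrow> degree (f k) = k \<and> f k \<noteq> 0"
 obtains \<beta> :: "nat \<Rightarrow> complex poly \<Rightarrow> complex"
  where "\<And>k p q. \<beta> k (p + q) = \<beta> k p + \<beta> k q" "\<And>k c p. \<beta> k (smult c p) = c * \<beta> k p"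
   "\<And>p. degree p < N \<Longrightarrow> p = (\<Sum>k<N. smult (\<beta> k p) (f k))"
   "\<And>k l. k < N \<Longrightarrow> l < N \<Longrightarrow> \<beta> k (f l) = (if k = l then 1 else 0)"
proof -
 define R :: "nat \<Rightarrow> (nat \<Rightarrow> complex poly \<Rightarrow> complex) \<Rightarrow> bool" where
  "R N \<beta> \<longleftrightarrow> (\<forall>k p q. \<beta> k (p + q) = \<beta> k p + \<beta> k q) \<and> (\<forall>k c p. \<beta> k (smult c p) = c * \<beta> k p) \<and>
   (\<forall>p. (p = 0 \<or> degree p < N) \<longrightarrow> p = (\<Sum>k<N. smult (\<beta> k p) (f k))) \<and>
   (\<forall>k l. k < N \<longrightarrow> l < N \<longrightarrow> \<beta> k (f l) = (if k = l then 1 else 0))" for N \<beta>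
 have "\<exists>\<beta>. R N \<beta>"
  using deg
 proof (induction N)
  case 0
  show ?case by (rule exI[of _ "\<lambda>_ _. 0"]) (simp add: R_def)
 next
  case (Suc N)
  have "\<exists>\<beta>. R N \<beta>" by (rule Suc.IH) (use Suc.prems in simp)
  then obtain \<beta> where \<beta>: "R N \<beta>" by (rule exE)
  note add = \<beta>[unfolded R_def, THEN conjunct1, rule_format]
   and smult = \<beta>[unfolded R_def, THEN conjunct2, THEN conjunct1, rule_format]
   and rep = \<beta>[unfolded R_def, THEN conjunct2, THEN conjunct2, THEN conjunct1, rule_format]
   and dual = \<beta>[unfolded R_def, THEN conjunct2, THEN conjunct2, THEN conjunct2, rule_format]
  define L where "L = coeff (f N) N"
  have L: "L \<noteq> 0" using Suc.prems[of N] unfolding L_def by (metis leading_coeff_0_iff lessI)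
  define \<tau> where "\<tau> p = coeff p N / L" for p
  define \<gamma> where "\<gamma> k p = (if k = N then \<tau> p else \<beta> k (p - smult (\<tau> p) (f N)))" for k p
  have diff: "\<beta> k (p - q) = \<beta> k p - \<beta> k q" for k p q
   using add[of k "p - q" q] by simp
  have \<tau>: "\<tau> (p + q) = \<tau> p + \<tau> q" "\<tau> (Polynomial.smult c p) = c * \<tau> p" for p q c
   by (simp_all add: \<tau>_def add_divide_distrib)
  have z: "\<beta> k 0 = 0" for k using smult[of k 0 0] by simp
  show ?case
   unfolding R_def
  proof (intro exI[of _ \<gamma>] conjI allI impI)
   show "\<gamma> k (p + q) = \<gamma> k p + \<gamma> k q" for k p q
    by (simp add: \<gamma>_def \<tau> diff add smult algebra_simps)
   show "\<gamma> k (Polynomial.smult c p) = c * \<gamma> k p" for k c p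
    by (simp add: \<gamma>_def \<tau> diff smult algebra_simps)
   fix p :: "complex poly" assume p: "p = 0 \<or> degree p < Suc N"
   define q where "q = p - Polynomial.smult (\<tau> p) (f N)"
   have "q = 0 \<or> degree q < N"
   proof (cases "q = 0")
    case False
    have "degree p \<le> N" using p by auto
    moreover have "degree (Polynomial.smult (\<tau> p) (f N)) \<le> N"
     using degree_smult_le[of "\<tau> p" "f N"] Suc.prems[of N] by simp
    ultimately have "degree q \<le> N" unfolding q_def by (rule degree_diff_le)
    moreover have "coeff q N = 0" using L by (simp add: q_def \<tau>_def L_def)
    ultimately show ?thesis using False by (metis leading_coeff_0_iff le_neq_implies_less)
   qed auto
   from rep[OF this] have "p = (\<Sum>k<N. Polynomial.smult (\<beta> k q) (f k)) + Polynomial.smult (\<tau> p) (f N)"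
    by (simp add: q_def algebra_simps)
   thus "p = (\<Sum>k<Suc N. Polynomial.smult (\<gamma> k p) (f k))"
    by (simp add: \<gamma>_def q_def)
  next
   fix k l assume kl: "k < Suc N" "l < Suc N"
   show "\<gamma> k (f l) = (if k = l then 1 else 0)"
   proof (cases "l = N")
    case True
    hence "\<tau> (f l) = 1" using L by (simp add: \<tau>_def L_def)
    thus ?thesis using True by (simp add: \<gamma>_def z)
   next
    case False
    hence "degree (f l) < N" using Suc.prems[of l] kl by simp
    hence "\<tau> (f l) = 0" by (simp add: \<tau>_def coeff_eq_0)
    thus ?thesis using False kl dual[of k l] by (auto simp: \<gamma>_def)
   qed
  qed
 qed
 then obtain \<beta> where "R N \<beta>" by (rule exE)
 thus ?thesis unfolding R_def by (intro that[of \<beta>]) (elim conjE, simp)+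
qed

text \<open>The trace of the \<open>m\<close>-th power of multiplication by \<open>x\<close> on \<open>\<complex>[x]/(Q)\<close>, computed in a basis with
 linear coordinate functionals \<open>\<alpha>\<close>, is compared with the trace in the Newton basis, where
 multiplication by \<open>x\<close> is triangular with the zeros of \<open>Q\<close> on the diagonal.\<close>

lemma trace_eq_power_sum:
 fixes Q :: "complex poly" and p :: "nat \<Rightarrow> complex poly" and \<alpha> :: "nat \<Rightarrow> complex poly \<Rightarrow> complex"
  and T :: "complex poly \<Rightarrow> complex poly"
 assumes deg: "degree Q = n" and Q: "Q \<noteq> 0"
  and \<alpha>: "\<And>k p q. \<alpha> k (p + q) = \<alpha> k p + \<alpha> k q" "\<And>k c p. \<alpha> k (smult c p) = c * \<alpha> k p"
  and rep: "\<And>q. degree q < n \<Longrightarrow> q = (\<Sum>k<n. smult (\<alpha> k q) (p k))"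
  and dp: "\<And>k. k < n \<Longrightarrow> degree (p k) < n"
  and T: "\<And>f. degree f < n \<Longrightarrow> T f = [:0, 1:] * f - smult (coeff f (n - 1) / lead_coeff Q) Q"
 shows "(\<Sum>k<n. \<alpha> k ((T ^^ m) (p k))) = (\<Sum>z\<in>#proots Q. z ^ m)"
proof (cases "n = 0")
 case True
 hence "proots Q = {#}" using deg size_proots_complex[of Q] by simp
 thus ?thesis using True by simp
next
 case False
 hence n: "n > 0" by simp
 obtain zs where zs: "mset zs = proots Q" by (metis ex_mset)
 have len: "length zs = n" using zs deg by (metis size_mset size_proots_complex)
 \<comment> \<open>The Newton basis at the zeros of \<open>Q\<close>, with multiplicity. Modulo
   \<open>Q\<close>, multiplication by x sends \<open>f k\<close> to
   \<open>f (Suc k) + zs ! k * f k\<close>, and \<open>f n\<close> is 0.\<close>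
 define f where "f k = (\<Prod>z\<leftarrow>take k zs. [:- z, 1:])" for k
 have f_Suc: "f (Suc k) = f k * [:- (zs ! k), 1:]" if "k < n" for k
  using that len by (simp add: f_def take_Suc_conv_app_nth)
 have fdeg: "degree (f k) = k \<and> lead_coeff (f k) = 1" if "k \<le> n" for k
  using that
 proof (induction k)
  case (Suc k)
  hence k: "degree (f k) = k" "lead_coeff (f k) = 1" "k < n" by auto
  have "f k \<noteq> 0" using k(2) by auto
  hence "degree (f (Suc k)) = Suc k"
   unfolding f_Suc[OF k(3)] by (subst degree_mult_eq) (use k(1) in auto)
  moreover have "lead_coeff (f (Suc k)) = 1"
   unfolding f_Suc[OF k(3)] lead_coeff_mult using k(2) by simp
  ultimately show ?case by simp
 qed (simp add: f_def)
 have fQ: "Q = smult (lead_coeff Q) (f n)"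
 proof -
  have "f n = (\<Prod>z\<in>#proots Q. [:- z, 1:])"
  proof -
   have "f n = prod_list (map (\<lambda>z. [:- z, 1:]) zs)" using len by (simp add: f_def)
   also have "\<dots> = prod_mset (mset (map (\<lambda>z. [:- z, 1:]) zs))" by (rule prod_mset_prod_list[symmetric])
   finally show ?thesis unfolding mset_map zs .
  qed
  thus ?thesis using complex_poly_decompose_multiset[of Q] by simp
 qed
 have Tdeg: "degree (T g) < n" if g: "degree g < n" for g
 proof -
  have "degree ([:0, 1:] * g) \<le> n" using degree_mult_le[of "[:0, 1:]" g] g by simp
  moreover have "degree (smult (coeff g (n - 1) / lead_coeff Q) Q) \<le> n" using degree_smult_le[of _ Q] deg by simp
  ultimately have "degree (T g) \<le> n" unfolding T[OF g] by (rule degree_diff_le)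
  moreover have "coeff Q n \<noteq> 0" using Q deg leading_coeff_0_iff[of Q] by simp
  hence "coeff (T g) n = 0" unfolding T[OF g] using n deg by (cases n) (auto simp: coeff_pCons)
  ultimately show ?thesis using n by (metis degree_0 leading_coeff_0_iff le_neq_implies_less)
 qed
 have add: "degree (a + b) < n" if "degree a < n" "degree b < n" for a b :: "complex poly"
  using that degree_add_le_max[of a b] by simp
 have sm: "degree (smult c a) < n" if "degree a < n" for a :: "complex poly" and c
  using that degree_smult_le[of c a] by simp
 have Tadd: "T (a + b) = T a + T b" if "degree a < n" "degree b < n" for a b
  using that add[OF that] by (simp add: T algebra_simps smult_add_left add_divide_distrib)
 have Tsm: "T (smult c a) = smult c (T a)" if "degree a < n" for a c
  using that sm[OF that] by (simp add: T smult_diff_right)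
 have Td: "degree ((T ^^ m) g) < n" if "degree g < n" for g m
  using that by (induction m) (auto intro: Tdeg)
 have TTadd: "(T ^^ m) (a + b) = (T ^^ m) a + (T ^^ m) b" if "degree a < n" "degree b < n" for a b m
  using that by (induction m) (auto simp: Tadd Td)
 have TTsm: "(T ^^ m) (smult c a) = smult c ((T ^^ m) a)" if "degree a < n" for a c m
  using that by (induction m) (auto simp: Tsm Td)
 have TT0: "(T ^^ m) 0 = 0" for m using TTsm[of 0 m 0] n by simp
 have TTsum: "(T ^^ m) (\<Sum>k\<in>I. smult (c k) (g k)) = (\<Sum>k\<in>I. smult (c k) ((T ^^ m) (g k)))"
  if "\<And>k. k \<in> I \<Longrightarrow> degree (g k) < n" for I :: "nat set" and c g m
  using that
 proof (induction I rule: infinite_finite_induct)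
  case (insert i I)
  have d1: "degree (g i) < n" and d: "\<And>k. k \<in> I \<Longrightarrow> degree (g k) < n" using insert.prems by auto
  have d2: "degree (\<Sum>k\<in>I. smult (c k) (g k)) < n"
   by (rule degree_sum_less) (use sm[OF d] n in auto)
  have IH: "(T ^^ m) (\<Sum>k\<in>I. smult (c k) (g k)) = (\<Sum>k\<in>I. smult (c k) ((T ^^ m) (g k)))"
   by (rule insert.IH) (rule d)
  show ?case
   unfolding sum.insert[OF insert.hyps(1,2)] TTadd[OF sm[OF d1] d2] TTsm[OF d1] by (rule arg_cong[OF IH])
 qed (auto simp: TT0)
 have fd: "degree (f k) = k \<and> f k \<noteq> 0" if "k < n" for k using fdeg[of k] that by auto
 obtain \<beta> where \<beta>: "\<And>k p q. \<beta> k (p + q) = \<beta> k p + \<beta> k q" "\<And>k c p. \<beta> k (smult c p) = c * \<beta> k p"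
   "\<And>p. degree p < n \<Longrightarrow> p = (\<Sum>k<n. smult (\<beta> k p) (f k))"
   "\<And>k l. k < n \<Longrightarrow> l < n \<Longrightarrow> \<beta> k (f l) = (if k = l then 1 else 0)"
  by (rule triangular_basis_coordinates[of n f], rule fd, assumption, rule that)
 have lin: "h (\<Sum>l\<in>I. smult (c l) (g l)) = (\<Sum>l\<in>I. c l * h (g l))"
  if h: "\<And>p q. h (p + q) = h p + h q" "\<And>c p. h (smult c p) = c * h p"
  for h :: "complex poly \<Rightarrow> complex" and c g and I :: "nat set"
 proof -
  have h0: "h 0 = 0" using h(2)[of 0 0] by simp
  show ?thesis
  proof (induction I rule: infinite_finite_induct)
   case (insert i I)
   thus ?case by (simp add: h)
  qed (simp_all add: h0)
 qed
 have \<alpha>sum: "\<alpha> k (\<Sum>l\<in>I. smult (c l) (g l)) = (\<Sum>l\<in>I. c l * \<alpha> k (g l))" for k c g and I :: "nat set"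
  by (rule lin) (rule \<alpha>)+
 have \<beta>sum: "\<beta> k (\<Sum>l\<in>I. smult (c l) (g l)) = (\<Sum>l\<in>I. c l * \<beta> k (g l))" for k c g and I :: "nat set"
  by (rule lin) (rule \<beta>)+
 \<comment> \<open>Invariance of the trace under change of basis: expand in \<open>f\<close>,
   exchange the sums, and collect the expansion of \<open>f l\<close> in the basis
   \<open>p\<close>.\<close>
 have "(\<Sum>k<n. \<alpha> k ((T ^^ m) (p k))) = (\<Sum>k<n. \<Sum>l<n. \<beta> l ((T ^^ m) (p k)) * \<alpha> k (f l))"
 proof (intro sum.cong refl)
  fix k assume "k \<in> {..<n}"
  hence "degree ((T ^^ m) (p k)) < n" using dp by (intro Td) auto
  from \<beta>(3)[OF this] have "\<alpha> k ((T ^^ m) (p k)) = \<alpha> k (\<Sum>l<n. smult (\<beta> l ((T ^^ m) (p k))) (f l))" by simp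
  thus "\<alpha> k ((T ^^ m) (p k)) = (\<Sum>l<n. \<beta> l ((T ^^ m) (p k)) * \<alpha> k (f l))" unfolding \<alpha>sum .
 qed
 also have "\<dots> = (\<Sum>l<n. \<Sum>k<n. \<alpha> k (f l) * \<beta> l ((T ^^ m) (p k)))"
  by (subst sum.swap) (simp add: mult.commute)
 also have "\<dots> = (\<Sum>l<n. \<beta> l ((T ^^ m) (f l)))"
 proof (intro sum.cong refl)
  fix l assume l: "l \<in> {..<n}"
  hence "degree (f l) < n" using fd by auto
  from rep[OF this] have "\<beta> l ((T ^^ m) (f l)) = \<beta> l ((T ^^ m) (\<Sum>k<n. smult (\<alpha> k (f l)) (p k)))" by simp
  also have "(T ^^ m) (\<Sum>k<n. smult (\<alpha> k (f l)) (p k)) = (\<Sum>k<n. smult (\<alpha> k (f l)) ((T ^^ m) (p k)))"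
   using dp by (intro TTsum) auto
  finally show "(\<Sum>k<n. \<alpha> k (f l) * \<beta> l ((T ^^ m) (p k))) = \<beta> l ((T ^^ m) (f l))" unfolding \<beta>sum ..
 qed
 also have "\<dots> = (\<Sum>l<n. (zs ! l) ^ m)"
 proof (intro sum.cong refl)
  fix l assume "l \<in> {..<n}"
  hence l: "l < n" by simp
  have Tf: "T (f k) = (if Suc k < n then f (Suc k) else 0) + smult (zs ! k) (f k)" if k: "k < n" for k
  proof -
   have e: "[:0, 1:] * f k = f (Suc k) + smult (zs ! k) (f k)"
    unfolding f_Suc[OF k] by (simp add: algebra_simps)
   have dk: "degree (f k) < n" using fd[OF k] k by simp
   show ?thesis
   proof (cases "Suc k < n")
    case True
    hence "coeff (f k) (n - 1) = 0" using fd[OF k] by (intro coeff_eq_0) simp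
    thus ?thesis unfolding T[OF dk] e using True by simp
   next
    case False
    hence kn: "Suc k = n" using k by simp
    hence "coeff (f k) (n - 1) = 1" using fdeg[of k] by auto
    hence "smult (coeff (f k) (n - 1) / lead_coeff Q) Q = f n"
     using Q by (subst (3) fQ) simp
    thus ?thesis unfolding T[OF dk] e using kn by simp
   qed
  qed
  \<comment> \<open>Triangularity: powers of \<open>T\<close> only add basis elements of index above
    \<open>l\<close>, which \<open>\<beta> l\<close> annihilates.\<close>
  have "\<exists>c. (T ^^ j) (f l) = smult ((zs ! l) ^ j) (f l) + (\<Sum>k\<in>{l<..<n}. smult (c k) (f k))" for j
  proof (induction j)
   case 0
   show ?case by (rule exI[of _ "\<lambda>_. 0"]) simp
  next
   case (Suc j)
   then obtain c where c: "(T ^^ j) (f l) = smult ((zs ! l) ^ j) (f l) + (\<Sum>k\<in>{l<..<n}. smult (c k) (f k))" by blast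
   define cc where "cc k = (if k = l then (zs ! l) ^ j else c k)" for k
   have ins: "{l..<n} = insert l {l<..<n}" using l by auto
   have "(T ^^ j) (f l) = (\<Sum>k\<in>{l..<n}. smult (cc k) (f k))"
    unfolding c ins by (simp add: cc_def)
   hence "(T ^^ Suc j) (f l) = (T ^^ 1) (\<Sum>k\<in>{l..<n}. smult (cc k) (f k))" by simp
   also have "\<dots> = (\<Sum>k\<in>{l..<n}. smult (cc k) ((T ^^ 1) (f k)))"
    using fd by (intro TTsum) auto
   also have "\<dots> = (\<Sum>k\<in>{l..<n}. smult (cc k) ((if Suc k < n then f (Suc k) else 0) + smult (zs ! k) (f k)))"
    using Tf by (intro sum.cong) auto
   also have "\<dots> = (\<Sum>k\<in>{l..<n}. if Suc k < n then smult (cc k) (f (Suc k)) else 0) + (\<Sum>k\<in>{l..<n}. smult (cc k * zs ! k) (f k))"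
    by (simp add: smult_add_right sum.distrib) (intro sum.cong, auto)
   also have "(\<Sum>k\<in>{l..<n}. if Suc k < n then smult (cc k) (f (Suc k)) else 0) = (\<Sum>k\<in>{l<..<n}. smult (cc (k - 1)) (f k))"
   proof -
    have "(\<Sum>k\<in>{l..<n}. if Suc k < n then smult (cc k) (f (Suc k)) else 0) = (\<Sum>k\<in>{l..<n - 1}. smult (cc k) (f (Suc k)))"
     by (rule sum.mono_neutral_cong_right) auto
    also have "\<dots> = (\<Sum>k\<in>{l<..<n}. smult (cc (k - 1)) (f k))"
     by (rule sum.reindex_bij_witness[of _ "\<lambda>k. k - 1" Suc]) auto
    finally show ?thesis .
   qed
   also have "(\<Sum>k\<in>{l..<n}. smult (cc k * zs ! k) (f k)) = smult (cc l * zs ! l) (f l) + (\<Sum>k\<in>{l<..<n}. smult (cc k * zs ! k) (f k))"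
    unfolding ins by simp
   finally have "(T ^^ Suc j) (f l) = smult (cc l * zs ! l) (f l) + (\<Sum>k\<in>{l<..<n}. smult (cc (k - 1) + cc k * zs ! k) (f k))"
    by (simp add: smult_add_left sum.distrib add_ac)
   thus ?case by (intro exI[of _ "\<lambda>k. cc (k - 1) + cc k * zs ! k"]) (simp add: cc_def mult.commute)
  qed
  then obtain c where c: "(T ^^ m) (f l) = smult ((zs ! l) ^ m) (f l) + (\<Sum>k\<in>{l<..<n}. smult (c k) (f k))" by blast
  have "\<beta> l ((T ^^ m) (f l)) = (zs ! l) ^ m * \<beta> l (f l) + (\<Sum>k\<in>{l<..<n}. c k * \<beta> l (f k))"
   unfolding c \<beta>(1) \<beta>(2) \<beta>sum ..
  also have "(\<Sum>k\<in>{l<..<n}. c k * \<beta> l (f k)) = 0" using \<beta>(4)[OF l] by (intro sum.neutral) auto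
  finally show "\<beta> l ((T ^^ m) (f l)) = (zs ! l) ^ m" using \<beta>(4)[OF l l] by simp
 qed
 also have "\<dots> = (\<Sum>z\<leftarrow>zs. z ^ m)" using len by (simp add: sum_list_sum_nth atLeast0LessThan)
 also have "\<dots> = (\<Sum>z\<in>#proots Q. z ^ m)" unfolding zs[symmetric] mset_map[symmetric] by (rule sum_mset_sum_list[symmetric])
 finally show ?thesis .
qed

section \<open>Weak asymptotics of Meixner--Pollaczek polynomials\<close>

definition mpr :: "nat \<Rightarrow> real \<Rightarrow> real" where
 "mpr k x = Re (poly (mp k) (cr x))"

definition sech_wt :: "real \<Rightarrow> real" where
 "sech_wt x = 1 / cosh (pi * x)"

lemma sech_wt_pos: "sech_wt x > 0"
 by (simp add: sech_wt_def)

lemma sech_wt_measurable [measurable]: "sech_wt \<in> borel_measurable borel"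
 unfolding sech_wt_def[abs_def] by measurable

lemma poly_mp_of_real: "poly (mp k) (cr x) = cr (mpr k x)"
proof (induction k rule: mp.induct)
 case (3 n)
 show ?case by (subst mpr_def) (simp add: 3 complex_is_Real_iff complex_eq_iff)
qed (auto simp: mpr_def complex_eq_iff)

lemma mpr_measurable [measurable]: "mpr k \<in> borel_measurable borel"
 unfolding mpr_def[abs_def]
 by (intro borel_measurable_continuous_onI continuous_intros)

lemma integrable_mpr: "integrable lborel (\<lambda>x. x ^ m * (mpr i x * mpr j x) * sech_wt x)"
proof -
 have "integrable lborel (\<lambda>x. Re (poly (monom 1 m * mp i * mp j) (cr x) * cr (1 / cosh (pi * x))))"
  by (intro integrable_Re integrable_poly_sech)
 moreover have "Re (poly (monom 1 m * mp i * mp j) (cr x) * cr (1 / cosh (pi * x))) =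
   x ^ m * (mpr i x * mpr j x) * sech_wt x" for x
 proof -
  have "poly (monom 1 m * mp i * mp j) (cr x) * cr (1 / cosh (pi * x)) =
   cr (x ^ m * (mpr i x * mpr j x) * sech_wt x)"
   by (simp add: poly_monom poly_mp_of_real sech_wt_def)
  thus ?thesis by (simp only: Re_complex_of_real)
 qed
 ultimately show ?thesis by simp
qed

lemma mpr_orthonormal: "(\<integral>x. mpr i x * mpr j x * sech_wt x \<partial>lborel) = (if i = j then 1 else 0)"
proof -
 have "sech_int (mp i * mp j) = (\<integral>x. cr (mpr i x * mpr j x * sech_wt x) \<partial>lborel)"
  by (simp add: sech_int_def poly_mp_of_real sech_wt_def)
 also have "\<dots> = cr (\<integral>x. mpr i x * mpr j x * sech_wt x \<partial>lborel)"
  by (rule integral_complex_of_real)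
 finally show ?thesis by (simp add: mp_orthonormal complex_eq_iff split: if_splits)
qed

lemma mpr_rec: "x * mpr n x = (real n + 1) / 2 * mpr (Suc n) x + real n / 2 * mpr (n - 1) x"
proof -
 have "cr ((real n + 1) * mpr (Suc n) x) = cr (2 * x * mpr n x - real n * mpr (n - 1) x)"
  using poly_mp_rec[of n "cr x"] by (simp add: poly_mp_of_real add.commute del: mp.simps)
 hence "(real n + 1) * mpr (Suc n) x = 2 * x * mpr n x - real n * mpr (n - 1) x"
  by (simp only: of_real_eq_iff)
 thus ?thesis by (simp add: field_simps)
qed

text \<open>An integer offset treats indices below and above \<open>n\<close> alike; the truncation
  by \<open>nat\<close> concerns only finitely many \<open>n\<close>.\<close>

definition shifted_mpr :: "int \<Rightarrow> nat \<Rightarrow> real \<Rightarrow> real" where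
 "shifted_mpr i n = mpr (nat (int n + i))"

section \<open>Averages over the circle as limits of averages against the polynomials\<close>

definition circle_mean :: "(real \<Rightarrow> 'a::{banach, second_countable_topology}) \<Rightarrow> 'a" where
 "circle_mean g = (1 / (2 * pi)) *\<^sub>R (LBINT t:{-pi..pi}. g t)"

lemma set_integrable_circle:
 fixes g :: "real \<Rightarrow> 'a::{banach, second_countable_topology}"
 assumes "continuous_on UNIV g"
 shows "set_integrable lborel {-pi..pi} g"
 by (intro borel_integrable_atLeastAtMost' continuous_on_subset[OF assms]) auto

lemma circle_mean_cos_int: "circle_mean (\<lambda>t. cos (real_of_int k * t)) = (if k = 0 then 1 else 0)"
proof (cases "k = 0")
 case True
 thus ?thesis by (simp add: circle_mean_def set_lebesgue_integral_def)
next
 case False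
 have "((\<lambda>t. cos (real_of_int k * t)) has_integral (sin (real_of_int k * pi) / k - sin (real_of_int k * - pi) / k)) {-pi..pi}"
  using False by (intro fundamental_theorem_of_calculus)
   (auto intro!: derivative_eq_intros simp: has_real_derivative_iff_has_vector_derivative[symmetric])
 moreover have "sin (real_of_int k * pi) = 0" by (simp add: sin_zero_iff_int2)
 ultimately have "integral {-pi..pi} (\<lambda>t. cos (real_of_int k * t)) = 0" by (simp add: integral_unique)
 moreover have "(LBINT t:{-pi..pi}. cos (real_of_int k * t)) = integral {-pi..pi} (\<lambda>t. cos (real_of_int k * t))"
  by (intro set_borel_integral_eq_integral set_integrable_circle continuous_intros)
 ultimately show ?thesis using False by (simp add: circle_mean_def)
qed

lemma circle_mean_add:
 assumes "continuous_on UNIV f" "continuous_on UNIV g"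
 shows "circle_mean (\<lambda>t. f t + g t) = circle_mean f + circle_mean g"
 unfolding circle_mean_def
 by (subst set_integral_add(2)[OF set_integrable_circle[OF assms(1)] set_integrable_circle[OF assms(2)]])
   (simp add: scaleR_add_right)

lemma circle_mean_mult_left: "circle_mean (\<lambda>t. c * f t) = c * circle_mean f" for c :: "'a :: {real_normed_field, banach, second_countable_topology}"
proof -
 have "(LBINT t:{-pi..pi}. c * f t) = c * (LBINT t:{-pi..pi}. f t)"
  unfolding set_lebesgue_integral_def mult_scaleR_right[symmetric] by (rule integral_mult_right_zero)
 thus ?thesis by (simp add: circle_mean_def)
qed

lemma circle_mean_sum:
 assumes "\<And>i. i \<in> I \<Longrightarrow> continuous_on UNIV (f i)"
 shows "circle_mean (\<lambda>t. \<Sum>i\<in>I. f i t) = (\<Sum>i\<in>I. circle_mean (f i))"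
 using assms
proof (induction I rule: infinite_finite_induct)
 case (insert i I)
 thus ?case by (simp add: circle_mean_add continuous_on_sum)
qed (simp_all add: circle_mean_def set_lebesgue_integral_def)

lemma norm_circle_mean_le:
 fixes g :: "real \<Rightarrow> 'a::{banach, second_countable_topology}"
 assumes "continuous_on UNIV g" "\<And>t. norm (g t) \<le> B"
 shows "norm (circle_mean g) \<le> B"
proof -
 have "norm (LBINT t:{-pi..pi}. g t) \<le> (\<integral>t. indicator {-pi..pi} t * B \<partial>lborel)"
  unfolding set_lebesgue_integral_def
 proof (rule norm_lebesgue_integral_le)
  show "integrable lborel (\<lambda>t. indicat_real {-pi..pi} t *\<^sub>R g t)"
   using set_integrable_circle[OF assms(1)] by (simp add: set_integrable_def)
  fix t show "norm (indicat_real {-pi..pi} t *\<^sub>R g t) \<le> indicator {-pi..pi} t * B"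
   using assms(2)[of t] by (auto simp: indicator_def)
 qed (auto intro!: integrable_real_mult_indicator)
 also have "\<dots> = 2 * pi * B" by simp
 finally show ?thesis by (simp add: circle_mean_def field_simps)
qed

text \<open>The recurrence coefficients at index n + i, divided by n, tend to 1/2. In the limit
  multiplication by x/n averages the two neighbours, just as multiplication by cos t does on the
  functions cos (k t).\<close>

lemma tendsto_mpr_monomial:
 "(\<lambda>n. \<integral>x. (x / real n) ^ m * (shifted_mpr i n x * shifted_mpr j n x) * sech_wt x \<partial>lborel)
   \<longlonglongrightarrow> circle_mean (\<lambda>t. cos t ^ m * cos (real_of_int (i - j) * t))"
proof (induction m arbitrary: i)
 case 0
 have ev: "\<forall>\<^sub>F n in sequentially. (\<integral>x. (x / real n) ^ 0 * (shifted_mpr i n x * shifted_mpr j n x) * sech_wt x \<partial>lborel)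
   = (if i - j = 0 then 1 else 0)"
  using eventually_ge_at_top[of "nat \<bar>i\<bar> + nat \<bar>j\<bar>"]
 proof eventually_elim
  case (elim n)
  hence "nat (int n + i) = nat (int n + j) \<longleftrightarrow> i = j" by linarith
  thus ?case by (simp add: shifted_mpr_def mpr_orthonormal)
 qed
 show ?case
  unfolding power_0 mult_1_left circle_mean_cos_int
  using ev by (intro tendsto_eventually) simp
next
 case (Suc m)
 let ?I = "\<lambda>m i n. \<integral>x. (x / real n) ^ m * (shifted_mpr i n x * shifted_mpr j n x) * sech_wt x \<partial>lborel"
 have int: "integrable lborel (\<lambda>x. (x / real n) ^ m * (shifted_mpr k n x * shifted_mpr l n x) * sech_wt x)" for n k l
  using integrable_mult_left[OF integrable_mpr[of m "nat (int n + k)" "nat (int n + l)"], of "1 / real n ^ m"]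
  by (simp add: shifted_mpr_def power_divide)
 have ev: "\<forall>\<^sub>F n in sequentially. (real n + i + 1) / (2 * real n) * ?I m (i + 1) n + (real n + i) / (2 * real n) * ?I m (i - 1) n = ?I (Suc m) i n"
  using eventually_ge_at_top[of "nat \<bar>i\<bar> + 1"]
 proof eventually_elim
  case (elim n)
  have e: "x / real n * shifted_mpr i n x = (real n + i + 1) / (2 * real n) * shifted_mpr (i + 1) n x + (real n + i) / (2 * real n) * shifted_mpr (i - 1) n x" for x
  proof -
   have 1: "Suc (nat (int n + i)) = nat (int n + (i + 1))" "nat (int n + i) - 1 = nat (int n + (i - 1))"
    "real (nat (int n + i)) = real n + i" using elim by (auto simp: nat_eq_iff)
   have "x * shifted_mpr i n x = (real n + i + 1) / 2 * shifted_mpr (i + 1) n x + (real n + i) / 2 * shifted_mpr (i - 1) n x"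
    using mpr_rec[of x "nat (int n + i)"] unfolding shifted_mpr_def 1 .
   moreover have "(u / 2 * A + v / 2 * B) / m = u / (2 * m) * A + v / (2 * m) * B" for u v A B m :: real
    by (simp add: add_divide_distrib)
   ultimately show ?thesis by (simp only: times_divide_eq_left[of x "real n"])
  qed
  have "?I (Suc m) i n = (\<integral>x. (real n + i + 1) / (2 * real n) * ((x / real n) ^ m * (shifted_mpr (i + 1) n x * shifted_mpr j n x) * sech_wt x) +
    (real n + i) / (2 * real n) * ((x / real n) ^ m * (shifted_mpr (i - 1) n x * shifted_mpr j n x) * sech_wt x) \<partial>lborel)"
  proof (intro Bochner_Integration.integral_cong refl)
   fix x
   have "(x / real n) ^ Suc m * (shifted_mpr i n x * shifted_mpr j n x) * sech_wt x =
    (x / real n) ^ m * ((x / real n * shifted_mpr i n x) * shifted_mpr j n x) * sech_wt x" by simp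
   thus "(x / real n) ^ Suc m * (shifted_mpr i n x * shifted_mpr j n x) * sech_wt x =
    (real n + i + 1) / (2 * real n) * ((x / real n) ^ m * (shifted_mpr (i + 1) n x * shifted_mpr j n x) * sech_wt x) +
    (real n + i) / (2 * real n) * ((x / real n) ^ m * (shifted_mpr (i - 1) n x * shifted_mpr j n x) * sech_wt x)"
    unfolding e by (simp add: algebra_simps)
  qed
  also have "\<dots> = (real n + i + 1) / (2 * real n) * ?I m (i + 1) n + (real n + i) / (2 * real n) * ?I m (i - 1) n"
   by (subst Bochner_Integration.integral_add) (intro integrable_mult_right int, intro integrable_mult_right int, simp only: integral_mult_right_zero)
  finally show ?case ..
 qed
 have l: "(\<lambda>n. (real n + i + 1) / (2 * real n)) \<longlonglongrightarrow> 1 / 2" "(\<lambda>n. (real n + i) / (2 * real n)) \<longlonglongrightarrow> 1 / 2"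
  by real_asymp+
 have "(\<lambda>n. (real n + i + 1) / (2 * real n) * ?I m (i + 1) n + (real n + i) / (2 * real n) * ?I m (i - 1) n) \<longlonglongrightarrow>
   1 / 2 * circle_mean (\<lambda>t. cos t ^ m * cos (real_of_int (i + 1 - j) * t)) + 1 / 2 * circle_mean (\<lambda>t. cos t ^ m * cos (real_of_int (i - 1 - j) * t))"
  by (intro tendsto_add tendsto_mult Suc.IH l)
 also have "1 / 2 * circle_mean (\<lambda>t. cos t ^ m * cos (real_of_int (i + 1 - j) * t)) + 1 / 2 * circle_mean (\<lambda>t. cos t ^ m * cos (real_of_int (i - 1 - j) * t))
   = circle_mean (\<lambda>t. 1 / 2 * (cos t ^ m * cos (real_of_int (i + 1 - j) * t)) + 1 / 2 * (cos t ^ m * cos (real_of_int (i - 1 - j) * t)))"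
  unfolding circle_mean_mult_left[symmetric] by (rule circle_mean_add[symmetric]) (intro continuous_intros)+
 also have "(\<lambda>t. 1 / 2 * (cos t ^ m * cos (real_of_int (i + 1 - j) * t)) + 1 / 2 * (cos t ^ m * cos (real_of_int (i - 1 - j) * t)))
   = (\<lambda>t. cos t ^ Suc m * cos (real_of_int (i - j) * t))"
 proof
  fix t :: real
  have "real_of_int (i + 1 - j) * t = real_of_int (i - j) * t + t" "real_of_int (i - 1 - j) * t = real_of_int (i - j) * t - t"
   by (simp_all add: algebra_simps)
  thus "1 / 2 * (cos t ^ m * cos (real_of_int (i + 1 - j) * t)) + 1 / 2 * (cos t ^ m * cos (real_of_int (i - 1 - j) * t))
   = cos t ^ Suc m * cos (real_of_int (i - j) * t)"
   by (simp only: cos_add cos_diff) (simp add: algebra_simps)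
 qed
 finally show ?case by (rule Lim_transform_eventually) (rule ev)
qed

text \<open>The sech weight lives on the whole line, so approximation on an interval is not enough.
  Outside [-2,2] the error is dominated by a high power of x^2/4; the limiting averages only see
  [-1,1], where that power contributes at most C (1/4)^L \<le> \<epsilon>.\<close>

lemma weierstrass_with_tail:
 fixes F :: "real \<Rightarrow> real"
 assumes F: "continuous_on UNIV F" "\<And>x. \<bar>F x\<bar> \<le> A * (1 + x^2)" and \<epsilon>: "\<epsilon> > 0"
 obtains a :: "nat \<Rightarrow> real" and N L :: nat and C :: real
  where "C \<ge> 0" "C * (1 / 4) ^ L \<le> \<epsilon>" "\<And>x. \<bar>x\<bar> \<le> 1 \<Longrightarrow> \<bar>F x - (\<Sum>i\<le>N. a i * x ^ i)\<bar> \<le> \<epsilon>"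
   "\<And>x. \<bar>F x - (\<Sum>i\<le>N. a i * x ^ i)\<bar> \<le> \<epsilon> + C * (x^2 / 4) ^ L"
proof -
 obtain g where g: "real_polynomial_function g" "\<And>x. x \<in> {-2..2} \<Longrightarrow> norm (F x - g x) < \<epsilon>"
  by (rule Stone_Weierstrass_real_polynomial_function[of "{-2..2::real}" F \<epsilon>])
    (use \<epsilon> continuous_on_subset[OF F(1) subset_UNIV] in \<open>auto simp: compact_Icc\<close>)
 obtain a N where gN: "g = (\<lambda>x. \<Sum>i\<le>N. a i * x ^ i)"
  using g(1) by (auto simp: real_polynomial_function_iff_sum)
 have A: "A \<ge> 0" using F(2)[of 0] by simp
 \<comment> \<open>Beyond 2 this power dominates both the approximating polynomial and the quadratic
   growth of \<open>F\<close>; \<open>L\<close> is later taken at least \<open>M\<close>.\<close>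
 define M where "M = N + 2"
 define C where "C = (2 * A + (\<Sum>i\<le>N. \<bar>a i\<bar>)) * 2 ^ M"
 have C: "C \<ge> 0" unfolding C_def using A by (intro mult_nonneg_nonneg add_nonneg_nonneg sum_nonneg) auto
 have "(\<lambda>L. C * (1 / 4) ^ L) \<longlonglongrightarrow> C * 0" by (intro tendsto_intros LIMSEQ_power_zero) auto
 hence "\<forall>\<^sub>F L in sequentially. C * (1 / 4) ^ L < \<epsilon>" using \<epsilon> by (intro order_tendstoD) auto
 then obtain L0 where L0: "\<And>L. L \<ge> L0 \<Longrightarrow> C * (1 / 4) ^ L < \<epsilon>" by (auto simp: eventually_sequentially)
 define L where "L = L0 + M"
 show ?thesis
 proof (rule that[where a = a and N = N and L = L and C = C])
  show "C * (1 / 4) ^ L \<le> \<epsilon>" using L0[of L] by (simp add: L_def)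
  show "\<bar>F x - (\<Sum>i\<le>N. a i * x ^ i)\<bar> \<le> \<epsilon>" if "\<bar>x\<bar> \<le> 1" for x
  proof -
   have "x \<in> {-2..2}" using that by auto
   from g(2)[OF this] show ?thesis by (simp add: gN)
  qed
  show "\<bar>F x - (\<Sum>i\<le>N. a i * x ^ i)\<bar> \<le> \<epsilon> + C * (x^2 / 4) ^ L" for x
  proof (cases "\<bar>x\<bar> \<le> 2")
   case True
   hence "x \<in> {-2..2}" by auto
   from g(2)[OF this] have "\<bar>F x - (\<Sum>i\<le>N. a i * x ^ i)\<bar> \<le> \<epsilon>" by (simp add: gN)
   moreover have "C * (x^2 / 4) ^ L \<ge> 0" using C by simp
   ultimately show ?thesis by linarith
  next
   case False
   hence x: "\<bar>x\<bar> > 2" by simp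
   have p: "\<bar>x\<bar> ^ i \<le> \<bar>x\<bar> ^ M" if "i \<le> M" for i using that x by (intro power_increasing) auto
   have "\<bar>\<Sum>i\<le>N. a i * x ^ i\<bar> \<le> (\<Sum>i\<le>N. \<bar>a i\<bar> * \<bar>x\<bar> ^ M)"
   proof (rule order_trans[OF sum_abs], rule sum_mono)
    fix i assume "i \<in> {..N}"
    hence "\<bar>x\<bar> ^ i \<le> \<bar>x\<bar> ^ M" by (intro p) (simp add: M_def)
    thus "\<bar>a i * x ^ i\<bar> \<le> \<bar>a i\<bar> * \<bar>x\<bar> ^ M"
     unfolding abs_mult power_abs by (intro mult_left_mono) auto
   qed
   moreover have "\<bar>F x\<bar> \<le> A * (\<bar>x\<bar> ^ M + \<bar>x\<bar> ^ M)"
   proof -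
    have "1 + x^2 \<le> \<bar>x\<bar> ^ M + \<bar>x\<bar> ^ M" using p[of 0] p[of 2] by (simp add: M_def)
    thus ?thesis using F(2)[of x] A by (meson mult_left_mono order_trans)
   qed
   ultimately have "\<bar>F x - (\<Sum>i\<le>N. a i * x ^ i)\<bar> \<le> (2 * A + (\<Sum>i\<le>N. \<bar>a i\<bar>)) * \<bar>x\<bar> ^ M"
    by (simp add: algebra_simps sum_distrib_left sum_distrib_right)
   also have "\<bar>x\<bar> ^ M = 2 ^ M * (\<bar>x\<bar> / 2) ^ M" by (simp add: power_divide)
   also have "(2 * A + (\<Sum>i\<le>N. \<bar>a i\<bar>)) * (2 ^ M * (\<bar>x\<bar> / 2) ^ M) = C * (\<bar>x\<bar> / 2) ^ M" by (simp add: C_def)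
   also have "\<dots> \<le> C * (\<bar>x\<bar> / 2) ^ (2 * L)"
    using x C by (intro mult_left_mono power_increasing) (auto simp: L_def)
   also have "(\<bar>x\<bar> / 2) ^ (2 * L) = (x^2 / 4) ^ L" by (simp add: power_mult power_divide)
   finally show ?thesis using \<epsilon> by linarith
  qed
 qed (rule C)
qed

lemma integrable_mpr_growth:
 assumes [measurable]: "F \<in> borel_measurable borel" and F: "\<And>x. \<bar>F x\<bar> \<le> A * (1 + x^2)"
 shows "integrable lborel (\<lambda>x. F (x / real n) * (mpr i x * mpr j x) * sech_wt x)"
proof (rule Bochner_Integration.integrable_bound)
 have "integrable lborel (\<lambda>x. A * ((x ^ 0 * (mpr k x * mpr k x) * sech_wt x) + 1 / (real n)^2 * (x ^ 2 * (mpr k x * mpr k x) * sech_wt x)))" for k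
  by (intro integrable_mult_right Bochner_Integration.integrable_add integrable_mpr)
 from Bochner_Integration.integrable_add[OF this[of i] this[of j]]
 show "integrable lborel (\<lambda>x. A * ((x ^ 0 * (mpr i x * mpr i x) * sech_wt x) + 1 / (real n)^2 * (x ^ 2 * (mpr i x * mpr i x) * sech_wt x)) +
   A * ((x ^ 0 * (mpr j x * mpr j x) * sech_wt x) + 1 / (real n)^2 * (x ^ 2 * (mpr j x * mpr j x) * sech_wt x)))" .
 show "AE x in lborel. norm (F (x / real n) * (mpr i x * mpr j x) * sech_wt x) \<le>
   norm (A * ((x ^ 0 * (mpr i x * mpr i x) * sech_wt x) + 1 / (real n)^2 * (x ^ 2 * (mpr i x * mpr i x) * sech_wt x)) +
   A * ((x ^ 0 * (mpr j x * mpr j x) * sech_wt x) + 1 / (real n)^2 * (x ^ 2 * (mpr j x * mpr j x) * sech_wt x)))"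
 proof (rule AE_I2)
  fix x :: real
  have A: "A \<ge> 0" using F[of 0] by simp
  have 1: "\<bar>mpr i x * mpr j x\<bar> \<le> mpr i x * mpr i x + mpr j x * mpr j x"
  proof -
   have "2 * \<bar>a\<bar> * \<bar>b\<bar> \<le> a * a + b * b" for a b :: real
    using sum_squares_bound[of "\<bar>a\<bar>" "\<bar>b\<bar>"] by (simp add: power2_eq_square)
   from this[of "mpr i x" "mpr j x"] mult_nonneg_nonneg[OF abs_ge_zero abs_ge_zero, of "mpr i x" "mpr j x"]
   show ?thesis unfolding abs_mult by linarith
  qed
  have "\<bar>F (x / real n)\<bar> * \<bar>mpr i x * mpr j x\<bar> * sech_wt x \<le> (A * (1 + (x / real n)^2)) * (mpr i x * mpr i x + mpr j x * mpr j x) * sech_wt x"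
   using F[of "x / real n"] 1 A less_imp_le[OF sech_wt_pos[of x]] by (intro mult_mono mult_right_mono) auto
  also have "\<dots> = A * ((x ^ 0 * (mpr i x * mpr i x) * sech_wt x) + 1 / (real n)^2 * (x ^ 2 * (mpr i x * mpr i x) * sech_wt x)) +
   A * ((x ^ 0 * (mpr j x * mpr j x) * sech_wt x) + 1 / (real n)^2 * (x ^ 2 * (mpr j x * mpr j x) * sech_wt x))"
   by (simp add: power_divide algebra_simps)
  finally show "norm (F (x / real n) * (mpr i x * mpr j x) * sech_wt x) \<le>
   norm (A * ((x ^ 0 * (mpr i x * mpr i x) * sech_wt x) + 1 / (real n)^2 * (x ^ 2 * (mpr i x * mpr i x) * sech_wt x)) +
   A * ((x ^ 0 * (mpr j x * mpr j x) * sech_wt x) + 1 / (real n)^2 * (x ^ 2 * (mpr j x * mpr j x) * sech_wt x)))"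
   using sech_wt_pos[of x] by (simp add: abs_mult)
 qed
qed measurable

text \<open>The product of two \<open>mpr\<close> is bounded by half the sum of their squares, so
  the approximation error is controlled by four monomial averages, collected in \<open>B\<close>,
  whose limits are known.\<close>

lemma tendsto_mpr_weak:
 fixes F :: "real \<Rightarrow> real"
 assumes F: "continuous_on UNIV F" "\<And>x. \<bar>F x\<bar> \<le> A * (1 + x^2)"
 shows "(\<lambda>n. \<integral>x. F (x / real n) * (shifted_mpr i n x * shifted_mpr j n x) * sech_wt x \<partial>lborel)
   \<longlonglongrightarrow> circle_mean (\<lambda>t. F (cos t) * cos (real_of_int (i - j) * t))"
proof (rule tendstoI)
 fix e :: real assume e: "e > 0"
 \<comment> \<open>Three parts for \<open>B\<close>, one for the polynomial average and one for the
   circle mean.\<close>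
 define \<epsilon> where "\<epsilon> = e / 6"
 have \<epsilon>: "\<epsilon> > 0" using e by (simp add: \<epsilon>_def)
 obtain a N L C where aC: "C \<ge> 0" "C * (1 / 4) ^ L \<le> \<epsilon>" "\<And>x. \<bar>x\<bar> \<le> 1 \<Longrightarrow> \<bar>F x - (\<Sum>i\<le>N. a i * x ^ i)\<bar> \<le> \<epsilon>"
   "\<And>x. \<bar>F x - (\<Sum>i\<le>N. a i * x ^ i)\<bar> \<le> \<epsilon> + C * (x^2 / 4) ^ L"
  by (rule weierstrass_with_tail[OF F \<epsilon>]) (rule that)
 let ?M = "\<lambda>m i j n. \<integral>x. (x / real n) ^ m * (shifted_mpr i n x * shifted_mpr j n x) * sech_wt x \<partial>lborel"
 let ?c = "\<lambda>m k. circle_mean (\<lambda>t. cos t ^ m * cos (real_of_int k * t))"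
 let ?p = "\<lambda>x. \<Sum>m\<le>N. a m * x ^ m"
 have [measurable]: "F \<in> borel_measurable borel" using F(1) by (rule borel_measurable_continuous_onI)
 have [measurable]: "shifted_mpr i n \<in> borel_measurable borel" for i n unfolding shifted_mpr_def by measurable
 have int: "integrable lborel (\<lambda>x. (x / real n) ^ m * (shifted_mpr k n x * shifted_mpr l n x) * sech_wt x)" for n k l m
  using integrable_mult_left[OF integrable_mpr[of m "nat (int n + k)" "nat (int n + l)"], of "1 / real n ^ m"]
  by (simp add: shifted_mpr_def power_divide)
 have intF: "integrable lborel (\<lambda>x. F (x / real n) * (shifted_mpr i n x * shifted_mpr j n x) * sech_wt x)" for n
  unfolding shifted_mpr_def by (rule integrable_mpr_growth[OF _ F(2)]) measurable
 define Ip where "Ip n = (\<Sum>m\<le>N. a m * ?M m i j n)" for n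
 define B where "B n = 1 / 2 * (\<epsilon> * (?M 0 i i n + ?M 0 j j n) + C * (1 / 4) ^ L * (?M (2 * L) i i n + ?M (2 * L) j j n))" for n
 have lim1: "Ip \<longlonglongrightarrow> (\<Sum>m\<le>N. a m * ?c m (i - j))"
  unfolding Ip_def by (intro tendsto_intros tendsto_mpr_monomial)
 have limB: "B \<longlonglongrightarrow> 1 / 2 * (\<epsilon> * (?c 0 (i - i) + ?c 0 (j - j)) + C * (1 / 4) ^ L * (?c (2 * L) (i - i) + ?c (2 * L) (j - j)))"
  unfolding B_def by (intro tendsto_intros tendsto_mpr_monomial)
 have c0: "?c 0 0 = 1" using circle_mean_cos_int[of 0] by simp
 have "\<bar>?c (2 * L) 0\<bar> \<le> 1"
  using norm_circle_mean_le[of "\<lambda>t. cos t ^ (2 * L) * cos (real_of_int 0 * t)" 1]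
  by (simp add: power_le_one abs_mult power_abs continuous_intros)
 hence "C * (1 / 4) ^ L * (?c (2 * L) 0 + ?c (2 * L) 0) \<le> \<epsilon> * (1 + 1)"
 proof -
  assume c: "\<bar>?c (2 * L) 0\<bar> \<le> 1"
  have "C * (1 / 4) ^ L * (?c (2 * L) 0 + ?c (2 * L) 0) \<le> C * (1 / 4) ^ L * (1 + 1)"
   using c aC(1) by (intro mult_left_mono add_mono) auto
  also have "\<dots> \<le> \<epsilon> * (1 + 1)" using aC(2) by (intro mult_right_mono) auto
  finally show ?thesis .
 qed
 hence "1 / 2 * (\<epsilon> * (?c 0 (i - i) + ?c 0 (j - j)) + C * (1 / 4) ^ L * (?c (2 * L) (i - i) + ?c (2 * L) (j - j))) < 3 * \<epsilon>"
  using \<epsilon> c0 by simp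
 hence evB: "\<forall>\<^sub>F n in sequentially. B n < 3 * \<epsilon>" using limB by (rule order_tendstoD(2)[rotated])
 have evp: "\<forall>\<^sub>F n in sequentially. dist (Ip n) (\<Sum>m\<le>N. a m * ?c m (i - j)) < \<epsilon>"
  using lim1 \<epsilon> by (rule tendstoD)
 have circ: "\<bar>circle_mean (\<lambda>t. F (cos t) * cos (real_of_int (i - j) * t)) - (\<Sum>m\<le>N. a m * ?c m (i - j))\<bar> \<le> \<epsilon>"
 proof -
  have cF: "continuous_on UNIV (\<lambda>t. F (cos t))"
   by (rule continuous_on_compose2[OF F(1)]) (auto intro!: continuous_intros)
  have "(\<Sum>m\<le>N. a m * ?c m (i - j)) = circle_mean (\<lambda>t. \<Sum>m\<le>N. a m * (cos t ^ m * cos (real_of_int (i - j) * t)))"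
   unfolding circle_mean_mult_left[symmetric] by (rule circle_mean_sum[symmetric]) (intro continuous_intros)
  moreover have "circle_mean (\<lambda>t. F (cos t) * cos (real_of_int (i - j) * t)) =
    circle_mean (\<lambda>t. (F (cos t) * cos (real_of_int (i - j) * t) - (\<Sum>m\<le>N. a m * (cos t ^ m * cos (real_of_int (i - j) * t)))) +
     (\<Sum>m\<le>N. a m * (cos t ^ m * cos (real_of_int (i - j) * t))))" by simp
  moreover have "\<dots> = circle_mean (\<lambda>t. (F (cos t) * cos (real_of_int (i - j) * t) - (\<Sum>m\<le>N. a m * (cos t ^ m * cos (real_of_int (i - j) * t))))) +
    circle_mean (\<lambda>t. \<Sum>m\<le>N. a m * (cos t ^ m * cos (real_of_int (i - j) * t)))"
   by (rule circle_mean_add) (intro continuous_intros cF)+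
  moreover have "norm (circle_mean (\<lambda>t. (F (cos t) * cos (real_of_int (i - j) * t) - (\<Sum>m\<le>N. a m * (cos t ^ m * cos (real_of_int (i - j) * t)))))) \<le> \<epsilon>"
  proof (rule norm_circle_mean_le)
   show "continuous_on UNIV (\<lambda>t. F (cos t) * cos (real_of_int (i - j) * t) - (\<Sum>m\<le>N. a m * (cos t ^ m * cos (real_of_int (i - j) * t))))"
    by (intro continuous_intros cF)
   fix t :: real
   have "F (cos t) * cos (real_of_int (i - j) * t) - (\<Sum>m\<le>N. a m * (cos t ^ m * cos (real_of_int (i - j) * t)))
     = (F (cos t) - ?p (cos t)) * cos (real_of_int (i - j) * t)"
    by (simp add: left_diff_distrib sum_distrib_right mult.assoc)
   moreover have "\<bar>F (cos t) - ?p (cos t)\<bar> * \<bar>cos (real_of_int (i - j) * t)\<bar> \<le> \<epsilon> * 1"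
    by (intro mult_mono aC(3)) (use \<epsilon> in auto)
   ultimately show "norm (F (cos t) * cos (real_of_int (i - j) * t) - (\<Sum>m\<le>N. a m * (cos t ^ m * cos (real_of_int (i - j) * t)))) \<le> \<epsilon>"
    by (simp add: abs_mult)
  qed
  ultimately show ?thesis by simp
 qed
 have bound: "\<bar>(\<integral>x. F (x / real n) * (shifted_mpr i n x * shifted_mpr j n x) * sech_wt x \<partial>lborel) - Ip n\<bar> \<le> B n" for n
 proof -
  let ?S = "\<lambda>x. shifted_mpr i n x" and ?T = "\<lambda>x. shifted_mpr j n x"
  have Ip: "Ip n = (\<integral>x. (\<Sum>m\<le>N. a m * ((x / real n) ^ m * (?S x * ?T x) * sech_wt x)) \<partial>lborel)"
   unfolding Ip_def by (subst Bochner_Integration.integral_sum) (intro integrable_mult_right int, simp)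
  have Bn: "B n = (\<integral>x. 1 / 2 * (\<epsilon> * ((x / real n) ^ 0 * (?S x * ?S x) * sech_wt x + (x / real n) ^ 0 * (?T x * ?T x) * sech_wt x) +
    C * (1 / 4) ^ L * ((x / real n) ^ (2 * L) * (?S x * ?S x) * sech_wt x + (x / real n) ^ (2 * L) * (?T x * ?T x) * sech_wt x)) \<partial>lborel)"
   unfolding B_def
   by (subst integral_mult_right_zero, subst Bochner_Integration.integral_add,
     (intro integrable_mult_right Bochner_Integration.integrable_add int)+,
     subst (1 2) integral_mult_right_zero, subst (1 2) Bochner_Integration.integral_add, (rule int)+) simp
  have "(\<integral>x. F (x / real n) * (?S x * ?T x) * sech_wt x \<partial>lborel) - Ip n =
   (\<integral>x. F (x / real n) * (?S x * ?T x) * sech_wt x - (\<Sum>m\<le>N. a m * ((x / real n) ^ m * (?S x * ?T x) * sech_wt x)) \<partial>lborel)"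
   unfolding Ip by (rule Bochner_Integration.integral_diff[symmetric, OF intF]) (intro Bochner_Integration.integrable_sum integrable_mult_right int)
  moreover have "norm (\<integral>x. F (x / real n) * (?S x * ?T x) * sech_wt x - (\<Sum>m\<le>N. a m * ((x / real n) ^ m * (?S x * ?T x) * sech_wt x)) \<partial>lborel) \<le> B n"
   unfolding Bn
  proof (rule norm_lebesgue_integral_le)
   fix x :: real
   define y where "y = x / real n"
   have st: "\<bar>?S x * ?T x\<bar> \<le> 1 / 2 * (?S x * ?S x + ?T x * ?T x)"
   proof -
    have "\<bar>a\<bar> * \<bar>b\<bar> \<le> 1 / 2 * (a * a + b * b)" for a b :: real
     using sum_squares_bound[of "\<bar>a\<bar>" "\<bar>b\<bar>"] by (simp add: power2_eq_square)
    from this[of "?S x" "?T x"] show ?thesis unfolding abs_mult .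
   qed
   have "F y * (?S x * ?T x) * sech_wt x - (\<Sum>m\<le>N. a m * (y ^ m * (?S x * ?T x) * sech_wt x)) = (F y - ?p y) * (?S x * ?T x) * sech_wt x"
    by (simp add: left_diff_distrib sum_distrib_right mult.assoc)
   hence "norm (F y * (?S x * ?T x) * sech_wt x - (\<Sum>m\<le>N. a m * (y ^ m * (?S x * ?T x) * sech_wt x))) = \<bar>F y - ?p y\<bar> * \<bar>?S x * ?T x\<bar> * sech_wt x"
    using sech_wt_pos[of x] by (simp add: abs_mult)
   also have "\<dots> \<le> (\<epsilon> + C * (y^2 / 4) ^ L) * (1 / 2 * (?S x * ?S x + ?T x * ?T x)) * sech_wt x"
    using aC(1) \<epsilon> less_imp_le[OF sech_wt_pos[of x]] by (intro mult_right_mono mult_mono aC(4) st) auto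
   also have "(y^2 / 4) ^ L = (1 / 4) ^ L * y ^ (2 * L)"
    by (simp add: power_divide power_mult)
   also have "(\<epsilon> + C * ((1 / 4) ^ L * y ^ (2 * L))) * (1 / 2 * (?S x * ?S x + ?T x * ?T x)) * sech_wt x =
     1 / 2 * (\<epsilon> * (y ^ 0 * (?S x * ?S x) * sech_wt x + y ^ 0 * (?T x * ?T x) * sech_wt x) +
     C * (1 / 4) ^ L * (y ^ (2 * L) * (?S x * ?S x) * sech_wt x + y ^ (2 * L) * (?T x * ?T x) * sech_wt x))"
    by (simp add: algebra_simps)
   finally show "norm (F (x / real n) * (?S x * ?T x) * sech_wt x - (\<Sum>m\<le>N. a m * ((x / real n) ^ m * (?S x * ?T x) * sech_wt x))) \<le>
     1 / 2 * (\<epsilon> * ((x / real n) ^ 0 * (?S x * ?S x) * sech_wt x + (x / real n) ^ 0 * (?T x * ?T x) * sech_wt x) +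
     C * (1 / 4) ^ L * ((x / real n) ^ (2 * L) * (?S x * ?S x) * sech_wt x + (x / real n) ^ (2 * L) * (?T x * ?T x) * sech_wt x))"
    unfolding y_def .
  qed (intro Bochner_Integration.integrable_diff intF Bochner_Integration.integrable_sum integrable_mult_right Bochner_Integration.integrable_add int)+
  ultimately show ?thesis by simp
 qed
 show "\<forall>\<^sub>F n in sequentially. dist (\<integral>x. F (x / real n) * (shifted_mpr i n x * shifted_mpr j n x) * sech_wt x \<partial>lborel)
   (circle_mean (\<lambda>t. F (cos t) * cos (real_of_int (i - j) * t))) < e"
  using evB evp
 proof eventually_elim
  case (elim n)
  thus ?case using bound[of n] circ unfolding dist_real_def \<epsilon>_def by linarith
 qed
qed

lemma circle_mean_odd:
 fixes g :: "real \<Rightarrow> real"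
 assumes "\<And>t. g (- t) = - g t"
 shows "circle_mean g = 0"
proof -
 have "(LBINT t:{-pi..pi}. g t) = (\<integral>t. indicator {-pi..pi} (0 + - 1 * t) *\<^sub>R g (0 + - 1 * t) \<partial>lborel)"
  unfolding set_lebesgue_integral_def by (subst lborel_integral_real_affine[of "-1" _ 0]) auto
 also have "\<dots> = (\<integral>t. - (indicator {-pi..pi} t *\<^sub>R g t) \<partial>lborel)"
  by (intro Bochner_Integration.integral_cong) (auto simp: assms indicator_def)
 also have "\<dots> = - (LBINT t:{-pi..pi}. g t)" by (simp add: set_lebesgue_integral_def)
 finally show ?thesis by (simp add: circle_mean_def)
qed

lemma circle_mean_of_real: "circle_mean (\<lambda>t. cr (g t)) = cr (circle_mean g)"
proof -
 have "(\<lambda>t. indicat_real {-pi..pi} t *\<^sub>R cr (g t)) = (\<lambda>t. cr (indicat_real {-pi..pi} t *\<^sub>R g t))"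
  by (simp add: scaleR_conv_of_real)
 hence "(LBINT t:{-pi..pi}. cr (g t)) = cr (LBINT t:{-pi..pi}. g t)"
  unfolding set_lebesgue_integral_def by (simp only: integral_complex_of_real)
 thus ?thesis by (simp add: circle_mean_def scaleR_conv_of_real)
qed

lemma circle_mean_Re:
 assumes "continuous_on UNIV g"
 shows "circle_mean (\<lambda>t. Re (g t)) = Re (circle_mean g)"
proof -
 have "(\<integral>t. Re (indicat_real {-pi..pi} t *\<^sub>R g t) \<partial>lborel) = Re (\<integral>t. indicat_real {-pi..pi} t *\<^sub>R g t \<partial>lborel)"
  using set_integrable_circle[OF assms] by (intro integral_Re) (simp add: set_integrable_def)
 thus ?thesis by (simp add: circle_mean_def set_lebesgue_integral_def)
qed

definition combo :: "(int \<Rightarrow> complex) \<Rightarrow> int set \<Rightarrow> nat \<Rightarrow> real \<Rightarrow> complex" where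
 "combo X S n x = (\<Sum>k\<in>S. X k * cr (shifted_mpr k n x))"

text \<open>The symbol of a combination: the offset \<open>k\<close> becomes
  \<open>cis (k * t)\<close>. Limits of sesquilinear averages of combinations are circle means of
  products of symbols (\<open>tendsto_combo\<close>).\<close>

definition combo_hat :: "(int \<Rightarrow> complex) \<Rightarrow> int set \<Rightarrow> real \<Rightarrow> complex" where
 "combo_hat X S t = (\<Sum>k\<in>S. X k * cis (real_of_int k * t))"

lemma continuous_combo_hat [continuous_intros]: "continuous_on A (combo_hat X S)"
 unfolding combo_hat_def[abs_def] by (intro continuous_intros)

lemma combo_measurable [measurable]: "combo X S n \<in> borel_measurable borel"
 unfolding combo_def[abs_def] shifted_mpr_def by measurable

text \<open>\<open>F (cos t)\<close> is even, so the sine part averages to 0; this lets the limits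
  of \<open>tendsto_mpr_weak\<close> be written with exponentials and factor into symbols.\<close>

lemma circle_mean_cis:
 assumes "continuous_on UNIV F"
 shows "circle_mean (\<lambda>t. cr (F (cos t)) * cis (real_of_int k * t)) =
   cr (circle_mean (\<lambda>t. F (cos t) * cos (real_of_int k * t)))"
proof -
 have cF: "continuous_on UNIV (\<lambda>t. F (cos t))"
  by (rule continuous_on_compose2[OF assms]) (auto intro!: continuous_intros)
 have "(\<lambda>t. cr (F (cos t)) * cis (real_of_int k * t)) =
   (\<lambda>t. cr (F (cos t) * cos (real_of_int k * t)) + \<i> * cr (F (cos t) * sin (real_of_int k * t)))"
  by (auto simp: fun_eq_iff complex_eq_iff)
 hence "circle_mean (\<lambda>t. cr (F (cos t)) * cis (real_of_int k * t)) =
   circle_mean (\<lambda>t. cr (F (cos t) * cos (real_of_int k * t))) + \<i> * circle_mean (\<lambda>t. cr (F (cos t) * sin (real_of_int k * t)))"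
  by (simp only: circle_mean_mult_left[symmetric])
    (rule circle_mean_add, (intro continuous_intros cF)+)
 also have "circle_mean (\<lambda>t. cr (F (cos t) * sin (real_of_int k * t))) = 0"
  unfolding circle_mean_of_real by (subst circle_mean_odd) auto
 finally show ?thesis by (simp only: circle_mean_of_real) simp
qed

lemma integrable_combo:
 assumes [measurable]: "F \<in> borel_measurable borel" and F: "\<And>x. \<bar>F x\<bar> \<le> A * (1 + x^2)"
 shows "integrable lborel (\<lambda>x. cr (F (x / real n)) * (combo X S n x * cnj (combo Y T n x)) * cr (sech_wt x))"
  and "(\<integral>x. cr (F (x / real n)) * (combo X S n x * cnj (combo Y T n x)) * cr (sech_wt x) \<partial>lborel) =
   (\<Sum>k\<in>S. \<Sum>l\<in>T. X k * cnj (Y l) * cr (\<integral>x. F (x / real n) * (shifted_mpr k n x * shifted_mpr l n x) * sech_wt x \<partial>lborel))"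
proof -
 have pr: "combo X S n x * cnj (combo Y T n x) =
   (\<Sum>k\<in>S. \<Sum>l\<in>T. (X k * cr (shifted_mpr k n x)) * cnj (Y l * cr (shifted_mpr l n x)))" for x
  unfolding combo_def cnj_sum by (rule sum_product)
 have e: "cr (F (x / real n)) * (combo X S n x * cnj (combo Y T n x)) * cr (sech_wt x) =
   (\<Sum>k\<in>S. \<Sum>l\<in>T. X k * cnj (Y l) * cr (F (x / real n) * (shifted_mpr k n x * shifted_mpr l n x) * sech_wt x))" for x
  unfolding pr sum_distrib_left sum_distrib_right
  by (intro sum.cong refl) (simp add: mult_ac)
 have int: "integrable lborel (\<lambda>x. X k * cnj (Y l) * cr (F (x / real n) * (shifted_mpr k n x * shifted_mpr l n x) * sech_wt x))" for k l
  unfolding shifted_mpr_def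
  by (intro integrable_mult_right integrable_of_real integrable_mpr_growth[OF _ F]) measurable
 show "integrable lborel (\<lambda>x. cr (F (x / real n)) * (combo X S n x * cnj (combo Y T n x)) * cr (sech_wt x))"
  unfolding e by (intro Bochner_Integration.integrable_sum int)
 show "(\<integral>x. cr (F (x / real n)) * (combo X S n x * cnj (combo Y T n x)) * cr (sech_wt x) \<partial>lborel) =
   (\<Sum>k\<in>S. \<Sum>l\<in>T. X k * cnj (Y l) * cr (\<integral>x. F (x / real n) * (shifted_mpr k n x * shifted_mpr l n x) * sech_wt x \<partial>lborel))"
  unfolding e using int
  by (subst Bochner_Integration.integral_sum, (intro Bochner_Integration.integrable_sum int)+)
    (intro sum.cong refl, subst Bochner_Integration.integral_sum, (rule int)+, simp only: integral_mult_right_zero integral_complex_of_real)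
qed

lemma tendsto_combo:
 assumes F: "continuous_on UNIV F" "\<And>x. \<bar>F x\<bar> \<le> A * (1 + x^2)"
 shows "(\<lambda>n. \<integral>x. cr (F (x / real n)) * (combo X S n x * cnj (combo Y T n x)) * cr (sech_wt x) \<partial>lborel)
  \<longlonglongrightarrow> circle_mean (\<lambda>t. cr (F (cos t)) * (combo_hat X S t * cnj (combo_hat Y T t)))"
proof -
 have m: "F \<in> borel_measurable borel" using F(1) by (rule borel_measurable_continuous_onI)
 have cF: "continuous_on UNIV (\<lambda>t. F (cos t))"
  by (rule continuous_on_compose2[OF F(1)]) (auto intro!: continuous_intros)
 have e: "cr (F (cos t)) * (combo_hat X S t * cnj (combo_hat Y T t)) =
   (\<Sum>k\<in>S. \<Sum>l\<in>T. X k * cnj (Y l) * (cr (F (cos t)) * cis (real_of_int (k - l) * t)))" for t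
 proof -
  have "cis (real_of_int (k - l) * t) = cis (real_of_int k * t) * cis (- (real_of_int l * t))" for k l
   by (simp add: cis_mult left_diff_distrib)
  moreover have "combo_hat X S t * cnj (combo_hat Y T t) =
    (\<Sum>k\<in>S. \<Sum>l\<in>T. (X k * cis (real_of_int k * t)) * cnj (Y l * cis (real_of_int l * t)))"
   unfolding combo_hat_def cnj_sum by (rule sum_product)
  ultimately show ?thesis
   by (simp only: sum_distrib_left) (intro sum.cong refl, simp add: cis_cnj mult_ac)
 qed
 have "circle_mean (\<lambda>t. cr (F (cos t)) * (combo_hat X S t * cnj (combo_hat Y T t))) =
   (\<Sum>k\<in>S. \<Sum>l\<in>T. X k * cnj (Y l) * circle_mean (\<lambda>t. cr (F (cos t)) * cis (real_of_int (k - l) * t)))"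
  unfolding e
  by (subst circle_mean_sum, (intro continuous_intros cF)+, intro sum.cong refl, subst circle_mean_sum,
    (intro continuous_intros cF)+, simp only: circle_mean_mult_left)
 also have "\<dots> = (\<Sum>k\<in>S. \<Sum>l\<in>T. X k * cnj (Y l) * cr (circle_mean (\<lambda>t. F (cos t) * cos (real_of_int (k - l) * t))))"
  unfolding circle_mean_cis[OF F(1)] ..
 finally have c: "circle_mean (\<lambda>t. cr (F (cos t)) * (combo_hat X S t * cnj (combo_hat Y T t))) = \<dots>" .
 show ?thesis unfolding c integrable_combo(2)[OF m F(2)]
  by (intro tendsto_intros tendsto_mpr_weak[OF F])
qed

lemma combo_norm_integral:
 assumes [measurable]: "F \<in> borel_measurable borel" and F: "\<And>x. \<bar>F x\<bar> \<le> A * (1 + x^2)"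
 shows "integrable lborel (\<lambda>x. F (x / real n) * (cmod (combo X S n x))^2 * sech_wt x)"
  and "(\<integral>x. F (x / real n) * (cmod (combo X S n x))^2 * sech_wt x \<partial>lborel) =
   Re (\<integral>x. cr (F (x / real n)) * (combo X S n x * cnj (combo X S n x)) * cr (sech_wt x) \<partial>lborel)"
proof -
 have pr: "combo X S n x * cnj (combo Y T n x) =
   (\<Sum>k\<in>S. \<Sum>l\<in>T. (X k * cr (shifted_mpr k n x)) * cnj (Y l * cr (shifted_mpr l n x)))" for x
  unfolding combo_def cnj_sum by (rule sum_product)
 have e: "cr (F (x / real n)) * (combo X S n x * cnj (combo X S n x)) * cr (sech_wt x) =
   cr (F (x / real n) * (cmod (combo X S n x))^2 * sech_wt x)" for x
  by (simp add: complex_norm_square del: of_real_power) 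
 show "integrable lborel (\<lambda>x. F (x / real n) * (cmod (combo X S n x))^2 * sech_wt x)"
  using integrable_Re[OF integrable_combo(1)[OF assms, of n X S X S]] unfolding e by simp
 show "(\<integral>x. F (x / real n) * (cmod (combo X S n x))^2 * sech_wt x \<partial>lborel) =
   Re (\<integral>x. cr (F (x / real n)) * (combo X S n x * cnj (combo X S n x)) * cr (sech_wt x) \<partial>lborel)"
  unfolding e integral_complex_of_real by simp
qed

lemma tendsto_combo_norm:
 assumes F: "continuous_on UNIV F" "\<And>x. \<bar>F x\<bar> \<le> A * (1 + x^2)"
 shows "(\<lambda>n. \<integral>x. F (x / real n) * (cmod (combo X S n x))^2 * sech_wt x \<partial>lborel)
  \<longlonglongrightarrow> circle_mean (\<lambda>t. F (cos t) * (cmod (combo_hat X S t))^2)"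
proof -
 have m: "F \<in> borel_measurable borel" using F(1) by (rule borel_measurable_continuous_onI)
 have cF: "continuous_on UNIV (\<lambda>t. F (cos t))"
  by (rule continuous_on_compose2[OF F(1)]) (auto intro!: continuous_intros)
 have "circle_mean (\<lambda>t. F (cos t) * (cmod (combo_hat X S t))^2) =
   Re (circle_mean (\<lambda>t. cr (F (cos t)) * (combo_hat X S t * cnj (combo_hat X S t))))"
  by (subst circle_mean_Re[symmetric]) (auto intro!: continuous_intros cF simp: complex_norm_square[symmetric] simp del: of_real_power)
 thus ?thesis unfolding combo_norm_integral(2)[OF m F(2)]
  by (simp only:) (rule tendsto_Re[OF tendsto_combo[where A = A, OF F]])
qed

text \<open>The factor \<open>r\<close> is taken at \<open>x\<close>, not at \<open>x / n\<close>,
  and is close to 1 only far out. Homogeneity of \<open>F\<close> moves the scale into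
  \<open>c n\<close>, so the bounded region where \<open>r\<close> is not close to 1 contributes at
  most a multiple of \<open>c n\<close>. Condition \<open>rK\<close> weights \<open>r - 1\<close> by
  \<open>F\<close>, which admits an \<open>r\<close> that is unbounded near a zero of
  \<open>F\<close>.\<close>

lemma tendsto_combo_perturbed:
 assumes F: "continuous_on UNIV F" "\<And>x. F x \<ge> 0" "\<And>x. F x \<le> A * (1 + x^2)"
  and sc: "\<And>n x. n > 0 \<Longrightarrow> F (x / real n) = F x * c n" "c \<longlonglongrightarrow> 0" "\<And>n. c n \<ge> 0"
  and r [measurable]: "r \<in> borel_measurable borel"
  and rK: "\<And>\<eta>. \<eta> > 0 \<Longrightarrow> \<exists>K. \<forall>x. F x * \<bar>r x - 1\<bar> \<le> \<eta> * F x + K"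
 shows "\<And>n. n > 0 \<Longrightarrow> integrable lborel (\<lambda>x. F (x / real n) * r x * (cmod (combo X S n x))^2 * sech_wt x)"
  and "(\<lambda>n. \<integral>x. F (x / real n) * r x * (cmod (combo X S n x))^2 * sech_wt x \<partial>lborel)
  \<longlonglongrightarrow> circle_mean (\<lambda>t. F (cos t) * (cmod (combo_hat X S t))^2)"
proof -
 have [measurable]: "F \<in> borel_measurable borel" using F(1) by (rule borel_measurable_continuous_onI)
 have Fa: "\<bar>F x\<bar> \<le> A * (1 + x^2)" for x using F(2,3)[of x] by simp
 let ?N = "\<lambda>n x. (cmod (combo X S n x))^2 * sech_wt x"
 let ?I = "\<lambda>n. \<integral>x. F (x / real n) * (cmod (combo X S n x))^2 * sech_wt x \<partial>lborel"
 let ?J = "\<lambda>n. \<integral>x. F (x / real n) * r x * (cmod (combo X S n x))^2 * sech_wt x \<partial>lborel"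
 let ?U = "\<lambda>n. \<integral>x. 1 * (cmod (combo X S n x))^2 * sech_wt x \<partial>lborel"
 have N0: "?N n x \<ge> 0" for n x using less_imp_le[OF sech_wt_pos[of x]] by simp
 have intF: "integrable lborel (\<lambda>x. F (x / real n) * (cmod (combo X S n x))^2 * sech_wt x)" for n
  by (rule combo_norm_integral(1)[OF _ Fa]) measurable
 have int1: "integrable lborel (\<lambda>x. 1 * (cmod (combo X S n x))^2 * sech_wt x)" for n
  by (rule combo_norm_integral(1)[where F = "\<lambda>_. 1" and A = 1]) auto
 have pw: "\<bar>F (x / real n) * (r x - 1) * (cmod (combo X S n x))^2 * sech_wt x\<bar> \<le>
   \<eta> * (F (x / real n) * (cmod (combo X S n x))^2 * sech_wt x) + K * c n * (1 * (cmod (combo X S n x))^2 * sech_wt x)"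
  if n: "n > 0" and K: "\<forall>x. F x * \<bar>r x - 1\<bar> \<le> \<eta> * F x + K" for n x \<eta> K
 proof -
  have "\<bar>F (x / real n) * (r x - 1) * (cmod (combo X S n x))^2 * sech_wt x\<bar> = (F x * \<bar>r x - 1\<bar>) * (c n * ?N n x)"
   using F(2)[of x] sc(3)[of n] N0[of n x] sech_wt_pos[of x] by (simp add: sc(1)[OF n] abs_mult)
  also have "\<dots> \<le> (\<eta> * F x + K) * (c n * ?N n x)"
   using K sc(3)[of n] N0[of n x] by (intro mult_right_mono) auto
  also have "\<dots> = \<eta> * (F (x / real n) * (cmod (combo X S n x))^2 * sech_wt x) + K * c n * (1 * (cmod (combo X S n x))^2 * sech_wt x)"
   by (simp add: sc(1)[OF n] algebra_simps)
  finally show ?thesis .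
 qed
 have intd: "integrable lborel (\<lambda>x. F (x / real n) * (r x - 1) * (cmod (combo X S n x))^2 * sech_wt x)" if n: "n > 0" for n
 proof -
  obtain K where K: "\<forall>x. F x * \<bar>r x - 1\<bar> \<le> 1 * F x + K" using rK[of 1] by auto
  show ?thesis
  proof (rule Bochner_Integration.integrable_bound)
   show "integrable lborel (\<lambda>x. 1 * (F (x / real n) * (cmod (combo X S n x))^2 * sech_wt x) + K * c n * (1 * (cmod (combo X S n x))^2 * sech_wt x))"
    by (intro Bochner_Integration.integrable_add integrable_mult_right intF int1)
   show "AE x in lborel. norm (F (x / real n) * (r x - 1) * (cmod (combo X S n x))^2 * sech_wt x) \<le>
    norm (1 * (F (x / real n) * (cmod (combo X S n x))^2 * sech_wt x) + K * c n * (1 * (cmod (combo X S n x))^2 * sech_wt x))"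
    using pw[OF n K] by (intro AE_I2) (simp only: real_norm_def, meson abs_ge_self order_trans)
  qed measurable
 qed
 have split: "F (x / real n) * r x * (cmod (combo X S n x))^2 * sech_wt x =
   F (x / real n) * (cmod (combo X S n x))^2 * sech_wt x + F (x / real n) * (r x - 1) * (cmod (combo X S n x))^2 * sech_wt x" for n x
  by (simp add: algebra_simps)
 show int: "integrable lborel (\<lambda>x. F (x / real n) * r x * (cmod (combo X S n x))^2 * sech_wt x)" if "n > 0" for n
  unfolding split by (intro Bochner_Integration.integrable_add intF intd that)
 have limI: "?I \<longlonglongrightarrow> circle_mean (\<lambda>t. F (cos t) * (cmod (combo_hat X S t))^2)"
  by (rule tendsto_combo_norm[OF F(1) Fa])
 have limU: "?U \<longlonglongrightarrow> circle_mean (\<lambda>t. 1 * (cmod (combo_hat X S t))^2)"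
  by (rule tendsto_combo_norm[where A = 1]) auto
 have "(\<lambda>n. ?J n - ?I n) \<longlonglongrightarrow> 0"
 proof (rule tendstoI)
  fix e :: real assume e: "e > 0"
  define L where "L = circle_mean (\<lambda>t. F (cos t) * (cmod (combo_hat X S t))^2)"
  define \<eta> where "\<eta> = e / (2 * (\<bar>L\<bar> + 1))"
  have \<eta>: "\<eta> > 0" using e by (simp add: \<eta>_def)
  obtain K where K: "\<forall>x. F x * \<bar>r x - 1\<bar> \<le> \<eta> * F x + K" using rK[OF \<eta>] by auto
  have "(\<lambda>n. \<eta> * ?I n + K * c n * ?U n) \<longlonglongrightarrow> \<eta> * L + K * 0 * circle_mean (\<lambda>t. 1 * (cmod (combo_hat X S t))^2)"
   unfolding L_def by (intro tendsto_intros limI limU sc(2))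
  moreover have "\<eta> * L \<le> e / 2"
  proof -
   have "\<eta> * L \<le> \<eta> * (\<bar>L\<bar> + 1)" using \<eta> by (intro mult_left_mono) auto
   also have "\<dots> = e / 2" by (simp add: \<eta>_def field_simps)
   finally show ?thesis .
  qed
  hence "\<eta> * L + K * 0 * circle_mean (\<lambda>t. 1 * (cmod (combo_hat X S t))^2) < e" using e by simp
  ultimately have "\<forall>\<^sub>F n in sequentially. \<eta> * ?I n + K * c n * ?U n < e" by (rule order_tendstoD(2))
  thus "\<forall>\<^sub>F n in sequentially. dist (?J n - ?I n) 0 < e"
   using eventually_gt_at_top[of 0]
  proof eventually_elim
   case (elim n)
   have 1: "?J n - ?I n = (\<integral>x. F (x / real n) * (r x - 1) * (cmod (combo X S n x))^2 * sech_wt x \<partial>lborel)"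
    unfolding split by (subst Bochner_Integration.integral_add[OF intF intd]) (use elim in auto)
   have "norm (\<integral>x. F (x / real n) * (r x - 1) * (cmod (combo X S n x))^2 * sech_wt x \<partial>lborel) \<le> (\<integral>x. \<eta> * (F (x / real n) * (cmod (combo X S n x))^2 * sech_wt x) + K * c n * (1 * (cmod (combo X S n x))^2 * sech_wt x) \<partial>lborel)"
   proof (rule norm_lebesgue_integral_le)
    show "integrable lborel (\<lambda>x. F (x / real n) * (r x - 1) * (cmod (combo X S n x))^2 * sech_wt x)"
     using elim by (intro intd) simp
    show "integrable lborel (\<lambda>x. \<eta> * (F (x / real n) * (cmod (combo X S n x))^2 * sech_wt x) + K * c n * (1 * (cmod (combo X S n x))^2 * sech_wt x))"
     by (intro Bochner_Integration.integrable_add integrable_mult_right intF int1)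
    show "norm (F (x / real n) * (r x - 1) * (cmod (combo X S n x))^2 * sech_wt x) \<le>
      \<eta> * (F (x / real n) * (cmod (combo X S n x))^2 * sech_wt x) + K * c n * (1 * (cmod (combo X S n x))^2 * sech_wt x)" for x
     unfolding real_norm_def using pw[OF _ K] elim by blast
   qed
   also have "\<dots> = \<eta> * ?I n + K * c n * ?U n"
    by (subst Bochner_Integration.integral_add) (intro integrable_mult_right intF int1, intro integrable_mult_right intF int1, simp only: integral_mult_right_zero)
   finally show ?case using elim 1 by simp
  qed
 qed
 from tendsto_add[OF this limI]
 show "?J \<longlonglongrightarrow> circle_mean (\<lambda>t. F (cos t) * (cmod (combo_hat X S t))^2)" by simp
qed

section \<open>Szego function of the jump weight\<close>

text \<open>Equal to \<open>x * cis (- (sgn x * \<theta>))\<close>, see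
  \<open>jump_phase_cis\<close>. This form is visibly continuous and linear in the two test
  functions \<open>x\<close> and \<bar>x\<bar>.\<close>

definition jump_phase :: "real \<Rightarrow> real \<Rightarrow> complex" where
 "jump_phase \<theta> x = cr x * cr (cos \<theta>) - \<i> * cr (\<bar>x\<bar> * sin \<theta>)"

text \<open>This is \<bar>2 u d - sqrt \<bar>x\<bar> a\<bar>^2 / sqrt \<bar>x\<bar> with u =
  \<open>jump_phase \<theta> x\<close> (\<open>energy_square\<close>), multiplied out to be
  continuous at 0. It is the scaling limit of the dual-norm density of the residual, for the symbols
  \<open>d\<close> of the approximant and \<open>a\<close> of the part orthogonal to low degrees; it
  vanishes where the factorization equation holds.\<close>

definition energy :: "real \<Rightarrow> real \<Rightarrow> complex \<Rightarrow> complex \<Rightarrow> real" where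
 "energy \<theta> x d a = 4 * (\<bar>x\<bar> * sqrt \<bar>x\<bar>) * (cmod d)^2 - 4 * Re (jump_phase \<theta> x * d * cnj a) + sqrt \<bar>x\<bar> * (cmod a)^2"

lemma cmod_jump_phase: "cmod (jump_phase \<theta> x) = \<bar>x\<bar>"
proof -
 have "(cmod (jump_phase \<theta> x))^2 = x^2 * ((cos \<theta>)^2 + (sin \<theta>)^2)"
  unfolding distrib_left by (simp add: cmod_power2 jump_phase_def power_mult_distrib)
 hence "(cmod (jump_phase \<theta> x))^2 = \<bar>x\<bar>^2" by simp
 thus ?thesis by (metis abs_ge_zero norm_ge_zero power2_eq_iff_nonneg)
qed

lemma cmod_diff_square: "(cmod (a - b))^2 = (cmod a)^2 - 2 * Re (a * cnj b) + (cmod b)^2"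
 unfolding cmod_power2 by (simp add: power2_eq_square algebra_simps)

lemma energy_square:
 assumes "x \<noteq> 0"
 shows "energy \<theta> x d a * sqrt \<bar>x\<bar> = (cmod (2 * jump_phase \<theta> x * d - cr (sqrt \<bar>x\<bar>) * a))^2"
proof -
 have gen: "(4 * (s * s * s) * D - 4 * e + s * a') * s = 4 * (s * s)^2 * D - 2 * (2 * s * e) + s^2 * a'" for s D e a' :: real
  by (simp add: power2_eq_square algebra_simps)
 define s where "s = sqrt \<bar>x\<bar>"
 define u where "u = jump_phase \<theta> x"
 have s: "s * s = \<bar>x\<bar>" by (simp add: s_def)
 have u: "(cmod u)^2 = (s * s)^2" by (simp add: u_def cmod_jump_phase s)
 have "(cmod (2 * u * d - cr s * a))^2 = (cmod (2 * u * d))^2 - 2 * Re (2 * u * d * cnj (cr s * a)) + (cmod (cr s * a))^2"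
  by (rule cmod_diff_square)
 also have "(cmod (2 * u * d))^2 = 4 * (s * s)^2 * (cmod d)^2" by (simp add: norm_mult power_mult_distrib u)
 also have "(cmod (cr s * a))^2 = s^2 * (cmod a)^2" by (simp add: norm_mult power_mult_distrib)
 also have "2 * u * d * cnj (cr s * a) = cr (2 * s) * (u * d * cnj a)" by simp
 also have "Re (cr (2 * s) * (u * d * cnj a)) = 2 * s * Re (u * d * cnj a)"
  by (simp only: Re_complex_of_real Im_complex_of_real times_complex.sel)
 finally have "(cmod (2 * u * d - cr s * a))^2 = 4 * (s * s)^2 * (cmod d)^2 - 2 * (2 * s * Re (u * d * cnj a)) + s^2 * (cmod a)^2" .
 moreover have "energy \<theta> x d a = 4 * (s * s * s) * (cmod d)^2 - 4 * Re (u * d * cnj a) + s * (cmod a)^2"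
  by (simp only: energy_def s_def[symmetric] u_def[symmetric] s)
 ultimately show ?thesis unfolding s_def[symmetric] u_def[symmetric]
  by (simp only: gen)
qed

lemma energy_le:
 assumes x: "x \<noteq> 0" and eq: "2 * jump_phase \<theta> x * d0 = cr (sqrt \<bar>x\<bar>) * a0"
 shows "energy \<theta> x d a \<le> 8 * (\<bar>x\<bar> * sqrt \<bar>x\<bar>) * (cmod (d - d0))^2 + 2 * sqrt \<bar>x\<bar> * (cmod (a - a0))^2"
proof -
 define s where "s = sqrt \<bar>x\<bar>"
 have s: "s > 0" "s * s = \<bar>x\<bar>" using x by (auto simp: s_def)
 have "2 * jump_phase \<theta> x * d - cr s * a = 2 * jump_phase \<theta> x * (d - d0) - cr s * (a - a0)"
  using eq by (simp add: s_def algebra_simps)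
 also have "cmod \<dots> \<le> 2 * \<bar>x\<bar> * cmod (d - d0) + s * cmod (a - a0)"
  by (rule order_trans[OF norm_triangle_ineq4]) (use s in \<open>simp add: norm_mult cmod_jump_phase\<close>)
 finally have "(cmod (2 * jump_phase \<theta> x * d - cr s * a))^2 \<le> (2 * \<bar>x\<bar> * cmod (d - d0) + s * cmod (a - a0))^2"
  by (intro power_mono) auto
 also have "\<dots> \<le> 2 * (2 * \<bar>x\<bar> * cmod (d - d0))^2 + 2 * (s * cmod (a - a0))^2"
  using sum_squares_bound[of "2 * \<bar>x\<bar> * cmod (d - d0)" "s * cmod (a - a0)"]
  by (simp add: power2_sum)
 also have "\<dots> = (8 * (\<bar>x\<bar> * s) * (cmod (d - d0))^2 + 2 * s * (cmod (a - a0))^2) * s"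
  unfolding s(2)[symmetric] by (simp add: power2_eq_square algebra_simps)
 finally have "energy \<theta> x d a * s \<le> (8 * (\<bar>x\<bar> * s) * (cmod (d - d0))^2 + 2 * s * (cmod (a - a0))^2) * s"
  using energy_square[OF x, of \<theta> d a] by (simp add: s_def)
 thus ?thesis using s by (simp add: s_def)
qed

lemma continuous_energy [continuous_intros]:
 assumes "continuous_on A x" "continuous_on A d" "continuous_on A a"
 shows "continuous_on A (\<lambda>t. energy \<theta> (x t) (d t) (a t))"
 unfolding energy_def jump_phase_def by (intro continuous_intros assms)

lemma abs_sin_ge_half:
 assumes "\<bar>y\<bar> \<le> pi / 2"
 shows "\<bar>y\<bar> / 2 \<le> \<bar>sin y\<bar>"
proof -
 have "\<bar>sin y - (\<Sum>m<3. sin_coeff m * y ^ m)\<bar> \<le> inverse (fact 3) * \<bar>y\<bar> ^ 3"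
  by (rule Maclaurin_sin_bound)
 moreover have "(\<Sum>m<3. sin_coeff m * y ^ m) = y" by (simp add: numeral_3_eq_3 sin_coeff_def)
 moreover have "(fact 3 :: real) = 6" by (simp add: numeral_3_eq_3)
 ultimately have 1: "\<bar>sin y - y\<bar> \<le> \<bar>y\<bar> ^ 3 / 6" by simp
 have "\<bar>y\<bar> \<le> 8 / 5" using assms pi_less_4 pi_approx by (simp add: divide_simps)
 hence "\<bar>y\<bar> * \<bar>y\<bar> \<le> 8 / 5 * (8 / 5)" by (intro mult_mono) auto
 hence "\<bar>y\<bar> * (\<bar>y\<bar> * \<bar>y\<bar>) \<le> \<bar>y\<bar> * 3" by (intro mult_left_mono) auto
 hence "\<bar>y\<bar> ^ 3 / 6 \<le> \<bar>y\<bar> / 2" by (simp add: power3_eq_cube mult.assoc)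
 thus ?thesis using 1 by linarith
qed

lemma integrable_inverse_sqrt_abs:
 "integrable lborel (\<lambda>t. indicator {-7..7} t * \<bar>t + c\<bar> powr (- 1 / 2) :: real)"
proof -
 define N where "N = 7 + \<bar>c\<bar>"
 have "((\<lambda>x. x powr (- 1 / 2)) has_integral (N powr (- 1 / 2 + 1) / (- 1 / 2 + 1))) {0..N}"
  by (rule has_integral_powr_from_0) (auto simp: N_def)
 from has_bochner_integral_has_integral_nonneg[OF this]
 have hb: "integrable lborel (\<lambda>x. indicator {0..N} x * x powr (- 1 / 2))" by (auto simp: has_bochner_integral_iff)
 have "integrable lborel (\<lambda>x. indicator {0..N} (0 + - 1 * x) * (0 + - 1 * x) powr (- 1 / 2))"
  by (rule lborel_integrable_real_affine[OF hb]) simp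
 hence "integrable lborel (\<lambda>x. indicator {0..N} x * x powr (- 1 / 2) + indicator {0..N} (- x) * (- x) powr (- 1 / 2))"
  using hb by (intro Bochner_Integration.integrable_add) auto
 from lborel_integrable_real_affine[OF this, of 1 c]
 have i: "integrable lborel (\<lambda>x. indicator {0..N} (c + x) * (c + x) powr (- 1 / 2) + indicator {0..N} (- (c + x)) * (- (c + x)) powr (- 1 / 2))"
  by simp
 show ?thesis
 proof (rule Bochner_Integration.integrable_bound[OF i])
  show "AE t in lborel. norm (indicator {-7..7} t * \<bar>t + c\<bar> powr (- 1 / 2) :: real) \<le>
   norm (indicator {0..N} (c + t) * (c + t) powr (- 1 / 2) + indicator {0..N} (- (c + t)) * (- (c + t)) powr (- 1 / 2))"
  proof (rule AE_I2)
   fix t :: real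
   show "norm (indicator {-7..7} t * \<bar>t + c\<bar> powr (- 1 / 2) :: real) \<le>
   norm (indicator {0..N} (c + t) * (c + t) powr (- 1 / 2) + indicator {0..N} (- (c + t)) * (- (c + t)) powr (- 1 / 2))"
   proof (cases "t \<in> {-7..7}")
    case True
    hence "\<bar>c + t\<bar> \<le> N" by (auto simp: N_def)
    moreover have "\<bar>t + c\<bar> = \<bar>c + t\<bar>" by simp
    ultimately show ?thesis using True
     by (cases "c + t" "0 :: real" rule: linorder_cases) (auto simp: indicator_def add.commute)
   qed simp
  qed
 qed measurable
qed

text \<open>Near its zeros the cosine is at least half the distance to the zero. This function is
  the majorant for the energies of the dilated Szego functions.\<close>

lemma integrable_inverse_sqrt_cos:
 "integrable lborel (\<lambda>t. indicator {-pi..pi} t * (1 / sqrt \<bar>cos t\<bar>) :: real)"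
proof (rule Bochner_Integration.integrable_bound)
 show "integrable lborel (\<lambda>t. 2 * (indicator {-7..7} t * \<bar>t + - (pi / 2)\<bar> powr (- 1 / 2)) + 2 * (indicator {-7..7} t * \<bar>t + pi / 2\<bar> powr (- 1 / 2)) :: real)"
  by (intro Bochner_Integration.integrable_add integrable_mult_right integrable_inverse_sqrt_abs)
 show "AE t in lborel. norm (indicator {-pi..pi} t * (1 / sqrt \<bar>cos t\<bar>) :: real) \<le>
   norm (2 * (indicator {-7..7} t * \<bar>t + - (pi / 2)\<bar> powr (- 1 / 2)) + 2 * (indicator {-7..7} t * \<bar>t + pi / 2\<bar> powr (- 1 / 2)) :: real)"
 proof (rule AE_I2)
  fix t :: real
  have key: "1 / sqrt \<bar>cos t\<bar> \<le> 2 * \<bar>y\<bar> powr (- 1 / 2)" if "\<bar>cos t\<bar> = \<bar>sin y\<bar>" "\<bar>y\<bar> \<le> pi / 2" for y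
  proof (cases "y = 0")
   case False
   have "sqrt \<bar>y\<bar> = sqrt (4 * (\<bar>y\<bar> / 4))" by simp
   also have "\<dots> = 2 * sqrt (\<bar>y\<bar> / 4)" by (subst real_sqrt_mult) simp
   also have "\<dots> \<le> 2 * sqrt \<bar>cos t\<bar>"
    using abs_sin_ge_half[OF that(2)] that(1) by (intro mult_left_mono real_sqrt_le_mono) auto
   finally have "1 / sqrt \<bar>cos t\<bar> \<le> 2 / sqrt \<bar>y\<bar>"
   proof -
    assume le: "sqrt \<bar>y\<bar> \<le> 2 * sqrt \<bar>cos t\<bar>"
    have "0 < sqrt \<bar>y\<bar>" using False by simp
    moreover from this le have "0 < sqrt \<bar>cos t\<bar>" by linarith
    ultimately show ?thesis using le by (simp add: divide_simps)
   qed
   also have "2 / sqrt \<bar>y\<bar> = 2 * \<bar>y\<bar> powr (- 1 / 2)"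
    using False powr_minus_divide[of "\<bar>y\<bar>" "1 / 2"] by (simp add: powr_half_sqrt)
   finally show ?thesis .
  qed (use that in simp)
  show "norm (indicator {-pi..pi} t * (1 / sqrt \<bar>cos t\<bar>) :: real) \<le>
   norm (2 * (indicator {-7..7} t * \<bar>t + - (pi / 2)\<bar> powr (- 1 / 2)) + 2 * (indicator {-7..7} t * \<bar>t + pi / 2\<bar> powr (- 1 / 2)) :: real)"
  proof (cases "t \<in> {-pi..pi}")
   case True
   hence t7: "t \<in> {-7..7}" using pi_less_4 by auto
   have nn: "\<bar>t + - (pi / 2)\<bar> powr (- 1 / 2) \<ge> 0" "\<bar>t + pi / 2\<bar> powr (- 1 / 2) \<ge> 0" by auto
   have "1 / sqrt \<bar>cos t\<bar> \<le> 2 * \<bar>t + - (pi / 2)\<bar> powr (- 1 / 2) + 2 * \<bar>t + pi / 2\<bar> powr (- 1 / 2)"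
   proof (cases "t \<ge> 0")
    case t: True
    have "sin (t + - (pi / 2)) = - cos t" by (simp add: sin_diff)
    hence "\<bar>cos t\<bar> = \<bar>sin (t + - (pi / 2))\<bar>" by simp
    moreover have "\<bar>t + - (pi / 2)\<bar> \<le> pi / 2"
    proof -
     have "t \<le> pi" using True by simp
     thus ?thesis using t by linarith
    qed
    ultimately have "1 / sqrt \<bar>cos t\<bar> \<le> 2 * \<bar>t + - (pi / 2)\<bar> powr (- 1 / 2)" by (rule key)
    thus ?thesis using nn by linarith
   next
    case False
    have "sin (t + pi / 2) = cos t" by (simp add: sin_add)
    hence "\<bar>cos t\<bar> = \<bar>sin (t + pi / 2)\<bar>" by simp
    moreover have "\<bar>t + pi / 2\<bar> \<le> pi / 2"
    proof -
     have "- pi \<le> t" using True by simp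
     thus ?thesis using False by linarith
    qed
    ultimately have "1 / sqrt \<bar>cos t\<bar> \<le> 2 * \<bar>t + pi / 2\<bar> powr (- 1 / 2)" by (rule key)
    thus ?thesis using nn by linarith
   qed
   thus ?thesis using True t7 nn by (simp add: abs_of_nonneg)
  qed simp
 qed
qed measurable

text \<open>The principal branch of (1 + i w)^a (1 - i w)^b. On the unit circle its branch points -i
  and i lie over cos t = 0, where the weight has both its root singularity and its jump.\<close>

definition szego_fun :: "real \<Rightarrow> real \<Rightarrow> complex \<Rightarrow> complex" where
 "szego_fun a b w = exp (cr a * Ln (1 + \<i> * w) + cr b * Ln (1 - \<i> * w))"

lemma cmod_szego_fun:
 assumes "1 + \<i> * w \<noteq> 0" "1 - \<i> * w \<noteq> 0"
 shows "cmod (szego_fun a b w) = cmod (1 + \<i> * w) powr a * cmod (1 - \<i> * w) powr b"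
proof -
 have e: "cmod (exp (cr x * Ln z)) = cmod z powr x" if "z \<noteq> 0" for x z
  using that by (simp add: norm_exp_eq_Re powr_def)
 show ?thesis unfolding szego_fun_def exp_add norm_mult by (simp only: e[OF assms(1)] e[OF assms(2)])
qed

lemma disc_Re:
 assumes "cmod w < 1"
 shows "Re (1 + \<i> * w) > 0" "Re (1 - \<i> * w) > 0"
 using assms abs_Im_le_cmod[of w] by auto

lemma disc_nz:
 assumes "cmod w < 1"
 shows "1 + \<i> * w \<noteq> 0" "1 - \<i> * w \<noteq> 0"
 using disc_Re[OF assms] by (metis less_irrefl zero_complex.sel(1))+

lemma holomorphic_szego: "szego_fun a b holomorphic_on ball 0 1"
proof -
 have "1 + \<i> * w \<notin> \<real>\<^sub>\<le>\<^sub>0 \<and> 1 - \<i> * w \<notin> \<real>\<^sub>\<le>\<^sub>0" if "w \<in> ball 0 1" for w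
  using disc_Re[of w] that by (auto simp: complex_nonpos_Reals_iff)
 thus ?thesis unfolding szego_fun_def[abs_def] by (intro holomorphic_intros) auto
qed

text \<open>On the circle (1 + i w)(1 + i cnj w) = 2 i cos t, and likewise with -i. The logarithms
  therefore add up to ln \<bar>2 cos t\<bar> with imaginary parts \<pi>/2 and -\<pi>/2, up to the
  sign of cos t. So \<alpha> + \<beta> = 1/2 produces the square root and \<alpha> - \<beta> = \<nu>
  the phase \<theta> sgn (cos t) that cancels the jump.\<close>

lemma boundary_relation:
 fixes t \<nu> :: real
 assumes c: "cos t \<noteq> 0"
 defines "\<alpha> \<equiv> 1 / 4 + \<nu> / 2" and "\<beta> \<equiv> 1 / 4 - \<nu> / 2" and "\<theta> \<equiv> pi * \<nu> / 2"
 defines "w \<equiv> cis (- t)"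
 shows "2 * jump_phase \<theta> (cos t) * (szego_fun \<alpha> \<beta> w / (2 * cr (cos t))) =
   cr (sqrt \<bar>cos t\<bar>) * (cr (sqrt 2) * szego_fun (- \<alpha>) (- \<beta>) (cnj w))"
proof -
 have s1: "\<bar>sin t\<bar> < 1" using c sin_cos_squared_add[of t] abs_square_less_1[of "sin t"]
  by (metis less_add_same_cancel1 zero_less_power2 add.commute)
 have re: "Re (1 + \<i> * w) > 0" "Re (1 - \<i> * w) > 0" "Re (1 + \<i> * cnj w) > 0" "Re (1 - \<i> * cnj w) > 0"
  using s1 by (auto simp: w_def)
 have im: "\<bar>Im (Ln z)\<bar> < pi / 2" if "Re z > 0" for z
  using that by (rule Re_Ln_pos_lt_imp)
 have add: "Ln z + Ln z' = Ln (z * z')" if "Re z > 0" "Re z' > 0" for z z'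
 proof -
  have "z \<noteq> 0" "z' \<noteq> 0" using that by auto
  moreover have "- pi < Im (Ln z) + Im (Ln z')" "Im (Ln z) + Im (Ln z') \<le> pi"
   using im[OF that(1)] im[OF that(2)] by linarith+
  ultimately show ?thesis by (subst Ln_times_simple) auto
 qed
 have ww: "w * cnj w = 1" by (simp add: w_def cis_cnj cis_mult)
 have wc: "w + cnj w = 2 * cr (cos t)" by (simp add: w_def complex_add_cnj)
 have p1: "(1 + \<i> * w) * (1 + \<i> * cnj w) = \<i> * cr (2 * cos t)"
 proof -
  have "(1 + \<i> * w) * (1 + \<i> * cnj w) = 1 + \<i> * (w + cnj w) - w * cnj w" by (simp add: algebra_simps)
  thus ?thesis unfolding ww wc by simp
 qed
 have p2: "(1 - \<i> * w) * (1 - \<i> * cnj w) = - \<i> * cr (2 * cos t)"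
 proof -
  have "(1 - \<i> * w) * (1 - \<i> * cnj w) = 1 - \<i> * (w + cnj w) - w * cnj w" by (simp add: algebra_simps)
  thus ?thesis unfolding ww wc by simp
 qed
 have L: "Ln (\<i> * cr y) = cr (ln \<bar>y\<bar>) + \<i> * cr (sgn y * (pi / 2))" if "y \<noteq> 0" for y
 proof (cases "y > 0")
  case True
  thus ?thesis using Ln_times_of_real[of y \<i>] by (simp add: mult.commute Ln_of_real Ln_ii)
 next
  case False
  hence y: "- y > 0" using that by simp
  have "Ln (\<i> * cr y) = Ln (cr (- y) * (- \<i>))" by (simp add: mult.commute)
  also have "\<dots> = cr (ln (- y)) + Ln (- \<i>)"
   using Ln_times_of_real[of "- y" "- \<i>"] y by (simp add: Ln_of_real del: of_real_minus)
  finally show ?thesis using y by (simp add: Ln_minus_ii sgn_if)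
 qed
 define l where "l = ln \<bar>2 * cos t\<bar>"
 define \<sigma> where "\<sigma> = sgn (cos t)"
 have L1: "Ln (1 + \<i> * w) + Ln (1 + \<i> * cnj w) = cr l + \<i> * cr (\<sigma> * (pi / 2))"
  unfolding add[OF re(1,3)] p1 using L[of "2 * cos t"] c by (simp add: l_def \<sigma>_def sgn_mult)
 have L2: "Ln (1 - \<i> * w) + Ln (1 - \<i> * cnj w) = cr l - \<i> * cr (\<sigma> * (pi / 2))"
 proof -
  have "- \<i> * cr (2 * cos t) = \<i> * cr (- (2 * cos t))" by simp
  thus ?thesis unfolding add[OF re(2,4)] p2 using L[of "- (2 * cos t)"] c by (simp add: l_def \<sigma>_def sgn_mult sgn_minus)
 qed
 have "szego_fun \<alpha> \<beta> w / szego_fun (- \<alpha>) (- \<beta>) (cnj w) =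
   exp (cr \<alpha> * (Ln (1 + \<i> * w) + Ln (1 + \<i> * cnj w)) + cr \<beta> * (Ln (1 - \<i> * w) + Ln (1 - \<i> * cnj w)))"
  unfolding szego_fun_def exp_diff[symmetric] by (rule arg_cong[where f = exp]) (simp add: algebra_simps)
 also have "\<dots> = exp (cr ((\<alpha> + \<beta>) * l) + \<i> * cr ((\<alpha> - \<beta>) * \<sigma> * (pi / 2)))"
  unfolding L1 L2 by (rule arg_cong[where f = exp]) (simp add: algebra_simps)
 also have "(\<alpha> + \<beta>) * l = l / 2" by (simp add: \<alpha>_def \<beta>_def)
 also have "(\<alpha> - \<beta>) * \<sigma> * (pi / 2) = \<sigma> * \<theta>" by (simp add: \<alpha>_def \<beta>_def \<theta>_def)
 also have "exp (cr (l / 2) + \<i> * cr (\<sigma> * \<theta>)) = cr (exp (l / 2)) * cis (\<sigma> * \<theta>)"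
  by (simp only: exp_add exp_of_real cis_conv_exp)
 also have "exp (l / 2) = sqrt \<bar>2 * cos t\<bar>"
 proof -
  have "exp (l / 2) = \<bar>2 * cos t\<bar> powr (1 / 2)" using c by (simp add: l_def powr_def)
  thus ?thesis by (simp only: powr_half_sqrt abs_ge_zero)
 qed
 finally have q: "szego_fun \<alpha> \<beta> w = cr (sqrt \<bar>2 * cos t\<bar>) * cis (\<sigma> * \<theta>) * szego_fun (- \<alpha>) (- \<beta>) (cnj w)"
  by (simp add: szego_fun_def field_simps)
 have j: "jump_phase \<theta> (cos t) = cr (cos t) * cis (- (\<sigma> * \<theta>))"
  using c by (cases "cos t > 0") (auto simp: jump_phase_def \<sigma>_def complex_eq_iff sgn_if)
 have "2 * jump_phase \<theta> (cos t) * (szego_fun \<alpha> \<beta> w / (2 * cr (cos t))) = cis (- (\<sigma> * \<theta>)) * szego_fun \<alpha> \<beta> w"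
  using c by (simp add: j)
 also have "\<dots> = (cis (- (\<sigma> * \<theta>)) * cis (\<sigma> * \<theta>)) * (cr (sqrt \<bar>2 * cos t\<bar>) * szego_fun (- \<alpha>) (- \<beta>) (cnj w))"
  unfolding q by (simp only: mult_ac)
 also have "cis (- (\<sigma> * \<theta>)) * cis (\<sigma> * \<theta>) = 1" by (simp add: cis_mult)
 finally show ?thesis by (simp add: abs_mult real_sqrt_mult mult_ac)
qed

text \<open>1 + z differs from 1 + r z by (1 - r) z, and 1 - r is itself at most \<bar>1 + r
  z\<bar>. This makes the later majorants uniform in the radius of dilation.\<close>

lemma dilation_ge:
 fixes z :: complex
 assumes "cmod z \<le> 1" "0 \<le> r" "r \<le> 1"
 shows "cmod (1 + z) \<le> 2 * cmod (1 + cr r * z)"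
proof -
 have "1 - r \<le> cmod (1 + cr r * z)"
 proof -
  have "r * cmod z \<le> r * 1" using assms by (intro mult_left_mono) auto
  thus ?thesis using norm_triangle_ineq2[of 1 "- (cr r * z)"] assms by (simp add: norm_mult)
 qed
 moreover have "cmod (1 + z) \<le> cmod (1 + cr r * z) + (1 - r) * cmod z"
 proof -
  have "1 + z = (1 + cr r * z) + cr (1 - r) * z" by (simp add: algebra_simps)
  hence "cmod (1 + z) \<le> cmod (1 + cr r * z) + cmod (cr (1 - r) * z)" by (metis norm_triangle_ineq)
  moreover have "cmod (cr (1 - r) * z) = (1 - r) * cmod z" using assms by (simp only: norm_mult norm_of_real abs_of_nonneg diff_ge_0_iff_ge)
  ultimately show ?thesis by simp
 qed
 moreover have "(1 - r) * cmod z \<le> (1 - r) * 1" using assms by (intro mult_left_mono) auto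
 ultimately show ?thesis by simp
qed

lemma energy_nonneg: "0 \<le> energy \<theta> x d a"
proof (cases "x = 0")
 case True
 thus ?thesis by (simp add: energy_def jump_phase_def)
next
 case False
 have "0 \<le> energy \<theta> x d a * sqrt \<bar>x\<bar>" unfolding energy_square[OF False] by simp
 thus ?thesis using False by (simp add: zero_le_mult_iff)
qed

lemma energy_bound: "energy \<theta> x d a \<le> 8 * (\<bar>x\<bar> * sqrt \<bar>x\<bar>) * (cmod d)^2 + 2 * sqrt \<bar>x\<bar> * (cmod a)^2"
proof (cases "x = 0")
 case True
 thus ?thesis by (simp add: energy_def jump_phase_def)
next
 case False
 thus ?thesis using energy_le[OF False, of \<theta> 0 0 d a] by simp
qed

lemma energy_triangle: "energy \<theta> x d a \<le> 2 * energy \<theta> x d' a' + 2 * energy \<theta> x (d - d') (a - a')"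
proof (cases "x = 0")
 case True
 thus ?thesis by (simp add: energy_def jump_phase_def)
next
 case False
 define u where "u = 2 * jump_phase \<theta> x * d' - cr (sqrt \<bar>x\<bar>) * a'"
 define v where "v = 2 * jump_phase \<theta> x * (d - d') - cr (sqrt \<bar>x\<bar>) * (a - a')"
 have "(cmod (u + v))^2 \<le> (cmod u + cmod v)^2" by (intro power_mono norm_triangle_ineq) auto
 also have "\<dots> \<le> 2 * (cmod u)^2 + 2 * (cmod v)^2"
  using sum_squares_bound[of "cmod u" "cmod v"] by (simp add: power2_sum)
 also have "u + v = 2 * jump_phase \<theta> x * d - cr (sqrt \<bar>x\<bar>) * a"
  by (simp add: u_def v_def algebra_simps)
 finally have "energy \<theta> x d a * sqrt \<bar>x\<bar> \<le> (2 * energy \<theta> x d' a' + 2 * energy \<theta> x (d - d') (a - a')) * sqrt \<bar>x\<bar>"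
  unfolding u_def v_def energy_square[OF False, symmetric] by (simp add: algebra_simps)
 thus ?thesis using False by simp
qed

lemma powr_dilation_bound:
 fixes z :: complex
 assumes z: "cmod z = 1" "1 + z \<noteq> 0" and r: "0 \<le> r" "r \<le> 1" and a: "0 \<le> a" "a \<le> \<gamma>"
 shows "cmod (1 + cr r * z) powr (- a) \<le> 2 powr \<gamma> * cmod (1 + z) powr (- \<gamma>)"
proof -
 define y where "y = cmod (1 + z)"
 have y: "y > 0" "y \<le> 2" using z norm_triangle_ineq[of 1 z] by (auto simp: y_def)
 have h: "y / 2 \<le> cmod (1 + cr r * z)" using dilation_ge[of z r] z r by (simp add: y_def)
 have "cmod (1 + cr r * z) powr (- a) \<le> (y / 2) powr (- a)"
  using h y a by (intro powr_mono2') auto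
 also have "\<dots> \<le> (y / 2) powr (- \<gamma>)" using y a by (intro powr_mono') auto
 also have "\<dots> = 2 powr \<gamma> * y powr (- \<gamma>)"
  using y by (simp add: powr_divide powr_minus field_simps)
 finally show ?thesis by (simp add: y_def)
qed

lemma cis_plus_minus:
 fixes t :: real
 assumes "cos t \<noteq> 0"
 shows "1 + \<i> * cis t \<noteq> 0" "1 - \<i> * cis t \<noteq> 0"
  and "cmod (1 + \<i> * cis t) * cmod (1 - \<i> * cis t) = 2 * \<bar>cos t\<bar>"
  and "1 + (cis t)^2 = 2 * cr (cos t) * cis t"
proof -
 show "1 + \<i> * cis t \<noteq> 0" "1 - \<i> * cis t \<noteq> 0"
  using assms by (auto simp: complex_eq_iff)
 have "1 = (cos t)^2 + (sin t)^2" by simp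
 thus e: "1 + (cis t)^2 = 2 * cr (cos t) * cis t"
  by (auto simp: complex_eq_iff power2_eq_square algebra_simps)
 have "(1 + \<i> * cis t) * (1 - \<i> * cis t) = 1 + (cis t)^2" by (simp add: algebra_simps power2_eq_square)
 hence "cmod ((1 + \<i> * cis t) * (1 - \<i> * cis t)) = 2 * \<bar>cos t\<bar>" unfolding e by (simp add: norm_mult)
 thus "cmod (1 + \<i> * cis t) * cmod (1 - \<i> * cis t) = 2 * \<bar>cos t\<bar>" by (simp add: norm_mult)
qed

text \<open>Both exponents are raised to the common \<open>\<gamma>\<close> so that the two factors
  combine to \<bar>1 + i cis t\<bar> \<bar>1 - i cis t\<bar> = 2 \<bar>cos t\<bar>.\<close>

lemma szego_bound:
 fixes t :: real
 assumes c: "cos t \<noteq> 0" and r: "0 \<le> r" "r < 1" and a: "0 \<le> a" "a \<le> \<gamma>" and b: "0 \<le> b" "b \<le> \<gamma>"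
 shows "cmod (szego_fun (- a) (- b) (cr r * cis t)) \<le> (2 / \<bar>cos t\<bar>) powr \<gamma>"
proof -
 have nz: "1 + \<i> * (cr r * cis t) \<noteq> 0" "1 - \<i> * (cr r * cis t) \<noteq> 0"
  using r by (intro disc_nz, simp add: norm_mult)+
 have e1: "1 + \<i> * (cr r * cis t) = 1 + cr r * (\<i> * cis t)"
  and e2: "1 - \<i> * (cr r * cis t) = 1 + cr r * (- (\<i> * cis t))" by simp_all
 have 1: "cmod (1 + cr r * (\<i> * cis t)) powr (- a) \<le> 2 powr \<gamma> * cmod (1 + \<i> * cis t) powr (- \<gamma>)"
  using cis_plus_minus[OF c] r a by (intro powr_dilation_bound) (auto simp: norm_mult)
 have 2: "cmod (1 + cr r * (- (\<i> * cis t))) powr (- b) \<le> 2 powr \<gamma> * cmod (1 + - (\<i> * cis t)) powr (- \<gamma>)"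
  using cis_plus_minus[OF c] r b by (intro powr_dilation_bound) (auto simp: norm_mult)
 have "cmod (szego_fun (- a) (- b) (cr r * cis t)) \<le>
   (2 powr \<gamma> * cmod (1 + \<i> * cis t) powr (- \<gamma>)) * (2 powr \<gamma> * cmod (1 + - (\<i> * cis t)) powr (- \<gamma>))"
  unfolding cmod_szego_fun[OF nz] unfolding e1 e2 by (intro mult_mono 1 2) auto
 also have "\<dots> = (4 powr \<gamma>) * (cmod (1 + \<i> * cis t) * cmod (1 - \<i> * cis t)) powr (- \<gamma>)"
  using powr_mult[of 2 2 \<gamma>] by (simp add: powr_mult)
 also have "\<dots> = (4 / (2 * \<bar>cos t\<bar>)) powr \<gamma>"
  unfolding cis_plus_minus(3)[OF c] by (simp only: powr_divide powr_minus_divide) (simp add: powr_minus_divide)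
 also have "4 / (2 * \<bar>cos t\<bar>) = 2 / \<bar>cos t\<bar>" by simp
 finally show ?thesis .
qed

lemma tendsto_szego:
 fixes t :: real
 assumes c: "cos t \<noteq> 0" and r: "r \<longlonglongrightarrow> 1"
 shows "(\<lambda>k. szego_fun a b (cr (r k) * cis t)) \<longlonglongrightarrow> szego_fun a b (cis t)"
proof -
 have "\<bar>sin t\<bar> < 1" using c by (metis less_add_same_cancel1 zero_less_power2 add.commute sin_cos_squared_add abs_square_less_1)
 hence re: "Re (1 + \<i> * cis t) > 0" "Re (1 - \<i> * cis t) > 0" by auto
 have w: "(\<lambda>k. cr (r k) * cis t) \<longlonglongrightarrow> cis t"
  using tendsto_mult[OF tendsto_of_real[OF r] tendsto_const[of "cis t"]] by simp
 have "isCont (szego_fun a b) (cis t)"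
  unfolding szego_fun_def[abs_def] using re
  by (intro continuous_intros) (auto simp: complex_nonpos_Reals_iff)
 thus ?thesis using w by (rule isCont_tendsto_compose)
qed

text \<open>Partial sums of the Taylor series with at least the constant term kept, so that the
  value at 0 is exact; this value later fixes a leading coefficient.\<close>

lemma holomorphic_poly_approx:
 fixes f :: "complex \<Rightarrow> complex"
 assumes f: "f holomorphic_on ball 0 R" and R: "R > 1" and \<eta>: "\<eta> > 0"
 obtains p where "coeff p 0 = f 0" "\<And>w. cmod w \<le> 1 \<Longrightarrow> cmod (poly p w - f w) \<le> \<eta>"
proof -
 define c where "c n = (deriv ^^ n) f 0 / fact n" for n
 have sums: "(\<lambda>n. c n * w ^ n) sums f w" if "cmod w < R" for w
  using holomorphic_power_series[OF f, of w] that by (simp add: c_def)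
 define \<rho> where "\<rho> = (1 + R) / 2"
 have \<rho>: "1 < \<rho>" "\<rho> < R" using R by (auto simp: \<rho>_def)
 have "summable (\<lambda>n. c n * cr \<rho> ^ n)" using sums[of "cr \<rho>"] \<rho> by (auto simp: sums_iff)
 from powser_insidea[OF this, of 1] have sm: "summable (\<lambda>n. cmod (c n))" using \<rho> by simp
 have "(\<lambda>N. \<Sum>n. cmod (c (n + N))) \<longlonglongrightarrow> 0" by (rule suminf_exist_split2[OF sm])
 hence "\<forall>\<^sub>F N in sequentially. (\<Sum>n. cmod (c (n + N))) < \<eta>" using \<eta> by (rule order_tendstoD(2))
 hence "\<forall>\<^sub>F N in sequentially. (\<Sum>n. cmod (c (n + N))) < \<eta> \<and> N > 0"
  using eventually_gt_at_top[of 0] by (rule eventually_conj)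
 from eventually_happens'[OF sequentially_bot this] obtain N where N: "(\<Sum>n. cmod (c (n + N))) < \<eta>" "N > 0" by blast
 define p where "p = (\<Sum>n<N. monom (c n) n)"
 have 0: "coeff p 0 = f 0" using N(2) by (simp add: p_def coeff_sum if_distrib c_def cong: if_cong)
 have "cmod (poly p w - f w) \<le> \<eta>" if w: "cmod w \<le> 1" for w
 proof -
  have s: "summable (\<lambda>n. c n * w ^ n)" "f w = (\<Sum>n. c n * w ^ n)" using sums[of w] w R by (auto simp: sums_iff)
  have sN: "summable (\<lambda>n. cmod (c (n + N)))" using sm by (rule summable_ignore_initial_segment)
  have le: "cmod (c (n + N) * w ^ (n + N)) \<le> cmod (c (n + N))" for n
   unfolding norm_mult norm_power using mult_left_mono[OF power_le_one[OF norm_ge_zero w, of "n + N"], of "cmod (c (n + N))"] by simp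
  have "f w - poly p w = (\<Sum>n. c (n + N) * w ^ (n + N))"
   unfolding s(2) suminf_split_initial_segment[OF s(1), of N] by (simp add: p_def poly_sum poly_monom)
  also have "cmod \<dots> \<le> (\<Sum>n. cmod (c (n + N)))"
   by (rule norm_suminf_le[OF le sN])
  finally show ?thesis using N(1) by (simp add: norm_minus_commute)
 qed
 with 0 show ?thesis by (rule that)
qed

lemma circle_mean_mono:
 fixes f g :: "real \<Rightarrow> real"
 assumes "continuous_on UNIV f" "continuous_on UNIV g" "\<And>t. f t \<le> g t"
 shows "circle_mean f \<le> circle_mean g"
proof -
 have "(LBINT t:{-pi..pi}. f t) \<le> (LBINT t:{-pi..pi}. g t)"
  by (rule set_integral_mono) (use set_integrable_circle[OF assms(1)] set_integrable_circle[OF assms(2)] assms(3) in auto)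
 thus ?thesis by (simp add: circle_mean_def divide_right_mono)
qed

lemma circle_mean_const: "circle_mean (\<lambda>_. c :: real) = c"
 by (simp add: circle_mean_def set_lebesgue_integral_def)

text \<open>The exact solution is unbounded on the circle, so it is first dilated and then replaced
  by Taylor polynomials. The lower bound for \<bar>(1 + w^2) D(w)\<bar> comes from the Szego
  function itself and does not deteriorate with \<open>\<epsilon>\<close>.\<close>

lemma szego_approx:
 fixes \<nu> \<rho> \<epsilon> :: real
 assumes \<nu>: "0 < \<nu>" "\<nu> \<le> 1 / 2" and \<epsilon>: "\<epsilon> > 0" and \<rho>: "\<rho> < 1"
 obtains D A :: "complex poly" where "coeff D 0 = 1"
  "circle_mean (\<lambda>t. energy (pi * \<nu> / 2) (cos t) (cis (- t) * poly D (cis (- t))) (poly A (cis t))) < \<epsilon>"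
  "\<And>w. cmod w \<le> \<rho> \<Longrightarrow> (1 - \<rho>)^2 / 8 \<le> cmod ((1 + w^2) * poly D w)"
proof -
 define \<alpha> \<beta> where "\<alpha> = 1 / 4 + \<nu> / 2" and "\<beta> = 1 / 4 - \<nu> / 2"
 define \<theta> where "\<theta> = pi * \<nu> / 2"
 have ab: "0 \<le> \<alpha>" "\<alpha> \<le> 1 / 2" "0 \<le> \<beta>" "\<beta> \<le> 1 / 2" using \<nu> by (auto simp: \<alpha>_def \<beta>_def)
 \<comment> \<open>The exponents \<alpha> - 1 and \<beta> - 1 arise from dividing by (1 + i w)(1 - i
   w) = 1 + w^2, which equals 2 w cos t on the circle: this writes the solution of
   \<open>boundary_relation\<close> as \<open>cis (- t)\<close> times an analytic function of
   \<open>cis (- t)\<close>.\<close>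
 define d where "d r t = cis (- t) * szego_fun (- (1 - \<alpha>)) (- (1 - \<beta>)) (cr r * cis (- t))" for r t
 define a where "a r t = cr (sqrt 2) * szego_fun (- \<alpha>) (- \<beta>) (cr r * cis t)" for r t
 define G where "G r t = energy \<theta> (cos t) (d r t) (a r t)" for r t
 define r where "r k = 1 - inverse (real (Suc k))" for k
 have r: "0 \<le> r k" "r k < 1" for k by (auto simp: r_def inverse_le_1_iff)
 have rlim: "r \<longlonglongrightarrow> 1"
  using tendsto_diff[OF tendsto_const LIMSEQ_inverse_real_of_nat, of 1] by (simp add: r_def[abs_def])
 have csz: "continuous_on UNIV (\<lambda>t. szego_fun a' b' (cr (r k) * cis (s * t)))" for a' b' s k
  by (rule continuous_on_compose2[OF holomorphic_on_imp_continuous_on[OF holomorphic_szego]])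
    (use r[of k] in \<open>auto intro!: continuous_intros simp: norm_mult\<close>)
 have cd: "continuous_on UNIV (d (r k))" for k
  unfolding d_def[abs_def] using csz[of _ _ k "-1"] by (intro continuous_intros) auto
 have ca: "continuous_on UNIV (a (r k))" for k
  unfolding a_def[abs_def] using csz[of _ _ k 1] by (intro continuous_intros) auto
 have cG: "continuous_on UNIV (G (r k))" for k
  unfolding G_def[abs_def] by (intro continuous_intros cd ca)
 \<comment> \<open>With c = \<bar>cos t\<bar>, the bounds 4/c^2 and 4/c for the squares of
   \<open>d\<close> and \<open>a\<close> meet the weights 8 c^(3/2) and 2 c^(1/2), giving (32 + 8) /
   sqrt c.\<close>
 have Gb: "G (r k) t \<le> 40 * (1 / sqrt \<bar>cos t\<bar>)" for k t
 proof (cases "cos t = 0")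
  case True
  thus ?thesis by (simp add: G_def energy_def jump_phase_def)
 next
  case False
  define s where "s = sqrt \<bar>cos t\<bar>"
  have s: "s > 0" "\<bar>cos t\<bar> = s * s" using False by (auto simp: s_def)
  have "cmod (szego_fun (- (1 - \<alpha>)) (- (1 - \<beta>)) (cr (r k) * cis (- t))) \<le> (2 / \<bar>cos (- t)\<bar>) powr 1"
   using False r ab by (intro szego_bound) auto
  hence "cmod (d (r k) t) \<le> 2 / \<bar>cos t\<bar>" using False by (simp add: d_def norm_mult)
  hence "(cmod (d (r k) t))^2 \<le> (2 / \<bar>cos t\<bar>)^2" by (intro power_mono) auto
  hence 1: "(cmod (d (r k) t))^2 \<le> 4 / (s * s * s * s)" by (simp add: s power2_eq_square)
  have "cmod (szego_fun (- \<alpha>) (- \<beta>) (cr (r k) * cis t)) \<le> (2 / \<bar>cos t\<bar>) powr (1 / 2)"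
   using False r ab by (intro szego_bound) auto
  hence "(cmod (szego_fun (- \<alpha>) (- \<beta>) (cr (r k) * cis t)))^2 \<le> ((2 / \<bar>cos t\<bar>) powr (1 / 2))^2"
   by (intro power_mono) auto
  also have "\<dots> = 2 / \<bar>cos t\<bar>" by (simp add: powr_half_sqrt)
  finally have 2: "(cmod (a (r k) t))^2 \<le> 4 / (s * s)" by (simp add: a_def norm_mult power_mult_distrib s)
  have "G (r k) t \<le> 8 * (\<bar>cos t\<bar> * sqrt \<bar>cos t\<bar>) * (cmod (d (r k) t))^2 + 2 * sqrt \<bar>cos t\<bar> * (cmod (a (r k) t))^2"
   unfolding G_def by (rule energy_bound)
  also have "\<dots> = 8 * (s * s * s) * (cmod (d (r k) t))^2 + 2 * s * (cmod (a (r k) t))^2" by (simp add: s_def)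
  also have "\<dots> \<le> 8 * (s * s * s) * (4 / (s * s * s * s)) + 2 * s * (4 / (s * s))"
   using s 1 2 by (intro add_mono mult_left_mono) auto
  also have "\<dots> = 40 * (1 / s)" using s by (simp add: field_simps)
  finally show ?thesis by (simp add: s_def)
 qed
 have Glim: "(\<lambda>k. G (r k) t) \<longlonglongrightarrow> 0" for t
 proof (cases "cos t = 0")
  case True
  thus ?thesis by (simp add: G_def energy_def jump_phase_def)
 next
  case False
  let ?S = "szego_fun (- (1 - \<alpha>)) (- (1 - \<beta>)) (cis (- t))"
  have d: "(\<lambda>k. d (r k) t) \<longlonglongrightarrow> cis (- t) * ?S"
   unfolding d_def using False by (intro tendsto_intros tendsto_szego rlim) auto
  have a: "(\<lambda>k. a (r k) t) \<longlonglongrightarrow> cr (sqrt 2) * szego_fun (- \<alpha>) (- \<beta>) (cis t)"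
   unfolding a_def using False by (intro tendsto_intros tendsto_szego rlim) auto
  have lim: "(\<lambda>k. G (r k) t) \<longlonglongrightarrow> energy \<theta> (cos t) (cis (- t) * ?S) (cr (sqrt 2) * szego_fun (- \<alpha>) (- \<beta>) (cis t))"
   unfolding G_def energy_def jump_phase_def by (intro tendsto_intros d a)
  have nz: "1 + \<i> * cis (- t) \<noteq> 0" "1 - \<i> * cis (- t) \<noteq> 0" using False by (intro cis_plus_minus, simp)+
  have "?S * ((1 + \<i> * cis (- t)) * (1 - \<i> * cis (- t))) = szego_fun \<alpha> \<beta> (cis (- t))"
  proof -
   have "(1 + \<i> * cis (- t)) * (1 - \<i> * cis (- t)) = exp (Ln (1 + \<i> * cis (- t)) + Ln (1 - \<i> * cis (- t)))"
    unfolding exp_add by (simp only: exp_Ln[OF nz(1)] exp_Ln[OF nz(2)])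
   thus ?thesis unfolding szego_fun_def
    by (simp only: exp_add[symmetric]) (rule arg_cong[where f = exp], simp add: algebra_simps)
  qed
  moreover have "(1 + \<i> * cis (- t)) * (1 - \<i> * cis (- t)) = 1 + (cis (- t))^2" by (simp add: algebra_simps power2_eq_square)
  ultimately have "?S * (2 * cr (cos t) * cis (- t)) = szego_fun \<alpha> \<beta> (cis (- t))"
   using cis_plus_minus(4)[of "- t"] False by simp
  hence "cis (- t) * ?S = szego_fun \<alpha> \<beta> (cis (- t)) / (2 * cr (cos t))"
   using False by (simp add: field_simps)
  moreover have "cnj (cis (- t)) = cis t" by (simp add: cis_cnj)
  ultimately have "2 * jump_phase \<theta> (cos t) * (cis (- t) * ?S) = cr (sqrt \<bar>cos t\<bar>) * (cr (sqrt 2) * szego_fun (- \<alpha>) (- \<beta>) (cis t))"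
   using boundary_relation[OF False, of \<nu>] by (simp only: \<alpha>_def \<beta>_def \<theta>_def)
  from energy_le[OF False this, of "cis (- t) * ?S" "cr (sqrt 2) * szego_fun (- \<alpha>) (- \<beta>) (cis t)"]
  have "energy \<theta> (cos t) (cis (- t) * ?S) (cr (sqrt 2) * szego_fun (- \<alpha>) (- \<beta>) (cis t)) = 0"
   using energy_nonneg[of \<theta> "cos t" "cis (- t) * ?S" "cr (sqrt 2) * szego_fun (- \<alpha>) (- \<beta>) (cis t)"] by simp
  thus ?thesis using lim by (simp only:)
 qed
 have "(\<lambda>k. LBINT t:{-pi..pi}. G (r k) t) \<longlonglongrightarrow> (\<integral>t. (0::real) \<partial>(lborel :: real measure))"
  unfolding set_lebesgue_integral_def
 proof (rule integral_dominated_convergence)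
  show "integrable lborel (\<lambda>t. 40 * (indicator {-pi..pi} t * (1 / sqrt \<bar>cos t\<bar>)) :: real)"
   by (intro integrable_mult_right integrable_inverse_sqrt_cos)
  show "AE t in lborel. (\<lambda>k. indicat_real {-pi..pi} t *\<^sub>R G (r k) t) \<longlonglongrightarrow> 0"
   using tendsto_scaleR[OF tendsto_const Glim] by (intro AE_I2) (metis scaleR_zero_right)
  show "AE t in lborel. norm (indicat_real {-pi..pi} t *\<^sub>R G (r k) t) \<le> 40 * (indicator {-pi..pi} t * (1 / sqrt \<bar>cos t\<bar>))" for k
   using Gb energy_nonneg by (intro AE_I2) (auto simp: indicator_def G_def)
  show "(\<lambda>t. indicat_real {-pi..pi} t *\<^sub>R G (r k) t) \<in> borel_measurable lborel" for k
   using borel_measurable_continuous_onI[OF cG[of k]] by measurable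
 qed simp
 hence "(\<lambda>k. circle_mean (G (r k))) \<longlonglongrightarrow> 0"
  unfolding circle_mean_def by (auto intro!: tendsto_eq_intros)
 hence "\<forall>\<^sub>F k in sequentially. circle_mean (G (r k)) < \<epsilon> / 4" using \<epsilon> by (intro order_tendstoD(2)) auto
 hence "\<forall>\<^sub>F k in sequentially. circle_mean (G (r k)) < \<epsilon> / 4 \<and> k > 0"
  using eventually_gt_at_top[of 0] by (rule eventually_conj)
 from eventually_happens'[OF sequentially_bot this] obtain k where k: "circle_mean (G (r k)) < \<epsilon> / 4" "k > 0" by blast
 define q where "q = r k"
 have q: "0 < q" "q < 1" using r[of k] k(2) by (auto simp: q_def r_def field_simps)
 have hol: "(\<lambda>w. szego_fun a' b' (cr q * w)) holomorphic_on ball 0 (1 / q)" for a' b'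
 proof -
  have "(szego_fun a' b' \<circ> (\<lambda>w. cr q * w)) holomorphic_on ball 0 (1 / q)"
   by (rule holomorphic_on_compose_gen[OF _ holomorphic_szego])
     (use q in \<open>auto intro!: holomorphic_intros simp: norm_mult field_simps\<close>)
  thus ?thesis by (simp add: o_def)
 qed
 \<comment> \<open>The polynomial errors add 20 \<eta>^2 to twice \<epsilon>/4, and 20/41 < 1/2. The
   second entry keeps 2 \<eta> below half of (1 - \<rho>)^2 / 4, the lower bound for the Szego
   function times 1 + w^2.\<close>
 define \<eta> where "\<eta> = min (sqrt (\<epsilon> / 41)) ((1 - \<rho>)^2 / 16)"
 have \<eta>: "\<eta> > 0" "\<eta> \<le> sqrt (\<epsilon> / 41)" "2 * \<eta> \<le> (1 - \<rho>)^2 / 8" using \<epsilon> \<rho> by (auto simp: \<eta>_def min_def)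
 have \<eta>2: "\<eta>^2 \<le> \<epsilon> / 41" using power_mono[OF \<eta>(2), of 2] \<eta>(1) \<epsilon> by simp
 have q1: "1 / q > 1" using q by simp
 obtain D where D: "coeff D 0 = szego_fun (- (1 - \<alpha>)) (- (1 - \<beta>)) (cr q * 0)"
   "\<And>w. cmod w \<le> 1 \<Longrightarrow> cmod (poly D w - szego_fun (- (1 - \<alpha>)) (- (1 - \<beta>)) (cr q * w)) \<le> \<eta>"
  by (rule holomorphic_poly_approx[OF hol q1 \<eta>(1)]) (rule that)
 have hol2: "(\<lambda>w. cr (sqrt 2) * szego_fun (- \<alpha>) (- \<beta>) (cr q * w)) holomorphic_on ball 0 (1 / q)"
  by (intro holomorphic_intros hol)
 obtain A where A: "\<And>w. cmod w \<le> 1 \<Longrightarrow> cmod (poly A w - cr (sqrt 2) * szego_fun (- \<alpha>) (- \<beta>) (cr q * w)) \<le> \<eta>"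
  by (rule holomorphic_poly_approx[OF hol2 q1 \<eta>(1)]) (rule that)
 show ?thesis
 proof (rule that)
  show "coeff D 0 = 1" using D(1) by (simp add: szego_fun_def)
  have pt: "energy \<theta> (cos t) (cis (- t) * poly D (cis (- t))) (poly A (cis t)) \<le> 2 * G q t + 20 * \<eta>^2" for t
  proof -
   let ?d = "cis (- t) * poly D (cis (- t)) - d q t" and ?a = "poly A (cis t) - a q t"
   have "?d = cis (- t) * (poly D (cis (- t)) - szego_fun (- (1 - \<alpha>)) (- (1 - \<beta>)) (cr q * cis (- t)))"
    by (simp add: d_def algebra_simps)
   hence "cmod ?d \<le> \<eta>" using D(2)[of "cis (- t)"] by (simp add: norm_mult)
   hence d: "(cmod ?d)^2 \<le> \<eta>^2" by (intro power_mono) auto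
   have "cmod ?a \<le> \<eta>" using A[of "cis t"] by (simp add: a_def)
   hence a: "(cmod ?a)^2 \<le> \<eta>^2" by (intro power_mono) auto
   have s: "sqrt \<bar>cos t\<bar> \<le> 1" "\<bar>cos t\<bar> \<le> 1" by auto
   have s2: "\<bar>cos t\<bar> * sqrt \<bar>cos t\<bar> \<le> 1 * 1" by (intro mult_mono s) auto
   have "energy \<theta> (cos t) ?d ?a \<le> 8 * (\<bar>cos t\<bar> * sqrt \<bar>cos t\<bar>) * (cmod ?d)^2 + 2 * sqrt \<bar>cos t\<bar> * (cmod ?a)^2"
    by (rule energy_bound)
   also have "\<dots> \<le> 8 * 1 * \<eta>^2 + 2 * 1 * \<eta>^2"
    using s s2 d a by (intro add_mono mult_mono) auto
   finally have "energy \<theta> (cos t) ?d ?a \<le> 10 * \<eta>^2" by simp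
   thus ?thesis using energy_triangle[of \<theta> "cos t" "cis (- t) * poly D (cis (- t))" "poly A (cis t)" "d q t" "a q t"]
    unfolding G_def by linarith
  qed
  have "circle_mean (\<lambda>t. energy \<theta> (cos t) (cis (- t) * poly D (cis (- t))) (poly A (cis t))) \<le> circle_mean (\<lambda>t. 2 * G q t + 20 * \<eta>^2)"
   using cG[of k] by (intro circle_mean_mono pt) (auto intro!: continuous_intros simp: q_def)
  also have "\<dots> = 2 * circle_mean (G q) + 20 * \<eta>^2"
   using cG[of k] by (subst circle_mean_add) (auto intro!: continuous_intros simp: q_def circle_mean_mult_left circle_mean_const)
  also have "\<dots> < 2 * (\<epsilon> / 4) + 20 * (\<epsilon> / 41)" using k(1) \<eta>2 unfolding q_def by linarith
  also have "\<dots> < \<epsilon>" using \<epsilon> by simp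
  finally show "circle_mean (\<lambda>t. energy (pi * \<nu> / 2) (cos t) (cis (- t) * poly D (cis (- t))) (poly A (cis t))) < \<epsilon>"
   by (simp only: \<theta>_def)
  show "(1 - \<rho>)^2 / 8 \<le> cmod ((1 + w^2) * poly D w)" if w: "cmod w \<le> \<rho>" for w
  proof -
   have w1: "cmod w < 1" using w \<rho> by simp
   have qw: "cmod (cr q * w) < 1"
    using mult_strict_mono[of q 1 "cmod w" 1] q w1 by (simp add: norm_mult)
   define u where "u = cr q * w"
   have nz: "1 + \<i> * u \<noteq> 0" "1 - \<i> * u \<noteq> 0" using disc_nz qw unfolding u_def by blast+
   have up: "cmod (1 + \<i> * u) \<le> 2" "cmod (1 - \<i> * u) \<le> 2"
    using norm_triangle_ineq[of 1 "\<i> * u"] norm_triangle_ineq4[of 1 "\<i> * u"] qw by (auto simp: norm_mult u_def)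
   have "cmod (szego_fun (- (1 - \<alpha>)) (- (1 - \<beta>)) u) = cmod (1 + \<i> * u) powr (- (1 - \<alpha>)) * cmod (1 - \<i> * u) powr (- (1 - \<beta>))"
    by (rule cmod_szego_fun[OF nz])
   also have "\<dots> \<ge> 2 powr (- (1 - \<alpha>)) * 2 powr (- (1 - \<beta>))"
    using up nz ab by (intro mult_mono powr_mono2') auto
   moreover have "(2::real) powr (- (1 - \<alpha>)) * 2 powr (- (1 - \<beta>)) \<ge> 2 powr (-1) * 2 powr (-1)"
    using ab by (intro mult_mono powr_mono) auto
   ultimately have S: "cmod (szego_fun (- (1 - \<alpha>)) (- (1 - \<beta>)) u) \<ge> 1 / 4" by (simp add: powr_minus_divide)
   have l: "1 - \<rho> \<le> cmod (1 + \<i> * w)" "1 - \<rho> \<le> cmod (1 - \<i> * w)"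
    using norm_triangle_ineq2[of 1 "\<i> * w"] norm_triangle_ineq2[of 1 "- (\<i> * w)"] w by (auto simp: norm_mult)
   have f: "1 + w^2 = (1 + \<i> * w) * (1 - \<i> * w)" by (simp add: algebra_simps power2_eq_square)
   have "(1 - \<rho>) * (1 - \<rho>) \<le> cmod (1 + \<i> * w) * cmod (1 - \<i> * w)"
    using l \<rho> by (intro mult_mono) auto
   hence l2: "(1 - \<rho>)^2 \<le> cmod (1 + w^2)" unfolding f by (simp add: norm_mult power2_eq_square)
   have u2: "cmod (1 + w^2) \<le> 2"
    using norm_triangle_ineq[of 1 "w^2"] power_le_one[of "cmod w" 2] w1 by (simp add: norm_power)
   have "(1 - \<rho>)^2 * (1 / 4) \<le> cmod (1 + w^2) * cmod (szego_fun (- (1 - \<alpha>)) (- (1 - \<beta>)) u)"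
    using l2 S by (intro mult_mono) auto
   also have "\<dots> = cmod ((1 + w^2) * poly D w - (1 + w^2) * (poly D w - szego_fun (- (1 - \<alpha>)) (- (1 - \<beta>)) u))"
    by (simp add: norm_mult[symmetric] algebra_simps)
   also have "\<dots> \<le> cmod ((1 + w^2) * poly D w) + cmod (1 + w^2) * cmod (poly D w - szego_fun (- (1 - \<alpha>)) (- (1 - \<beta>)) u)"
    by (rule order_trans[OF norm_triangle_ineq4]) (simp add: norm_mult)
   also have "cmod (1 + w^2) * cmod (poly D w - szego_fun (- (1 - \<alpha>)) (- (1 - \<beta>)) u) \<le> 2 * \<eta>"
    using D(2)[of w] w1 u2 unfolding u_def by (intro mult_mono) auto
   finally show ?thesis using \<eta>(3) by linarith
  qed
 qed
qed

section \<open>The weighted norm on polynomials\<close>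

lemma degree_mp: "degree (mp n) = n"
 and lead_coeff_mp_Suc: "of_nat (Suc n) * lead_coeff (mp (Suc n)) = 2 * lead_coeff (mp n)"
 and lead_coeff_mp: "lead_coeff (mp n) \<noteq> 0"
proof -
 have 1: "degree (mp n) \<le> n" for n
 proof (induction n rule: mp.induct)
  case (3 n)
  have "degree ([:0, 2:] * mp (Suc n)) \<le> Suc (Suc n)"
   by (rule order_trans[OF degree_mult_le]) (use 3 in simp)
  moreover have "degree (smult (of_nat (n + 1)) (mp n)) \<le> Suc (Suc n)"
   using 3 by (intro order_trans[OF degree_smult_le]) simp
  ultimately have "degree ([:0, 2:] * mp (Suc n) - smult (of_nat (n + 1)) (mp n)) \<le> Suc (Suc n)"
   by (rule degree_diff_le)
  thus ?case unfolding mp.simps by (rule order_trans[OF degree_smult_le])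
 qed auto
 have 2: "of_nat (Suc n) * coeff (mp (Suc n)) (Suc n) = 2 * coeff (mp n) n" for n
 proof -
  have "coeff ([:0, 2:] * mp n) (Suc n) = of_nat (Suc n) * coeff (mp (Suc n)) (Suc n) + of_nat n * coeff (mp (n - 1)) (Suc n)"
   unfolding mp_rec by (simp only: coeff_add coeff_smult)
  moreover have "coeff (mp (n - 1)) (Suc n) = 0"
   using 1[of "n - 1"] by (intro coeff_eq_0) linarith
  ultimately show ?thesis by simp
 qed
 have 3: "coeff (mp n) n \<noteq> 0" for n
 proof (induction n)
  case (Suc n)
  thus ?case using 2[of n] by (metis mult_eq_0_iff mult_zero_right zero_neq_numeral)
 qed simp
 have d: "degree (mp n) = n" for n using 1[of n] 3[of n] le_degree[of "mp n" n] by (simp add: le_antisym)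
 show "degree (mp n) = n" by (rule d)
 show "of_nat (Suc n) * lead_coeff (mp (Suc n)) = 2 * lead_coeff (mp n)" using 2[of n] by (simp only: d)
 show "lead_coeff (mp n) \<noteq> 0" using 3[of n] by (simp add: d)
qed

lemma mp_nonzero: "mp n \<noteq> 0"
 using lead_coeff_mp[of n] by auto

lemma poly_map_cnj: "poly (map_poly cnj p) (cr x) = cnj (poly p (cr x))"
 by (induction p) (auto simp: map_poly_pCons)

section \<open>Parseval and multiplication by x in low degree\<close>

definition sech_inner :: "complex poly \<Rightarrow> complex poly \<Rightarrow> complex" where
 "sech_inner p q = (\<integral>x. poly p (cr x) * cnj (poly q (cr x)) * cr (sech_wt x) \<partial>lborel)"

definition sech_norm2 :: "complex poly \<Rightarrow> real" where
 "sech_norm2 p = (\<integral>x. (cmod (poly p (cr x)))^2 * sech_wt x \<partial>lborel)"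

lemma integrable_sech_inner:
 "integrable lborel (\<lambda>x. poly p (cr x) * cnj (poly q (cr x)) * cr (sech_wt x))"
 using integrable_poly_sech[of "p * map_poly cnj q"] by (simp add: poly_map_cnj sech_wt_def)

lemma sech_inner_sum_left: "sech_inner (\<Sum>i\<in>A. smult (c i) (p i)) q = (\<Sum>i\<in>A. c i * sech_inner (p i) q)"
proof -
 have "sech_inner (\<Sum>i\<in>A. smult (c i) (p i)) q =
   (\<integral>x. (\<Sum>i\<in>A. c i * (poly (p i) (cr x) * cnj (poly q (cr x)) * cr (sech_wt x))) \<partial>lborel)"
  unfolding sech_inner_def
  by (intro Bochner_Integration.integral_cong refl) (simp add: poly_sum sum_distrib_left sum_distrib_right mult_ac)
 also have "\<dots> = (\<Sum>i\<in>A. c i * sech_inner (p i) q)"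
  unfolding sech_inner_def
  by (subst Bochner_Integration.integral_sum, intro integrable_mult_right integrable_sech_inner) (simp only: integral_mult_right_zero)
 finally show ?thesis .
qed

lemma sech_inner_cnj: "cnj (sech_inner p q) = sech_inner q p"
 unfolding sech_inner_def Bochner_Integration.integral_cnj[symmetric]
 by (intro Bochner_Integration.integral_cong refl) (simp add: mult_ac)

lemma sech_inner_sum_right: "sech_inner q (\<Sum>i\<in>A. smult (c i) (p i)) = (\<Sum>i\<in>A. cnj (c i) * sech_inner q (p i))"
 by (subst sech_inner_cnj[symmetric], subst sech_inner_sum_left) (simp add: sech_inner_cnj)

lemma sech_inner_mp: "sech_inner (mp j) (mp k) = (if j = k then 1 else 0)"
proof -
 have "sech_inner (mp j) (mp k) = sech_int (mp j * mp k)"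
  unfolding sech_inner_def sech_int_def by (simp add: poly_mp_of_real sech_wt_def)
 thus ?thesis using mp_orthonormal[of j k] by simp
qed

lemma sech_norm2_inner: "cr (sech_norm2 p) = sech_inner p p"
proof -
 have "poly p (cr x) * cnj (poly p (cr x)) * cr (sech_wt x) =
   cr ((cmod (poly p (cr x)))^2 * sech_wt x)" for x
  by (simp only: of_real_mult complex_norm_square)
 thus ?thesis unfolding sech_inner_def sech_norm2_def by (simp only: integral_complex_of_real)
qed

lemma integrable_sech_norm2: "integrable lborel (\<lambda>x. (cmod (poly p (cr x)))^2 * sech_wt x)"
proof -
 have "Re (poly p (cr x) * cnj (poly p (cr x)) * cr (sech_wt x)) =
   (cmod (poly p (cr x)))^2 * sech_wt x" for x
  by (simp add: complex_mult_cnj cmod_power2)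
 thus ?thesis using integrable_Re[OF integrable_sech_inner[of p p]] by (simp only:)
qed

lemma sech_norm2_nonneg: "0 \<le> sech_norm2 p"
 unfolding sech_norm2_def using less_imp_le[OF sech_wt_pos] by (intro integral_nonneg_AE AE_I2) auto

lemma parseval:
 assumes A: "finite A" "inj_on \<sigma> A"
 shows "sech_norm2 (\<Sum>k\<in>A. smult (c k) (mp (\<sigma> k))) = (\<Sum>k\<in>A. (cmod (c k))^2)"
proof -
 have "cr (sech_norm2 (\<Sum>k\<in>A. smult (c k) (mp (\<sigma> k)))) = (\<Sum>k\<in>A. c k * (\<Sum>l\<in>A. cnj (c l) * (if \<sigma> k = \<sigma> l then 1 else 0)))"
  unfolding sech_norm2_inner sech_inner_sum_left unfolding sech_inner_sum_right sech_inner_mp ..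
 also have "\<dots> = (\<Sum>k\<in>A. c k * (\<Sum>l\<in>A. if k = l then cnj (c l) else 0))"
  using A by (intro sum.cong refl arg_cong2[where f = "(*)"]) (auto simp: inj_on_eq_iff)
 also have "\<dots> = (\<Sum>k\<in>A. c k * cnj (c k))"
  using A by (intro sum.cong refl) simp
 also have "\<dots> = cr (\<Sum>k\<in>A. (cmod (c k))^2)" unfolding of_real_sum complex_norm_square ..
 finally show ?thesis by (simp only: of_real_eq_iff)
qed

definition mp_coeff :: "nat \<Rightarrow> complex poly \<Rightarrow> complex" where
 "mp_coeff k p = sech_inner p (mp k)"

lemma mp_coeff_add: "mp_coeff k (p + q) = mp_coeff k p + mp_coeff k q"
 using sech_inner_sum_left[of "\<lambda>_. 1" "\<lambda>b. if b then p else q" UNIV "mp k"] by (simp add: mp_coeff_def UNIV_bool add.commute)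

lemma mp_coeff_smult: "mp_coeff k (smult c p) = c * mp_coeff k p"
 using sech_inner_sum_left[of "\<lambda>_. c" "\<lambda>_. p" "{()}" "mp k"] by (simp add: mp_coeff_def)

lemma mp_expansion:
 assumes "degree p < n"
 shows "p = (\<Sum>k<n. smult (mp_coeff k p) (mp k))"
proof -
 have deg: "degree (mp k) = k \<and> mp k \<noteq> 0" for k by (simp add: degree_mp mp_nonzero)
 obtain \<beta> :: "nat \<Rightarrow> complex poly \<Rightarrow> complex" where \<beta>: "\<And>q. degree q < n \<Longrightarrow> q = (\<Sum>k<n. smult (\<beta> k q) (mp k))"
  by (rule triangular_basis_coordinates[where f = mp and N = n], rule deg) (rule that)
 have "mp_coeff l p = \<beta> l p" if "l < n" for l
 proof -
  have "mp_coeff l p = mp_coeff l (\<Sum>k<n. smult (\<beta> k p) (mp k))" using \<beta>[OF assms] by simp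
  also have "\<dots> = (\<Sum>k<n. \<beta> k p * (if k = l then 1 else 0))"
   unfolding mp_coeff_def sech_inner_sum_left sech_inner_mp ..
  also have "\<dots> = \<beta> l p" using that by (simp add: if_distrib cong: if_cong)
  finally show ?thesis .
 qed
 thus ?thesis using \<beta>[OF assms] by simp
qed

lemma sech_norm2_expansion:
 assumes "degree p < n"
 shows "sech_norm2 p = (\<Sum>k<n. (cmod (mp_coeff k p))^2)"
 by (subst mp_expansion[OF assms]) (rule parseval, auto)

lemma cmod_mp_coeff_le:
 assumes "degree p < n" "k < n"
 shows "(cmod (mp_coeff k p))^2 \<le> sech_norm2 p"
 unfolding sech_norm2_expansion[OF assms(1)] using assms(2) by (intro member_le_sum) auto

lemma sech_norm2_smult: "sech_norm2 (smult c p) = (cmod c)^2 * sech_norm2 p"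
 by (simp add: sech_norm2_def norm_mult power_mult_distrib mult.assoc)

lemma sech_norm2_add: "sech_norm2 (p + q) \<le> 2 * sech_norm2 p + 2 * sech_norm2 q"
proof -
 have "(cmod (a + b))^2 \<le> 2 * (cmod a)^2 + 2 * (cmod b)^2" for a b
  using power_mono[OF norm_triangle_ineq[of a b] norm_ge_zero, of 2] sum_squares_bound[of "cmod a" "cmod b"]
  by (simp add: power2_sum)
 hence "(cmod (poly (p + q) (cr x)))^2 * sech_wt x \<le>
   2 * ((cmod (poly p (cr x)))^2 * sech_wt x) + 2 * ((cmod (poly q (cr x)))^2 * sech_wt x)" for x
  using less_imp_le[OF sech_wt_pos[of x]] by (simp add: distrib_right[symmetric] mult.assoc[symmetric] mult_right_mono)
 hence "sech_norm2 (p + q) \<le> (\<integral>x. 2 * ((cmod (poly p (cr x)))^2 * sech_wt x) + 2 * ((cmod (poly q (cr x)))^2 * sech_wt x) \<partial>lborel)"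
  unfolding sech_norm2_def
  by (intro Bochner_Integration.integral_mono Bochner_Integration.integrable_add integrable_mult_right integrable_sech_norm2)
 also have "\<dots> = 2 * sech_norm2 p + 2 * sech_norm2 q"
  unfolding sech_norm2_def
  by (subst Bochner_Integration.integral_add, (intro integrable_mult_right integrable_sech_norm2)+) (simp only: integral_mult_right_zero)
 finally show ?thesis .
qed

text \<open>Twice multiplication by x is the sum of a raising and a lowering part. By Parseval each
  multiplies the norm by at most n on polynomials of degree below n.\<close>

lemma sech_norm2_mult_x:
 assumes "degree p < n"
 shows "sech_norm2 ([:0, 1:] * p) \<le> (real n)^2 * sech_norm2 p"
proof -
 let ?c = "\<lambda>k. mp_coeff k p"
 define X where "X = (\<Sum>k<n. smult (?c k * of_nat (Suc k)) (mp (Suc k)))"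
 define Y where "Y = (\<Sum>k\<in>{1..<n}. smult (?c k * of_nat k) (mp (k - 1)))"
 have "smult 2 ([:0, 1:] * p) = [:0, 2:] * p" by simp
 also have "\<dots> = [:0, 2:] * (\<Sum>k<n. smult (?c k) (mp k))"
  using mp_expansion[OF assms] by (rule arg_cong)
 also have "\<dots> = (\<Sum>k<n. smult (?c k) ([:0, 2:] * mp k))"
  by (simp only: sum_distrib_left mult_smult_right)
 also have "\<dots> = (\<Sum>k<n. smult (?c k * of_nat (Suc k)) (mp (Suc k)) + smult (?c k * of_nat k) (mp (k - 1)))"
  unfolding mp_rec smult_add_right smult_smult ..
 also have "\<dots> = X + (\<Sum>k<n. smult (?c k * of_nat k) (mp (k - 1)))"
  by (simp only: sum.distrib X_def)
 also have "(\<Sum>k<n. smult (?c k * of_nat k) (mp (k - 1))) = Y"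
  unfolding Y_def by (rule sum.mono_neutral_right) auto
 finally have e: "smult 2 ([:0, 1:] * p) = X + Y" .
 have X: "sech_norm2 X \<le> (real n)^2 * sech_norm2 p"
 proof -
  have "sech_norm2 X = (\<Sum>k<n. (cmod (?c k * of_nat (Suc k)))^2)" unfolding X_def by (rule parseval) auto
  also have "\<dots> \<le> (\<Sum>k<n. (real n)^2 * (cmod (?c k))^2)"
  proof (intro sum_mono)
   fix k assume "k \<in> {..<n}"
   hence "(real (Suc k))^2 \<le> (real n)^2" by (intro power_mono) auto
   thus "(cmod (?c k * of_nat (Suc k)))^2 \<le> (real n)^2 * (cmod (?c k))^2"
    by (simp only: norm_mult norm_of_nat power_mult_distrib) (subst mult.commute, intro mult_right_mono, auto)
  qed
  finally show ?thesis by (simp only: sum_distrib_left[symmetric] sech_norm2_expansion[OF assms])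
 qed
 have Y: "sech_norm2 Y \<le> (real n)^2 * sech_norm2 p"
 proof -
  have "sech_norm2 Y = (\<Sum>k\<in>{1..<n}. (cmod (?c k * of_nat k))^2)"
   unfolding Y_def by (rule parseval) (auto simp: inj_on_def)
  also have "\<dots> \<le> (\<Sum>k\<in>{1..<n}. (real n)^2 * (cmod (?c k))^2)"
  proof (intro sum_mono)
   fix k assume "k \<in> {1..<n}"
   hence "(real k)^2 \<le> (real n)^2" by (intro power_mono) auto
   thus "(cmod (?c k * of_nat k))^2 \<le> (real n)^2 * (cmod (?c k))^2"
    by (simp only: norm_mult norm_of_nat power_mult_distrib) (subst mult.commute, intro mult_right_mono, auto)
  qed
  also have "\<dots> \<le> (\<Sum>k<n. (real n)^2 * (cmod (?c k))^2)" by (intro sum_mono2) auto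
  finally show ?thesis by (simp only: sum_distrib_left[symmetric] sech_norm2_expansion[OF assms])
 qed
 have "4 * sech_norm2 ([:0, 1:] * p) = sech_norm2 (X + Y)"
  unfolding e[symmetric] by (subst sech_norm2_smult) simp
 also have "\<dots> \<le> 2 * sech_norm2 X + 2 * sech_norm2 Y" by (rule sech_norm2_add)
 finally show ?thesis using X Y by linarith
qed

text \<open>The arithmetic-geometric inequality \<bar>x\<bar> \<le> x^2 / (2n) + n/2 reduces the
  claim to the bound for multiplication by x.\<close>

lemma sech_norm2_abs_x:
 assumes "degree p < n"
 shows "integrable lborel (\<lambda>x. \<bar>x\<bar> * ((cmod (poly p (cr x)))^2 * sech_wt x))"
  and "(\<integral>x. \<bar>x\<bar> * ((cmod (poly p (cr x)))^2 * sech_wt x) \<partial>lborel) \<le> real n * sech_norm2 p"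
proof -
 let ?g = "\<lambda>x. (cmod (poly p (cr x)))^2 * sech_wt x"
 let ?h = "\<lambda>x. (cmod (poly ([:0, 1:] * p) (cr x)))^2 * sech_wt x"
 have n: "real n > 0" using assms by simp
 have h: "?h x = x^2 * ?g x" for x by (simp add: norm_mult power_mult_distrib)
 have g0: "?g x \<ge> 0" for x using less_imp_le[OF sech_wt_pos[of x]] by simp
 have pw: "\<bar>x\<bar> * ?g x \<le> 1 / (2 * real n) * ?h x + real n / 2 * ?g x" for x
 proof -
  have "0 \<le> (\<bar>x\<bar> - real n)^2 / (2 * real n)" using n by simp
  hence "\<bar>x\<bar> \<le> 1 / (2 * real n) * x^2 + real n / 2" using n by (simp add: power2_diff field_simps power2_eq_square)
  from mult_right_mono[OF this g0[of x]] show ?thesis unfolding h by (simp add: algebra_simps)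
 qed
 have ih: "integrable lborel (\<lambda>x. 1 / (2 * real n) * ?h x + real n / 2 * ?g x)"
  by (intro Bochner_Integration.integrable_add integrable_mult_right integrable_sech_norm2)
 have m: "?g \<in> borel_measurable borel" using integrable_sech_norm2[of p] by (auto dest: borel_measurable_integrable)
 show i: "integrable lborel (\<lambda>x. \<bar>x\<bar> * ?g x)"
 proof (rule Bochner_Integration.integrable_bound[OF ih])
  show "(\<lambda>x. \<bar>x\<bar> * ?g x) \<in> borel_measurable lborel" using m by measurable
  show "AE x in lborel. norm (\<bar>x\<bar> * ?g x) \<le> norm (1 / (2 * real n) * ?h x + real n / 2 * ?g x)"
  proof (rule AE_I2)
   fix x
   have "norm (\<bar>x\<bar> * ?g x) = \<bar>x\<bar> * ?g x" using less_imp_le[OF sech_wt_pos[of x]] by (simp add: abs_mult)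
   also have "\<dots> \<le> norm (1 / (2 * real n) * ?h x + real n / 2 * ?g x)" using pw[of x] by (simp only: real_norm_def)
   finally show "norm (\<bar>x\<bar> * ?g x) \<le> norm (1 / (2 * real n) * ?h x + real n / 2 * ?g x)" .
  qed
 qed
 have "(\<integral>x. \<bar>x\<bar> * ?g x \<partial>lborel) \<le> (\<integral>x. 1 / (2 * real n) * ?h x + real n / 2 * ?g x \<partial>lborel)"
  by (rule Bochner_Integration.integral_mono[OF i ih pw])
 also have "\<dots> = 1 / (2 * real n) * sech_norm2 ([:0, 1:] * p) + real n / 2 * sech_norm2 p"
  unfolding sech_norm2_def
  by (subst Bochner_Integration.integral_add, (intro integrable_mult_right integrable_sech_norm2)+) (simp only: integral_mult_right_zero)
 also have "\<dots> \<le> 1 / (2 * real n) * ((real n)^2 * sech_norm2 p) + real n / 2 * sech_norm2 p"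
  using n by (intro add_mono mult_left_mono sech_norm2_mult_x assms) auto
 also have "\<dots> = real n * sech_norm2 p" using n by (simp add: field_simps power2_eq_square)
 finally show "(\<integral>x. \<bar>x\<bar> * ?g x \<partial>lborel) \<le> real n * sech_norm2 p" .
qed

text \<open>Cauchy-Schwarz with the reproducing kernel on the diagonal: it converts closeness in the
  sech norm into a pointwise estimate at complex points.\<close>

lemma cmod_poly_le:
 assumes "degree p < n"
 shows "cmod (poly p z) \<le> sqrt (sech_norm2 p) * sqrt (\<Sum>k<n. (cmod (poly (mp k) z))^2)"
proof -
 have "poly p z = (\<Sum>k<n. mp_coeff k p * poly (mp k) z)"
  by (subst mp_expansion[OF assms]) (simp add: poly_sum)
 hence "cmod (poly p z) \<le> (\<Sum>k<n. \<bar>cmod (mp_coeff k p)\<bar> * \<bar>cmod (poly (mp k) z)\<bar>)"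
  by (auto intro!: order_trans[OF norm_sum] simp: norm_mult)
 also have "\<dots> \<le> L2_set (\<lambda>k. cmod (mp_coeff k p)) {..<n} * L2_set (\<lambda>k. cmod (poly (mp k) z)) {..<n}"
  by (rule L2_set_mult_ineq)
 finally show ?thesis by (simp add: L2_set_def sech_norm2_expansion[OF assms])
qed

lemma sech_inner_mp_low:
 assumes "degree p < n" "n \<le> m"
 shows "sech_inner (mp m) p = 0"
 by (subst mp_expansion[OF assms(1)], subst sech_inner_sum_right) (use assms(2) in \<open>auto simp: sech_inner_mp\<close>)

section \<open>The sector-valued weight\<close>

text \<open>In terms of the modified Bessel function, \<open>bessel_weight \<nu> x = 2 \<surd>2 K\<^sub>\<nu>(\<pi> \<bar>x\<bar>)\<close>.\<close>

definition bessel_weight :: "real \<Rightarrow> real \<Rightarrow> real" where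
 "bessel_weight \<nu> x = 2 * exp (- (pi * \<bar>x\<bar>)) * \<bar>x\<bar> powr (- 1 / 2) * bessel_K_factor \<nu> (pi * \<bar>x\<bar>)"

definition sector_weight :: "real \<Rightarrow> real \<Rightarrow> complex" where
 "sector_weight \<nu> x = cr (bessel_weight \<nu> x) * cis (- (sgn x * (pi * \<nu> / 2)))"

text \<open>The factor by which the Bessel weight departs from \<bar>x\<bar>^(-1/2) sech (\<pi> x),
  see \<open>bessel_weight_eq\<close>; it tends to 1 at infinity.\<close>

definition weight_ratio :: "real \<Rightarrow> real \<Rightarrow> real" where
 "weight_ratio \<nu> x = (1 + exp (- (2 * pi * \<bar>x\<bar>))) * bessel_K_factor \<nu> (pi * \<bar>x\<bar>)"

lemma bessel_weight_measurable [measurable]: "bessel_weight \<nu> \<in> borel_measurable borel"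
 unfolding bessel_weight_def[abs_def] by measurable

lemma weight_ratio_measurable [measurable]: "weight_ratio \<nu> \<in> borel_measurable borel"
 unfolding weight_ratio_def[abs_def] by measurable

lemma bessel_weight_0 [simp]: "bessel_weight \<nu> 0 = 0"
 by (simp add: bessel_weight_def)

lemma sech_wt_exp: "sech_wt x * (1 + exp (- (2 * pi * \<bar>x\<bar>))) = 2 * exp (- (pi * \<bar>x\<bar>))"
proof -
 have "cosh (pi * x) = cosh (pi * \<bar>x\<bar>)" by (cases "x \<ge> 0") auto
 also have "\<dots> = (exp (pi * \<bar>x\<bar>) + exp (- (pi * \<bar>x\<bar>))) / 2" by (simp add: cosh_field_def)
 also have "\<dots> = exp (pi * \<bar>x\<bar>) * (1 + exp (- (2 * pi * \<bar>x\<bar>))) / 2"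
  by (simp add: distrib_left exp_add[symmetric] algebra_simps)
 finally have c: "cosh (pi * x) = exp (pi * \<bar>x\<bar>) * (1 + exp (- (2 * pi * \<bar>x\<bar>))) / 2" .
 have "1 + exp (- (2 * pi * \<bar>x\<bar>)) \<noteq> 0" using exp_gt_zero[of "- (2 * pi * \<bar>x\<bar>)"] by linarith
 moreover have "1 / (a * E / 2) * E = 2 * inverse a" if "a \<noteq> 0" "E \<noteq> 0" for a E :: real
  using that by (simp add: field_simps)
 ultimately show ?thesis unfolding sech_wt_def c exp_minus[of "pi * \<bar>x\<bar>"] by simp
qed

lemma bessel_weight_eq:
 assumes "x \<noteq> 0"
 shows "bessel_weight \<nu> x = sech_wt x * weight_ratio \<nu> x / sqrt \<bar>x\<bar>"
proof -
 have "bessel_weight \<nu> x = (sech_wt x * (1 + exp (- (2 * pi * \<bar>x\<bar>)))) * \<bar>x\<bar> powr (- 1 / 2) * bessel_K_factor \<nu> (pi * \<bar>x\<bar>)"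
  unfolding sech_wt_exp bessel_weight_def ..
 also have "\<bar>x\<bar> powr (- 1 / 2) = 1 / sqrt \<bar>x\<bar>"
  using powr_minus_divide[of "\<bar>x\<bar>" "1 / 2"] by (simp add: powr_half_sqrt)
 finally show ?thesis by (simp add: weight_ratio_def)
qed

context
 fixes \<nu> :: real
 assumes \<nu>: "0 < \<nu>" "\<nu> \<le> 1 / 2"
begin

lemma weight_ratio_bounds:
 assumes "x \<noteq> 0"
 shows "0 < weight_ratio \<nu> x" "weight_ratio \<nu> x \<le> 2"
  and "2 / 3 * sqrt (pi * \<bar>x\<bar> / (1 + pi * \<bar>x\<bar>)) \<le> weight_ratio \<nu> x"
proof -
 have y: "pi * \<bar>x\<bar> > 0" using assms by simp
 let ?f = "bessel_K_factor \<nu> (pi * \<bar>x\<bar>)" and ?e = "exp (- (2 * pi * \<bar>x\<bar>))"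
 have l: "2 / 3 * sqrt (pi * \<bar>x\<bar> / (1 + pi * \<bar>x\<bar>)) \<le> ?f" by (rule bessel_K_factor_ge[OF \<nu> y])
 have p: "0 < 2 / 3 * sqrt (pi * \<bar>x\<bar> / (1 + pi * \<bar>x\<bar>))" using y by simp
 have f0: "?f > 0" using l p by linarith
 have f1: "?f \<le> 1" by (rule bessel_K_factor_le_1[OF \<nu> y])
 have e: "0 < ?e" "?e \<le> 1" by auto
 show "0 < weight_ratio \<nu> x" unfolding weight_ratio_def using f0 e by (intro mult_pos_pos) linarith+
 have "weight_ratio \<nu> x \<le> 2 * 1" unfolding weight_ratio_def using f0 f1 e by (intro mult_mono) auto
 thus "weight_ratio \<nu> x \<le> 2" by simp
 have "1 * ?f \<le> weight_ratio \<nu> x" unfolding weight_ratio_def using f0 e by (intro mult_right_mono) auto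
 thus "2 / 3 * sqrt (pi * \<bar>x\<bar> / (1 + pi * \<bar>x\<bar>)) \<le> weight_ratio \<nu> x" using l by linarith
qed

lemma bessel_weight_nonneg: "0 \<le> bessel_weight \<nu> x"
proof (cases "x = 0")
 case False
 thus ?thesis using bessel_weight_eq[OF False, of \<nu>] weight_ratio_bounds(1)[OF False] sech_wt_pos[of x]
  by (simp add: less_imp_le)
qed simp

lemma bessel_weight_pos: "x \<noteq> 0 \<Longrightarrow> 0 < bessel_weight \<nu> x"
 using bessel_weight_eq[of x \<nu>] weight_ratio_bounds(1)[of x] sech_wt_pos[of x] by simp

text \<open>Near 0 the ratio is only known to be bounded below by a multiple of sqrt \<bar>x\<bar>,
  so its reciprocal must be paired with that root. The constant works out because 3/2 \<le> sqrt
  \<pi>.\<close>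

lemma weight_ratio_sqrt:
 assumes "x \<noteq> 0"
 shows "sqrt \<bar>x\<bar> / weight_ratio \<nu> x \<le> sqrt (1 + pi * \<bar>x\<bar>)"
proof -
 have px: "pi * \<bar>x\<bar> > 0" using assms by simp
 have "sqrt \<bar>x\<bar> * (3 / 2) \<le> sqrt \<bar>x\<bar> * sqrt pi"
 proof (intro mult_left_mono)
  have "sqrt ((3 / 2)^2) \<le> sqrt pi" using pi_gt3 by (intro real_sqrt_le_mono) (simp add: power2_eq_square)
  thus "3 / 2 \<le> sqrt pi" by (simp only: real_sqrt_abs)
 qed simp
 also have "\<dots> = sqrt (pi * \<bar>x\<bar>)" by (simp add: real_sqrt_mult)
 also have "\<dots> = (sqrt (1 + pi * \<bar>x\<bar>) * (2 / 3 * sqrt (pi * \<bar>x\<bar> / (1 + pi * \<bar>x\<bar>)))) * (3 / 2)"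
  using px by (simp add: real_sqrt_divide real_sqrt_eq_zero_cancel_iff)
 also have "\<dots> \<le> (sqrt (1 + pi * \<bar>x\<bar>) * weight_ratio \<nu> x) * (3 / 2)"
  using weight_ratio_bounds(3)[OF assms] px by (intro mult_right_mono mult_left_mono) auto
 finally have "sqrt \<bar>x\<bar> \<le> sqrt (1 + pi * \<bar>x\<bar>) * weight_ratio \<nu> x" by simp
 thus ?thesis using weight_ratio_bounds(1)[OF assms] by (simp add: divide_le_eq)
qed

lemma bessel_weight_ge:
 assumes "x \<noteq> 0"
 shows "sech_wt x / sqrt (1 + pi * \<bar>x\<bar>) \<le> bessel_weight \<nu> x"
proof -
 have w: "0 < weight_ratio \<nu> x" "0 < sqrt \<bar>x\<bar>" "0 < sqrt (1 + pi * \<bar>x\<bar>)" using weight_ratio_bounds(1)[OF assms] assms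
  by (auto simp: add_pos_nonneg)
 have "1 / sqrt (1 + pi * \<bar>x\<bar>) \<le> weight_ratio \<nu> x / sqrt \<bar>x\<bar>"
  using weight_ratio_sqrt[OF assms] w by (simp add: divide_simps mult_ac)
 from mult_left_mono[OF this less_imp_le[OF sech_wt_pos[of x]]] show ?thesis
  unfolding bessel_weight_eq[OF assms] by simp
qed

lemma weight_ratio_eventually:
 assumes "\<eta> > 0"
 obtains X where "X > 0" "\<And>x. X \<le> \<bar>x\<bar> \<Longrightarrow> \<bar>weight_ratio \<nu> x - 1\<bar> \<le> \<eta> \<and> \<bar>1 / weight_ratio \<nu> x - 1\<bar> \<le> \<eta>"
proof -
 define g where "g y = (1 + exp (- (2 * y))) * bessel_K_factor \<nu> y" for y
 have e: "((\<lambda>y::real. exp (- (2 * y))) \<longlongrightarrow> 0) at_top" by real_asymp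
 have "(g \<longlongrightarrow> (1 + 0) * 1) at_top"
  unfolding g_def[abs_def] by (intro tendsto_intros e tendsto_bessel_K_factor[OF \<nu>])
 hence g: "(g \<longlongrightarrow> 1) at_top" by simp
 hence "((\<lambda>y. 1 / g y) \<longlongrightarrow> 1 / 1) at_top" by (intro tendsto_intros) auto
 hence g': "((\<lambda>y. 1 / g y) \<longlongrightarrow> 1) at_top" by simp
 have "\<forall>\<^sub>F y in at_top. dist (g y) 1 < \<eta> \<and> dist (1 / g y) 1 < \<eta> \<and> y > 0"
  using tendstoD[OF g assms] tendstoD[OF g' assms] eventually_gt_at_top[of 0] by eventually_elim auto
 then obtain Y where Y: "\<And>y. Y \<le> y \<Longrightarrow> dist (g y) 1 < \<eta> \<and> dist (1 / g y) 1 < \<eta> \<and> y > 0"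
  by (auto simp: eventually_at_top_linorder)
 have "\<bar>weight_ratio \<nu> x - 1\<bar> \<le> \<eta> \<and> \<bar>1 / weight_ratio \<nu> x - 1\<bar> \<le> \<eta>" if x: "max Y 1 \<le> \<bar>x\<bar>" for x
 proof -
  have "1 * \<bar>x\<bar> \<le> pi * \<bar>x\<bar>" using pi_gt3 by (intro mult_right_mono) auto
  hence "Y \<le> pi * \<bar>x\<bar>" using x by linarith
  moreover have "weight_ratio \<nu> x = g (pi * \<bar>x\<bar>)" by (simp add: weight_ratio_def g_def)
  ultimately show ?thesis using Y[of "pi * \<bar>x\<bar>"] by (simp add: dist_real_def)
 qed
 thus ?thesis by (intro that[of "max Y 1"]) auto
qed

text \<open>Condition \<open>rK\<close> of \<open>tendsto_combo_perturbed\<close> for the ratio and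
  for its reciprocal: far out both are within \<eta> of 1, and on a bounded set the weighted
  deviation is bounded.\<close>

lemma weight_ratio_perturbation:
 assumes "\<eta> > 0"
 shows "\<exists>K. \<forall>x. (\<bar>x\<bar> * sqrt \<bar>x\<bar>) * \<bar>weight_ratio \<nu> x - 1\<bar> \<le> \<eta> * (\<bar>x\<bar> * sqrt \<bar>x\<bar>) + K"
  and "\<exists>K. \<forall>x. sqrt \<bar>x\<bar> * \<bar>1 / weight_ratio \<nu> x - 1\<bar> \<le> \<eta> * sqrt \<bar>x\<bar> + K"
proof -
 obtain X where X: "X > 0" "\<And>x. X \<le> \<bar>x\<bar> \<Longrightarrow> \<bar>weight_ratio \<nu> x - 1\<bar> \<le> \<eta> \<and> \<bar>1 / weight_ratio \<nu> x - 1\<bar> \<le> \<eta>"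
  by (rule weight_ratio_eventually[OF assms]) (rule that)
 have "(\<bar>x\<bar> * sqrt \<bar>x\<bar>) * \<bar>weight_ratio \<nu> x - 1\<bar> \<le> \<eta> * (\<bar>x\<bar> * sqrt \<bar>x\<bar>) + X * sqrt X" for x
 proof (cases "X \<le> \<bar>x\<bar>")
  case True
  have "(\<bar>x\<bar> * sqrt \<bar>x\<bar>) * \<bar>weight_ratio \<nu> x - 1\<bar> \<le> (\<bar>x\<bar> * sqrt \<bar>x\<bar>) * \<eta>"
   using X(2)[OF True] by (intro mult_left_mono) auto
  moreover have "0 \<le> X * sqrt X" using X(1) by simp
  ultimately show ?thesis by (simp add: mult.commute)
 next
  case False
  have "(\<bar>x\<bar> * sqrt \<bar>x\<bar>) * \<bar>weight_ratio \<nu> x - 1\<bar> \<le> (X * sqrt X) * 1"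
  proof (cases "x = 0")
   case True
   thus ?thesis using X(1) by simp
  next
   case x: False
   show ?thesis using False X(1) weight_ratio_bounds(1,2)[OF x] by (intro mult_mono) auto
  qed
  moreover have "0 \<le> \<eta> * (\<bar>x\<bar> * sqrt \<bar>x\<bar>)" using assms by simp
  ultimately show ?thesis by linarith
 qed
 thus "\<exists>K. \<forall>x. (\<bar>x\<bar> * sqrt \<bar>x\<bar>) * \<bar>weight_ratio \<nu> x - 1\<bar> \<le> \<eta> * (\<bar>x\<bar> * sqrt \<bar>x\<bar>) + K" by blast
 have "sqrt \<bar>x\<bar> * \<bar>1 / weight_ratio \<nu> x - 1\<bar> \<le> \<eta> * sqrt \<bar>x\<bar> + (sqrt (1 + pi * X) + sqrt X)" for x
 proof (cases "X \<le> \<bar>x\<bar>")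
  case True
  have "sqrt \<bar>x\<bar> * \<bar>1 / weight_ratio \<nu> x - 1\<bar> \<le> sqrt \<bar>x\<bar> * \<eta>"
   using X(2)[OF True] by (intro mult_left_mono) auto
  moreover have "0 \<le> sqrt (1 + pi * X) + sqrt X" using X(1) by simp
  ultimately show ?thesis by (simp add: mult.commute)
 next
  case False
  have "sqrt \<bar>x\<bar> * \<bar>1 / weight_ratio \<nu> x - 1\<bar> \<le> sqrt (1 + pi * X) + sqrt X"
  proof (cases "x = 0")
   case True
   thus ?thesis using X(1) by simp
  next
   case x: False
   have "\<bar>1 / weight_ratio \<nu> x - 1\<bar> \<le> 1 / weight_ratio \<nu> x + 1"
    using weight_ratio_bounds(1)[OF x] by (simp add: abs_le_iff)
   hence "sqrt \<bar>x\<bar> * \<bar>1 / weight_ratio \<nu> x - 1\<bar> \<le> sqrt \<bar>x\<bar> * (1 / weight_ratio \<nu> x + 1)" by (intro mult_left_mono) auto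
   also have "\<dots> = sqrt \<bar>x\<bar> / weight_ratio \<nu> x + sqrt \<bar>x\<bar>" by (simp add: distrib_left)
   also have "sqrt \<bar>x\<bar> / weight_ratio \<nu> x \<le> sqrt (1 + pi * \<bar>x\<bar>)" by (rule weight_ratio_sqrt[OF x])
   also have "sqrt (1 + pi * \<bar>x\<bar>) + sqrt \<bar>x\<bar> \<le> sqrt (1 + pi * X) + sqrt X"
    using False by (intro add_mono real_sqrt_le_mono mult_left_mono) auto
   finally show ?thesis by simp
  qed
  moreover have "0 \<le> \<eta> * sqrt \<bar>x\<bar>" using assms by simp
  ultimately show ?thesis by linarith
 qed
 thus "\<exists>K. \<forall>x. sqrt \<bar>x\<bar> * \<bar>1 / weight_ratio \<nu> x - 1\<bar> \<le> \<eta> * sqrt \<bar>x\<bar> + K" by blast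
qed

lemma bessel_weight_half_moment:
 "has_bochner_integral lborel (\<lambda>x. indicator {0<..} x * (x ^ j * bessel_weight \<nu> x))
   (2 * pi powr (- 1 / 2) * bessel_K_moment \<nu> j / pi ^ j)"
proof -
 have "has_bochner_integral lborel (\<lambda>x. indicator {0<..} (0 + pi * x) *
   ((0 + pi * x) powr (real j - 1 / 2) * exp (- (0 + pi * x)) * bessel_K_factor \<nu> (0 + pi * x))) (bessel_K_moment \<nu> j /\<^sub>R \<bar>pi\<bar>)"
  using has_bochner_integral_bessel_K[OF \<nu>, of j] by (subst lborel_has_bochner_integral_real_affine_iff[symmetric]) simp_all
 hence h: "has_bochner_integral lborel (\<lambda>x. 2 * pi powr (1 / 2 - real j) * (indicator {0<..} (0 + pi * x) *
   ((0 + pi * x) powr (real j - 1 / 2) * exp (- (0 + pi * x)) * bessel_K_factor \<nu> (0 + pi * x))))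
   (2 * pi powr (1 / 2 - real j) * (bessel_K_moment \<nu> j /\<^sub>R \<bar>pi\<bar>))"
  by (rule has_bochner_integral_mult_right)
 have f: "2 * pi powr (1 / 2 - real j) * (indicator {0<..} (0 + pi * x) *
   ((0 + pi * x) powr (real j - 1 / 2) * exp (- (0 + pi * x)) * bessel_K_factor \<nu> (0 + pi * x))) =
   indicator {0<..} x * (x ^ j * bessel_weight \<nu> x)" for x
 proof (cases "x > 0")
  case True
  have "pi powr (1 / 2 - real j) * (pi * x) powr (real j - 1 / 2) = x powr (real j - 1 / 2)"
   using True powr_add[of pi "1 / 2 - real j" "real j - 1 / 2"] by (simp add: powr_mult)
  also have "\<dots> = x ^ j * x powr (- 1 / 2)"
   using True powr_add[of x "real j" "- 1 / 2"] by (simp add: powr_realpow)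
  finally have e: "pi powr (1 / 2 - real j) * (pi * x) powr (real j - 1 / 2) = x ^ j * x powr (- 1 / 2)" .
  have "2 * pi powr (1 / 2 - real j) * (indicator {0<..} (0 + pi * x) *
   ((0 + pi * x) powr (real j - 1 / 2) * exp (- (0 + pi * x)) * bessel_K_factor \<nu> (0 + pi * x))) =
   2 * (pi powr (1 / 2 - real j) * (pi * x) powr (real j - 1 / 2)) * exp (- (pi * x)) * bessel_K_factor \<nu> (pi * x)"
   using True by simp
  thus ?thesis unfolding e using True by (simp add: bessel_weight_def)
 qed (auto simp: indicator_def zero_less_mult_iff)
 have v: "2 * pi powr (1 / 2 - real j) * (bessel_K_moment \<nu> j /\<^sub>R \<bar>pi\<bar>) = 2 * pi powr (- 1 / 2) * bessel_K_moment \<nu> j / pi ^ j"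
 proof -
  have "pi powr (1 / 2 - real j) = pi powr (- 1 / 2) * pi powr 1 * pi powr (- real j)"
   unfolding powr_add[symmetric] by simp
  also have "pi powr (- real j) = 1 / pi ^ j"
   using powr_minus_divide[of pi "real j"] powr_realpow[OF pi_gt_zero, of j] by (simp only:)
  also have "pi powr 1 = pi" using pi_gt_zero by (simp only: powr_one)
  finally have e: "pi powr (1 / 2 - real j) = pi powr (- 1 / 2) * pi * (1 / pi ^ j)" .
  show ?thesis unfolding e using pi_gt_zero by (simp add: field_simps)
 qed
 show ?thesis using h unfolding f v .
qed

text \<open>The half-line moments combine with the factor i^j (cis (-\<theta>) + (-1)^j cis
  \<theta>). With i^2 = -1 absorbed, both sides obey the same two-step recurrence; the cases j = 0
  and 1 are \<open>bessel_K_moment_0_1\<close>. The regularized functional thus becomes an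
  absolutely convergent integral.\<close>

lemma has_bochner_integral_sector_moment:
 "has_bochner_integral lborel (\<lambda>x. (\<i> * cr (pi * x)) ^ j * sector_weight \<nu> x)
   (cr (4 * pi powr (- 1 / 2) * bessel_K_moment \<nu> 0 * cos (pi * \<nu> / 2) * bessel_moment \<nu> j))"
proof -
 define \<theta> where "\<theta> = pi * \<nu> / 2"
 define c where "c = 2 * pi powr (- 1 / 2) * bessel_K_moment \<nu> j / pi ^ j"
 define R where "R x = indicator {0<..} x * (x ^ j * bessel_weight \<nu> x)" for x
 have hR: "has_bochner_integral lborel R c" unfolding R_def[abs_def] c_def by (rule bessel_weight_half_moment)
 have hL: "has_bochner_integral lborel (\<lambda>x. R (0 + - 1 * x)) c"
  using lborel_has_bochner_integral_real_affine_iff[of "- 1" R c 0] hR by simp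
 define T where "T = \<i> ^ j * (cis (- \<theta>) + (- 1) ^ j * cis \<theta>)"
 have h: "has_bochner_integral lborel (\<lambda>x. (\<i> * cr pi) ^ j * cis (- \<theta>) * cr (R x) +
   (\<i> * cr pi) ^ j * (- 1) ^ j * cis \<theta> * cr (R (0 + - 1 * x)))
   ((\<i> * cr pi) ^ j * cis (- \<theta>) * cr c + (\<i> * cr pi) ^ j * (- 1) ^ j * cis \<theta> * cr c)"
  by (intro has_bochner_integral_add has_bochner_integral_mult_right has_bochner_integral_of_real hR hL)
 have f: "(\<i> * cr pi) ^ j * cis (- \<theta>) * cr (R x) +
   (\<i> * cr pi) ^ j * (- 1) ^ j * cis \<theta> * cr (R (0 + - 1 * x)) =
   (\<i> * cr (pi * x)) ^ j * sector_weight \<nu> x" for x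
 proof (cases x "0 :: real" rule: linorder_cases)
  case less
  have "(- 1) ^ j * cr ((- x) ^ j) = cr (x ^ j)"
   by (simp add: power_mult_distrib[symmetric])
  moreover have "bessel_weight \<nu> (- x) = bessel_weight \<nu> x" by (simp add: bessel_weight_def)
  ultimately show ?thesis using less
   by (simp add: R_def sector_weight_def \<theta>_def power_mult_distrib mult_ac)
 next
  case greater
  thus ?thesis by (simp add: R_def sector_weight_def \<theta>_def power_mult_distrib mult_ac)
 qed (simp add: R_def sector_weight_def)
 have v1: "(\<i> * cr pi) ^ j * cis (- \<theta>) * cr c + (\<i> * cr pi) ^ j * (- 1) ^ j * cis \<theta> * cr c =
   cr (2 * pi powr (- 1 / 2) * bessel_K_moment \<nu> j) * T"
  by (simp add: c_def T_def power_mult_distrib field_simps)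
 have "cr (bessel_K_moment \<nu> j) * (\<i> ^ j * (cis (- \<theta>) + (- 1) ^ j * cis \<theta>)) =
   cr (2 * bessel_K_moment \<nu> 0 * cos \<theta> * bessel_moment \<nu> j) \<and>
   cr (bessel_K_moment \<nu> (Suc j)) * (\<i> ^ Suc j * (cis (- \<theta>) + (- 1) ^ Suc j * cis \<theta>)) =
   cr (2 * bessel_K_moment \<nu> 0 * cos \<theta> * bessel_moment \<nu> (Suc j))"
 proof (induction j)
  case 0
  have "\<i> * (cis (- \<theta>) - cis \<theta>) = cr (2 * sin \<theta>)" by (simp add: complex_eq_iff)
  moreover have "cis (- \<theta>) + cis \<theta> = cr (2 * cos \<theta>)" by (simp add: complex_eq_iff)
  moreover have "bessel_K_moment \<nu> (Suc 0) * (2 * sin \<theta>) = 2 * bessel_K_moment \<nu> 0 * cos \<theta> * \<nu>"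
   using bessel_K_moment_0_1(2)[OF \<nu>] by (simp add: \<theta>_def)
  ultimately show ?case by (simp add: of_real_mult[symmetric] mult_ac del: of_real_mult)
 next
  case (Suc j)
  have "cr (bessel_K_moment \<nu> (Suc (Suc j))) * (\<i> ^ Suc (Suc j) * (cis (- \<theta>) + (- 1) ^ Suc (Suc j) * cis \<theta>)) =
    cr (\<nu>^2 - (real j + 1)^2) * (cr (bessel_K_moment \<nu> j) * (\<i> ^ j * (cis (- \<theta>) + (- 1) ^ j * cis \<theta>)))"
   unfolding bessel_K_moment_rec[OF \<nu>] by (simp add: algebra_simps)
  also have "\<dots> = cr (\<nu>^2 - (real j + 1)^2) * cr (2 * bessel_K_moment \<nu> 0 * cos \<theta> * bessel_moment \<nu> j)"
   using Suc by (simp only:)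
  also have "\<dots> = cr (2 * bessel_K_moment \<nu> 0 * cos \<theta> * bessel_moment \<nu> (Suc (Suc j)))"
   by (simp only: of_real_mult[symmetric] bessel_moment.simps) (simp add: mult_ac)
  finally show ?case using Suc by blast
 qed
 hence v2: "cr (2 * pi powr (- 1 / 2) * bessel_K_moment \<nu> j) * T =
   cr (2 * pi powr (- 1 / 2)) * cr (2 * bessel_K_moment \<nu> 0 * cos \<theta> * bessel_moment \<nu> j)"
  unfolding T_def of_real_mult by (simp only: mult.assoc)
 have v3: "cr (2 * pi powr (- 1 / 2)) * cr (2 * bessel_K_moment \<nu> 0 * cos \<theta> * bessel_moment \<nu> j) =
   cr (4 * pi powr (- 1 / 2) * bessel_K_moment \<nu> 0 * cos (pi * \<nu> / 2) * bessel_moment \<nu> j)"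
  unfolding of_real_mult[symmetric] \<theta>_def by (rule arg_cong[where f = of_real]) simp
 show ?thesis using h unfolding f v1 v2 v3 .
qed

end

section \<open>From the regularized polynomials to their limit\<close>

lemma moment_functional_scale: "moment_functional (\<lambda>j. K * m j) p = K * moment_functional m p"
 by (simp add: moment_functional_def sum_distrib_left mult_ac)

lemma moment_OP_scale:
 assumes "K \<noteq> 0"
 shows "moment_OP (\<lambda>j. K * m j) n = moment_OP m n"
proof (induction n rule: less_induct)
 case (less n)
 have "(\<Sum>k<n. smult (moment_functional (\<lambda>j. K * m j) (monom 1 n * moment_OP (\<lambda>j. K * m j) k) /
   moment_functional (\<lambda>j. K * m j) (moment_OP (\<lambda>j. K * m j) k * moment_OP (\<lambda>j. K * m j) k)) (moment_OP (\<lambda>j. K * m j) k)) =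
   (\<Sum>k<n. smult (moment_functional m (monom 1 n * moment_OP m k) /
   moment_functional m (moment_OP m k * moment_OP m k)) (moment_OP m k))"
  using assms by (intro sum.cong refl) (simp add: less moment_functional_scale)
 thus ?case by (simp add: moment_OP.simps[of _ n])
qed

lemma has_integral_bessel_moment:
 assumes \<nu>: "0 < \<nu>" and s: "s > 0"
 shows "((\<lambda>x. poly p x * x ^ j * bessel_J \<nu> x * exp (- s * x)) has_integral
   moment_functional (\<lambda>i. laplace_moment (bessel_J \<nu>) i s) (p * monom 1 j)) {0..}"
proof -
 let ?m = "\<lambda>i. laplace_moment (bessel_J \<nu>) i s" and ?q = "p * monom 1 j"
 have 1: "((\<lambda>x. x ^ i * bessel_J \<nu> x * exp (- (s * x))) has_integral ?m i) {0..}" for i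
 proof -
  have si: "set_integrable lborel {0<..} (\<lambda>x. x ^ i * bessel_J \<nu> x * exp (- (s * x)))"
   by (rule intF) (use \<nu> s in auto)
  have "((\<lambda>x. x ^ i * bessel_J \<nu> x * exp (- (s * x))) has_integral ?m i) {0<..}"
   unfolding laplace_moment_def set_borel_integral_eq_integral(2)[OF si]
   using set_borel_integral_eq_integral(1)[OF si] by (rule integrable_integral)
  moreover have "((\<lambda>x. x ^ i * bessel_J \<nu> x * exp (- (s * x))) has_integral ?m i) {0..} \<longleftrightarrow>
    ((\<lambda>x. x ^ i * bessel_J \<nu> x * exp (- (s * x))) has_integral ?m i) {0<..}"
   by (rule has_integral_spike_set_eq; rule negligible_subset[of "{0 :: real}"]) auto
  ultimately show ?thesis by blast
 qed
 have "((\<lambda>x. \<Sum>i\<le>degree ?q. coeff ?q i * (x ^ i * bessel_J \<nu> x * exp (- (s * x)))) has_integral (\<Sum>i\<le>degree ?q. coeff ?q i * ?m i)) {0..}"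
  by (intro has_integral_sum has_integral_mult_right 1) auto
 moreover have "(\<Sum>i\<le>degree ?q. coeff ?q i * (x ^ i * bessel_J \<nu> x * exp (- (s * x)))) = poly p x * x ^ j * bessel_J \<nu> x * exp (- s * x)" for x
 proof -
  have "poly p x * x ^ j = (\<Sum>i\<le>degree ?q. coeff ?q i * x ^ i)"
   unfolding poly_altdef[symmetric] by (simp add: poly_monom)
  thus ?thesis by (simp add: sum_distrib_right mult.assoc)
 qed
 ultimately show ?thesis unfolding moment_functional_def by simp
qed

text \<open>Nonzero limiting norms force nonzero norms of the Laplace moments for small s > 0, so
  there the regularized polynomial is unique and given by Gram-Schmidt; its coefficients converge,
  and the unknown factor \<open>K\<close> cancels.\<close>

lemma is_bessel_OP_moment_OP:
 assumes \<nu>: "0 < \<nu>" and nz: "\<forall>k. moment_norm (bessel_moment \<nu>) k \<noteq> 0"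
 shows "is_bessel_OP \<nu> n (moment_OP (bessel_moment \<nu>) n)"
  and "bessel_OP \<nu> n = map_poly cr (moment_OP (bessel_moment \<nu>) n)"
proof -
 obtain K where K: "K \<noteq> 0" and lim: "\<And>j. ((laplace_moment (bessel_J \<nu>) j) \<longlongrightarrow> K * bessel_moment \<nu> j) (at_right 0)"
  by (rule tendsto_bessel_moments[OF \<nu>]) (rule that)
 let ?lim = "\<lambda>j. K * bessel_moment \<nu> j" and ?m = "\<lambda>s j. laplace_moment (bessel_J \<nu>) j s"
 have nz0: "moment_norm ?lim k \<noteq> 0" for k
  using nz K by (simp add: moment_norm_def moment_OP_scale moment_functional_scale)
 have OP0: "moment_OP ?lim k = moment_OP (bessel_moment \<nu>) k" for k using K by (rule moment_OP_scale)
 have "\<forall>\<^sub>F s in at_right 0. moment_norm (?m s) k \<noteq> 0" for k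
  by (rule tendsto_imp_eventually_ne[OF tendsto_moment_norm[OF lim]]) (use nz0 in auto)
 hence "\<forall>\<^sub>F s in at_right 0. \<forall>k\<in>{..<n}. moment_norm (?m s) k \<noteq> 0"
  by (intro eventually_ball_finite) auto
 moreover have "\<forall>\<^sub>F s::real in at_right 0. s > 0" by (rule eventually_at_right_less)
 ultimately have ev: "\<forall>\<^sub>F s in at_right 0. s > 0 \<and> (\<forall>k<n. moment_norm (?m s) k \<noteq> 0)"
  by eventually_elim auto
 have char: "is_bessel_OP_reg \<nu> n s q \<longleftrightarrow> q = moment_OP (?m s) n"
  if s: "s > 0" "\<forall>k<n. moment_norm (?m s) k \<noteq> 0" for s q
 proof -
  have eq: "((\<lambda>x. poly q x * x ^ j * bessel_J \<nu> x * exp (- s * x)) has_integral 0) {0..} \<longleftrightarrow>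
    moment_functional (?m s) (q * monom 1 j) = 0" for j q
   using has_integral_bessel_moment[OF \<nu> s(1), of q j] has_integral_unique by metis
  have "degree (monom 1 j :: real poly) < n" if "j < n" for j using that by (simp add: degree_monom_eq)
  hence "moment_functional (?m s) (moment_OP (?m s) n * monom 1 j) = 0" if "j < n" for j
   using that s(2) by (intro moment_OP_orthogonal_poly) auto
  moreover have "q = moment_OP (?m s) n" if "degree q = n" "lead_coeff q = 1" "\<forall>j<n. moment_functional (?m s) (q * monom 1 j) = 0"
   using s(2) that by (intro moment_OP_unique) auto
  ultimately show ?thesis unfolding is_bessel_OP_reg_def eq
   using degree_moment_OP[of "?m s" n] lead_coeff_moment_OP[of "?m s" n] by blast
 qed
 have reg: "(\<exists>!q. is_bessel_OP_reg \<nu> n s q) \<and> bessel_OP_reg \<nu> n s = moment_OP (?m s) n"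
  if s: "s > 0 \<and> (\<forall>k<n. moment_norm (?m s) k \<noteq> 0)" for s
 proof -
  have "is_bessel_OP_reg \<nu> n s = (\<lambda>q. q = moment_OP (?m s) n)" using char[of s] s by (intro ext) blast
  thus ?thesis by (simp add: bessel_OP_reg_def)
 qed
 have lim2: "((\<lambda>s. poly (moment_OP (?m s) n) x) \<longlongrightarrow> poly (moment_OP (bessel_moment \<nu>) n) x) (at_right 0)" for x
 proof -
  have "((\<lambda>s. \<Sum>i\<le>n. coeff (moment_OP (?m s) n) i * x ^ i) \<longlongrightarrow> (\<Sum>i\<le>n. coeff (moment_OP ?lim n) i * x ^ i)) (at_right 0)"
   by (intro tendsto_intros tendsto_moment_OP[OF lim]) (use nz0 in auto)
  thus ?thesis by (simp add: poly_altdef degree_moment_OP OP0)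
 qed
 show isop: "is_bessel_OP \<nu> n (moment_OP (bessel_moment \<nu>) n)"
  unfolding is_bessel_OP_def
 proof (intro conjI allI)
  show "\<forall>\<^sub>F s in at_right 0. \<exists>!q. is_bessel_OP_reg \<nu> n s q"
   using ev by (rule eventually_mono) (use reg in blast)
  show "((\<lambda>s. poly (bessel_OP_reg \<nu> n s) x) \<longlongrightarrow> poly (moment_OP (bessel_moment \<nu>) n) x) (at_right 0)" for x
   using lim2[of x] by (rule Lim_transform_eventually) (rule eventually_mono[OF ev], use reg in simp)
 qed
 have "p = moment_OP (bessel_moment \<nu>) n" if "is_bessel_OP \<nu> n p" for p
 proof -
  have "poly p x = poly (moment_OP (bessel_moment \<nu>) n) x" for x
   using that isop unfolding is_bessel_OP_def
   by (intro tendsto_unique[of "at_right (0::real)" "\<lambda>s. poly (bessel_OP_reg \<nu> n s) x"]) auto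
  thus ?thesis by (auto simp: poly_eq_poly_eq_iff[symmetric] fun_eq_iff)
 qed
 with isop have "(THE p. is_bessel_OP \<nu> n p) = moment_OP (bessel_moment \<nu>) n"
  by (intro the_equality)
 thus "bessel_OP \<nu> n = map_poly cr (moment_OP (bessel_moment \<nu>) n)"
  by (simp only: bessel_OP_def)
qed

section \<open>Coercivity and existence\<close>

lemma degree_diff_less:
 fixes p q :: "'a :: comm_ring poly"
 assumes "degree p \<le> n" "degree q \<le> n" "coeff p n = coeff q n" "n > 0"
 shows "degree (p - q) < n"
proof (rule ccontr)
 assume "\<not> degree (p - q) < n"
 hence d: "degree (p - q) = n" using degree_diff_le[OF assms(1,2)] by simp
 have "lead_coeff (p - q) = 0" using assms(3) unfolding d by simp
 hence "p - q = 0" by (simp only: leading_coeff_0_iff)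
 thus False using d assms(4) by simp
qed

lemma map_poly_add_of_real:
 "map_poly cr (p + q) = map_poly cr p + map_poly cr q"
 by (rule poly_eqI) (simp add: coeff_map_poly)

lemma map_poly_mult_of_real:
 "map_poly cr (p * q) = map_poly cr p * map_poly cr q"
 by (rule poly_eqI) (simp add: coeff_map_poly coeff_mult)

definition imag_poly :: "real poly \<Rightarrow> complex poly" where
 "imag_poly q = pcompose (map_poly cr q) [:0, \<i> * cr pi:]"

lemma poly_imag_poly: "poly (imag_poly q) z = poly (map_poly cr q) (\<i> * cr pi * z)"
 by (simp add: imag_poly_def poly_pcompose mult_ac)

lemma degree_imag_poly: "degree (imag_poly q) = degree q"
 by (simp add: imag_poly_def degree_map_poly degree_pcompose)

lemma lead_coeff_imag_poly: "lead_coeff (imag_poly q) = cr (lead_coeff q) * (\<i> * cr pi) ^ degree q"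
 unfolding imag_poly_def
 by (subst lead_coeff_comp) (auto simp: degree_map_poly coeff_map_poly)

lemma imag_poly_mult: "imag_poly (p * q) = imag_poly p * imag_poly q"
 by (simp add: imag_poly_def map_poly_mult_of_real pcompose_mult)

lemma poly_imag_poly_altdef:
 "poly (imag_poly q) z = (\<Sum>i\<le>degree q. cr (coeff q i) * (\<i> * cr pi * z) ^ i)"
 unfolding poly_imag_poly by (simp add: poly_altdef degree_map_poly coeff_map_poly)

lemma map_poly_pcompose_minus:
 "map_poly cr (pcompose P [:0, -1:]) = pcompose (map_poly cr P) [:0, -1:]"
proof -
 have "map_poly cr (- q) = - map_poly cr q" for q
  by (rule poly_eqI) (simp add: coeff_map_poly)
 thus ?thesis
  by (induction P) (simp_all add: pcompose_pCons map_poly_pCons map_poly_add_of_real map_poly_mult_of_real)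
qed

context
 fixes \<nu> :: real
 assumes \<nu>: "0 < \<nu>" "\<nu> \<le> 1 / 2"
begin

abbreviation "sector_const \<equiv> 4 * pi powr (- 1 / 2) * bessel_K_moment \<nu> 0 * cos (pi * \<nu> / 2)"

lemma cos_sector_pos: "0 < cos (pi * \<nu> / 2)"
proof (rule cos_gt_zero_pi)
 have "0 < pi * \<nu>" "pi * \<nu> \<le> pi * (1 / 2)" using \<nu> by (auto intro!: mult_left_mono)
 thus "- (pi / 2) < pi * \<nu> / 2" "pi * \<nu> / 2 < pi / 2" using pi_gt_zero by linarith+
qed

lemma integrable_sector: "integrable lborel (\<lambda>x. poly p (cr x) * sector_weight \<nu> x)"
proof -
 have "integrable lborel (\<lambda>x. (coeff p j / (\<i> * cr pi) ^ j) * ((\<i> * cr (pi * x)) ^ j * sector_weight \<nu> x))" for j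
  using has_bochner_integral_sector_moment[OF \<nu>, of j] by (intro integrable_mult_right) (simp add: has_bochner_integral_iff)
 hence "integrable lborel (\<lambda>x. \<Sum>j\<le>degree p. (coeff p j / (\<i> * cr pi) ^ j) * ((\<i> * cr (pi * x)) ^ j * sector_weight \<nu> x))"
  by (intro Bochner_Integration.integrable_sum)
 moreover have "(\<Sum>j\<le>degree p. (coeff p j / (\<i> * cr pi) ^ j) * ((\<i> * cr (pi * x)) ^ j * sector_weight \<nu> x)) =
   poly p (cr x) * sector_weight \<nu> x" for x
  unfolding poly_altdef sum_distrib_right by (intro sum.cong refl) (simp add: power_mult_distrib)
 ultimately show ?thesis by (simp only:)
qed

lemma sector_imag_poly:
 "(\<integral>x. poly (imag_poly q) (cr x) * sector_weight \<nu> x \<partial>lborel) =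
   cr (sector_const * moment_functional (bessel_moment \<nu>) q)"
proof -
 have h: "has_bochner_integral lborel (\<lambda>x. \<Sum>i\<le>degree q. cr (coeff q i) * ((\<i> * cr (pi * x)) ^ i * sector_weight \<nu> x))
   (\<Sum>i\<le>degree q. cr (coeff q i) * cr (sector_const * bessel_moment \<nu> i))"
  by (intro has_bochner_integral_sum has_bochner_integral_mult_right has_bochner_integral_sector_moment[OF \<nu>])
 have f: "(\<Sum>i\<le>degree q. cr (coeff q i) * ((\<i> * cr (pi * x)) ^ i * sector_weight \<nu> x)) =
   poly (imag_poly q) (cr x) * sector_weight \<nu> x" for x
  unfolding poly_imag_poly_altdef sum_distrib_right by (intro sum.cong refl) (simp add: mult.assoc)
 have v: "(\<Sum>i\<le>degree q. cr (coeff q i) * cr (sector_const * bessel_moment \<nu> i)) =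
   cr (sector_const * moment_functional (bessel_moment \<nu>) q)"
  unfolding moment_functional_def sum_distrib_left of_real_sum by (intro sum.cong refl) (simp add: mult_ac)
 show ?thesis using h unfolding f v by (rule has_bochner_integral_integral_eq)
qed

definition sector_inner :: "complex poly \<Rightarrow> complex poly \<Rightarrow> complex" where
 "sector_inner p q = (\<integral>x. poly p (cr x) * cnj (poly q (cr x)) * sector_weight \<nu> x \<partial>lborel)"

definition bessel_norm2 :: "complex poly \<Rightarrow> real" where
 "bessel_norm2 p = (\<integral>x. (cmod (poly p (cr x)))^2 * bessel_weight \<nu> x \<partial>lborel)"

lemma integrable_sector_inner:
 "integrable lborel (\<lambda>x. poly p (cr x) * cnj (poly q (cr x)) * sector_weight \<nu> x)"
 using integrable_sector[of "p * map_poly cnj q"] by (simp add: poly_map_cnj)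

lemma integrable_bessel_norm2: "integrable lborel (\<lambda>x. (cmod (poly p (cr x)))^2 * bessel_weight \<nu> x)"
proof -
 have "norm (poly p (cr x) * cnj (poly p (cr x)) * sector_weight \<nu> x) =
   (cmod (poly p (cr x)))^2 * bessel_weight \<nu> x" for x
  using bessel_weight_nonneg[OF \<nu>, of x] by (simp add: norm_mult sector_weight_def power2_eq_square)
 thus ?thesis using integrable_norm[OF integrable_sector_inner[of p p]] by (simp only:)
qed

lemma Re_sector_inner: "Re (sector_inner p p) = cos (pi * \<nu> / 2) * bessel_norm2 p"
proof -
 have "Re (poly p (cr x) * cnj (poly p (cr x)) * sector_weight \<nu> x) =
   cos (pi * \<nu> / 2) * ((cmod (poly p (cr x)))^2 * bessel_weight \<nu> x)" for x
 proof -
  have "bessel_weight \<nu> x * cos (sgn x * (pi * \<nu> / 2)) = bessel_weight \<nu> x * cos (pi * \<nu> / 2)"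
   by (cases x "0 :: real" rule: linorder_cases) auto
  moreover have "poly p (cr x) * cnj (poly p (cr x)) = cr ((cmod (poly p (cr x)))^2)"
   by (simp only: complex_norm_square)
  ultimately show ?thesis by (simp add: sector_weight_def Re_complex_of_real)
 qed
 hence "Re (sector_inner p p) = (\<integral>x. cos (pi * \<nu> / 2) * ((cmod (poly p (cr x)))^2 * bessel_weight \<nu> x) \<partial>lborel)"
  unfolding sector_inner_def integral_Re[OF integrable_sector_inner, symmetric] by (simp only:)
 thus ?thesis by (simp add: bessel_norm2_def)
qed

text \<open>The weight decays like \<open>1 / sqrt \<bar>x\<bar>\<close> relative to \<open>sech (\<pi> x)\<close>; the tangent of \<open>u \<mapsto> 1 / sqrt u\<close> at
 \<open>1 + \<pi> n\<close> reduces the estimate to the bound of multiplication by \<open>x\<close> in degree below \<open>n\<close>.\<close>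

lemma bessel_norm2_ge:
 assumes "degree p < n"
 shows "sech_norm2 p / sqrt (1 + pi * real n) \<le> bessel_norm2 p"
proof -
 define U where "U = 1 + pi * real n"
 have U: "U > 0" using pi_gt_zero by (simp add: U_def add_pos_nonneg)
 let ?g = "\<lambda>x. (cmod (poly p (cr x)))^2 * sech_wt x"
 have tangent: "(3 / 2 - u / (2 * U)) / sqrt U \<le> 1 / sqrt u" if u: "u > 0" for u
 proof -
  define w where "w = sqrt u / sqrt U"
  have w: "w > 0" using u U by (simp add: w_def)
  have "w * w = u / U" using u U by (simp add: w_def)
  hence e: "3 / 2 - u / (2 * U) = 3 / 2 - w * w / 2" by simp
  \<comment> \<open>This expands to w (3 - w^2) \<le> 2, the tangent inequality in the variable w =
    sqrt (u / U), touching at w = 1.\<close>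
  have "0 \<le> (w - 1)^2 * (w + 2)" using w by simp
  hence "w * (3 / 2 - w * w / 2) \<le> 1" by (simp add: power2_eq_square algebra_simps)
  hence "3 / 2 - w * w / 2 \<le> 1 / w" using w by (simp add: pos_le_divide_eq mult.commute)
  hence "(3 / 2 - u / (2 * U)) / sqrt U \<le> (1 / w) / sqrt U" unfolding e using U by (intro divide_right_mono) auto
  also have "\<dots> = 1 / sqrt u" using u U by (simp add: w_def)
  finally show ?thesis .
 qed
 define c d where "c = (3 / 2 - 1 / (2 * U)) / sqrt U" and "d = pi / (2 * U) / sqrt U"
 have d0: "d \<ge> 0" using U by (simp add: d_def)
 have lin: "(3 / 2 - (1 + pi * \<bar>x\<bar>) / (2 * U)) / sqrt U = c - d * \<bar>x\<bar>" for x
  by (simp add: c_def d_def diff_divide_distrib add_divide_distrib)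
 have "(\<integral>x. c * ?g x - d * (\<bar>x\<bar> * ?g x) \<partial>lborel) \<le> bessel_norm2 p"
  unfolding bessel_norm2_def
 proof (rule integral_mono_AE)
  show "integrable lborel (\<lambda>x. c * ?g x - d * (\<bar>x\<bar> * ?g x))"
   by (intro Bochner_Integration.integrable_diff integrable_mult_right integrable_sech_norm2 sech_norm2_abs_x(1)[OF assms])
  show "AE x in lborel. c * ?g x - d * (\<bar>x\<bar> * ?g x) \<le> (cmod (poly p (cr x)))^2 * bessel_weight \<nu> x"
   using AE_lborel_singleton[of "0 :: real"]
  proof eventually_elim
   case (elim x)
   have u: "1 + pi * \<bar>x\<bar> > 0" by (simp add: add_pos_nonneg)
   have "c * ?g x - d * (\<bar>x\<bar> * ?g x) = (c - d * \<bar>x\<bar>) * ?g x" by (simp add: algebra_simps)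
   also have "\<dots> \<le> 1 / sqrt (1 + pi * \<bar>x\<bar>) * ?g x"
    using tangent[OF u] less_imp_le[OF sech_wt_pos[of x]] unfolding lin by (intro mult_right_mono) auto
   also have "\<dots> = (cmod (poly p (cr x)))^2 * (sech_wt x / sqrt (1 + pi * \<bar>x\<bar>))" by simp
   also have "\<dots> \<le> (cmod (poly p (cr x)))^2 * bessel_weight \<nu> x"
    using elim by (intro mult_left_mono bessel_weight_ge[OF \<nu>]) auto
   finally show ?case .
  qed
 qed (rule integrable_bessel_norm2)
 moreover have "(\<integral>x. c * ?g x - d * (\<bar>x\<bar> * ?g x) \<partial>lborel) = c * sech_norm2 p - d * (\<integral>x. \<bar>x\<bar> * ?g x \<partial>lborel)"
  unfolding sech_norm2_def
  by (subst Bochner_Integration.integral_diff, (intro integrable_mult_right integrable_sech_norm2 sech_norm2_abs_x(1)[OF assms])+)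
    (simp only: integral_mult_right_zero)
 moreover have "d * (\<integral>x. \<bar>x\<bar> * ?g x \<partial>lborel) \<le> d * (real n * sech_norm2 p)"
  using sech_norm2_abs_x(2)[OF assms] d0 by (rule mult_left_mono)
 moreover have "c * sech_norm2 p - d * (real n * sech_norm2 p) = (c - d * real n) * sech_norm2 p" by (simp add: algebra_simps)
 moreover have "c - d * real n = 1 / sqrt U"
  using lin[of "real n"] U by (simp add: U_def[symmetric])
 ultimately show ?thesis unfolding U_def by simp
qed

lemma bessel_norm2_pos:
 assumes "p \<noteq> 0"
 shows "0 < bessel_norm2 p"
proof -
 define n where "n = Suc (degree p)"
 have n: "degree p < n" by (simp add: n_def)
 have "sech_norm2 p \<noteq> 0"
 proof
  assume "sech_norm2 p = 0"
  hence "\<forall>k<n. mp_coeff k p = 0" unfolding sech_norm2_expansion[OF n] by (simp add: sum_nonneg_eq_0_iff)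
  hence "p = 0" using mp_expansion[OF n] by simp
  thus False using assms by simp
 qed
 hence "0 < sech_norm2 p / sqrt (1 + pi * real n)"
  using sech_norm2_nonneg[of p] by (simp add: add_pos_nonneg)
 thus ?thesis using bessel_norm2_ge[OF n] by linarith
qed

text \<open>\<open>P\<close> has real coefficients, so on the imaginary axis P(-x) is the conjugate
  of P(x). Hence the functional applied to P(x) P(-x) is, up to a positive factor, the sector form
  of \<open>imag_poly P\<close> with itself, whose real part is positive. As P(-x) agrees with
  (-1)^k P(x) up to lower degree, orthogonality makes the same number (-1)^k times the norm.\<close>

lemma moment_norm_bessel_nonzero: "moment_norm (bessel_moment \<nu>) k \<noteq> 0"
proof (induction k rule: less_induct)
 case (less k)
 let ?L = "moment_functional (bessel_moment \<nu>)"
 define P where "P = moment_OP (bessel_moment \<nu>) k"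
 have P: "degree P = k" "lead_coeff P = 1" unfolding P_def by (rule degree_moment_OP, rule lead_coeff_moment_OP)
 define r where "r = pcompose P [:0, -1:]"
 have r: "degree r = k" "coeff r k = (- 1) ^ k"
 proof -
  show d: "degree r = k" by (simp add: r_def P degree_pcompose)
  have "lead_coeff r = lead_coeff P * (- 1) ^ degree P" unfolding r_def by (subst lead_coeff_comp) auto
  thus "coeff r k = (- 1) ^ k" unfolding P(2) unfolding d P(1) by simp
 qed
 define s where "s = r - smult ((- 1) ^ k) P"
 have "?L (P * s) = 0"
 proof (cases "k = 0")
  case True
  have "degree s = 0" using degree_diff_le[of r k "smult ((- 1) ^ k) P"] r(1) P(1) True by (simp add: s_def)
  moreover have "coeff s 0 = 0" using r(2) P True by (simp add: s_def)
  ultimately have "s = 0" by (metis leading_coeff_0_iff)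
  thus ?thesis by simp
 next
  case False
  have "degree s < k" unfolding s_def
   using r P False by (intro degree_diff_less) auto
  thus ?thesis unfolding P_def using less by (intro moment_OP_orthogonal_poly) auto
 qed
 hence "?L (P * r) = (- 1) ^ k * ?L (P * P)"
  by (simp add: s_def right_diff_distrib moment_functional_diff moment_functional_smult)
 moreover have "?L (P * r) \<noteq> 0"
 proof
  assume "?L (P * r) = 0"
  hence 0: "(\<integral>x. poly (imag_poly (P * r)) (cr x) * sector_weight \<nu> x \<partial>lborel) = 0"
   unfolding sector_imag_poly by simp
  have "poly (imag_poly r) (cr x) = cnj (poly (imag_poly P) (cr x))" for x
  proof -
   have "poly r y = poly P (- y)" for y by (simp add: r_def poly_pcompose)
   have "map_poly cr r = pcompose (map_poly cr P) [:0, -1:]"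
    unfolding r_def by (rule map_poly_pcompose_minus)
   hence "poly (imag_poly r) (cr x) = poly (map_poly cr P) (- (\<i> * cr pi * cr x))"
    by (simp add: poly_imag_poly poly_pcompose)
   also have "\<dots> = cnj (poly (map_poly cr P) (\<i> * cr pi * cr x))"
    by (simp add: poly_altdef degree_map_poly coeff_map_poly)
   finally show ?thesis by (simp add: poly_imag_poly)
  qed
  hence "sector_inner (imag_poly P) (imag_poly P) = 0"
   using 0 by (simp add: sector_inner_def imag_poly_mult)
  hence "bessel_norm2 (imag_poly P) = 0"
   using Re_sector_inner[of "imag_poly P"] cos_sector_pos by simp
  moreover have "imag_poly P \<noteq> 0"
  proof
   assume "imag_poly P = 0"
   hence "lead_coeff (imag_poly P) = 0" by simp
   thus False unfolding lead_coeff_imag_poly P(2) by simp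
  qed
  ultimately show False using bessel_norm2_pos[of "imag_poly P"] by simp
 qed
 ultimately show ?case by (simp add: moment_norm_def P_def)
qed

lemma bessel_OP_eq: "is_bessel_OP \<nu> n (moment_OP (bessel_moment \<nu>) n)"
 "bessel_OP \<nu> n = map_poly cr (moment_OP (bessel_moment \<nu>) n)"
 using is_bessel_OP_moment_OP[OF \<nu>(1)] moment_norm_bessel_nonzero by blast+

text \<open>\<open>P\<^sub>n(i \<pi> x)\<close>, normalised to have the leading coefficient of \<^term>\<open>mp n\<close>.\<close>

definition scaled_OP :: "nat \<Rightarrow> complex poly" where
 "scaled_OP n = smult (lead_coeff (mp n) / (\<i> * cr pi) ^ n) (imag_poly (moment_OP (bessel_moment \<nu>) n))"

lemma poly_scaled_OP:
 "poly (scaled_OP n) z = lead_coeff (mp n) / (\<i> * cr pi) ^ n * poly (bessel_OP \<nu> n) (\<i> * cr pi * z)"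
 by (simp add: scaled_OP_def poly_imag_poly bessel_OP_eq(2))

lemma degree_scaled_OP: "degree (scaled_OP n) = n"
 using lead_coeff_mp[of n] by (simp add: scaled_OP_def degree_imag_poly degree_moment_OP)

lemma lead_coeff_scaled_OP: "lead_coeff (scaled_OP n) = lead_coeff (mp n)"
proof -
 have "lead_coeff (scaled_OP n) = lead_coeff (mp n) / (\<i> * cr pi) ^ n * lead_coeff (imag_poly (moment_OP (bessel_moment \<nu>) n))"
  unfolding scaled_OP_def by (rule lead_coeff_smult)
 thus ?thesis unfolding lead_coeff_imag_poly lead_coeff_moment_OP unfolding degree_moment_OP by simp
qed

text \<open>On the real line the conjugate of a polynomial is again a polynomial in
  \<open>x\<close>, so bilinear orthogonality to monomials carries over to the sesquilinear
  form.\<close>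

lemma scaled_OP_orthogonal:
 assumes "degree e < n"
 shows "sector_inner (scaled_OP n) e = 0"
proof -
 let ?P = "moment_OP (bessel_moment \<nu>) n" and ?c = "lead_coeff (mp n) / (\<i> * cr pi) ^ n"
 have 0: "(\<integral>x. poly (imag_poly (?P * monom 1 j)) (cr x) * sector_weight \<nu> x \<partial>lborel) = 0" if "j < n" for j
 proof -
  have "moment_functional (bessel_moment \<nu>) (?P * monom 1 j) = 0"
   using moment_norm_bessel_nonzero that by (intro moment_OP_orthogonal_poly) (auto simp: degree_monom_eq)
  thus ?thesis unfolding sector_imag_poly by simp
 qed
 have "poly (scaled_OP n) (cr x) * cnj (poly e (cr x)) * sector_weight \<nu> x =
   (\<Sum>j\<le>degree e. (?c * cnj (coeff e j) / (\<i> * cr pi) ^ j) *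
    (poly (imag_poly (?P * monom 1 j)) (cr x) * sector_weight \<nu> x))" for x
 proof -
  have "poly (imag_poly (monom 1 j)) (cr x) = (\<i> * cr pi) ^ j * cr x ^ j" for j
   by (simp add: poly_imag_poly map_poly_monom poly_monom power_mult_distrib)
  hence m: "cr x ^ j = poly (imag_poly (monom 1 j)) (cr x) / (\<i> * cr pi) ^ j" for j
   by simp
  have "cnj (poly e (cr x)) = (\<Sum>j\<le>degree e. cnj (coeff e j) * cr x ^ j)"
   unfolding poly_altdef by simp
  also have "\<dots> = (\<Sum>j\<le>degree e. cnj (coeff e j) * (poly (imag_poly (monom 1 j)) (cr x) / (\<i> * cr pi) ^ j))"
   unfolding m ..
  finally have e: "cnj (poly e (cr x)) = \<dots>" .
  show ?thesis unfolding e sum_distrib_left sum_distrib_right imag_poly_mult scaled_OP_def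
   by (intro sum.cong refl) (simp add: field_simps)
 qed
 hence "sector_inner (scaled_OP n) e = (\<integral>x. (\<Sum>j\<le>degree e. (?c * cnj (coeff e j) / (\<i> * cr pi) ^ j) *
    (poly (imag_poly (?P * monom 1 j)) (cr x) * sector_weight \<nu> x)) \<partial>lborel)"
  unfolding sector_inner_def by (simp only:)
 also have "\<dots> = (\<Sum>j\<le>degree e. (?c * cnj (coeff e j) / (\<i> * cr pi) ^ j) *
    (\<integral>x. poly (imag_poly (?P * monom 1 j)) (cr x) * sector_weight \<nu> x \<partial>lborel))"
  by (subst Bochner_Integration.integral_sum, intro integrable_mult_right integrable_sector) (simp only: integral_mult_right_zero)
 also have "\<dots> = 0" using 0 assms by (intro sum.neutral) auto
 finally show ?thesis .
qed

lemma sector_inner_diff: "sector_inner (p - q) r = sector_inner p r - sector_inner q r"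
 unfolding sector_inner_def
 by (subst Bochner_Integration.integral_diff[symmetric], (rule integrable_sector_inner)+)
   (intro Bochner_Integration.integral_cong refl, simp add: algebra_simps)

text \<open>For e = Q - q the two orthogonality relations leave only the integral of - v cnj e as
  the form of e with itself, v being the residual q W - a sech. Coercivity bounds this from below; a
  weighted Young inequality bounds it from above.\<close>

lemma energy_estimate:
 assumes Q: "sector_inner Q (Q - q) = 0" and a: "sech_inner a (Q - q) = 0" and G: "integrable lborel G"
  and vG: "\<And>x. x \<noteq> 0 \<Longrightarrow> (cmod (poly q (cr x) * sector_weight \<nu> x - poly a (cr x) * cr (sech_wt x)))^2
   \<le> bessel_weight \<nu> x * G x"
 shows "(cos (pi * \<nu> / 2))^2 * bessel_norm2 (Q - q) \<le> (\<integral>x. G x \<partial>lborel)"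
proof -
 define e where "e = Q - q"
 define c where "c = cos (pi * \<nu> / 2)"
 have c: "c > 0" using cos_sector_pos by (simp add: c_def)
 let ?v = "\<lambda>x. poly q (cr x) * sector_weight \<nu> x - poly a (cr x) * cr (sech_wt x)"
 let ?e = "\<lambda>x. poly e (cr x)"
 have sp: "?v x * cnj (?e x) = poly q (cr x) * cnj (?e x) * sector_weight \<nu> x - poly a (cr x) * cnj (?e x) * cr (sech_wt x)" for x
  by (simp add: algebra_simps)
 have iv: "integrable lborel (\<lambda>x. ?v x * cnj (?e x))"
  unfolding sp by (intro Bochner_Integration.integrable_diff integrable_sector_inner integrable_sech_inner)
 have "sector_inner e e = sector_inner Q e - sector_inner q e" by (subst (1) e_def) (rule sector_inner_diff)
 also have "\<dots> = - (sector_inner q e - sech_inner a e)" using Q a by (simp add: e_def)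
 also have "sector_inner q e - sech_inner a e = (\<integral>x. ?v x * cnj (?e x) \<partial>lborel)"
  unfolding sp sector_inner_def sech_inner_def
  by (rule Bochner_Integration.integral_diff[symmetric]) (rule integrable_sector_inner, rule integrable_sech_inner)
 finally have s: "sector_inner e e = - (\<integral>x. ?v x * cnj (?e x) \<partial>lborel)" .
 have "c * bessel_norm2 e = Re (sector_inner e e)" by (simp add: Re_sector_inner c_def)
 also have "\<dots> \<le> cmod (sector_inner e e)" by (rule complex_Re_le_cmod)
 also have "\<dots> \<le> (\<integral>x. cmod (?v x * cnj (?e x)) \<partial>lborel)" unfolding s norm_minus_cancel by (rule integral_norm_bound)
 also have "\<dots> \<le> (\<integral>x. 1 / (2 * c) * G x + c / 2 * ((cmod (?e x))^2 * bessel_weight \<nu> x) \<partial>lborel)"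
 proof (rule integral_mono_AE)
  show "integrable lborel (\<lambda>x. cmod (?v x * cnj (?e x)))" by (intro integrable_norm iv)
  show "integrable lborel (\<lambda>x. 1 / (2 * c) * G x + c / 2 * ((cmod (?e x))^2 * bessel_weight \<nu> x))"
   by (intro Bochner_Integration.integrable_add integrable_mult_right G integrable_bessel_norm2)
  show "AE x in lborel. cmod (?v x * cnj (?e x)) \<le> 1 / (2 * c) * G x + c / 2 * ((cmod (?e x))^2 * bessel_weight \<nu> x)"
   using AE_lborel_singleton[of "0 :: real"]
  proof eventually_elim
   case (elim x)
   define k where "k = bessel_weight \<nu> x"
   have k: "k > 0" using bessel_weight_pos[OF \<nu> elim] by (simp add: k_def)
   define V where "V = cmod (?v x)"
   define E where "E = cmod (?e x)"
   have "V^2 \<le> k * G x" using vG[OF elim] by (simp only: V_def k_def)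
   \<comment> \<open>The weight \<open>c * k\<close> is chosen so that exactly half of
     \<open>c * bessel_norm2 e\<close> appears on the right and can be absorbed.\<close>
   moreover have "2 * V * (c * k * E) \<le> V^2 + (c * k * E)^2" by (rule sum_squares_bound)
   ultimately have "k * (2 * c * (V * E)) \<le> k * (G x + c * c * (E * E * k))"
    by (simp add: power2_eq_square algebra_simps)
   hence "2 * c * (V * E) \<le> G x + c * c * (E * E * k)" using k by (simp only: mult_le_cancel_left_pos)
   hence "V * E \<le> (G x + c * c * (E * E * k)) / (2 * c)" using c by (simp add: pos_le_divide_eq mult_ac)
   also have "\<dots> = 1 / (2 * c) * G x + c / 2 * (E^2 * k)" using c by (simp add: field_simps power2_eq_square)
   finally show ?case by (simp only: norm_mult complex_mod_cnj V_def E_def k_def)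
  qed
 qed
 also have "\<dots> = 1 / (2 * c) * (\<integral>x. G x \<partial>lborel) + c / 2 * bessel_norm2 e"
  unfolding bessel_norm2_def
  by (subst Bochner_Integration.integral_add, (intro integrable_mult_right G integrable_bessel_norm2)+) (simp only: integral_mult_right_zero)
 finally have "c * bessel_norm2 e \<le> 1 / (2 * c) * (\<integral>x. G x \<partial>lborel) + c / 2 * bessel_norm2 e" .
 hence "c / 2 * bessel_norm2 e \<le> (\<integral>x. G x \<partial>lborel) / (2 * c)" by (simp add: field_simps)
 thus ?thesis using c unfolding c_def[symmetric] e_def[symmetric] by (simp add: field_simps power2_eq_square)
qed

end

section \<open>Strong asymptotics\<close>

lemma jump_phase_cis: "jump_phase \<theta> x = cr x * cis (- (sgn x * \<theta>))"
 by (cases x "0 :: real" rule: linorder_cases) (auto simp: jump_phase_def complex_eq_iff)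

definition down_poly :: "complex poly \<Rightarrow> nat \<Rightarrow> complex poly" where
 "down_poly D n = (\<Sum>i\<le>degree D. smult (coeff D i) (mp (n - 1 - i)))"

definition up_poly :: "complex poly \<Rightarrow> nat \<Rightarrow> complex poly" where
 "up_poly A n = (\<Sum>j\<le>degree A. smult (coeff A j) (mp (n + j)))"

text \<open>The factor 2/n comes from n lc (mp n) = 2 lc (mp (n-1)), lc denoting leading
  coefficients: with \<open>coeff D 0 = 1\<close> the leading coefficient is that of
  \<open>scaled_OP n\<close>, so their difference has degree below n. The factor x tames the
  singularity of the weight at 0.\<close>

definition approx_poly :: "complex poly \<Rightarrow> nat \<Rightarrow> complex poly" where
 "approx_poly D n = smult (2 / of_nat n) ([:0, 1:] * down_poly D n)"

abbreviation "down_combo D \<equiv> combo (\<lambda>k. coeff D (nat (- 1 - k))) ((\<lambda>i. - 1 - int i) ` {..degree D})"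
abbreviation "down_hat D \<equiv> combo_hat (\<lambda>k. coeff D (nat (- 1 - k))) ((\<lambda>i. - 1 - int i) ` {..degree D})"
abbreviation "up_combo A \<equiv> combo (\<lambda>k. coeff A (nat k)) (int ` {..degree A})"
abbreviation "up_hat A \<equiv> combo_hat (\<lambda>k. coeff A (nat k)) (int ` {..degree A})"

lemma poly_down_poly: "poly (down_poly D n) (cr x) = down_combo D n x"
proof -
 have "nat (int n + (- 1 - int i)) = n - 1 - i" for i by arith
 thus ?thesis
  unfolding combo_def down_poly_def shifted_mpr_def
  by (subst sum.reindex) (auto simp: inj_on_def poly_sum poly_mp_of_real)
qed

lemma poly_up_poly: "poly (up_poly A n) (cr x) = up_combo A n x"
proof -
 have "nat (int n + int i) = n + i" for i by arith
 thus ?thesis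
  unfolding combo_def up_poly_def shifted_mpr_def
  by (subst sum.reindex) (auto simp: inj_on_def poly_sum poly_mp_of_real)
qed

lemma down_hat_eq: "down_hat D t = cis (- t) * poly D (cis (- t))"
proof -
 have "cis (real_of_int (- 1 - int i) * t) = cis (- t) * cis (- t) ^ i" for i
  unfolding Complex.DeMoivre cis_mult by (simp add: algebra_simps)
 hence "down_hat D t = (\<Sum>i\<le>degree D. coeff D i * (cis (- t) * cis (- t) ^ i))"
  unfolding combo_hat_def by (subst sum.reindex) (auto simp: inj_on_def)
 thus ?thesis unfolding poly_altdef sum_distrib_left by (simp add: mult_ac)
qed

lemma up_hat_eq: "up_hat A t = poly A (cis t)"
proof -
 have "up_hat A t = (\<Sum>i\<le>degree A. coeff A i * cis t ^ i)"
  unfolding combo_hat_def Complex.DeMoivre by (subst sum.reindex) (auto simp: inj_on_def)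
 thus ?thesis unfolding poly_altdef .
qed

lemma down_poly_coeff:
 assumes "degree D < n" "coeff D 0 = 1"
 shows "degree (down_poly D n) < n" "coeff (down_poly D n) (n - 1) = lead_coeff (mp (n - 1))"
proof -
 show "degree (down_poly D n) < n"
  unfolding down_poly_def using assms(1)
  by (intro degree_sum_less) (auto intro!: le_less_trans[OF degree_smult_le] simp: degree_mp)
 have "coeff (down_poly D n) (n - 1) = (\<Sum>i\<le>degree D. coeff D i * coeff (mp (n - 1 - i)) (n - 1))"
  by (simp add: down_poly_def coeff_sum)
 also have "\<dots> = (\<Sum>i\<in>{0}. coeff D i * coeff (mp (n - 1 - i)) (n - 1))"
  using assms(1) by (intro sum.mono_neutral_right) (auto intro!: coeff_eq_0 simp: degree_mp)
 finally show "coeff (down_poly D n) (n - 1) = lead_coeff (mp (n - 1))" using assms(2) by (simp add: degree_mp)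
qed

lemma approx_poly_coeff:
 assumes "degree D < n" "coeff D 0 = 1"
 shows "degree (approx_poly D n) \<le> n" "coeff (approx_poly D n) n = lead_coeff (mp n)"
proof -
 obtain m where n: "n = Suc m" using assms(1) by (cases n) auto
 have "degree ([:0, 1:] * down_poly D n) \<le> n"
  using down_poly_coeff(1)[OF assms] by (intro order_trans[OF degree_mult_le]) auto
 thus "degree (approx_poly D n) \<le> n" unfolding approx_poly_def by (rule order_trans[OF degree_smult_le])
 have "coeff (approx_poly D n) n = 2 / of_nat n * coeff (down_poly D n) (n - 1)"
  by (simp add: approx_poly_def n)
 also have "\<dots> = 2 / of_nat n * lead_coeff (mp m)" unfolding down_poly_coeff(2)[OF assms] by (simp add: n)
 also have "\<dots> = lead_coeff (mp n)"
  using lead_coeff_mp_Suc[of m] unfolding n by (simp add: field_simps del: of_nat_Suc)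
 finally show "coeff (approx_poly D n) n = lead_coeff (mp n)" .
qed

lemma sech_norm2_approx_poly:
 assumes "degree D < n" "coeff D 0 = 1"
 shows "sech_norm2 (approx_poly D n) \<le> 4 * (\<Sum>i\<le>degree D. (cmod (coeff D i))^2)"
proof -
 have n: "real n > 0" using assms(1) by simp
 have "sech_norm2 (approx_poly D n) = (2 / real n)^2 * sech_norm2 ([:0, 1:] * down_poly D n)"
  unfolding approx_poly_def sech_norm2_smult by (simp add: norm_divide)
 also have "\<dots> \<le> (2 / real n)^2 * ((real n)^2 * sech_norm2 (down_poly D n))"
  by (intro mult_left_mono sech_norm2_mult_x down_poly_coeff[OF assms]) auto
 also have "\<dots> = 4 * sech_norm2 (down_poly D n)" using n by (simp add: power_divide)
 also have "sech_norm2 (down_poly D n) = (\<Sum>i\<le>degree D. (cmod (coeff D i))^2)"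
  unfolding down_poly_def using assms(1) by (intro parseval) (auto simp: inj_on_def)
 finally show ?thesis .
qed

lemma sqrt_abs_le: "sqrt \<bar>x\<bar> \<le> 1 + x^2"
proof (cases "\<bar>x\<bar> \<le> 1")
 case True
 hence "sqrt \<bar>x\<bar> \<le> 1" by simp
 thus ?thesis using zero_le_power2[of x] by linarith
next
 case False
 hence "sqrt \<bar>x\<bar> * 1 \<le> sqrt \<bar>x\<bar> * sqrt \<bar>x\<bar>" by (intro mult_left_mono) auto
 moreover have "\<bar>x\<bar> * 1 \<le> \<bar>x\<bar> * \<bar>x\<bar>" using False by (intro mult_left_mono) auto
 ultimately show ?thesis by (simp add: power2_eq_square)
qed

lemma abs_le_square: "\<bar>x :: real\<bar> \<le> 1 + x^2"
 using sum_squares_bound[of "\<bar>x\<bar>" 1] zero_le_power2[of x] by simp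

lemma abs_sqrt_abs_le: "\<bar>x\<bar> * sqrt \<bar>x\<bar> \<le> 1 + x^2"
proof (cases "\<bar>x\<bar> \<le> 1")
 case True
 hence "\<bar>x\<bar> * sqrt \<bar>x\<bar> \<le> 1 * 1" by (intro mult_mono) auto
 thus ?thesis using zero_le_power2[of x] by linarith
next
 case False
 hence "sqrt \<bar>x\<bar> * 1 \<le> sqrt \<bar>x\<bar> * sqrt \<bar>x\<bar>" by (intro mult_left_mono) auto
 hence "\<bar>x\<bar> * sqrt \<bar>x\<bar> \<le> \<bar>x\<bar> * \<bar>x\<bar>" by (intro mult_left_mono) auto
 thus ?thesis by (simp add: power2_eq_square)
qed

context
 fixes \<nu> :: real
 assumes \<nu>: "0 < \<nu>" "\<nu> \<le> 1 / 2"
begin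

text \<open>\<open>W\<close> is the energy at \<open>x / n\<close> before the limit, with the exact
  weight. The squares carry the ratio and its reciprocal and fall under
  \<open>tendsto_combo_perturbed\<close>; in the mixed term the ratio cancels, so
  \<open>tendsto_combo\<close> with the test functions x and \<bar>x\<bar> applies.\<close>

lemma tendsto_energy:
 fixes \<theta> :: real
 defines "W \<equiv> \<lambda>X S Y T n x. 4 * ((\<bar>x / real n\<bar> * sqrt \<bar>x / real n\<bar>) * weight_ratio \<nu> x * (cmod (combo X S n x))^2 * sech_wt x)
   + (- 4) * Re (jump_phase \<theta> (x / real n) * (combo X S n x * cnj (combo Y T n x)) * cr (sech_wt x))
   + sqrt \<bar>x / real n\<bar> * (1 / weight_ratio \<nu> x) * (cmod (combo Y T n x))^2 * sech_wt x"
 shows "\<And>n. n > 0 \<Longrightarrow> integrable lborel (W X S Y T n)"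
  and "(\<lambda>n. \<integral>x. W X S Y T n x \<partial>lborel) \<longlonglongrightarrow> circle_mean (\<lambda>t. energy \<theta> (cos t) (combo_hat X S t) (combo_hat Y T t))"
proof -
 define f1 where "f1 n x = (\<bar>x / real n\<bar> * sqrt \<bar>x / real n\<bar>) * weight_ratio \<nu> x * (cmod (combo X S n x))^2 * sech_wt x" for n x
 define f2 where "f2 n x = sqrt \<bar>x / real n\<bar> * (1 / weight_ratio \<nu> x) * (cmod (combo Y T n x))^2 * sech_wt x" for n x
 define g where "g F n x = cr (F (x / real n)) * (combo X S n x * cnj (combo Y T n x)) * cr (sech_wt x)" for F n x
 let ?id = "\<lambda>x::real. x" and ?abs = "\<lambda>x::real. \<bar>x\<bar>"
 have F1: "continuous_on UNIV (\<lambda>x::real. \<bar>x\<bar> * sqrt \<bar>x\<bar>)" and F2: "continuous_on UNIV (\<lambda>x::real. sqrt \<bar>x\<bar>)"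
  by (intro continuous_intros)+
 have sc1: "\<bar>x / real n\<bar> * sqrt \<bar>x / real n\<bar> = (\<bar>x\<bar> * sqrt \<bar>x\<bar>) * (1 / (real n * sqrt (real n)))" for n x
  by (simp add: real_sqrt_divide)
 have sc2: "sqrt \<bar>x / real n\<bar> = sqrt \<bar>x\<bar> * (1 / sqrt (real n))" for n x
  by (simp add: real_sqrt_divide)
 have c1: "(\<lambda>n. 1 / (real n * sqrt (real n))) \<longlonglongrightarrow> 0" by real_asymp
 have c2: "(\<lambda>n. 1 / sqrt (real n)) \<longlonglongrightarrow> 0" by real_asymp
 have m2: "(\<lambda>x. 1 / weight_ratio \<nu> x) \<in> borel_measurable borel" by measurable
 have i1: "integrable lborel (f1 n)" if "n > 0" for n
  unfolding f1_def[abs_def]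
  by (rule tendsto_combo_perturbed(1)[where F = "\<lambda>x. \<bar>x\<bar> * sqrt \<bar>x\<bar>" and A = 1 and r = "weight_ratio \<nu>" and c = "\<lambda>n. 1 / (real n * sqrt (real n))"])
    (use that F1 abs_sqrt_abs_le sc1 c1 weight_ratio_perturbation(1)[OF \<nu>] in auto)
 have l1: "(\<lambda>n. \<integral>x. f1 n x \<partial>lborel) \<longlonglongrightarrow> circle_mean (\<lambda>t. (\<bar>cos t\<bar> * sqrt \<bar>cos t\<bar>) * (cmod (combo_hat X S t))^2)"
  unfolding f1_def
  by (rule tendsto_combo_perturbed(2)[where F = "\<lambda>x. \<bar>x\<bar> * sqrt \<bar>x\<bar>" and A = 1 and r = "weight_ratio \<nu>" and c = "\<lambda>n. 1 / (real n * sqrt (real n))"])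
    (use F1 abs_sqrt_abs_le sc1 c1 weight_ratio_perturbation(1)[OF \<nu>] in auto)
 have i2: "integrable lborel (f2 n)" if "n > 0" for n
  unfolding f2_def[abs_def]
  by (rule tendsto_combo_perturbed(1)[where F = "\<lambda>x. sqrt \<bar>x\<bar>" and A = 1 and r = "\<lambda>x. 1 / weight_ratio \<nu> x" and c = "\<lambda>n. 1 / sqrt (real n)"])
    (use that F2 sqrt_abs_le sc2 c2 m2 weight_ratio_perturbation(2)[OF \<nu>] in auto)
 have l2: "(\<lambda>n. \<integral>x. f2 n x \<partial>lborel) \<longlonglongrightarrow> circle_mean (\<lambda>t. sqrt \<bar>cos t\<bar> * (cmod (combo_hat Y T t))^2)"
  unfolding f2_def
  by (rule tendsto_combo_perturbed(2)[where F = "\<lambda>x. sqrt \<bar>x\<bar>" and A = 1 and r = "\<lambda>x. 1 / weight_ratio \<nu> x" and c = "\<lambda>n. 1 / sqrt (real n)"])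
    (use F2 sqrt_abs_le sc2 c2 m2 weight_ratio_perturbation(2)[OF \<nu>] in auto)
 have cid: "continuous_on UNIV ?id" "continuous_on UNIV ?abs" by (intro continuous_intros)+
 have bid: "\<bar>?id x\<bar> \<le> 1 * (1 + x^2)" "\<bar>?abs x\<bar> \<le> 1 * (1 + x^2)" for x using abs_le_square[of x] by auto
 have ig: "integrable lborel (g ?id n)" "integrable lborel (g ?abs n)" for n
  unfolding g_def[abs_def]
  using integrable_combo(1)[of ?id 1 n X S Y T] integrable_combo(1)[of ?abs 1 n X S Y T] bid by auto
 have lg: "(\<lambda>n. \<integral>x. g ?id n x \<partial>lborel) \<longlonglongrightarrow> circle_mean (\<lambda>t. cr (cos t) * (combo_hat X S t * cnj (combo_hat Y T t)))"
  "(\<lambda>n. \<integral>x. g ?abs n x \<partial>lborel) \<longlonglongrightarrow> circle_mean (\<lambda>t. cr \<bar>cos t\<bar> * (combo_hat X S t * cnj (combo_hat Y T t)))"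
  unfolding g_def using tendsto_combo[OF cid(1) bid(1)] tendsto_combo[OF cid(2) bid(2)] by blast+
 let ?c = "cr (cos \<theta>)" and ?s = "- (\<i> * cr (sin \<theta>))"
 have W: "W X S Y T n x = 4 * f1 n x + (- 4) * Re (?c * g ?id n x + ?s * g ?abs n x) + f2 n x" for n x
 proof -
  have "jump_phase \<theta> (x / real n) * (combo X S n x * cnj (combo Y T n x)) * cr (sech_wt x) = ?c * g ?id n x + ?s * g ?abs n x"
   by (simp add: jump_phase_def g_def algebra_simps)
  thus ?thesis by (simp only: W_def f1_def f2_def)
 qed
 have hb: "has_bochner_integral lborel (W X S Y T n)
   (4 * (\<integral>x. f1 n x \<partial>lborel) + (- 4) * Re (?c * (\<integral>x. g ?id n x \<partial>lborel) + ?s * (\<integral>x. g ?abs n x \<partial>lborel)) + (\<integral>x. f2 n x \<partial>lborel))"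
  if "n > 0" for n
  unfolding W[abs_def]
  by (intro has_bochner_integral_add has_bochner_integral_mult_right has_bochner_integral_Re has_bochner_integral_integrable i1 i2 ig that)
 show "integrable lborel (W X S Y T n)" if "n > 0" for n using hb[OF that] by (simp add: has_bochner_integral_iff)
 have cX: "continuous_on UNIV (combo_hat X S)" "continuous_on UNIV (combo_hat Y T)" by (intro continuous_intros)+
 let ?A = "\<lambda>t. (\<bar>cos t\<bar> * sqrt \<bar>cos t\<bar>) * (cmod (combo_hat X S t))^2" and ?C = "\<lambda>t. sqrt \<bar>cos t\<bar> * (cmod (combo_hat Y T t))^2"
 let ?B1 = "\<lambda>t. cr (cos t) * (combo_hat X S t * cnj (combo_hat Y T t))"
 let ?B2 = "\<lambda>t. cr \<bar>cos t\<bar> * (combo_hat X S t * cnj (combo_hat Y T t))"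
 have e: "energy \<theta> (cos t) (combo_hat X S t) (combo_hat Y T t) = (4 * ?A t + (- 4) * Re (?c * ?B1 t + ?s * ?B2 t)) + ?C t" for t
 proof -
  have "jump_phase \<theta> (cos t) * combo_hat X S t * cnj (combo_hat Y T t) = ?c * ?B1 t + ?s * ?B2 t"
   by (simp add: jump_phase_def algebra_simps)
  thus ?thesis by (simp only: energy_def)
 qed
 have cm: "circle_mean (\<lambda>t. energy \<theta> (cos t) (combo_hat X S t) (combo_hat Y T t)) =
   4 * circle_mean ?A + (- 4) * Re (?c * circle_mean ?B1 + ?s * circle_mean ?B2) + circle_mean ?C"
 proof -
  have "circle_mean (\<lambda>t. energy \<theta> (cos t) (combo_hat X S t) (combo_hat Y T t)) =
    circle_mean (\<lambda>t. 4 * ?A t + (- 4) * Re (?c * ?B1 t + ?s * ?B2 t)) + circle_mean ?C"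
   unfolding e by (rule circle_mean_add) (intro continuous_intros cX)+
  also have "circle_mean (\<lambda>t. 4 * ?A t + (- 4) * Re (?c * ?B1 t + ?s * ?B2 t)) =
    circle_mean (\<lambda>t. 4 * ?A t) + circle_mean (\<lambda>t. (- 4) * Re (?c * ?B1 t + ?s * ?B2 t))"
   by (rule circle_mean_add) (intro continuous_intros cX)+
  also have "circle_mean (\<lambda>t. 4 * ?A t) = 4 * circle_mean ?A" by (rule circle_mean_mult_left)
  also have "circle_mean (\<lambda>t. (- 4) * Re (?c * ?B1 t + ?s * ?B2 t)) = (- 4) * circle_mean (\<lambda>t. Re (?c * ?B1 t + ?s * ?B2 t))"
   by (rule circle_mean_mult_left)
  also have "circle_mean (\<lambda>t. Re (?c * ?B1 t + ?s * ?B2 t)) = Re (circle_mean (\<lambda>t. ?c * ?B1 t + ?s * ?B2 t))"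
   by (rule circle_mean_Re) (intro continuous_intros cX)
  also have "circle_mean (\<lambda>t. ?c * ?B1 t + ?s * ?B2 t) = circle_mean (\<lambda>t. ?c * ?B1 t) + circle_mean (\<lambda>t. ?s * ?B2 t)"
   by (rule circle_mean_add) (intro continuous_intros cX)+
  also have "circle_mean (\<lambda>t. ?c * ?B1 t) = ?c * circle_mean ?B1" by (rule circle_mean_mult_left)
  also have "circle_mean (\<lambda>t. ?s * ?B2 t) = ?s * circle_mean ?B2" by (rule circle_mean_mult_left)
  finally show ?thesis .
 qed
 have "(\<lambda>n. 4 * (\<integral>x. f1 n x \<partial>lborel) + (- 4) * Re (?c * (\<integral>x. g ?id n x \<partial>lborel) + ?s * (\<integral>x. g ?abs n x \<partial>lborel)) + (\<integral>x. f2 n x \<partial>lborel))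
   \<longlonglongrightarrow> circle_mean (\<lambda>t. energy \<theta> (cos t) (combo_hat X S t) (combo_hat Y T t))"
  unfolding cm by (intro tendsto_intros l1 l2 lg)
 thus "(\<lambda>n. \<integral>x. W X S Y T n x \<partial>lborel) \<longlonglongrightarrow> circle_mean (\<lambda>t. energy \<theta> (cos t) (combo_hat X S t) (combo_hat Y T t))"
 proof (rule Lim_transform_eventually)
  show "\<forall>\<^sub>F n in sequentially. 4 * (\<integral>x. f1 n x \<partial>lborel) + (- 4) * Re (?c * (\<integral>x. g ?id n x \<partial>lborel) + ?s * (\<integral>x. g ?abs n x \<partial>lborel)) + (\<integral>x. f2 n x \<partial>lborel)
    = (\<integral>x. W X S Y T n x \<partial>lborel)"
   using eventually_gt_at_top[of 0] by (rule eventually_mono) (rule has_bochner_integral_integral_eq[OF hb, symmetric])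
 qed
qed

text \<open>To be read with s = sqrt \<bar>x\<bar>, q = sqrt n, r the weight ratio, S the sech
  weight, k = S r / s the Bessel weight and c the phase. Division by k is the dual norm; the
  remaining factor 1/q is what the scaling gains.\<close>

lemma residual_identity:
 fixes s q r S k :: real and D A c :: complex
 assumes s: "s > 0" "q > 0" "r > 0" and x: "\<bar>x\<bar> = s * s" and k: "k = S * r / s" and n: "n = q * q" and c: "cmod c = 1"
 shows "(cmod (cr (2 / n * x) * D * (cr k * c) - cr (1 / q) * A * cr S))^2 =
  k * ((1 / q) * (4 * ((\<bar>x / n\<bar> * (s / q)) * r * (cmod D)^2 * S) + (- 4) * Re (cr (x / n) * c * (D * cnj A) * cr S)
    + (s / q) * (1 / r) * (cmod A)^2 * S))"
proof -
 let ?a = "cr (2 / n * x) * D * (cr k * c)" and ?b = "cr (1 / q) * A * cr S"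
 define m where "m = Re (cr (x / n) * c * (D * cnj A) * cr S)"
 have n0: "n > 0" using s n by simp
 have xx: "x * x = (s * s) * (s * s)" using x by (metis abs_mult_self_eq)
 have "(cmod ?a)^2 = 4 / n^2 * x^2 * k^2 * (cmod D)^2"
  by (simp add: norm_mult norm_divide power_mult_distrib power_divide c)
 also have "\<dots> = 4 / (n * n) * (x * x) * k^2 * (cmod D)^2" by (simp add: power2_eq_square)
 also have "\<dots> = k * ((1 / q) * (4 * ((\<bar>x / n\<bar> * (s / q)) * r * (cmod D)^2 * S)))"
 proof -
  have "\<bar>x / n\<bar> = s * s / n" using x n0 by simp
  thus ?thesis unfolding xx k n using s by (simp add: field_simps power2_eq_square)
 qed
 finally have 1: "(cmod ?a)^2 = k * ((1 / q) * (4 * ((\<bar>x / n\<bar> * (s / q)) * r * (cmod D)^2 * S)))" .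
 have "?a * cnj ?b = cr (2 * k / q) * (cr (x / n) * c * (D * cnj A) * cr S)" by (simp add: mult_ac)
 hence 2: "Re (?a * cnj ?b) = 2 * k / q * m" unfolding m_def by (simp only: Re_complex_of_real times_complex.sel Im_complex_of_real)
 have "(cmod ?b)^2 = (cmod A)^2 * S^2 / (q * q)"
  by (simp add: norm_mult norm_divide power_mult_distrib power_divide power2_eq_square)
 also have "\<dots> = k * ((1 / q) * ((s / q) * (1 / r) * (cmod A)^2 * S))"
  unfolding k using s by (simp add: field_simps power2_eq_square)
 finally have 3: "(cmod ?b)^2 = k * ((1 / q) * ((s / q) * (1 / r) * (cmod A)^2 * S))" .
 show ?thesis unfolding cmod_diff_square 1 2 3 m_def[symmetric] by (simp add: algebra_simps)
qed

lemma scaled_OP_approx_bound: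
 fixes D A :: "complex poly"
 assumes D: "degree D < n" "coeff D 0 = 1"
 defines "W \<equiv> \<lambda>x. 4 * ((\<bar>x / real n\<bar> * sqrt \<bar>x / real n\<bar>) * weight_ratio \<nu> x * (cmod (down_combo D n x))^2 * sech_wt x)
   + (- 4) * Re (jump_phase (pi * \<nu> / 2) (x / real n) * (down_combo D n x * cnj (up_combo A n x)) * cr (sech_wt x))
   + sqrt \<bar>x / real n\<bar> * (1 / weight_ratio \<nu> x) * (cmod (up_combo A n x))^2 * sech_wt x"
 shows "(cos (pi * \<nu> / 2))^2 * sech_norm2 (scaled_OP \<nu> n - approx_poly D n) \<le> 3 * (\<integral>x. W x \<partial>lborel)"
proof -
 have n: "n > 0" using D(1) by simp
 define e where "e = scaled_OP \<nu> n - approx_poly D n"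
 define a where "a = smult (cr (1 / sqrt (real n))) (up_poly A n)"
 have de: "degree e < n"
  unfolding e_def
  using approx_poly_coeff[OF D] degree_scaled_OP[OF \<nu>, of n] lead_coeff_scaled_OP[OF \<nu>, of n] n
  by (intro degree_diff_less) auto
 have iW: "integrable lborel W" unfolding W_def by (rule tendsto_energy(1)[OF n])
 have "sech_inner (up_poly A n) e = 0"
  unfolding up_poly_def sech_inner_sum_left using de by (simp add: sech_inner_mp_low)
 hence ae: "sech_inner a e = 0"
  using sech_inner_sum_left[of "\<lambda>_. cr (1 / sqrt (real n))" "\<lambda>_. up_poly A n" "{()}" e] by (simp add: a_def)
 have "(cos (pi * \<nu> / 2))^2 * bessel_norm2 \<nu> e \<le> (\<integral>x. 1 / sqrt (real n) * W x \<partial>lborel)"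
  unfolding e_def
 proof (rule energy_estimate[OF \<nu>])
  show "sector_inner \<nu> (scaled_OP \<nu> n) (scaled_OP \<nu> n - approx_poly D n) = 0"
   using scaled_OP_orthogonal[OF \<nu> de] by (simp only: e_def)
  show "sech_inner a (scaled_OP \<nu> n - approx_poly D n) = 0" using ae by (simp only: e_def)
  show "integrable lborel (\<lambda>x. 1 / sqrt (real n) * W x)" by (intro integrable_mult_right iW)
  fix x :: real assume x: "x \<noteq> 0"
  have q: "poly (approx_poly D n) (cr x) = cr (2 / real n * x) * down_combo D n x"
   by (simp add: approx_poly_def poly_down_poly)
  have p: "poly a (cr x) = cr (1 / sqrt (real n)) * up_combo A n x"
   by (simp add: a_def poly_up_poly)
  have sq: "sqrt \<bar>x / real n\<bar> = sqrt \<bar>x\<bar> / sqrt (real n)" by (simp add: real_sqrt_divide)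
  have "(cmod (poly (approx_poly D n) (cr x) * sector_weight \<nu> x - poly a (cr x) * cr (sech_wt x)))^2
    = bessel_weight \<nu> x * (1 / sqrt (real n) * W x)"
   unfolding q p sector_weight_def W_def jump_phase_cis sq
   by (subst residual_identity[where s = "sqrt \<bar>x\<bar>" and r = "weight_ratio \<nu> x"])
     (use x n weight_ratio_bounds(1)[OF \<nu> x] bessel_weight_eq[OF x, of \<nu>] in \<open>auto simp: sgn_divide\<close>)
  thus "(cmod (poly (approx_poly D n) (cr x) * sector_weight \<nu> x - poly a (cr x) * cr (sech_wt x)))^2
    \<le> bessel_weight \<nu> x * (1 / sqrt (real n) * W x)" by simp
 qed
 hence 1: "(cos (pi * \<nu> / 2))^2 * bessel_norm2 \<nu> e \<le> 1 / sqrt (real n) * (\<integral>x. W x \<partial>lborel)"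
  by (simp only: integral_mult_right_zero)
 \<comment> \<open>\<open>bessel_norm2_ge\<close> loses sqrt (1 + \<pi> n) \<le> 3 sqrt n, which the
   factor 1 / sqrt n of the residual compensates; this is the 3 in the conclusion.\<close>
 have "1 + pi * real n \<le> (3 * sqrt (real n))^2"
 proof -
  have "pi * real n \<le> 4 * real n" using pi_less_4 by (intro mult_right_mono) auto
  moreover have "real n \<ge> 1" using n by simp
  moreover have "(3 * sqrt (real n))^2 = 9 * real n" by (simp add: power_mult_distrib)
  ultimately show ?thesis by linarith
 qed
 hence "sqrt (1 + pi * real n) \<le> 3 * sqrt (real n)" by (intro real_le_lsqrt) (auto simp: add_nonneg_nonneg)
 hence "sech_norm2 e / (3 * sqrt (real n)) \<le> sech_norm2 e / sqrt (1 + pi * real n)"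
  using n sech_norm2_nonneg[of e] by (intro divide_left_mono) (auto intro!: mult_pos_pos simp: add_pos_nonneg)
 also have "\<dots> \<le> bessel_norm2 \<nu> e" by (rule bessel_norm2_ge[OF \<nu> de])
 finally have "(cos (pi * \<nu> / 2))^2 * (sech_norm2 e / (3 * sqrt (real n))) \<le> (cos (pi * \<nu> / 2))^2 * bessel_norm2 \<nu> e"
  by (intro mult_left_mono) auto
 also note 1
 finally show ?thesis using n unfolding e_def[symmetric] by (simp add: field_simps)
qed

theorem scaled_OP_approx:
 assumes \<epsilon>: "\<epsilon> > 0" and \<rho>: "\<rho> < 1"
 obtains D where "coeff D 0 = 1" "\<And>w. cmod w \<le> \<rho> \<Longrightarrow> (1 - \<rho>)^2 / 8 \<le> cmod ((1 + w^2) * poly D w)"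
  "\<forall>\<^sub>F n in sequentially. sech_norm2 (scaled_OP \<nu> n - approx_poly D n) \<le> \<epsilon>"
proof -
 define c where "c = (cos (pi * \<nu> / 2))^2"
 have c: "c > 0" using cos_sector_pos[OF \<nu>] by (simp add: c_def)
 have \<epsilon>': "\<epsilon> * c / 3 > 0" using \<epsilon> c by simp
 obtain D A where D: "coeff D 0 = 1"
   "circle_mean (\<lambda>t. energy (pi * \<nu> / 2) (cos t) (cis (- t) * poly D (cis (- t))) (poly A (cis t))) < \<epsilon> * c / 3"
   "\<And>w. cmod w \<le> \<rho> \<Longrightarrow> (1 - \<rho>)^2 / 8 \<le> cmod ((1 + w^2) * poly D w)"
  by (rule szego_approx[OF \<nu> \<epsilon>' \<rho>]) (rule that, assumption+)
 have m: "circle_mean (\<lambda>t. energy (pi * \<nu> / 2) (cos t) (down_hat D t) (up_hat A t)) < \<epsilon> * c / 3"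
  using D(2) by (simp only: down_hat_eq up_hat_eq)
 have "\<forall>\<^sub>F n in sequentially. sech_norm2 (scaled_OP \<nu> n - approx_poly D n) \<le> \<epsilon>"
  using order_tendstoD(2)[OF tendsto_energy(2) m] eventually_gt_at_top[of "degree D"]
 proof eventually_elim
  case (elim n)
  from order_trans[OF scaled_OP_approx_bound[OF elim(2) D(1), of A] mult_left_mono[OF less_imp_le[OF elim(1)], of 3]]
  have "c * sech_norm2 (scaled_OP \<nu> n - approx_poly D n) \<le> c * \<epsilon>" by (simp add: c_def mult.commute)
  thus ?case using c by (simp only: mult_le_cancel_left_pos)
 qed
 with D(1,3) show ?thesis by (rule that)
qed

end

text \<open>The Jacobi bound with entries k/2 \<le> n/2, taken at n z, whose distance from [-n,n] is
  at least n \<delta>. The sum contains \<open>mp 0 = 1\<close>, so it also shows that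
  \<open>mp n\<close> does not vanish there.\<close>

lemma mp_off_interval:
 assumes n: "n > 0" and \<delta>: "\<delta> > 0" and z: "\<And>s. s \<in> {-1..1} \<Longrightarrow> \<delta> \<le> cmod (z - cr s)"
 shows "sqrt (\<Sum>k<n. (cmod (poly (mp k) (of_nat n * z)))^2) \<le> cmod (poly (mp n) (of_nat n * z)) / (2 * \<delta>)"
  and "poly (mp n) (of_nat n * z) \<noteq> 0"
proof -
 let ?P = "\<lambda>k. poly (mp k) (of_nat n * z)"
 have "sqrt (\<Sum>k<n. (cmod (?P k))^2) * (real n * \<delta>) \<le> real n / 2 * cmod (?P n)"
 proof (rule jacobi_sum_bound[where x = "of_nat n * z" and c = "real n" and a = "\<lambda>k. real k / 2" and P = ?P])
  show "of_nat n * z * ?P k = cr (real (Suc k) / 2) * ?P (Suc k) + cr (real k / 2) * ?P (k - 1)" for k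
   using poly_mp_rec[of k "of_nat n * z"] by (simp add: field_simps)
  show "real n * \<delta> \<le> cmod (of_nat n * z - cr s)" if "\<bar>s\<bar> \<le> real n" for s
  proof -
   have "\<delta> \<le> cmod (z - cr (s / real n))"
    using that n by (intro z) (auto simp: abs_le_iff field_simps)
   hence "real n * \<delta> \<le> real n * cmod (z - cr (s / real n))" by (intro mult_left_mono) auto
   also have "\<dots> = cmod (of_nat n * (z - cr (s / real n)))" by (simp add: norm_mult)
   also have "of_nat n * (z - cr (s / real n)) = of_nat n * z - cr s"
    using n by (simp add: right_diff_distrib)
   finally show ?thesis .
  qed
 qed (use n \<delta> in auto)
 hence b: "sqrt (\<Sum>k<n. (cmod (?P k))^2) * \<delta> \<le> cmod (?P n) / 2" using n by (simp add: field_simps)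
 thus "sqrt (\<Sum>k<n. (cmod (?P k))^2) \<le> cmod (?P n) / (2 * \<delta>)" using \<delta> by (simp add: field_simps)
 have "(cmod (?P 0))^2 \<le> (\<Sum>k<n. (cmod (?P k))^2)" using n by (intro member_le_sum) auto
 hence "1 \<le> sqrt (\<Sum>k<n. (cmod (?P k))^2)" by simp
 hence "1 * \<delta> \<le> sqrt (\<Sum>k<n. (cmod (?P k))^2) * \<delta>" using \<delta> by (intro mult_right_mono) auto
 hence s: "0 < sqrt (\<Sum>k<n. (cmod (?P k))^2) * \<delta>" using \<delta> by linarith
 show "?P n \<noteq> 0"
 proof
  assume "?P n = 0"
  thus False using b s by (simp only: norm_zero)
 qed
qed

text \<open>At index n - j the recurrence coefficients deviate from their value at n by O(j), hence
  the error \<open>e\<close> of order 1/n in the constant-coefficient recurrence. The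
  \<open>L\<close> extra indices give the downward contraction room to reduce the a priori bound
  \<open>M\<close> by \<rho>^L; the powers of \<open>w\<close> then follow by telescoping.\<close>

lemma mp_ratio_asymptotics:
 assumes J: "Suc (J0 + L) \<le> n" and \<delta>: "\<delta> > 0"
  and z: "\<And>s. s \<in> {-1..1} \<Longrightarrow> \<delta> \<le> cmod (z - cr s)"
  and w: "w \<noteq> 0" "cmod w \<le> \<rho>" "\<rho> < 1" "w + 1 / w = 2 * z"
 defines "R \<equiv> \<lambda>j. poly (mp (n - j)) (of_nat n * z) / poly (mp n) (of_nat n * z)"
  and "M \<equiv> max 1 (1 / (2 * \<delta>))"
 defines "e \<equiv> 2 * real (J0 + L) / real n * M"
 shows "\<And>j. 1 \<le> j \<Longrightarrow> j \<le> J0 + L \<Longrightarrow> cmod (R (Suc j) - 2 * z * R j + R (j - 1)) \<le> e"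
  and "\<And>j. j \<le> J0 \<Longrightarrow> cmod (R j - w ^ j) \<le> real J0 * (\<rho> ^ L * (2 * M) + e * real (J0 + L))"
proof -
 have n: "n > 0" using J by simp
 let ?P = "\<lambda>k. poly (mp k) (of_nat n * z)"
 have nz: "?P n \<noteq> 0" by (rule mp_off_interval(2)[OF n \<delta> z])
 have M0: "M \<ge> 1" by (simp add: M_def)
 have e0: "e \<ge> 0" using M0 by (simp add: e_def)
 have RM: "cmod (R j) \<le> M" for j
 proof (cases "n - j = n")
  case True
  thus ?thesis using nz M0 by (simp add: R_def)
 next
  case False
  have "(cmod (?P (n - j)))^2 \<le> (\<Sum>k<n. (cmod (?P k))^2)" using n False by (intro member_le_sum) auto
  hence "cmod (?P (n - j)) \<le> sqrt (\<Sum>k<n. (cmod (?P k))^2)" by (rule real_le_rsqrt)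
  also have "\<dots> \<le> cmod (?P n) / (2 * \<delta>)" by (rule mp_off_interval(1)[OF n \<delta> z])
  finally have "cmod (R j) \<le> 1 / (2 * \<delta>)" using nz by (simp add: R_def norm_divide field_simps)
  thus ?thesis by (simp add: M_def)
 qed
 show rec: "cmod (R (Suc j) - 2 * z * R j + R (j - 1)) \<le> e" if j: "1 \<le> j" "j \<le> J0 + L" for j
 proof -
  obtain i where i: "j = Suc i" using j(1) by (cases j) auto
  have jn: "j < n" using j(2) J by simp
  define k where "k = n - j"
  have k: "Suc k = n - i" "k - 1 = n - Suc j" "real k = real n - real j" using jn i by (auto simp: k_def of_nat_diff)
  have "of_nat (Suc k) * ?P (Suc k) = 2 * (of_nat n * z) * ?P k - of_nat k * ?P (k - 1)" by (rule poly_mp_rec)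
  hence "of_nat (Suc k) * (?P (Suc k) / ?P n) = 2 * (of_nat n * z) * (?P k / ?P n) - of_nat k * (?P (k - 1) / ?P n)"
   using nz by (simp add: field_simps)
  hence "of_nat (Suc k) * R i = 2 * (of_nat n * z) * R j - of_nat k * R (Suc j)"
   by (simp only: R_def k k_def[symmetric])
  moreover have "of_nat k = of_nat n - (of_nat j :: complex)" using jn by (simp add: k_def of_nat_diff)
  ultimately have "of_nat n * (R (Suc j) - 2 * z * R j + R i) = of_nat j * R (Suc j) + of_nat i * R i"
   using i by (simp add: algebra_simps)
  hence "R (Suc j) - 2 * z * R j + R i = (of_nat j * R (Suc j) + of_nat i * R i) / of_nat n"
   using n by (simp add: nonzero_eq_divide_eq mult.commute)
  hence "cmod (R (Suc j) - 2 * z * R j + R i) = cmod (of_nat j * R (Suc j) + of_nat i * R i) / real n"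
   by (simp add: norm_divide)
  also have "\<dots> \<le> (real (J0 + L) * M + real (J0 + L) * M) / real n"
  proof (intro divide_right_mono order_trans[OF norm_triangle_ineq] add_mono)
   show "cmod (of_nat j * R (Suc j)) \<le> real (J0 + L) * M"
    unfolding norm_mult norm_of_nat using j RM[of "Suc j"] by (intro mult_mono) auto
   show "cmod (of_nat i * R i) \<le> real (J0 + L) * M"
    unfolding norm_mult norm_of_nat using j i RM[of i] by (intro mult_mono) auto
  qed simp
  also have "\<dots> = e" by (simp add: e_def)
  finally show ?thesis using i by simp
 qed
 define \<eta> where "\<eta> = \<rho> ^ L * (2 * M) + e * real (J0 + L)"
 have \<rho>: "0 \<le> \<rho>" using w(2) norm_ge_zero[of w] by linarith
 have \<eta>0: "\<eta> \<ge> 0" using \<rho> M0 e0 by (simp add: \<eta>_def)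
 have step: "cmod (R j - w * R (j - 1)) \<le> \<eta>" if j: "1 \<le> j" "j \<le> J0" for j
 proof -
  have "cmod (R j - w * R (j - 1)) \<le> \<rho> ^ (Suc (J0 + L) - j) * (2 * M) + e * real (Suc (J0 + L) - j)"
   by (rule joukowski_ratio_bound[OF w rec RM]) (use j in auto)
  also have "\<dots> \<le> \<eta>"
  proof -
   have "\<rho> ^ (Suc (J0 + L) - j) \<le> \<rho> ^ L" using \<rho> w(3) j by (intro power_decreasing) auto
   moreover have "real (Suc (J0 + L) - j) \<le> real (J0 + L)" using j by simp
   ultimately show ?thesis unfolding \<eta>_def using M0 e0 by (intro add_mono mult_right_mono mult_left_mono) auto
  qed
  finally show ?thesis .
 qed
 have "cmod (R j - w ^ j) \<le> real j * \<eta>" if "j \<le> J0" for j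
  using that
 proof (induction j)
  case 0
  show ?case using nz by (simp add: R_def)
 next
  case (Suc j)
  have "R (Suc j) - w ^ Suc j = (R (Suc j) - w * R j) + w * (R j - w ^ j)" by (simp add: algebra_simps)
  hence "cmod (R (Suc j) - w ^ Suc j) \<le> cmod (R (Suc j) - w * R j) + cmod w * cmod (R j - w ^ j)"
   by (metis norm_mult norm_triangle_ineq)
  also have "\<dots> \<le> \<eta> + 1 * (real j * \<eta>)"
   using step[of "Suc j"] Suc w(2,3) \<eta>0 by (intro add_mono mult_mono) auto
  finally show ?case by (simp add: algebra_simps)
 qed
 moreover have "real j * \<eta> \<le> real J0 * \<eta>" if "j \<le> J0" for j using that \<eta>0 by (intro mult_right_mono) auto
 ultimately show "cmod (R j - w ^ j) \<le> real J0 * (\<rho> ^ L * (2 * M) + e * real (J0 + L))" if "j \<le> J0" for j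
  using that unfolding \<eta>_def by (meson order_trans)
qed

context
 fixes \<nu> :: real
 assumes \<nu>: "0 < \<nu>" "\<nu> \<le> 1 / 2"
begin

text \<open>Divided by \<open>mp n\<close> at n z, the approximant is close to (1 + w^2) D(w), which
  is at least m in modulus. The bound m depends on \<delta> only, so the accuracy (m \<delta> / 2)^2
  can be prescribed before \<open>D\<close> is known; through the kernel bound 1 / (2 \<delta>) it
  costs m/4, and the approximant costs another m/4.\<close>

theorem scaled_OP_zero_free:
 assumes \<delta>: "\<delta> > 0"
 shows "\<forall>\<^sub>F n in sequentially. \<forall>z. (\<forall>s\<in>{-1..1}. \<delta> \<le> cmod (z - cr s)) \<longrightarrow> poly (scaled_OP \<nu> n) (of_nat n * z) \<noteq> 0"
proof -
 define \<rho> where "\<rho> = 1 / (1 + \<delta>)"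
 have \<rho>: "0 < \<rho>" "\<rho> < 1" using \<delta> by (auto simp: \<rho>_def)
 define m where "m = (1 - \<rho>)^2 / 8"
 have m: "m > 0" using \<rho> by (simp add: m_def)
 have \<epsilon>: "(m * \<delta> / 2)^2 > 0" using m \<delta> by simp
 obtain D where D: "coeff D 0 = 1" "\<And>w. cmod w \<le> \<rho> \<Longrightarrow> (1 - \<rho>)^2 / 8 \<le> cmod ((1 + w^2) * poly D w)"
  "\<forall>\<^sub>F n in sequentially. sech_norm2 (scaled_OP \<nu> n - approx_poly D n) \<le> (m * \<delta> / 2)^2"
  by (rule scaled_OP_approx[OF \<nu> \<epsilon> \<rho>(2)]) (rule that, assumption+)
 define M where "M = max 1 (1 / (2 * \<delta>))"
 define J0 where "J0 = degree D + 2"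
 define B where "B = (\<Sum>i\<le>degree D. cmod (coeff D i))"
 have B0: "B \<ge> 0" unfolding B_def by (intro sum_nonneg) auto
 \<comment> \<open>\<open>L\<close> is fixed first, to make the contraction term small; large
   \<open>n\<close> then removes the error of the recurrence.\<close>
 have "(\<lambda>L. B * (2 * (real J0 * (\<rho> ^ L * (2 * M))))) \<longlonglongrightarrow> B * (2 * (real J0 * (0 * (2 * M))))"
  using \<rho> by (intro tendsto_intros LIMSEQ_realpow_zero) auto
 hence "\<forall>\<^sub>F L in sequentially. B * (2 * (real J0 * (\<rho> ^ L * (2 * M)))) < m / 4"
  by (rule order_tendstoD(2)) (use m in simp)
 from eventually_happens'[OF sequentially_bot this] obtain L where L: "B * (2 * (real J0 * (\<rho> ^ L * (2 * M)))) < m / 4" by blast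
 define e where "e n = 2 * real (J0 + L) / real n * M" for n
 have e: "e \<longlonglongrightarrow> 0" unfolding e_def[abs_def] by real_asymp
 have "(\<lambda>n. B * (e n + 2 * (real J0 * (\<rho> ^ L * (2 * M) + e n * real (J0 + L))))) \<longlonglongrightarrow> B * (0 + 2 * (real J0 * (\<rho> ^ L * (2 * M) + 0 * real (J0 + L))))"
  by (intro tendsto_intros e)
 hence "\<forall>\<^sub>F n in sequentially. B * (e n + 2 * (real J0 * (\<rho> ^ L * (2 * M) + e n * real (J0 + L)))) < m / 4"
  by (rule order_tendstoD(2)) (use L in simp)
 thus ?thesis using D(3) eventually_ge_at_top[of "Suc (J0 + L)"]
 proof eventually_elim
  case (elim n)
  define \<eta> where "\<eta> = real J0 * (\<rho> ^ L * (2 * M) + e n * real (J0 + L))"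
  show ?case
  proof (intro allI impI)
   fix z :: complex assume "\<forall>s\<in>{-1..1}. \<delta> \<le> cmod (z - cr s)"
   hence z: "\<And>s. s \<in> {-1..1} \<Longrightarrow> \<delta> \<le> cmod (z - cr s)" by blast
   obtain w where w: "w \<noteq> 0" "cmod w \<le> 1 / (1 + \<delta>)" "w + 1 / w = 2 * z"
    by (rule exists_joukowski_inverse[OF \<delta> z]) (assumption, rule that, assumption+)
   have w\<rho>: "cmod w \<le> \<rho>" using w(2) by (simp add: \<rho>_def)
   have n: "n > 0" using elim(3) by simp
   have degD: "degree D < n" using elim(3) by (simp add: J0_def)
   let ?x = "of_nat n * z"
   define p where "p = poly (mp n) ?x"
   define R where "R j = poly (mp (n - j)) ?x / p" for j
   note ra = mp_ratio_asymptotics[OF elim(3) \<delta> z w(1) w\<rho> \<rho>(2) w(3)]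
   have rec: "cmod (R (Suc j) - 2 * z * R j + R (j - 1)) \<le> e n" if "1 \<le> j" "j \<le> J0 + L" for j
    using ra(1)[OF _ that] unfolding R_def p_def e_def M_def by simp
   have close: "cmod (R j - w ^ j) \<le> \<eta>" if "j \<le> J0" for j
    using ra(2)[OF _ that] unfolding R_def p_def e_def M_def \<eta>_def by simp
   have p: "p \<noteq> 0" unfolding p_def by (rule mp_off_interval(2)[OF n \<delta> z])
   have q: "poly (approx_poly D n) ?x / p = (\<Sum>i\<le>degree D. coeff D i * (2 * z * R (Suc i)))"
   proof -
    have "poly (approx_poly D n) ?x = 2 * z * (\<Sum>i\<le>degree D. coeff D i * poly (mp (n - Suc i)) ?x)"
     using n by (simp add: approx_poly_def down_poly_def poly_sum)
    thus ?thesis unfolding R_def by (simp add: sum_distrib_left sum_divide_distrib mult_ac)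
   qed
   have t: "(1 + w^2) * poly D w = (\<Sum>i\<le>degree D. coeff D i * (w ^ i + w ^ Suc (Suc i)))"
    unfolding poly_altdef sum_distrib_left by (intro sum.cong refl) (simp add: algebra_simps power2_eq_square)
   \<comment> \<open>z ranges over an unbounded set, so the error of \<open>R (Suc i)\<close> must
     not be multiplied by z. Instead the recurrence replaces \<open>2 * z * R (Suc i)\<close> by
     \<open>R i + R (Suc (Suc i))\<close> at the cost of \<open>e n\<close>.\<close>
   have tm: "cmod (2 * z * R (Suc i) - (w ^ i + w ^ Suc (Suc i))) \<le> e n + 2 * \<eta>" if i: "i \<le> degree D" for i
   proof -
    have "2 * z * R (Suc i) - (w ^ i + w ^ Suc (Suc i)) =
     (R i - w ^ i) + (R (Suc (Suc i)) - w ^ Suc (Suc i)) - (R (Suc (Suc i)) - 2 * z * R (Suc i) + R i)" by simp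
    also have "cmod \<dots> \<le> (cmod (R i - w ^ i) + cmod (R (Suc (Suc i)) - w ^ Suc (Suc i))) + cmod (R (Suc (Suc i)) - 2 * z * R (Suc i) + R i)"
     by (rule order_trans[OF norm_triangle_ineq4 add_right_mono[OF norm_triangle_ineq]])
    also have "\<dots> \<le> (\<eta> + \<eta>) + e n"
     using close[of i] close[of "Suc (Suc i)"] rec[of "Suc i"] i by (intro add_mono) (auto simp: J0_def)
    finally show ?thesis by simp
   qed
   have "poly (approx_poly D n) ?x / p - (1 + w^2) * poly D w = (\<Sum>i\<le>degree D. coeff D i * (2 * z * R (Suc i) - (w ^ i + w ^ Suc (Suc i))))"
    unfolding q t sum_subtractf[symmetric] by (intro sum.cong refl) (simp only: right_diff_distrib)
   also have "cmod \<dots> \<le> (\<Sum>i\<le>degree D. cmod (coeff D i) * (e n + 2 * \<eta>))"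
    by (intro order_trans[OF norm_sum] sum_mono) (unfold norm_mult, intro mult_left_mono tm, simp_all)
   also have "\<dots> = B * (e n + 2 * \<eta>)" by (simp only: B_def sum_distrib_right)
   also have "\<dots> < m / 4" using elim(1) by (simp only: \<eta>_def)
   finally have 1: "cmod (poly (approx_poly D n) ?x / p - (1 + w^2) * poly D w) < m / 4" .
   have 2: "m \<le> cmod ((1 + w^2) * poly D w)" using D(2)[OF w\<rho>] by (simp only: m_def)
   define E where "E = scaled_OP \<nu> n - approx_poly D n"
   have dE: "degree E < n" unfolding E_def
    using approx_poly_coeff[OF degD D(1)] degree_scaled_OP[OF \<nu>, of n] lead_coeff_scaled_OP[OF \<nu>, of n] n
    by (intro degree_diff_less) auto
   have "cmod (poly E ?x) \<le> sqrt (sech_norm2 E) * sqrt (\<Sum>k<n. (cmod (poly (mp k) ?x))^2)" by (rule cmod_poly_le[OF dE])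
   also have "\<dots> \<le> (m * \<delta> / 2) * (cmod p / (2 * \<delta>))"
   proof (intro mult_mono)
    show "sqrt (sech_norm2 E) \<le> m * \<delta> / 2" using elim(2) m \<delta> unfolding E_def by (intro real_le_lsqrt) auto
    show "sqrt (\<Sum>k<n. (cmod (poly (mp k) ?x))^2) \<le> cmod p / (2 * \<delta>)"
     unfolding p_def by (rule mp_off_interval(1)[OF n \<delta> z])
   qed (use m \<delta> in \<open>auto intro!: sum_nonneg\<close>)
   also have "\<dots> = m / 4 * cmod p" using \<delta> by simp
   finally have 3: "cmod (poly E ?x / p) \<le> m / 4" using p by (simp add: norm_divide divide_le_eq)
   have 4: "poly (scaled_OP \<nu> n) ?x / p = poly E ?x / p + (poly (approx_poly D n) ?x / p - (1 + w^2) * poly D w) + (1 + w^2) * poly D w"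
    by (simp add: E_def diff_divide_distrib)
   show "poly (scaled_OP \<nu> n) ?x \<noteq> 0"
   proof
    assume "poly (scaled_OP \<nu> n) ?x = 0"
    hence "(1 + w^2) * poly D w = - (poly E ?x / p + (poly (approx_poly D n) ?x / p - (1 + w^2) * poly D w))"
     using 4 by (simp add: add_eq_0_iff)
    hence "cmod ((1 + w^2) * poly D w) \<le> cmod (poly E ?x / p) + cmod (poly (approx_poly D n) ?x / p - (1 + w^2) * poly D w)"
     by (metis norm_minus_cancel norm_triangle_ineq)
    thus False using 1 2 3 m by linarith
   qed
  qed
 qed
qed

end

section \<open>Zero distribution\<close>

lemma sum_powers_bounds:
 "real (Suc m) * (\<Sum>k<n. real k ^ m) \<le> real n ^ Suc m"
 "real n ^ Suc m \<le> real (Suc m) * (\<Sum>k<n. real k ^ m) + real (Suc m) * real n ^ m"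
proof -
 have step: "real (Suc m) * real k ^ m \<le> real (Suc k) ^ Suc m - real k ^ Suc m \<and>
   real (Suc k) ^ Suc m - real k ^ Suc m \<le> real (Suc m) * real (Suc k) ^ m" for k
 proof -
  have d: "((\<lambda>x. x ^ Suc m) has_real_derivative real (Suc m) * x ^ m) (at x)" for x :: real
   using DERIV_pow[of "Suc m" x UNIV] by simp
  obtain \<xi> where \<xi>: "real k < \<xi>" "\<xi> < real (Suc k)"
    "real (Suc k) ^ Suc m - real k ^ Suc m = (real (Suc k) - real k) * (real (Suc m) * \<xi> ^ m)"
   using MVT2[of "real k" "real (Suc k)" "\<lambda>x. x ^ Suc m" "\<lambda>x. real (Suc m) * x ^ m"] d by auto
  have "real k ^ m \<le> \<xi> ^ m" "\<xi> ^ m \<le> real (Suc k) ^ m" using \<xi>(1,2) by (auto intro!: power_mono)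
  thus ?thesis unfolding \<xi>(3) by (auto intro!: mult_left_mono)
 qed
 have tel: "(\<Sum>k<n. real (Suc k) ^ Suc m - real k ^ Suc m) = real n ^ Suc m"
  by (subst sum_lessThan_telescope) simp
 have "(\<Sum>k<n. real (Suc m) * real k ^ m) \<le> (\<Sum>k<n. real (Suc k) ^ Suc m - real k ^ Suc m)"
  using step by (intro sum_mono) blast
 thus "real (Suc m) * (\<Sum>k<n. real k ^ m) \<le> real n ^ Suc m" unfolding tel sum_distrib_left .
 have "(\<Sum>k<n. real (Suc k) ^ Suc m - real k ^ Suc m) \<le> (\<Sum>k<n. real (Suc m) * real (Suc k) ^ m)"
  using step by (intro sum_mono) blast
 also have "\<dots> = real (Suc m) * (\<Sum>k<n. real (Suc k) ^ m)" by (simp only: sum_distrib_left)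
 also have "(\<Sum>k<n. real (Suc k) ^ m) \<le> (\<Sum>k<n. real k ^ m) + real n ^ m"
 proof -
  have "(\<Sum>k<Suc n. real k ^ m) = real 0 ^ m + (\<Sum>k<n. real (Suc k) ^ m)" by (rule sum.lessThan_Suc_shift)
  thus ?thesis by simp
 qed
 hence "real (Suc m) * (\<Sum>k<n. real (Suc k) ^ m) \<le> real (Suc m) * ((\<Sum>k<n. real k ^ m) + real n ^ m)"
  by (intro mult_left_mono) auto
 finally show "real n ^ Suc m \<le> real (Suc m) * (\<Sum>k<n. real k ^ m) + real (Suc m) * real n ^ m"
  unfolding tel by (simp only: distrib_left)
qed

lemma tendsto_sum_powers: "(\<lambda>n. (\<Sum>k<n. real k ^ m) / real n ^ Suc m) \<longlonglongrightarrow> 1 / real (Suc m)"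
proof (rule tendsto_sandwich)
 show "\<forall>\<^sub>F n in sequentially. 1 / real (Suc m) - 1 / real n \<le> (\<Sum>k<n. real k ^ m) / real n ^ Suc m"
  using eventually_gt_at_top[of 0]
 proof eventually_elim
  case (elim n)
  hence n: "real n > 0" by simp
  have "real n ^ Suc m - real (Suc m) * real n ^ m \<le> real (Suc m) * (\<Sum>k<n. real k ^ m)"
   using sum_powers_bounds(2)[of n m] by linarith
  hence "(real n ^ Suc m - real (Suc m) * real n ^ m) / (real (Suc m) * real n ^ Suc m) \<le>
    (real (Suc m) * (\<Sum>k<n. real k ^ m)) / (real (Suc m) * real n ^ Suc m)"
   using n by (intro divide_right_mono) auto
  also have "(real n ^ Suc m - real (Suc m) * real n ^ m) / (real (Suc m) * real n ^ Suc m) = 1 / real (Suc m) - 1 / real n"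
   using n by (simp add: diff_divide_distrib)
  also have "(real (Suc m) * (\<Sum>k<n. real k ^ m)) / (real (Suc m) * real n ^ Suc m) = (\<Sum>k<n. real k ^ m) / real n ^ Suc m"
   by (simp add: mult_divide_mult_cancel_left del: of_nat_Suc)
  finally show ?case .
 qed
 show "\<forall>\<^sub>F n in sequentially. (\<Sum>k<n. real k ^ m) / real n ^ Suc m \<le> 1 / real (Suc m)"
  using eventually_gt_at_top[of 0]
 proof eventually_elim
  case (elim n)
  have "(\<Sum>k<n. real k ^ m) * real (Suc m) \<le> 1 * real n ^ Suc m"
   using sum_powers_bounds(1)[of m n] by (simp only: mult.commute mult_1_left)
  thus ?case using elim by (simp add: frac_le_eq divide_simps mult.commute del: of_nat_Suc power_Suc)
 qed
 show "(\<lambda>n. 1 / real (Suc m) - 1 / real n) \<longlonglongrightarrow> 1 / real (Suc m)" by real_asymp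
qed simp

lemma tendsto_cesaro_0:
 fixes a :: "nat \<Rightarrow> real"
 assumes a: "a \<longlonglongrightarrow> 0" "\<And>k. a k \<ge> 0"
 shows "(\<lambda>n. (\<Sum>k<n. a k) / real n) \<longlonglongrightarrow> 0"
proof (rule tendstoI)
 fix e :: real assume e: "e > 0"
 have "\<forall>\<^sub>F k in sequentially. a k < e / 2" using a(1) e by (intro order_tendstoD(2)) auto
 then obtain N where N: "\<And>k. N \<le> k \<Longrightarrow> a k < e / 2" by (auto simp: eventually_sequentially)
 have "(\<lambda>n. (\<Sum>k<N. a k) / real n) \<longlonglongrightarrow> 0" by (rule lim_const_over_n)
 hence "\<forall>\<^sub>F n in sequentially. (\<Sum>k<N. a k) / real n < e / 2" by (rule order_tendstoD(2)) (use e in simp)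
 thus "\<forall>\<^sub>F n in sequentially. dist ((\<Sum>k<n. a k) / real n) 0 < e"
  using eventually_gt_at_top[of 0]
 proof eventually_elim
  case (elim n)
  have "(\<Sum>k<n. a k) \<le> (\<Sum>k\<in>{..<N} \<union> {..<n} - {..<N}. a k) + (\<Sum>k<N. a k)"
   using a(2) by (subst sum.subset_diff[of "{..<N}" "{..<N} \<union> {..<n}", symmetric]) (auto intro!: sum_mono2)
  also have "(\<Sum>k\<in>{..<N} \<union> {..<n} - {..<N}. a k) \<le> (\<Sum>k\<in>{..<N} \<union> {..<n} - {..<N}. e / 2)"
   using N by (intro sum_mono) (auto intro: less_imp_le)
  also have "\<dots> \<le> (\<Sum>k<n. e / 2)" using e by (intro sum_mono2) auto
  also have "\<dots> = real n * (e / 2)" by simp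
  finally have "(\<Sum>k<n. a k) \<le> real n * (e / 2) + (\<Sum>k<N. a k)" by simp
  hence "(\<Sum>k<n. a k) / real n \<le> (real n * (e / 2) + (\<Sum>k<N. a k)) / real n" by (intro divide_right_mono) auto
  also have "\<dots> = e / 2 + (\<Sum>k<N. a k) / real n" using elim by (simp add: add_divide_distrib)
  finally have "(\<Sum>k<n. a k) / real n < e" using elim(1) by linarith
  moreover have "(\<Sum>k<n. a k) \<ge> 0" using a(2) by (intro sum_nonneg)
  ultimately show ?case by (simp add: dist_real_def)
 qed
qed

text \<open>The diagonal entries of the m-th power of the Jacobi matrix are k^m b(k) with convergent
  b; their normalised trace acquires the factor 1 / (m + 1).\<close>

lemma tendsto_weighted_cesaro:
 fixes b :: "nat \<Rightarrow> real"
 assumes b: "b \<longlonglongrightarrow> c"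
 shows "(\<lambda>n. (\<Sum>k<n. real k ^ m * b k) / real n ^ Suc m) \<longlonglongrightarrow> c / real (Suc m)"
proof -
 have "(\<lambda>k. \<bar>b k - c\<bar>) \<longlonglongrightarrow> 0" using tendsto_rabs_zero[OF LIM_zero[OF b]] by simp
 hence ces: "(\<lambda>n. (\<Sum>k<n. \<bar>b k - c\<bar>) / real n) \<longlonglongrightarrow> 0" by (rule tendsto_cesaro_0) simp
 have "(\<lambda>n. (\<Sum>k<n. real k ^ m * (b k - c)) / real n ^ Suc m) \<longlonglongrightarrow> 0"
 proof (rule Lim_null_comparison[OF _ ces])
  show "\<forall>\<^sub>F n in sequentially. norm ((\<Sum>k<n. real k ^ m * (b k - c)) / real n ^ Suc m) \<le> (\<Sum>k<n. \<bar>b k - c\<bar>) / real n"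
   using eventually_gt_at_top[of 0]
  proof eventually_elim
   case (elim n)
   have "\<bar>\<Sum>k<n. real k ^ m * (b k - c)\<bar> \<le> (\<Sum>k<n. real n ^ m * \<bar>b k - c\<bar>)"
   proof (rule order_trans[OF sum_abs], intro sum_mono)
    fix k assume "k \<in> {..<n}"
    hence "real k ^ m \<le> real n ^ m" by (intro power_mono) auto
    thus "\<bar>real k ^ m * (b k - c)\<bar> \<le> real n ^ m * \<bar>b k - c\<bar>" by (simp add: abs_mult mult_right_mono)
   qed
   also have "\<dots> = real n ^ m * (\<Sum>k<n. \<bar>b k - c\<bar>)" by (simp only: sum_distrib_left)
   finally have "\<bar>\<Sum>k<n. real k ^ m * (b k - c)\<bar> / real n ^ Suc m \<le> (real n ^ m * (\<Sum>k<n. \<bar>b k - c\<bar>)) / real n ^ Suc m"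
    by (intro divide_right_mono) auto
   also have "\<dots> = (\<Sum>k<n. \<bar>b k - c\<bar>) / real n" using elim by simp
   finally show ?case by simp
  qed
 qed
 from tendsto_add[OF this tendsto_mult[OF tendsto_const tendsto_sum_powers, of c m]]
 have lim: "(\<lambda>n. (\<Sum>k<n. real k ^ m * (b k - c)) / real n ^ Suc m + c * ((\<Sum>k<n. real k ^ m) / real n ^ Suc m)) \<longlonglongrightarrow> 0 + c * (1 / real (Suc m))" .
 have "(\<Sum>k<n. real k ^ m * (b k - c)) / real n ^ Suc m + c * ((\<Sum>k<n. real k ^ m) / real n ^ Suc m) = (\<Sum>k<n. real k ^ m * b k) / real n ^ Suc m" for n
 proof -
  have "(\<Sum>k<n. real k ^ m * b k) = (\<Sum>k<n. real k ^ m * (b k - c)) + c * (\<Sum>k<n. real k ^ m)"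
   unfolding sum_distrib_left sum.distrib[symmetric] by (intro sum.cong refl) (simp add: algebra_simps)
  thus ?thesis by (simp add: add_divide_distrib)
 qed
 thus ?thesis using lim by (simp del: power_Suc of_nat_Suc)
qed

section \<open>Moments of the limiting density\<close>

lemma zero_density_nonneg:
 assumes "x \<in> {-1..1}"
 shows "0 \<le> zero_density x"
proof (cases "x = 0")
 case False
 have "\<bar>x\<bar> \<le> 1" using assms by auto
 moreover have "0 \<le> sqrt (1 - x^2)" using \<open>\<bar>x\<bar> \<le> 1\<close> by (simp add: abs_square_le_1)
 ultimately have "\<bar>x\<bar> \<le> 1 + sqrt (1 - x^2)" by linarith
 hence "1 \<le> (1 + sqrt (1 - x^2)) / \<bar>x\<bar>" using False by simp
 thus ?thesis by (simp add: zero_density_def)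
qed (simp add: zero_density_def)

lemma circle_mean_cos_power: "circle_mean (\<lambda>t. cos t ^ m) = 1 / pi * integral {0..pi} (\<lambda>t. cos t ^ m)"
proof -
 have i: "(\<lambda>t. cos t ^ m) integrable_on {a..b}" for a b :: real by (intro integrable_continuous_real continuous_intros)
 have "set_integrable lborel {-pi..pi} (\<lambda>t. cos t ^ m)" by (intro set_integrable_circle continuous_intros)
 hence "(LBINT t:{-pi..pi}. cos t ^ m) = integral {-pi..pi} (\<lambda>t. cos t ^ m)" by (rule set_borel_integral_eq_integral)
 also have "\<dots> = integral {-pi..0} (\<lambda>t. cos t ^ m) + integral {0..pi} (\<lambda>t. cos t ^ m)"
  by (rule Henstock_Kurzweil_Integration.integral_combine[symmetric]) (auto intro: i)
 also have "integral {-pi..0} (\<lambda>t. cos t ^ m) = integral {0..pi} (\<lambda>t. cos t ^ m)"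
 proof -
  have "integral {- pi..- 0} (\<lambda>t. cos (- t) ^ m) = integral {0..pi} (\<lambda>t. cos t ^ m)"
   by (rule Henstock_Kurzweil_Integration.integral_reflect_real)
  thus ?thesis by (simp only: cos_minus minus_zero)
 qed
 finally show ?thesis by (simp add: circle_mean_def field_simps)
qed

lemma continuous_x_ln_abs: "continuous_on UNIV (\<lambda>x::real. x * ln \<bar>x\<bar>)"
proof (rule continuous_at_imp_continuous_on, intro ballI)
 fix x :: real
 show "isCont (\<lambda>x. x * ln \<bar>x\<bar>) x"
 proof (cases "x = 0")
  case True
  have "((\<lambda>x::real. x * ln \<bar>x\<bar>) \<longlongrightarrow> 0) (at 0)"
  proof (rule filterlim_split_at)
   show "((\<lambda>x::real. x * ln \<bar>x\<bar>) \<longlongrightarrow> 0) (at_left 0)" by real_asymp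
   show "((\<lambda>x::real. x * ln \<bar>x\<bar>) \<longlongrightarrow> 0) (at_right 0)" by real_asymp
  qed
  thus ?thesis using True by (simp add: isCont_def)
 next
  case False
  thus ?thesis by (intro continuous_intros) auto
 qed
qed

lemma has_real_derivative_density:
 assumes x: "\<bar>x\<bar> < 1" "x \<noteq> 0"
 shows "((\<lambda>x. ln (1 + sqrt (1 - x^2)) - ln \<bar>x\<bar>) has_real_derivative - 1 / (x * sqrt (1 - x^2))) (at x)"
proof -
 define s where "s = sqrt (1 - x^2)"
 have x2: "x^2 < 1" using x(1) by (simp add: abs_square_less_1)
 have s: "s > 0" "s * s = 1 - x * x" using x2 by (auto simp: s_def power2_eq_square)
 have "((\<lambda>x. ln (1 + sqrt (1 - x^2))) has_real_derivative (- (2 * x) * (inverse s / 2)) * (1 / (1 + s))) (at x)"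
  unfolding s_def using x2 s(1)
  by (auto intro!: derivative_eq_intros simp: add_pos_nonneg field_simps s_def)
 moreover have "((\<lambda>x. ln \<bar>x\<bar>) has_real_derivative 1 / x) (at x)"
 proof (cases "x > 0")
  case True
  have "(ln has_real_derivative 1 / x) (at x)" using True by (auto intro!: derivative_eq_intros)
  thus ?thesis by (rule has_field_derivative_transform_within_open[of _ _ _ "{0<..}"]) (use True in auto)
 next
  case False
  hence neg: "x < 0" using x(2) by simp
  have "((\<lambda>x. ln (- x)) has_real_derivative 1 / x) (at x)" using neg by (auto intro!: derivative_eq_intros simp: field_simps)
  thus ?thesis by (rule has_field_derivative_transform_within_open[of _ _ _ "{..<0}"]) (use neg in auto)
 qed
 ultimately have "((\<lambda>x. ln (1 + sqrt (1 - x^2)) - ln \<bar>x\<bar>) has_real_derivative (- (2 * x) * (inverse s / 2)) * (1 / (1 + s)) - 1 / x) (at x)"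
  by (rule DERIV_diff)
 moreover have "(- (2 * x) * (inverse s / 2)) * (1 / (1 + s)) - 1 / x = - 1 / (x * s)"
 proof -
  have "(- (2 * x) * (inverse s / 2)) * (1 / (1 + s)) - 1 / x = - (x * x + s * (1 + s)) / (x * s * (1 + s))"
   using s(1) x(2) by (simp add: divide_simps)
  also have "x * x + s * (1 + s) = 1 + s" using s(2) by (simp add: algebra_simps)
  also have "- (1 + s) / (x * s * (1 + s)) = - 1 / (x * s)" using s(1) by (simp add: divide_simps)
  finally show ?thesis .
 qed
 ultimately show ?thesis by (simp add: s_def)
qed

text \<open>The density is the law of u cos t with u uniform on [0,1] and t uniform on the circle,
  whence the factor 1 / (m + 1). In the proof, \<open>G\<close> is \<pi> x^(m+1) times the density
  minus \<open>K (arccos x)\<close>; the latter cancels the derivative -1 / (x sqrt (1 - x^2)) of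
  the logarithm. The point 0 is exceptional, but x ln \<bar>x\<bar> is continuous there.\<close>

lemma has_integral_zero_density:
 "((\<lambda>x. x ^ m * zero_density x) has_integral circle_mean (\<lambda>t. cos t ^ m) / real (Suc m)) {-1..1}"
proof -
 define K where "K u = integral {0..u} (\<lambda>t. cos t ^ m)" for u :: real
 define G where "G x = x ^ m * (x * ln (1 + sqrt (1 - x^2)) - x * ln \<bar>x\<bar>) - K (arccos x)" for x :: real
 have dK: "(K has_real_derivative cos u ^ m) (at u within {0..pi})" if "u \<in> {0..pi}" for u
  unfolding K_def[abs_def] has_real_derivative_iff_has_vector_derivative
  by (rule integral_has_vector_derivative[OF _ that]) (intro continuous_intros)
 have cK: "continuous_on {0..pi} K"
  using dK by (intro DERIV_continuous_on)
 have cG: "continuous_on {-1..1} G"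
 proof -
  have c1: "continuous_on {-1..1} (\<lambda>x. K (arccos x))"
   by (rule continuous_on_compose2[OF cK]) (auto intro!: continuous_intros arccos_lbound arccos_ubound)
  have c2: "continuous_on {-1..1} (\<lambda>x::real. ln (1 + sqrt (1 - x^2)))"
  proof (intro continuous_intros ballI)
   fix x :: real assume "x \<in> {-1..1}"
   hence "0 \<le> sqrt (1 - x^2)" by (auto simp: abs_square_le_1 abs_le_iff)
   thus "1 + sqrt (1 - x^2) \<noteq> 0" by linarith
  qed
  have c3: "continuous_on {-1..1} (\<lambda>x::real. x * ln \<bar>x\<bar>)" by (rule continuous_on_subset[OF continuous_x_ln_abs]) simp
  show ?thesis unfolding G_def[abs_def]
   by (intro c1 c2 c3 continuous_on_diff continuous_on_mult continuous_on_power continuous_on_id)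
 qed
 have dG: "(G has_vector_derivative (real (Suc m) * pi) * (x ^ m * zero_density x)) (at x)" if x: "x \<in> {-1<..<1} - {0}" for x
 proof -
  define s where "s = sqrt (1 - x^2)"
  define l where "l = ln (1 + s) - ln \<bar>x\<bar>"
  have x': "\<bar>x\<bar> < 1" "x \<noteq> 0" "-1 < x" "x < 1" using x by (auto simp: abs_less_iff)
  have s: "s > 0" using x'(1) by (simp add: s_def abs_square_less_1)
  have "arccos x \<in> {0<..<pi}" using arccos_lt_bounded[OF x'(3,4)] by simp
  hence "(K has_real_derivative cos (arccos x) ^ m) (at (arccos x))"
   using dK[of "arccos x"] at_within_interior[of "arccos x" "{0..pi}"] by (auto simp: less_imp_le)
  moreover have "(arccos has_real_derivative inverse (- s)) (at x)"
   unfolding s_def using x' by (intro DERIV_arccos)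
  ultimately have 1: "((\<lambda>x. K (arccos x)) has_real_derivative cos (arccos x) ^ m * inverse (- s)) (at x)"
   by (rule DERIV_chain2)
  have 2: "((\<lambda>x. x ^ Suc m * (ln (1 + sqrt (1 - x^2)) - ln \<bar>x\<bar>)) has_real_derivative
    real (Suc m) * x ^ m * l + (- 1 / (x * s)) * x ^ Suc m) (at x)"
   using DERIV_mult[OF DERIV_pow[of "Suc m" x UNIV] has_real_derivative_density[OF x'(1,2)]] by (simp add: l_def s_def del: power_Suc of_nat_Suc)
  have G: "G = (\<lambda>x. x ^ Suc m * (ln (1 + sqrt (1 - x^2)) - ln \<bar>x\<bar>) - K (arccos x))"
   by (auto simp: G_def fun_eq_iff algebra_simps)
  have "(G has_real_derivative real (Suc m) * x ^ m * l + (- 1 / (x * s)) * x ^ Suc m - cos (arccos x) ^ m * inverse (- s)) (at x)"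
   unfolding G by (rule DERIV_diff[OF 2 1])
  moreover have "real (Suc m) * x ^ m * l + (- 1 / (x * s)) * x ^ Suc m - cos (arccos x) ^ m * inverse (- s) = real (Suc m) * x ^ m * l"
   using x' s by (simp add: field_simps)
  moreover have "l = pi * zero_density x"
  proof -
   have "1 + s > 0" using s by simp
   thus ?thesis unfolding zero_density_def s_def[symmetric] using x'(2) by (simp add: l_def ln_div)
  qed
  ultimately show ?thesis by (simp add: has_real_derivative_iff_has_vector_derivative mult_ac)
 qed
 have "((\<lambda>x. (real (Suc m) * pi) * (x ^ m * zero_density x)) has_integral (G 1 - G (- 1))) {-1..1}"
  by (rule fundamental_theorem_of_calculus_interior_strong[where S = "{0}"]) (use dG cG in auto)
 moreover have "G 1 - G (- 1) = pi * circle_mean (\<lambda>t. cos t ^ m)"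
  unfolding circle_mean_cos_power by (simp add: G_def K_def)
 ultimately have "((\<lambda>x. (real (Suc m) * pi) * (x ^ m * zero_density x)) has_integral pi * circle_mean (\<lambda>t. cos t ^ m)) {-1..1}" by simp
 from has_integral_mult_right[OF this, of "1 / (real (Suc m) * pi)"] show ?thesis
  by (simp add: mult.assoc[symmetric] del: of_nat_Suc)
qed

section \<open>Multiplication by x modulo a polynomial, and its traces\<close>

lemma sech_norm2_mp: "sech_norm2 (mp k) = 1"
 using sech_norm2_inner[of "mp k"] by (simp add: sech_inner_mp)

text \<open>Multiplication by x on the quotient of the polynomial ring by \<open>Q\<close>, acting
  on representatives of degree below that of \<open>Q\<close>: one multiple of \<open>Q\<close>
  suffices to cancel the leading term.\<close>

definition trunc_mult :: "complex poly \<Rightarrow> complex poly \<Rightarrow> complex poly" where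
 "trunc_mult Q f = [:0, 1:] * f - smult (coeff f (degree Q - 1) / lead_coeff Q) Q"

context
 fixes Q :: "complex poly" and n :: nat and B :: real
 assumes n: "n > 0" and Q: "degree Q = n" "lead_coeff Q = lead_coeff (mp n)" and B: "sech_norm2 Q \<le> B"
begin

lemma degree_trunc_mult:
 assumes "degree f < n"
 shows "degree (trunc_mult Q f) < n"
 unfolding trunc_mult_def
proof (rule degree_diff_less)
 show "degree ([:0, 1:] * f) \<le> n" using assms by (intro order_trans[OF degree_mult_le]) auto
 show "degree (smult (coeff f (degree Q - 1) / lead_coeff Q) Q) \<le> n"
  using Q(1) by (intro order_trans[OF degree_smult_le]) auto
 have "lead_coeff Q \<noteq> 0" unfolding Q(2) by (rule lead_coeff_mp)
 thus "coeff ([:0, 1:] * f) n = coeff (smult (coeff f (degree Q - 1) / lead_coeff Q) Q) n"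
  using n unfolding Q(1) by (cases n) auto
qed (rule n)

text \<open>Since n times the leading coefficient of \<open>Q\<close> is twice that of
  \<open>mp (n - 1)\<close>, the subtracted multiple of \<open>Q\<close> is n/2 times the last
  coordinate of \<open>f\<close>. A bounded norm of \<open>Q\<close> therefore keeps the operator of
  order n.\<close>

lemma sech_norm2_trunc_mult:
 assumes "degree f < n"
 shows "sech_norm2 (trunc_mult Q f) \<le> (2 + B / 2) * (real n)^2 * sech_norm2 f"
proof -
 obtain n' where n': "n = Suc n'" using n by (cases n) auto
 have "coeff f n' = (\<Sum>k<n. mp_coeff k f * coeff (mp k) n')"
  by (subst mp_expansion[OF assms]) (simp add: coeff_sum)
 also have "\<dots> = (\<Sum>k\<in>{n'}. mp_coeff k f * coeff (mp k) n')"
  using n' by (intro sum.mono_neutral_right) (auto intro!: coeff_eq_0 simp: degree_mp)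
 finally have c: "coeff f n' = mp_coeff n' f * lead_coeff (mp n')" by (simp add: degree_mp)
 have "of_nat n * lead_coeff Q = 2 * lead_coeff (mp n')" unfolding Q(2) n' by (rule lead_coeff_mp_Suc)
 hence e: "lead_coeff (mp n') = of_nat n * lead_coeff Q / 2" by simp
 have nz: "lead_coeff Q \<noteq> 0" unfolding Q(2) by (rule lead_coeff_mp)
 have "degree Q - 1 = n'" by (simp add: Q(1) n')
 hence f: "coeff f (degree Q - 1) = mp_coeff n' f * (of_nat n * lead_coeff Q / 2)" by (simp only: c e)
 have r: "coeff f (degree Q - 1) / lead_coeff Q = mp_coeff n' f * of_nat n / 2"
  unfolding f using nz by simp
 have "(cmod (mp_coeff n' f))^2 \<le> sech_norm2 f" by (rule cmod_mp_coeff_le[OF assms]) (simp add: n')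
 hence "(cmod (coeff f (degree Q - 1) / lead_coeff Q))^2 \<le> sech_norm2 f * (real n)^2 / 4"
  unfolding r by (simp add: norm_mult norm_divide power_mult_distrib power_divide mult_right_mono)
 hence q: "(cmod (coeff f (degree Q - 1) / lead_coeff Q))^2 * sech_norm2 Q \<le> (sech_norm2 f * (real n)^2 / 4) * B"
  using sech_norm2_nonneg[of Q] sech_norm2_nonneg[of f] B by (intro mult_mono) auto
 have "trunc_mult Q f = [:0, 1:] * f + smult (- (coeff f (degree Q - 1) / lead_coeff Q)) Q"
  by (simp add: trunc_mult_def)
 hence "sech_norm2 (trunc_mult Q f) \<le> 2 * sech_norm2 ([:0, 1:] * f) + 2 * sech_norm2 (smult (- (coeff f (degree Q - 1) / lead_coeff Q)) Q)"
  by (simp only: sech_norm2_add)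
 also have "sech_norm2 (smult (- (coeff f (degree Q - 1) / lead_coeff Q)) Q) = (cmod (coeff f (degree Q - 1) / lead_coeff Q))^2 * sech_norm2 Q"
  unfolding sech_norm2_smult norm_minus_cancel ..
 finally have "sech_norm2 (trunc_mult Q f) \<le> 2 * ((real n)^2 * sech_norm2 f) + 2 * ((sech_norm2 f * (real n)^2 / 4) * B)"
  using q sech_norm2_mult_x[OF assms] by linarith
 thus ?thesis by (simp add: algebra_simps)
qed

lemma trunc_mult_power:
 assumes "degree f < n"
 shows "degree ((trunc_mult Q ^^ m) f) < n \<and> sech_norm2 ((trunc_mult Q ^^ m) f) \<le> ((2 + B / 2) * (real n)^2) ^ m * sech_norm2 f"
proof (induction m)
 case (Suc m)
 have B0: "0 \<le> (2 + B / 2) * (real n)^2" using B sech_norm2_nonneg[of Q] by simp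
 let ?g = "(trunc_mult Q ^^ m) f"
 have "sech_norm2 (trunc_mult Q ?g) \<le> (2 + B / 2) * (real n)^2 * sech_norm2 ?g"
  using Suc by (intro sech_norm2_trunc_mult) simp
 also have "\<dots> \<le> (2 + B / 2) * (real n)^2 * (((2 + B / 2) * (real n)^2) ^ m * sech_norm2 f)"
  using Suc B0 by (intro mult_left_mono) auto
 finally show ?case using degree_trunc_mult[of ?g] Suc by (simp add: mult.assoc)
qed (use assms in simp)

text \<open>As long as the degree stays below n nothing is reduced, so these diagonal entries are
  those of the untruncated Jacobi matrix.\<close>

lemma trunc_mult_power_mp:
 assumes "k + m < n"
 shows "(trunc_mult Q ^^ m) (mp k) = [:0, 1:] ^ m * mp k"
 using assms
proof (induction m)
 case (Suc m)
 have "degree ([:0, 1:] ^ m * mp k :: complex poly) = m + k"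
  by (subst degree_mult_eq) (auto simp: degree_power_eq degree_mp mp_nonzero)
 hence "coeff ([:0, 1:] ^ m * mp k) (degree Q - 1) = 0" using Suc.prems Q(1) by (intro coeff_eq_0) simp
 thus ?case using Suc by (simp add: trunc_mult_def)
qed simp

lemma cmod_mp_coeff_trunc_mult:
 assumes "k < n"
 shows "cmod (mp_coeff k ((trunc_mult Q ^^ m) (mp k))) \<le> sqrt ((2 + B / 2) ^ m) * real n ^ m"
proof -
 have d: "degree (mp k) < n" using assms by (simp add: degree_mp)
 have "(cmod (mp_coeff k ((trunc_mult Q ^^ m) (mp k))))^2 \<le> sech_norm2 ((trunc_mult Q ^^ m) (mp k))"
  using trunc_mult_power[OF d, of m] assms by (intro cmod_mp_coeff_le) auto
 also have "\<dots> \<le> ((2 + B / 2) * (real n)^2) ^ m * sech_norm2 (mp k)" using trunc_mult_power[OF d, of m] by blast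
 finally have "(cmod (mp_coeff k ((trunc_mult Q ^^ m) (mp k))))^2 \<le> (2 + B / 2) ^ m * (real n ^ m)^2"
  by (simp add: sech_norm2_mp power_mult_distrib power_mult[symmetric] mult.commute)
 hence "cmod (mp_coeff k ((trunc_mult Q ^^ m) (mp k))) \<le> sqrt ((2 + B / 2) ^ m * (real n ^ m)^2)" by (rule real_le_rsqrt)
 thus ?thesis by (simp add: real_sqrt_mult)
qed

lemma power_sum_eq: "(\<Sum>k<n. mp_coeff k ((trunc_mult Q ^^ m) (mp k))) = (\<Sum>z\<in>#proots Q. z ^ m)"
proof (rule trace_eq_power_sum[where Q = Q and n = n and p = mp and \<alpha> = mp_coeff and T = "trunc_mult Q"])
 show "Q \<noteq> 0" using Q(1) n by auto
 show "trunc_mult Q f = [:0, 1:] * f - smult (coeff f (n - 1) / lead_coeff Q) Q" for f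
  by (simp add: trunc_mult_def Q(1))
qed (auto simp: Q(1) mp_coeff_add mp_coeff_smult degree_mp intro: mp_expansion)

end

definition mp_moment :: "nat \<Rightarrow> nat \<Rightarrow> real" where
 "mp_moment m k = (\<integral>x. (x / real k) ^ m * (mpr k x * mpr k x) * sech_wt x \<partial>lborel)"

lemma tendsto_mp_moment: "mp_moment m \<longlonglongrightarrow> circle_mean (\<lambda>t. cos t ^ m)"
 using tendsto_mpr_monomial[of m 0 0] by (simp add: mp_moment_def[abs_def] shifted_mpr_def)

lemma mp_coeff_power:
 assumes "k > 0"
 shows "mp_coeff k ([:0, 1:] ^ m * mp k) = cr (real k ^ m * mp_moment m k)"
proof -
 have "poly ([:0, 1:] ^ m * mp k) (cr x) * cnj (poly (mp k) (cr x)) * cr (sech_wt x) =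
   cr (real k ^ m * ((x / real k) ^ m * (mpr k x * mpr k x) * sech_wt x))" for x
  using assms by (simp add: poly_mp_of_real power_divide)
 thus ?thesis unfolding mp_coeff_def sech_inner_def mp_moment_def
  by (simp only: integral_complex_of_real integral_mult_right_zero)
qed

context
 fixes \<nu> :: real
 assumes \<nu>: "0 < \<nu>" "\<nu> \<le> 1 / 2"
begin

lemma scaled_OP_bounded:
 obtains B where "\<forall>\<^sub>F n in sequentially. sech_norm2 (scaled_OP \<nu> n) \<le> B"
proof -
 obtain D where D: "coeff D 0 = 1" "\<forall>\<^sub>F n in sequentially. sech_norm2 (scaled_OP \<nu> n - approx_poly D n) \<le> 1"
  by (rule scaled_OP_approx[OF \<nu>, of 1 0]) (simp, simp, rule that, assumption+)
 have "\<forall>\<^sub>F n in sequentially. sech_norm2 (scaled_OP \<nu> n) \<le> 2 * 1 + 2 * (4 * (\<Sum>i\<le>degree D. (cmod (coeff D i))^2))"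
  using D(2) eventually_gt_at_top[of "degree D"]
 proof eventually_elim
  case (elim n)
  have "sech_norm2 ((scaled_OP \<nu> n - approx_poly D n) + approx_poly D n) \<le>
    2 * sech_norm2 (scaled_OP \<nu> n - approx_poly D n) + 2 * sech_norm2 (approx_poly D n)" by (rule sech_norm2_add)
  thus ?case using elim(1) sech_norm2_approx_poly[OF elim(2) D(1)] by simp
 qed
 thus ?thesis by (rule that)
qed

theorem tendsto_root_power_mean:
 "(\<lambda>n. 1 / of_nat n * (\<Sum>x\<in>#proots (scaled_OP \<nu> n). (x / of_nat n) ^ m))
   \<longlonglongrightarrow> cr (circle_mean (\<lambda>t. cos t ^ m) / real (Suc m))"
proof -
 obtain B where B: "\<forall>\<^sub>F n in sequentially. sech_norm2 (scaled_OP \<nu> n) \<le> B" by (rule scaled_OP_bounded) (rule that)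
 obtain b where b: "\<And>k. \<bar>mp_moment m k\<bar> \<le> b"
  using convergent_imp_Bseq[OF convergentI[OF tendsto_mp_moment[of m]]] by (auto simp: Bseq_def)
 define C where "C = sqrt ((2 + B / 2) ^ m) + b"
 define S where "S n = (\<Sum>k<n. real k ^ m * mp_moment m k)" for n
 define Z where "Z n = (\<Sum>x\<in>#proots (scaled_OP \<nu> n). x ^ m)" for n
 have ev: "\<forall>\<^sub>F n in sequentially. cmod (Z n / of_nat n ^ Suc m - cr (S n / real n ^ Suc m)) \<le> real (Suc m) * C / real n"
  using B eventually_gt_at_top[of m]
 proof eventually_elim
  case (elim n)
  have n: "n > 0" using elim(2) by simp
  note ctx = n degree_scaled_OP[OF \<nu>, of n] lead_coeff_scaled_OP[OF \<nu>, of n] elim(1)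
  let ?\<tau> = "\<lambda>k. mp_coeff k ((trunc_mult (scaled_OP \<nu> n) ^^ m) (mp k))"
  let ?b = "\<lambda>k. cr (real k ^ m * mp_moment m k)"
  have Z: "Z n = (\<Sum>k<n. ?\<tau> k)" unfolding Z_def by (rule power_sum_eq[OF ctx, symmetric])
  have bad: "cmod (?\<tau> k - ?b k) \<le> C * real n ^ m" if k: "k < n" for k
  proof -
   have "cmod (?b k) = real k ^ m * \<bar>mp_moment m k\<bar>" unfolding norm_of_real by (simp add: abs_mult)
   also have "\<dots> \<le> real n ^ m * b" using k b by (intro mult_mono power_mono) auto
   finally show ?thesis
    using norm_triangle_ineq4[of "?\<tau> k" "?b k"] cmod_mp_coeff_trunc_mult[OF ctx k, of m] by (simp add: C_def algebra_simps)
  qed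
  \<comment> \<open>Index 0 is set aside because \<open>mp_moment\<close> divides by
    \<open>k\<close>. Together with the last m indices this leaves at most m + 1 exceptions, each of
    order n^m against the normalisation n^(m+1).\<close>
  have good: "?\<tau> k - ?b k = 0" if "0 < k" "k + m < n" for k
   using trunc_mult_power_mp[OF ctx that(2)] mp_coeff_power[OF that(1), of m] by simp
  have C0: "0 \<le> C * real n ^ m" using order_trans[OF norm_ge_zero bad[OF n]] .
  have "cmod (Z n - cr (S n)) = cmod (\<Sum>k<n. ?\<tau> k - ?b k)"
   unfolding Z S_def of_real_sum sum_subtractf ..
  also have "(\<Sum>k<n. ?\<tau> k - ?b k) = (\<Sum>k\<in>insert 0 {n - m..<n}. ?\<tau> k - ?b k)"
  proof (rule sum.mono_neutral_right)
   show "insert 0 {n - m..<n} \<subseteq> {..<n}" using n by auto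
   show "\<forall>k\<in>{..<n} - insert 0 {n - m..<n}. ?\<tau> k - ?b k = 0" using elim(2) by (intro ballI good) auto
  qed simp
  also have "cmod \<dots> \<le> (\<Sum>k\<in>insert 0 {n - m..<n}. C * real n ^ m)"
   using bad n by (intro order_trans[OF norm_sum] sum_mono) auto
  also have "\<dots> = real (card (insert 0 {n - m..<n})) * (C * real n ^ m)" by simp
  also have "\<dots> \<le> real (Suc m) * (C * real n ^ m)"
  proof -
   have "card (insert 0 {n - m..<n}) \<le> Suc (card {n - m..<n})" by (rule card_insert_le_m1) auto
   also have "\<dots> = Suc m" using elim(2) by simp
   finally show ?thesis using C0 by (intro mult_right_mono) auto
  qed
  finally have 1: "cmod (Z n - cr (S n)) \<le> real (Suc m) * (C * real n ^ m)" .
  have "Z n / of_nat n ^ Suc m - cr (S n / real n ^ Suc m) = (Z n - cr (S n)) / of_nat n ^ Suc m"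
   by (simp add: diff_divide_distrib)
  hence "cmod (Z n / of_nat n ^ Suc m - cr (S n / real n ^ Suc m)) = cmod (Z n - cr (S n)) / real n ^ Suc m"
   by (simp only: norm_divide norm_power norm_of_nat)
  also have "\<dots> \<le> (real (Suc m) * (C * real n ^ m)) / real n ^ Suc m" using 1 by (rule divide_right_mono) simp
  also have "\<dots> = real (Suc m) * C / real n" using n by simp
  finally show ?case .
 qed
 have "(\<lambda>n. Z n / of_nat n ^ Suc m - cr (S n / real n ^ Suc m)) \<longlonglongrightarrow> 0"
  by (rule Lim_null_comparison[OF ev lim_const_over_n])
 moreover have "(\<lambda>n. cr (S n / real n ^ Suc m)) \<longlonglongrightarrow> cr (circle_mean (\<lambda>t. cos t ^ m) / real (Suc m))"
  unfolding S_def by (intro tendsto_of_real tendsto_weighted_cesaro tendsto_mp_moment)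
 ultimately have "(\<lambda>n. (Z n / of_nat n ^ Suc m - cr (S n / real n ^ Suc m)) + cr (S n / real n ^ Suc m))
   \<longlonglongrightarrow> 0 + cr (circle_mean (\<lambda>t. cos t ^ m) / real (Suc m))" by (rule tendsto_add)
 moreover have "Z n / of_nat n ^ Suc m = 1 / of_nat n * (\<Sum>x\<in>#proots (scaled_OP \<nu> n). (x / of_nat n) ^ m)" for n
 proof -
  have "(\<Sum>x\<in>#A. (x / of_nat n) ^ m) = (\<Sum>x\<in>#A. x ^ m) / of_nat n ^ m" for A :: "complex multiset"
   by (induction A) (simp_all add: power_divide add_divide_distrib)
  thus ?thesis by (simp add: Z_def)
 qed
 ultimately show ?thesis by simp
qed

end

section \<open>From power sums to continuous test functions\<close>

lemma proots_pcompose_scale: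
 fixes p :: "complex poly"
 assumes p: "p \<noteq> 0" and a: "a \<noteq> 0"
 shows "proots (pcompose p [:0, a:]) = image_mset (\<lambda>z. z / a) (proots p)"
proof -
 have lin: "pcompose [:- x, 1:] [:0, a:] = smult a [:- (x / a), 1:]" for x
  using a by (simp add: pcompose_pCons)
 have A: "proots (pcompose (\<Prod>x\<in>#A. [:- x, 1:]) [:0, a:]) = image_mset (\<lambda>z. z / a) A \<and>
   pcompose (\<Prod>x\<in>#A. [:- x, 1:]) [:0, a:] \<noteq> 0" for A
 proof (induction A)
  case (add x A)
  have nz: "smult a [:- (x / a), 1:] \<noteq> 0" using a by simp
  have "pcompose (\<Prod>y\<in>#add_mset x A. [:- y, 1:]) [:0, a:] =
    smult a [:- (x / a), 1:] * pcompose (\<Prod>y\<in>#A. [:- y, 1:]) [:0, a:]"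
   by (simp only: image_mset_add_mset prod_mset.add_mset pcompose_mult lin)
  moreover have "proots (smult a [:- (x / a), 1:]) = {#x / a#}" by (subst proots_smult[OF a]) (simp only: proots_linear_factor minus_minus)
  ultimately show ?case using add nz by (simp add: proots_mult del: mult_smult_left mult_pCons_left)
 qed (simp add: one_pCons pcompose_const)
 have "pcompose p [:0, a:] = smult (lead_coeff p) (pcompose (\<Prod>x\<in>#proots p. [:- x, 1:]) [:0, a:])"
  by (subst (1) complex_poly_decompose_multiset[of p, symmetric]) (rule pcompose_smult)
 thus ?thesis using p A[of "proots p"] by simp
qed

context
 fixes \<nu> :: real
 assumes \<nu>: "0 < \<nu>" "\<nu> \<le> 1 / 2"
begin

lemma sum_roots_bessel_OP:
 "(\<Sum>z\<in>#proots (bessel_OP \<nu> n). f (z / (\<i> * cr pi * of_nat n))) = (\<Sum>x\<in>#proots (scaled_OP \<nu> n). f (x / of_nat n))"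
proof -
 have c: "lead_coeff (mp n) / (\<i> * cr pi) ^ n \<noteq> 0" using lead_coeff_mp[of n] by simp
 have P0: "bessel_OP \<nu> n \<noteq> 0"
 proof -
  have "lead_coeff (moment_OP (bessel_moment \<nu>) n) = 1" by (rule lead_coeff_moment_OP)
  hence "moment_OP (bessel_moment \<nu>) n \<noteq> 0" by auto
  thus ?thesis by (simp add: bessel_OP_eq(2)[OF \<nu>] map_poly_eq_0_iff)
 qed
 have "proots (scaled_OP \<nu> n) = image_mset (\<lambda>z. z / (\<i> * cr pi)) (proots (bessel_OP \<nu> n))"
  unfolding scaled_OP_def[OF \<nu>] imag_poly_def bessel_OP_eq(2)[OF \<nu>, symmetric] proots_smult[OF c]
  by (rule proots_pcompose_scale[OF P0]) simp
 thus ?thesis by (simp add: image_mset.compositionality o_def)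
qed

lemma eventually_roots_in:
 assumes U: "open U" "cr ` {-1..1} \<subseteq> U"
 shows "\<forall>\<^sub>F n in sequentially. \<forall>z. poly (scaled_OP \<nu> n) (of_nat n * z) = 0 \<longrightarrow> z \<in> U"
proof -
 have "compact (cr ` {-1..1})" by (intro compact_continuous_image continuous_intros compact_Icc)
 then obtain \<delta> where \<delta>: "\<delta> > 0" "(\<Union>x\<in>cr ` {-1..1}. ball x \<delta>) \<subseteq> U"
  by (rule compact_subset_open_imp_ball_epsilon_subset[OF _ U]) (rule that)
 show ?thesis using scaled_OP_zero_free[OF \<nu> \<delta>(1)]
 proof eventually_elim
  case (elim n)
  show ?case
  proof (intro allI impI)
   fix z assume "poly (scaled_OP \<nu> n) (of_nat n * z) = 0"
   then obtain s where s: "s \<in> {-1..1}" "cmod (z - cr s) < \<delta>" using elim by (meson not_le)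
   hence "z \<in> ball (cr s) \<delta>" by (simp add: dist_norm norm_minus_commute)
   thus "z \<in> U" using \<delta>(2) s(1) by blast
  qed
 qed
qed

lemma has_integral_poly_density:
 "((\<lambda>x. poly p (cr x) * cr (zero_density x)) has_integral
   (\<Sum>i\<le>degree p. coeff p i * cr (circle_mean (\<lambda>t. cos t ^ i) / real (Suc i)))) {-1..1}"
proof -
 have "((\<lambda>x. cr (x ^ i * zero_density x)) has_integral cr (circle_mean (\<lambda>t. cos t ^ i) / real (Suc i))) {-1..1}" for i
  using has_integral_linear[OF has_integral_zero_density[of i] bounded_linear_of_real] by (simp only: o_def)
 hence "((\<lambda>x. \<Sum>i\<le>degree p. coeff p i * cr (x ^ i * zero_density x)) has_integral
   (\<Sum>i\<le>degree p. coeff p i * cr (circle_mean (\<lambda>t. cos t ^ i) / real (Suc i)))) {-1..1}"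
  by (intro has_integral_sum has_integral_mult_right) auto
 moreover have "(\<Sum>i\<le>degree p. coeff p i * cr (x ^ i * zero_density x)) = poly p (cr x) * cr (zero_density x)" for x
  by (simp add: poly_altdef sum_distrib_left sum_distrib_right mult_ac)
 ultimately show ?thesis by simp
qed

lemma tendsto_poly_root_mean:
 "(\<lambda>n. 1 / of_nat n * (\<Sum>x\<in>#proots (scaled_OP \<nu> n). poly p (x / of_nat n)))
   \<longlonglongrightarrow> integral {-1..1} (\<lambda>x. poly p (cr x) * cr (zero_density x))"
proof -
 have "(\<lambda>n. \<Sum>i\<le>degree p. coeff p i * (1 / of_nat n * (\<Sum>x\<in>#proots (scaled_OP \<nu> n). (x / of_nat n) ^ i)))
   \<longlonglongrightarrow> (\<Sum>i\<le>degree p. coeff p i * cr (circle_mean (\<lambda>t. cos t ^ i) / real (Suc i)))"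
  by (intro tendsto_sum tendsto_mult tendsto_const tendsto_root_power_mean[OF \<nu>])
 moreover have "(\<Sum>i\<le>degree p. coeff p i * (1 / of_nat n * (\<Sum>x\<in>#A. (x / of_nat n) ^ i))) = 1 / of_nat n * (\<Sum>x\<in>#A. poly p (x / of_nat n))" for n and A :: "complex multiset"
 proof (induction A)
  case (add x A)
  have "(\<Sum>i\<le>degree p. coeff p i * (1 / of_nat n * (\<Sum>y\<in>#add_mset x A. (y / of_nat n) ^ i))) =
   1 / of_nat n * (\<Sum>i\<le>degree p. coeff p i * (x / of_nat n) ^ i) + (\<Sum>i\<le>degree p. coeff p i * (1 / of_nat n * (\<Sum>y\<in>#A. (y / of_nat n) ^ i)))"
   unfolding sum_distrib_left sum.distrib[symmetric] by (intro sum.cong refl) (simp add: distrib_left mult_ac)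
  thus ?case unfolding add.IH by (simp add: poly_altdef[of p "x / of_nat n"] distrib_left)
 qed simp
 ultimately show ?thesis using has_integral_poly_density[of p] by (simp add: integral_unique)
qed

text \<open>Clamping the argument extends \<open>f\<close> to the whole line as a bounded function,
  so that \<open>weierstrass_with_tail\<close> applies to its real and imaginary parts.\<close>

lemma complex_weierstrass:
 fixes f :: "real \<Rightarrow> complex"
 assumes f: "continuous_on {-1..1} f" and \<epsilon>: "\<epsilon> > 0"
 obtains p where "\<And>x. x \<in> {-1..1} \<Longrightarrow> cmod (f x - poly p (cr x)) \<le> \<epsilon>"
proof -
 define c :: "real \<Rightarrow> real" where "c x = max (-1) (min 1 x)" for x
 have c: "c x \<in> {-1..1}" for x by (auto simp: c_def)
 have cc: "continuous_on UNIV c" unfolding c_def[abs_def] by (intro continuous_intros)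
 have fc: "continuous_on UNIV (\<lambda>x. f (c x))" by (rule continuous_on_compose2[OF f cc]) (use c in auto)
 have "bounded (f ` {-1..1})" by (intro compact_imp_bounded compact_continuous_image f compact_Icc)
 then obtain A where "\<forall>y\<in>f ` {-1..1}. cmod y \<le> A" unfolding bounded_iff by blast
 hence A: "cmod (f x) \<le> A" if "x \<in> {-1..1}" for x using that by blast
 have A0: "A \<ge> 0" by (rule order_trans[OF norm_ge_zero A[of 0]]) simp
 have b: "cmod (f (c x)) \<le> A * (1 + x^2)" for x
 proof -
  have "A * 1 \<le> A * (1 + x^2)" using A0 by (intro mult_left_mono) auto
  thus ?thesis using A[OF c[of x]] by simp
 qed
 have approx: "\<exists>p :: complex poly. \<forall>x. \<bar>x\<bar> \<le> 1 \<longrightarrow> cmod (cr (F x) - poly p (cr x)) \<le> \<epsilon> / 2"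
  if F: "continuous_on UNIV F" "\<And>x. \<bar>F x\<bar> \<le> A * (1 + x^2)" for F :: "real \<Rightarrow> real"
 proof -
  have e2: "\<epsilon> / 2 > 0" using \<epsilon> by simp
  obtain a :: "nat \<Rightarrow> real" and N where a: "\<And>x. \<bar>x\<bar> \<le> 1 \<Longrightarrow> \<bar>F x - (\<Sum>i\<le>N. a i * x ^ i)\<bar> \<le> \<epsilon> / 2"
   by (rule weierstrass_with_tail[OF F e2]) (rule that)
  have "poly (\<Sum>i\<le>N. monom (cr (a i)) i) (cr x) = cr (\<Sum>i\<le>N. a i * x ^ i)" for x
   by (simp add: poly_sum poly_monom)
  hence e: "cmod (cr (F x) - poly (\<Sum>i\<le>N. monom (cr (a i)) i) (cr x)) = \<bar>F x - (\<Sum>i\<le>N. a i * x ^ i)\<bar>" for x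
   by (simp only: of_real_diff[symmetric] norm_of_real)
  show ?thesis
   by (intro exI[where x = "\<Sum>i\<le>N. monom (cr (a i)) i"] allI impI, unfold e, rule a)
 qed
 have "\<exists>p :: complex poly. \<forall>x. \<bar>x\<bar> \<le> 1 \<longrightarrow> cmod (cr (Re (f (c x))) - poly p (cr x)) \<le> \<epsilon> / 2"
  by (rule approx[OF continuous_on_Re[OF fc] order_trans[OF abs_Re_le_cmod b]])
 then obtain p1 where p1: "\<And>x. \<bar>x\<bar> \<le> 1 \<Longrightarrow> cmod (cr (Re (f (c x))) - poly p1 (cr x)) \<le> \<epsilon> / 2"
  by blast
 have "\<exists>p :: complex poly. \<forall>x. \<bar>x\<bar> \<le> 1 \<longrightarrow> cmod (cr (Im (f (c x))) - poly p (cr x)) \<le> \<epsilon> / 2"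
  by (rule approx[OF continuous_on_Im[OF fc] order_trans[OF abs_Im_le_cmod b]])
 then obtain p2 where p2: "\<And>x. \<bar>x\<bar> \<le> 1 \<Longrightarrow> cmod (cr (Im (f (c x))) - poly p2 (cr x)) \<le> \<epsilon> / 2"
  by blast
 show ?thesis
 proof (rule that)
  fix x :: real assume x: "x \<in> {-1..1}"
  hence x1: "\<bar>x\<bar> \<le> 1" and cx: "c x = x" by (auto simp: c_def)
  have "f x - poly (p1 + smult \<i> p2) (cr x) =
   (cr (Re (f x)) - poly p1 (cr x)) + \<i> * (cr (Im (f x)) - poly p2 (cr x))"
   using complex_eq[of "f x"] by (simp add: algebra_simps)
  hence "cmod (f x - poly (p1 + smult \<i> p2) (cr x)) \<le>
   cmod (cr (Re (f x)) - poly p1 (cr x)) + cmod (\<i> * (cr (Im (f x)) - poly p2 (cr x)))"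
   by (simp only: norm_triangle_ineq)
  also have "\<dots> \<le> \<epsilon> / 2 + \<epsilon> / 2"
   using p1[OF x1] p2[OF x1] unfolding cx by (intro add_mono) (simp_all add: norm_mult)
  finally show "cmod (f x - poly (p1 + smult \<i> p2) (cr x)) \<le> \<epsilon>" by simp
 qed
qed

text \<open>The zeros are complex and \<open>f\<close> is merely continuous, so a polynomial can
  approximate it on [-1,1] only. By continuity the difference stays small on a neighbourhood
  \<open>V\<close> of the interval, and \<open>V\<close> eventually contains all scaled zeros; the
  polynomial itself is covered by the power sums.\<close>

lemma tendsto_root_mean:
 assumes U: "open U" "cr ` {-1..1} \<subseteq> U" and f: "continuous_on U f"
 shows "(\<lambda>n. 1 / of_nat n * (\<Sum>x\<in>#proots (scaled_OP \<nu> n). f (x / of_nat n)))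
   \<longlonglongrightarrow> integral {-1..1} (\<lambda>x. f (cr x) * cr (zero_density x))"
proof (rule tendstoI)
 fix e :: real assume e: "e > 0"
 \<comment> \<open>The errors are \<epsilon> for the polynomial mean, 2 \<epsilon> on
   \<open>V\<close> and \<epsilon> for the integral, in total less than 5 \<epsilon>.\<close>
 define \<epsilon> where "\<epsilon> = e / 5"
 have \<epsilon>: "\<epsilon> > 0" using e by (simp add: \<epsilon>_def)
 have fr: "continuous_on {-1..1} (\<lambda>x. f (cr x))"
  by (rule continuous_on_compose2[OF f]) (use U(2) in \<open>auto intro!: continuous_intros\<close>)
 obtain p where p: "\<And>x. x \<in> {-1..1} \<Longrightarrow> cmod (f (cr x) - poly p (cr x)) \<le> \<epsilon>"
  by (rule complex_weierstrass[OF fr \<epsilon>]) (rule that)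
 define h where "h z = f z - poly p z" for z
 have h: "continuous_on U h" unfolding h_def[abs_def] by (intro continuous_intros f)
 define V where "V = U \<inter> h -` ball 0 (2 * \<epsilon>)"
 have V: "open V" unfolding V_def by (rule continuous_open_preimage[OF h U(1) open_ball])
 have KV: "cr ` {-1..1} \<subseteq> V"
 proof
  fix z assume "z \<in> cr ` {-1..1}"
  then obtain x where x: "x \<in> {-1..1}" "z = cr x" by blast
  have "cmod (h z) \<le> \<epsilon>" using p[OF x(1)] by (simp add: h_def x(2))
  moreover have "z \<in> U" using U(2) x by blast
  ultimately show "z \<in> V" using \<epsilon> by (simp add: V_def)
 qed
 let ?I = "\<lambda>g. integral {-1..1} (\<lambda>x. g (cr x) * cr (zero_density x))"
 have d: "(zero_density has_integral 1) {-1..1}"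
  using has_integral_zero_density[of 0] by (simp add: circle_mean_const)
 have da: "zero_density absolutely_integrable_on {-1..1}"
  using d zero_density_nonneg by (intro nonnegative_absolutely_integrable_1) (auto simp: has_integral_iff)
 have if_: "(\<lambda>x. f (cr x) * cr (zero_density x)) integrable_on {-1..1}"
 proof -
  have "(\<lambda>x. zero_density x *\<^sub>R f (cr x)) absolutely_integrable_on {-1..1}"
  proof (rule absolutely_integrable_bounded_measurable_product[where h = "\<lambda>a b. b *\<^sub>R a", OF _ _ _ _ da])
   show "bilinear (\<lambda>(a::complex) (b::real). b *\<^sub>R a)"
    unfolding bilinear_def by (auto intro!: linearI simp: scaleR_add_left scaleR_add_right)
   show "(\<lambda>x. f (cr x)) \<in> borel_measurable (lebesgue_on {-1..1})"
    by (rule continuous_imp_measurable_on_sets_lebesgue[OF fr]) simp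
   show "bounded ((\<lambda>x. f (cr x)) ` {-1..1})"
    by (intro compact_imp_bounded compact_continuous_image fr compact_Icc)
  qed simp
  hence "(\<lambda>x. zero_density x *\<^sub>R f (cr x)) integrable_on {-1..1}"
   by (rule set_lebesgue_integral_eq_integral)
  thus ?thesis by (simp add: scaleR_conv_of_real mult.commute)
 qed
 have ip: "(\<lambda>x. poly p (cr x) * cr (zero_density x)) integrable_on {-1..1}"
  using has_integral_poly_density[of p] by (rule has_integral_integrable)
 have int: "cmod (?I f - ?I (poly p)) \<le> \<epsilon>"
 proof -
  have "?I f - ?I (poly p) = integral {-1..1} (\<lambda>x. f (cr x) * cr (zero_density x) - poly p (cr x) * cr (zero_density x))"
   by (rule Henstock_Kurzweil_Integration.integral_diff[OF if_ ip, symmetric])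
  also have "cmod \<dots> \<le> integral {-1..1} (\<lambda>x. \<epsilon> * zero_density x)"
  proof (rule integral_norm_bound_integral)
   show "(\<lambda>x. f (cr x) * cr (zero_density x) - poly p (cr x) * cr (zero_density x)) integrable_on {-1..1}"
    by (rule Henstock_Kurzweil_Integration.integrable_diff[OF if_ ip])
   show "(\<lambda>x. \<epsilon> * zero_density x) integrable_on {-1..1}"
    using has_integral_mult_right[OF d, of \<epsilon>] by (rule has_integral_integrable)
   show "cmod (f (cr x) * cr (zero_density x) - poly p (cr x) * cr (zero_density x)) \<le> \<epsilon> * zero_density x"
    if "x \<in> {-1..1}" for x
    using mult_right_mono[OF p[OF that] zero_density_nonneg[OF that]] zero_density_nonneg[OF that]
    by (simp add: left_diff_distrib[symmetric] norm_mult)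
  qed
  also have "\<dots> = \<epsilon>" using integral_unique[OF has_integral_mult_right[OF d, of \<epsilon>]] by (simp only: mult_1_right)
  finally show ?thesis .
 qed
 have "\<forall>\<^sub>F n in sequentially. dist (1 / of_nat n * (\<Sum>x\<in>#proots (scaled_OP \<nu> n). poly p (x / of_nat n))) (?I (poly p)) < \<epsilon>"
  using tendstoD[OF tendsto_poly_root_mean \<epsilon>] .
 thus "\<forall>\<^sub>F n in sequentially. dist (1 / of_nat n * (\<Sum>x\<in>#proots (scaled_OP \<nu> n). f (x / of_nat n))) (?I f) < e"
  using eventually_roots_in[OF V KV] eventually_gt_at_top[of 0]
 proof eventually_elim
  case (elim n)
  let ?Q = "scaled_OP \<nu> n"
  let ?S = "\<lambda>g. \<Sum>x\<in>#proots ?Q. g (x / of_nat n)"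
  have hs: "cmod (h (x / of_nat n)) \<le> 2 * \<epsilon>" if "x \<in># proots ?Q" for x
  proof -
   have "?Q \<noteq> 0" using that by auto
   hence "poly ?Q x = 0" using that by simp
   hence "poly ?Q (of_nat n * (x / of_nat n)) = 0" using elim(3) by simp
   hence "x / of_nat n \<in> V" using elim(2) by blast
   thus ?thesis by (simp add: V_def)
  qed
  have bd: "cmod (\<Sum>x\<in>#A. h (x / of_nat n)) \<le> real (size A) * (2 * \<epsilon>)" if "\<And>x. x \<in># A \<Longrightarrow> cmod (h (x / of_nat n)) \<le> 2 * \<epsilon>" for A
   using that
  proof (induction A)
   case (add x A)
   have "cmod (\<Sum>y\<in>#add_mset x A. h (y / of_nat n)) \<le> cmod (h (x / of_nat n)) + cmod (\<Sum>y\<in>#A. h (y / of_nat n))"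
    by (simp add: norm_triangle_ineq)
   also have "\<dots> \<le> 2 * \<epsilon> + real (size A) * (2 * \<epsilon>)" using add by (intro add_mono) auto
   finally show ?case by (simp add: algebra_simps)
  qed simp
  have "cmod (?S h) \<le> real (size (proots ?Q)) * (2 * \<epsilon>)" by (rule bd) (rule hs)
  hence sh: "cmod (?S h) \<le> real n * (2 * \<epsilon>)"
   unfolding size_proots_complex degree_scaled_OP[OF \<nu>] .
  have "?S f = ?S (poly p) + ?S h" by (simp add: h_def sum_mset.distrib[symmetric])
  define X Y H where "X = 1 / of_nat n * ?S f - ?I f" and "Y = 1 / of_nat n * ?S (poly p) - ?I (poly p)" and "H = 1 / of_nat n * ?S h"
  have "X = Y + H - (?I f - ?I (poly p))"
   unfolding X_def Y_def H_def \<open>?S f = ?S (poly p) + ?S h\<close> distrib_left by simp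
  hence "cmod X \<le> cmod Y + cmod H + cmod (?I f - ?I (poly p))"
   using order_trans[OF norm_triangle_ineq4 add_right_mono[OF norm_triangle_ineq]] by metis
  moreover have "cmod H \<le> 2 * \<epsilon>"
  proof -
   have "cmod H = cmod (?S h) / real n" unfolding H_def norm_mult norm_divide by simp
   thus ?thesis using sh elim(3) by (simp add: divide_le_eq mult.commute)
  qed
  moreover have "cmod Y < \<epsilon>" using elim(1) by (simp only: Y_def dist_norm)
  ultimately have "cmod X < e" using int \<epsilon> unfolding \<epsilon>_def by linarith
  thus ?case by (simp only: X_def dist_norm)
 qed
qed

end

theorem theorem2p1:
  fixes \<nu> :: real
  assumes "0 < \<nu>" and "\<nu> \<le> 1 / 2"
  shows "(\<forall>\<^sub>F n in sequentially. \<exists>p. is_bessel_OP \<nu> n p) \<and>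
    (\<forall>U :: complex set. open U \<longrightarrow> complex_of_real ` {-1..1} \<subseteq> U \<longrightarrow>
       (\<forall>\<^sub>F n in sequentially. \<forall>z. poly (bessel_OP \<nu> n) (\<i> * of_nat n * of_real pi * z) = 0 \<longrightarrow> z \<in> U)) \<and>
    (\<forall>(U :: complex set) (f :: complex \<Rightarrow> complex).
       open U \<longrightarrow> complex_of_real ` {-1..1} \<subseteq> U \<longrightarrow> continuous_on U f \<longrightarrow>
       (\<lambda>n. 1 / of_nat n * (\<Sum>z\<in>#proots (bessel_OP \<nu> n). f (z / (\<i> * of_real pi * of_nat n))))
         \<longlonglongrightarrow> integral {-1..1} (\<lambda>x. f (of_real x) * of_real (zero_density x)))"
proof (intro conjI allI impI)
  show "\<forall>\<^sub>F n in sequentially. \<exists>p. is_bessel_OP \<nu> n p"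
    using bessel_OP_eq(1)[OF assms] by (intro always_eventually allI exI)
next
  fix U :: "complex set"
  assume U: "open U" "complex_of_real ` {-1..1} \<subseteq> U"
  have e: "\<i> * of_nat n * of_real pi * z = \<i> * complex_of_real pi * (of_nat n * z)" for n z by (simp only: mult_ac)
  show "\<forall>\<^sub>F n in sequentially. \<forall>z. poly (bessel_OP \<nu> n) (\<i> * of_nat n * of_real pi * z) = 0 \<longrightarrow> z \<in> U"
    using eventually_roots_in[OF assms U]
  proof eventually_elim
    case (elim n)
    show ?case
    proof (intro allI impI)
      fix z assume "poly (bessel_OP \<nu> n) (\<i> * of_nat n * of_real pi * z) = 0"
      hence "poly (scaled_OP \<nu> n) (of_nat n * z) = 0" unfolding poly_scaled_OP[OF assms] e by simp
      thus "z \<in> U" using elim by blast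
    qed
  qed
next
  fix U :: "complex set" and f :: "complex \<Rightarrow> complex"
  assume U: "open U" "complex_of_real ` {-1..1} \<subseteq> U" and f: "continuous_on U f"
  show "(\<lambda>n. 1 / of_nat n * (\<Sum>z\<in>#proots (bessel_OP \<nu> n). f (z / (\<i> * of_real pi * of_nat n))))
         \<longlonglongrightarrow> integral {-1..1} (\<lambda>x. f (of_real x) * of_real (zero_density x))"
    unfolding sum_roots_bessel_OP[OF assms] by (rule tendsto_root_mean[OF assms U f])
qed

end
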